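(* Let $V=V_0\oplus\dots\oplus V_k$ be a direct sum of nonzero finite dimensional complex vector spaces, let $0=\beta_0<\beta_1<\dots<\beta_k$ be integers, and let $\mathbb C^*$ act on $\mathbb P(V)$ by $\lambda*[v_0:\dots:v_k]=[v_0:\lambda^{\beta_1}v_1:\dots:\lambda^{\beta_k}v_k]$. The closure in $\mathbb P^1\times\mathbb P(V)\times\mathbb P(V)$ of the graph $\{([1:\lambda],w,\lambda*w)\mid\lambda\in\mathbb C^*,\ w\in\mathbb P(V)\}$ of the action is the blow-up of the bihomogeneous ideal $$\mathcal I=\langle\mu^{\beta_k}w_0,\ \mu^{\beta_k-\beta_1}\lambda^{\beta_1}w_1,\ \dots,\ \mu^{\beta_k-\beta_{k-1}}\lambda^{\beta_{k-1}}w_{k-1},\ \lambda^{\beta_k}w_k\rangle$$ on $\mathbb P^1\times\mathbb P(V)$ (with coordinates $([\mu:\lambda],[w_0:\dots:w_k])$), and this can be described as the variety $G_k$ defined in the context. The restriction to $G_k$ of the projection $\pi_{1,2}:\mathbb P^1\times\mathbb P(V)\times\mathbb P(V)\to\mathbb P^1\times\mathbb P(V)$ is the blow-down map. The exceptional divisor consists of two separate collections of components: $$\bigcup_{i=0}^{k-1}\{[0:1]\}\times C_i^\infty\quad\text{lying over }\{\mu=0,\ w_k=0\},\qquad\text{and}\qquad \bigcup_{i=1}^{k}\{[1:0]\}\times C_i^0\quad\text{lying over }\{\lambda=0,\ w_0=0\}.$$ All components have multiplicity $1$ and dimension equal to $\dim\mathbb P(V)$. The intersection $G_k\cap\{\mu=0\}$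 consists of the first union together with $\{[0:1]\}\times C_k^\infty$, while $G_k\cap\{\lambda=0\}$ consists of the second union together with $\{[1:0]\}\times C_0^0$, each appearing with multiplicity $1$.
   Context: Points of $\mathbb P^1\times\mathbb P(V)\times\mathbb P(V)$ are written $([\mu:\lambda],[w_0:\dots:w_k],[v_0:\dots:v_k])$ with $w_i,v_i\in V_i$; $\mathbb C^*\subset\mathbb P^1$ via $\lambda\mapsto[1:\lambda]$. For vectors $a,b$, "$a\wedge b=0$" means linear dependence. For each nonempty interval $I=\{m,m+1,\dots,N\}\subset\{0,\dots,k\}$ consider the equations $$(\mu^{\beta_N-\beta_m}w_m,\ \mu^{\beta_N-\beta_{m+1}}\lambda^{\beta_{m+1}-\beta_m}w_{m+1},\ \dots,\ \lambda^{\beta_N-\beta_m}w_N)\wedge(v_m,v_{m+1},\dots,v_N)=0.$$ $G_k$ is the projective variety, with its reduced structure, defined by the radical of the ideal generated by these equations for all such $I$. Put $V_i^+=\bigoplus_{j\le i}V_j$, $V_i^-=\bigoplus_{j\ge i}V_j$ and $$C_i^\infty=\{([w],[v])\in\mathbb P(V_i^+)\times\mathbb P(V_i^-)\mid w_i\wedge v_i=0\},\qquad C_i^0=\{([w],[v])\in\mathbb P(V_i^-)\times\mathbb P(V_i^+)\mid w_i\wedge v_i=0\}.$$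
   Formalization: "All components have multiplicity 1" is proved for multiplicity in G_k∩{μ=0}, resp. G_k∩{λ=0}. In the exceptional divisor itself it fails: the multiplicities there are β_k−β_i along {[0:1]}×C_i^∞ and β_i along {[1:0]}×C_i^0 (e.g. 2 when k=1, β_1=2). *)

theory Defs
  imports
    "HOL-Analysis.Abstract_Topology"
    "HOL-Analysis.Product_Vector"
    "HOL-Library.Extended_Nat"
    "HOL-Algebra.Ideal_Product"
begin

section \<open>Commutative algebra\<close>

definition ideal_radical :: "('a, 'm) ring_scheme \<Rightarrow> 'a set \<Rightarrow> 'a set" where
  "ideal_radical R I = {f \<in> carrier R. \<exists>n::nat. f [^]\<^bsub>R\<^esub> n \<in> I}"

text \<open>For a finitely generated ideal \<open>B\<close> this is the union of the colon ideals of \<open>I\<close> by the powers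
  of \<open>B\<close>.\<close>

definition saturation :: "('a, 'm) ring_scheme \<Rightarrow> 'a set \<Rightarrow> 'a set \<Rightarrow> 'a set" where
  "saturation R B I = {f \<in> carrier R. \<forall>g\<in>B. \<exists>n::nat. (g [^]\<^bsub>R\<^esub> n) \<otimes>\<^bsub>R\<^esub> f \<in> I}"

text \<open>The localization of a commutative ring at a prime ideal \<open>P\<close>, as classes of fractions \<open>(a, s)\<close>
  with \<open>s\<close> outside \<open>P\<close>.\<close>

definition fraction_rel :: "('a, 'm) ring_scheme \<Rightarrow> 'a set \<Rightarrow> (('a \<times> 'a) \<times> ('a \<times> 'a)) set" where
  "fraction_rel R P = {((a, s), (b, t)).
     a \<in> carrier R \<and> b \<in> carrier R \<and> s \<in> carrier R - P \<and> t \<in> carrier R - P \<and>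
     (\<exists>u \<in> carrier R - P. u \<otimes>\<^bsub>R\<^esub> (a \<otimes>\<^bsub>R\<^esub> t) = u \<otimes>\<^bsub>R\<^esub> (b \<otimes>\<^bsub>R\<^esub> s))}"

definition fraction :: "('a, 'm) ring_scheme \<Rightarrow> 'a set \<Rightarrow> 'a \<Rightarrow> 'a \<Rightarrow> ('a \<times> 'a) set" where
  "fraction R P a s = fraction_rel R P `` {(a, s)}"

definition localization :: "('a, 'm) ring_scheme \<Rightarrow> 'a set \<Rightarrow> ('a \<times> 'a) set ring" where
  "localization R P =
     \<lparr>carrier = {fraction R P a s | a s. a \<in> carrier R \<and> s \<in> carrier R - P},
      mult = (\<lambda>X Y. \<Union>(a, s)\<in>X. \<Union>(b, t)\<in>Y. fraction R P (a \<otimes>\<^bsub>R\<^esub> b) (s \<otimes>\<^bsub>R\<^esub> t)),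
      one = fraction R P \<one>\<^bsub>R\<^esub> \<one>\<^bsub>R\<^esub>,
      zero = fraction R P \<zero>\<^bsub>R\<^esub> \<one>\<^bsub>R\<^esub>,
      add = (\<lambda>X Y. \<Union>(a, s)\<in>X. \<Union>(b, t)\<in>Y.
        fraction R P ((a \<otimes>\<^bsub>R\<^esub> t) \<oplus>\<^bsub>R\<^esub> (b \<otimes>\<^bsub>R\<^esub> s)) (s \<otimes>\<^bsub>R\<^esub> t))\<rparr>"

text \<open>The length of the \<open>R\<close>-module \<open>R/I\<close>; its submodules are the ideals of \<open>R\<close> containing \<open>I\<close>.\<close>

definition quotient_length :: "('a, 'm) ring_scheme \<Rightarrow> 'a set \<Rightarrow> enat" where
  "quotient_length R I = Sup {enat n | n. \<exists>c :: nat \<Rightarrow> 'a set.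
     (\<forall>i\<le>n. ideal (c i) R \<and> I \<subseteq> c i) \<and> (\<forall>i<n. c i \<subset> c (Suc i))}"

text \<open>The length of the localization of \<open>R/I\<close> at the prime \<open>P\<close>.\<close>

definition length_at :: "('a, 'm) ring_scheme \<Rightarrow> 'a set \<Rightarrow> 'a set \<Rightarrow> enat" where
  "length_at R P I = quotient_length (localization R P)
     (genideal (localization R P) ((\<lambda>a. fraction R P a \<one>\<^bsub>R\<^esub>) ` I))"

section \<open>Irreducible sets and dimension\<close>

definition irreducible_in :: "'a topology \<Rightarrow> 'a set \<Rightarrow> bool" where
  "irreducible_in T Z \<longleftrightarrow> Z \<noteq> {} \<and> Z \<subseteq> topspace T \<and>
     (\<forall>A B. closedin T A \<and> closedin T B \<and> Z \<subseteq> A \<union> B \<longrightarrow> Z \<subseteq> A \<or> Z \<subseteq> B)"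

definition irreducible_components :: "'a topology \<Rightarrow> 'a set \<Rightarrow> 'a set set" where
  "irreducible_components T Y =
     {Z. irreducible_in T Z \<and> Z \<subseteq> Y \<and> (\<forall>Z'. irreducible_in T Z' \<and> Z' \<subseteq> Y \<and> Z \<subseteq> Z' \<longrightarrow> Z' = Z)}"

definition krull_dim :: "'a topology \<Rightarrow> 'a set \<Rightarrow> enat" where
  "krull_dim T Y = Sup {enat n | n. \<exists>c :: nat \<Rightarrow> 'a set.
     (\<forall>i\<le>n. closedin (subtopology T Y) (c i) \<and> irreducible_in T (c i)) \<and>
     (\<forall>i<n. c i \<subset> c (Suc i))}"

section \<open>Projective spaces and polynomial functions\<close>

text \<open>A complex vector space is given by its scalar multiplication \<open>scl\<close> on a type.  Points of its
  projectivization are the lines through the origin.\<close>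

definition line :: "(complex \<Rightarrow> 'a \<Rightarrow> 'a) \<Rightarrow> 'a \<Rightarrow> 'a set" where
  "line scl v = range (\<lambda>c. scl c v)"

definition proj :: "(complex \<Rightarrow> 'a \<Rightarrow> 'a) \<Rightarrow> 'a::zero set \<Rightarrow> 'a set set" where
  "proj scl U = line scl ` (U - {0})"

definition pair_scale ::
  "(complex \<Rightarrow> 'a \<Rightarrow> 'a) \<Rightarrow> (complex \<Rightarrow> 'b \<Rightarrow> 'b) \<Rightarrow> complex \<Rightarrow> 'a \<times> 'b \<Rightarrow> 'a \<times> 'b" where
  "pair_scale s1 s2 c = (\<lambda>(x, y). (s1 c x, s2 c y))"

type_synonym C2 = "complex \<times> complex"

abbreviation scale2 :: "complex \<Rightarrow> C2 \<Rightarrow> C2" where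
  "scale2 \<equiv> pair_scale (*) (*)"

text \<open>Since the complex field is infinite, the symmetric algebra of the dual of a finite dimensional
  space is the ring of polynomial functions, i.e. of the functions generated by the constants and
  the linear functionals.  This avoids a choice of coordinates.\<close>

inductive_set poly_fun :: "(complex \<Rightarrow> 'a \<Rightarrow> 'a) \<Rightarrow> ('a::ab_group_add \<Rightarrow> complex) set"
  for scl :: "complex \<Rightarrow> 'a \<Rightarrow> 'a" where
  const: "(\<lambda>_. c) \<in> poly_fun scl"
| functional: "Vector_Spaces.linear scl (*) \<phi> \<Longrightarrow> \<phi> \<in> poly_fun scl"
| add: "f \<in> poly_fun scl \<Longrightarrow> g \<in> poly_fun scl \<Longrightarrow> (\<lambda>x. f x + g x) \<in> poly_fun scl"
| mult: "f \<in> poly_fun scl \<Longrightarrow> g \<in> poly_fun scl \<Longrightarrow> (\<lambda>x. f x * g x) \<in> poly_fun scl"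

definition fun_ring :: "('x \<Rightarrow> complex) set \<Rightarrow> ('x \<Rightarrow> complex) ring" where
  "fun_ring A = \<lparr>carrier = A, mult = (\<lambda>f g x. f x * g x), one = (\<lambda>_. 1),
     zero = (\<lambda>_. 0), add = (\<lambda>f g x. f x + g x)\<rparr>"

text \<open>\<open>ring2\<close> and \<open>ring3\<close> are the multigraded coordinate rings of \<open>P1 \<times> P(V)\<close> and
  \<open>P1 \<times> P(V) \<times> P(V)\<close>.\<close>

definition ring2 :: "(complex \<Rightarrow> 'v \<Rightarrow> 'v) \<Rightarrow> (C2 \<times> 'v::ab_group_add \<Rightarrow> complex) ring" where
  "ring2 scl = fun_ring (poly_fun (pair_scale scale2 scl))"

definition ring3 :: "(complex \<Rightarrow> 'v \<Rightarrow> 'v) \<Rightarrow> (C2 \<times> 'v \<times> 'v::ab_group_add \<Rightarrow> complex) ring" where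
  "ring3 scl = fun_ring (poly_fun (pair_scale scale2 (pair_scale scl scl)))"

definition bihom ::
  "(complex \<Rightarrow> 'v \<Rightarrow> 'v) \<Rightarrow> nat \<Rightarrow> nat \<Rightarrow> (C2 \<times> 'v::ab_group_add \<Rightarrow> complex) \<Rightarrow> bool" where
  "bihom scl d e g \<longleftrightarrow> g \<in> carrier (ring2 scl) \<and>
     (\<forall>r s a w. g (scale2 r a, scl s w) = r ^ d * s ^ e * g (a, w))"

definition trihom ::
  "(complex \<Rightarrow> 'v \<Rightarrow> 'v) \<Rightarrow> nat \<Rightarrow> nat \<Rightarrow> nat \<Rightarrow> (C2 \<times> 'v \<times> 'v::ab_group_add \<Rightarrow> complex) \<Rightarrow> bool"
where
  "trihom scl d e f F \<longleftrightarrow> F \<in> carrier (ring3 scl) \<and>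
     (\<forall>r s t a w v. F (scale2 r a, scl s w, scl t v) = r ^ d * s ^ e * t ^ f * F (a, w, v))"

type_synonym 'v point2 = "C2 set \<times> 'v set"
type_synonym 'v point3 = "C2 set \<times> 'v set \<times> 'v set"

definition points2 :: "(complex \<Rightarrow> 'v \<Rightarrow> 'v) \<Rightarrow> 'v::ab_group_add point2 set" where
  "points2 scl = proj scale2 UNIV \<times> proj scl UNIV"

definition points3 :: "(complex \<Rightarrow> 'v \<Rightarrow> 'v) \<Rightarrow> 'v::ab_group_add point3 set" where
  "points3 scl = proj scale2 UNIV \<times> proj scl UNIV \<times> proj scl UNIV"

definition zeros3 ::
  "(complex \<Rightarrow> 'v \<Rightarrow> 'v) \<Rightarrow> (C2 \<times> 'v \<times> 'v \<Rightarrow> complex) set \<Rightarrow> 'v::ab_group_add point3 set" where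
  "zeros3 scl A = {p \<in> points3 scl. \<forall>F\<in>A. \<forall>a w v.
     p = (line scale2 a, line scl w, line scl v) \<longrightarrow> F (a, w, v) = 0}"

definition ideal_of2 ::
  "(complex \<Rightarrow> 'v \<Rightarrow> 'v) \<Rightarrow> 'v::ab_group_add point2 set \<Rightarrow> (C2 \<times> 'v \<Rightarrow> complex) set" where
  "ideal_of2 scl Z = {g \<in> carrier (ring2 scl). \<forall>a w.
     (line scale2 a, line scl w) \<in> Z \<longrightarrow> g (a, w) = 0}"

definition ideal_of3 ::
  "(complex \<Rightarrow> 'v \<Rightarrow> 'v) \<Rightarrow> 'v::ab_group_add point3 set \<Rightarrow> (C2 \<times> 'v \<times> 'v \<Rightarrow> complex) set" where
  "ideal_of3 scl Z = {F \<in> carrier (ring3 scl). \<forall>a w v.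
     (line scale2 a, line scl w, line scl v) \<in> Z \<longrightarrow> F (a, w, v) = 0}"

definition zariski3 :: "(complex \<Rightarrow> 'v \<Rightarrow> 'v) \<Rightarrow> 'v::ab_group_add point3 topology" where
  "zariski3 scl =
     topology_generated_by {points3 scl - zeros3 scl {F} | F. \<exists>d e f. trihom scl d e f F}"

definition irrelevant3 ::
  "(complex \<Rightarrow> 'v \<Rightarrow> 'v) \<Rightarrow> (C2 \<times> 'v \<times> 'v::ab_group_add \<Rightarrow> complex) set" where
  "irrelevant3 scl = genideal (ring3 scl) {(\<lambda>(a, w, v). \<chi> a * \<phi> w * \<psi> v) | \<chi> \<phi> \<psi>.
     Vector_Spaces.linear scale2 (*) \<chi> \<and>
     Vector_Spaces.linear scl (*) \<phi> \<and> Vector_Spaces.linear scl (*) \<psi>}"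

text \<open>Closed subschemes of \<open>P1 \<times> P(V) \<times> P(V)\<close> are represented by trihomogeneous ideals; two ideals
  define the same subscheme iff their saturations by the irrelevant ideal agree.\<close>

definition same_subscheme ::
  "(complex \<Rightarrow> 'v \<Rightarrow> 'v) \<Rightarrow> (C2 \<times> 'v \<times> 'v::ab_group_add \<Rightarrow> complex) set \<Rightarrow>
    (C2 \<times> 'v \<times> 'v \<Rightarrow> complex) set \<Rightarrow> bool" where
  "same_subscheme scl I J \<longleftrightarrow>
     saturation (ring3 scl) (irrelevant3 scl) I = saturation (ring3 scl) (irrelevant3 scl) J"

text \<open>The multiplicity of the subscheme given by \<open>I\<close> along an irreducible component \<open>Z\<close> of it: the
  length of \<open>S/I\<close> localized at the homogeneous prime of \<open>Z\<close>, \<open>S\<close> being the coordinate ring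
  (Hartshorne, Algebraic Geometry, I.7).\<close>

definition multiplicity_along ::
  "(complex \<Rightarrow> 'v \<Rightarrow> 'v) \<Rightarrow> (C2 \<times> 'v \<times> 'v \<Rightarrow> complex) set \<Rightarrow> 'v::ab_group_add point3 set \<Rightarrow> enat"
where
  "multiplicity_along scl I Z = length_at (ring3 scl) (ideal_of3 scl Z) I"

section \<open>Blow-ups\<close>

definition pr12 :: "'a \<times> 'b \<times> 'c \<Rightarrow> 'a \<times> 'b" where
  "pr12 = (\<lambda>(x, y, z). (x, y))"

text \<open>The Rees algebra, i.e. the sum of the \<open>I^n t^n\<close> inside \<open>R[t]\<close> for \<open>R = ring2 scl\<close>; elements of
  \<open>R[t]\<close> are functions of \<open>(x, t)\<close>.\<close>

definition rees_algebra ::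
  "(complex \<Rightarrow> 'v \<Rightarrow> 'v) \<Rightarrow> (C2 \<times> 'v \<Rightarrow> complex) set \<Rightarrow>
    ((C2 \<times> 'v::ab_group_add) \<times> complex \<Rightarrow> complex) ring" where
  "rees_algebra scl I = fun_ring {(\<lambda>(x, t). \<Sum>n\<le>N. g n x * t ^ n) | N g.
     \<forall>n::nat. g n \<in> I [^]\<^bsub>ideals_set (ring2 scl)\<^esub> n}"

text \<open>\<open>K\<close> defines a closed subscheme of \<open>P1 \<times> P(V) \<times> P(V)\<close> which, with \<open>\<pi>\<close> as map to \<open>P1 \<times> P(V)\<close>,
  is the blow-up of \<open>I\<close>, that is, Proj of the Rees algebra over \<open>P1 \<times> P(V)\<close> with its structure map.
  The Rees algebra is presented by a surjection \<open>\<Theta>\<close> of graded algebras over \<open>R = ring2 scl\<close> from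
  \<open>ring3 scl = R[V]\<close> whose kernel defines the subscheme.  As a twist by a line bundle does not change
  Proj, \<open>\<Theta>\<close> may shift bidegrees by \<open>(p, q)\<close> for each power of \<open>t\<close>; here \<open>(p, q)\<close> is the common
  bidegree of the generators of \<open>I\<close> that are the images of the coordinates on the last factor.
  On points, the structure map of Proj is the contraction of homogeneous primes to \<open>R\<close>.\<close>

definition is_blowup ::
  "(complex \<Rightarrow> 'v \<Rightarrow> 'v) \<Rightarrow> (C2 \<times> 'v \<Rightarrow> complex) set \<Rightarrow>
    (C2 \<times> 'v \<times> 'v::ab_group_add \<Rightarrow> complex) set \<Rightarrow> ('v point3 \<Rightarrow> 'v point2) \<Rightarrow> bool" where
  "is_blowup scl I K \<pi> \<longleftrightarrow>
     (\<exists>\<Theta> p q. \<Theta> \<in> ring_hom (ring3 scl) (rees_algebra scl I) \<and>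
        \<Theta> ` carrier (ring3 scl) = carrier (rees_algebra scl I) \<and>
        (\<forall>g \<in> carrier (ring2 scl). \<Theta> (g \<circ> pr12) = g \<circ> fst) \<and>
        (\<forall>d e n F. trihom scl d e n F \<longrightarrow>
           (\<exists>g. bihom scl (d + n * p) (e + n * q) g \<and> \<Theta> F = (\<lambda>(x, t). g x * t ^ n))) \<and>
        same_subscheme scl (a_kernel (ring3 scl) (rees_algebra scl I) \<Theta>) K) \<and>
     (\<forall>z \<in> zeros3 scl K. \<pi> z \<in> points2 scl \<and>
        ideal_of2 scl {\<pi> z} = {g \<in> carrier (ring2 scl). g \<circ> pr12 \<in> ideal_of3 scl {z}})"

text \<open>The ideal of the inverse image, in the subscheme given by \<open>K\<close>, of the subscheme of
  \<open>P1 \<times> P(V)\<close> given by \<open>I\<close>.\<close>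

definition inverse_image_ideal ::
  "(complex \<Rightarrow> 'v \<Rightarrow> 'v) \<Rightarrow> (C2 \<times> 'v \<Rightarrow> complex) set \<Rightarrow>
    (C2 \<times> 'v \<times> 'v::ab_group_add \<Rightarrow> complex) set \<Rightarrow> (C2 \<times> 'v \<times> 'v \<Rightarrow> complex) set" where
  "inverse_image_ideal scl I K = genideal (ring3 scl) (K \<union> (\<lambda>g. g \<circ> pr12) ` I)"

section \<open>The graph of the action\<close>

definition direct_sum_decomposition ::
  "(complex \<Rightarrow> 'v \<Rightarrow> 'v) \<Rightarrow> (nat \<Rightarrow> 'v::ab_group_add set) \<Rightarrow> nat \<Rightarrow> bool" where
  "direct_sum_decomposition scl V k \<longleftrightarrow> (\<forall>i\<le>k. module.subspace scl (V i)) \<and>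
     (\<forall>v. \<exists>!u. (\<forall>i\<le>k. u i \<in> V i) \<and> (\<forall>i>k. u i = 0) \<and> v = (\<Sum>i\<le>k. u i))"

definition component :: "(nat \<Rightarrow> 'v::ab_group_add set) \<Rightarrow> nat \<Rightarrow> nat \<Rightarrow> 'v \<Rightarrow> 'v" where
  "component V k i v =
     (THE u. (\<forall>j\<le>k. u j \<in> V j) \<and> (\<forall>j>k. u j = 0) \<and> v = (\<Sum>j\<le>k. u j)) i"

definition act ::
  "(complex \<Rightarrow> 'v \<Rightarrow> 'v) \<Rightarrow> (nat \<Rightarrow> 'v::ab_group_add set) \<Rightarrow> nat \<Rightarrow> (nat \<Rightarrow> nat) \<Rightarrow>
    complex \<Rightarrow> 'v \<Rightarrow> 'v" where
  "act scl V k \<beta> l v = (\<Sum>i\<le>k. scl (l ^ \<beta> i) (component V k i v))"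

definition action_graph ::
  "(complex \<Rightarrow> 'v \<Rightarrow> 'v) \<Rightarrow> (nat \<Rightarrow> 'v::ab_group_add set) \<Rightarrow> nat \<Rightarrow> (nat \<Rightarrow> nat) \<Rightarrow> 'v point3 set"
where
  "action_graph scl V k \<beta> =
     {(line scale2 (1, l), line scl w, line scl (act scl V k \<beta> l w)) | l w. l \<noteq> 0 \<and> w \<noteq> 0}"

definition center_ideal ::
  "(complex \<Rightarrow> 'v \<Rightarrow> 'v) \<Rightarrow> (nat \<Rightarrow> 'v::ab_group_add set) \<Rightarrow> nat \<Rightarrow> (nat \<Rightarrow> nat) \<Rightarrow>
    (C2 \<times> 'v \<Rightarrow> complex) set" where
  "center_ideal scl V k \<beta> = genideal (ring2 scl)
     {(\<lambda>((\<mu>, l), w). \<mu> ^ (\<beta> k - \<beta> i) * l ^ \<beta> i * \<phi> (component V k i w)) | i \<phi>.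
        i \<le> k \<and> Vector_Spaces.linear scl (*) \<phi>}"

definition window_left ::
  "(complex \<Rightarrow> 'v \<Rightarrow> 'v) \<Rightarrow> (nat \<Rightarrow> 'v::ab_group_add set) \<Rightarrow> nat \<Rightarrow> (nat \<Rightarrow> nat) \<Rightarrow>
    nat \<Rightarrow> nat \<Rightarrow> complex \<Rightarrow> complex \<Rightarrow> 'v \<Rightarrow> 'v" where
  "window_left scl V k \<beta> m N \<mu> l w =
     (\<Sum>j=m..N. scl (\<mu> ^ (\<beta> N - \<beta> j) * l ^ (\<beta> j - \<beta> m)) (component V k j w))"

definition window_right ::
  "(nat \<Rightarrow> 'v::ab_group_add set) \<Rightarrow> nat \<Rightarrow> nat \<Rightarrow> nat \<Rightarrow> 'v \<Rightarrow> 'v" where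
  "window_right V k m N v = (\<Sum>j=m..N. component V k j v)"

text \<open>The equation \<open>a \<and> b = 0\<close> between vectors stands for the vanishing of all minors
  \<open>\<phi> a * \<psi> b - \<psi> a * \<phi> b\<close>.\<close>

definition G_ideal ::
  "(complex \<Rightarrow> 'v \<Rightarrow> 'v) \<Rightarrow> (nat \<Rightarrow> 'v::ab_group_add set) \<Rightarrow> nat \<Rightarrow> (nat \<Rightarrow> nat) \<Rightarrow>
    (C2 \<times> 'v \<times> 'v \<Rightarrow> complex) set" where
  "G_ideal scl V k \<beta> = ideal_radical (ring3 scl) (genideal (ring3 scl)
     {(\<lambda>((\<mu>, l), w, v).
          \<phi> (window_left scl V k \<beta> m N \<mu> l w) * \<psi> (window_right V k m N v)
        - \<psi> (window_left scl V k \<beta> m N \<mu> l w) * \<phi> (window_right V k m N v)) | m N \<phi> \<psi>.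
        m \<le> N \<and> N \<le> k \<and> Vector_Spaces.linear scl (*) \<phi> \<and> Vector_Spaces.linear scl (*) \<psi>})"

definition G_variety ::
  "(complex \<Rightarrow> 'v \<Rightarrow> 'v) \<Rightarrow> (nat \<Rightarrow> 'v::ab_group_add set) \<Rightarrow> nat \<Rightarrow> (nat \<Rightarrow> nat) \<Rightarrow> 'v point3 set"
where
  "G_variety scl V k \<beta> = zeros3 scl (G_ideal scl V k \<beta>)"

definition coord_mu :: "C2 \<times> 'v \<times> 'v \<Rightarrow> complex" where
  "coord_mu = (\<lambda>((\<mu>, l), w, v). \<mu>)"

definition coord_lambda :: "C2 \<times> 'v \<times> 'v \<Rightarrow> complex" where
  "coord_lambda = (\<lambda>((\<mu>, l), w, v). l)"

definition G_section_ideal ::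
  "(complex \<Rightarrow> 'v \<Rightarrow> 'v) \<Rightarrow> (nat \<Rightarrow> 'v::ab_group_add set) \<Rightarrow> nat \<Rightarrow> (nat \<Rightarrow> nat) \<Rightarrow>
    (C2 \<times> 'v \<times> 'v \<Rightarrow> complex) \<Rightarrow> (C2 \<times> 'v \<times> 'v \<Rightarrow> complex) set" where
  "G_section_ideal scl V k \<beta> h = genideal (ring3 scl) (insert h (G_ideal scl V k \<beta>))"

text \<open>The ideal below has order \<open>\<beta> k - \<beta> i\<close> along \<open>E_infinity i\<close> and \<open>\<beta> i\<close> along \<open>E_zero i\<close>.  The
  multiplicity that equals one for all these components is the one in the section of the variety
  by \<open>\<mu> = 0\<close>, respectively \<open>\<lambda> = 0\<close>, given by \<open>G_section_ideal\<close>.\<close>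

definition exceptional_ideal ::
  "(complex \<Rightarrow> 'v \<Rightarrow> 'v) \<Rightarrow> (nat \<Rightarrow> 'v::ab_group_add set) \<Rightarrow> nat \<Rightarrow> (nat \<Rightarrow> nat) \<Rightarrow>
    (C2 \<times> 'v \<times> 'v \<Rightarrow> complex) set" where
  "exceptional_ideal scl V k \<beta> =
     inverse_image_ideal scl (center_ideal scl V k \<beta>) (G_ideal scl V k \<beta>)"

definition lin_dep :: "(complex \<Rightarrow> 'v \<Rightarrow> 'v) \<Rightarrow> 'v::ab_group_add \<Rightarrow> 'v \<Rightarrow> bool" where
  "lin_dep scl a b \<longleftrightarrow> (\<exists>r s. (r, s) \<noteq> (0, 0) \<and> scl r a + scl s b = 0)"

definition V_plus ::
  "(complex \<Rightarrow> 'v \<Rightarrow> 'v) \<Rightarrow> (nat \<Rightarrow> 'v::ab_group_add set) \<Rightarrow> nat \<Rightarrow> 'v set" where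
  "V_plus scl V i = module.span scl (\<Union>j\<in>{..i}. V j)"

definition V_minus ::
  "(complex \<Rightarrow> 'v \<Rightarrow> 'v) \<Rightarrow> (nat \<Rightarrow> 'v::ab_group_add set) \<Rightarrow> nat \<Rightarrow> nat \<Rightarrow> 'v set" where
  "V_minus scl V k i = module.span scl (\<Union>j\<in>{i..k}. V j)"

definition C_infinity ::
  "(complex \<Rightarrow> 'v \<Rightarrow> 'v) \<Rightarrow> (nat \<Rightarrow> 'v::ab_group_add set) \<Rightarrow> nat \<Rightarrow> nat \<Rightarrow> ('v set \<times> 'v set) set"
where
  "C_infinity scl V k i = {(line scl w, line scl v) | w v.
     w \<in> V_plus scl V i - {0} \<and> v \<in> V_minus scl V k i - {0} \<and>
     lin_dep scl (component V k i w) (component V k i v)}"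

definition C_zero ::
  "(complex \<Rightarrow> 'v \<Rightarrow> 'v) \<Rightarrow> (nat \<Rightarrow> 'v::ab_group_add set) \<Rightarrow> nat \<Rightarrow> nat \<Rightarrow> ('v set \<times> 'v set) set"
where
  "C_zero scl V k i = {(line scl w, line scl v) | w v.
     w \<in> V_minus scl V k i - {0} \<and> v \<in> V_plus scl V i - {0} \<and>
     lin_dep scl (component V k i w) (component V k i v)}"

definition E_infinity ::
  "(complex \<Rightarrow> 'v \<Rightarrow> 'v) \<Rightarrow> (nat \<Rightarrow> 'v::ab_group_add set) \<Rightarrow> nat \<Rightarrow> nat \<Rightarrow> 'v point3 set" where
  "E_infinity scl V k i = {line scale2 (0, 1)} \<times> C_infinity scl V k i"

definition E_zero ::
  "(complex \<Rightarrow> 'v \<Rightarrow> 'v) \<Rightarrow> (nat \<Rightarrow> 'v::ab_group_add set) \<Rightarrow> nat \<Rightarrow> nat \<Rightarrow> 'v point3 set" where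
  "E_zero scl V k i = {line scale2 (1, 0)} \<times> C_zero scl V k i"

definition center_infinity ::
  "(complex \<Rightarrow> 'v \<Rightarrow> 'v) \<Rightarrow> (nat \<Rightarrow> 'v::ab_group_add set) \<Rightarrow> nat \<Rightarrow> 'v point2 set" where
  "center_infinity scl V k = {(line scale2 (\<mu>, l), line scl w) | \<mu> l w.
     (\<mu>, l) \<noteq> (0, 0) \<and> w \<noteq> 0 \<and> \<mu> = 0 \<and> component V k k w = 0}"

definition center_zero ::
  "(complex \<Rightarrow> 'v \<Rightarrow> 'v) \<Rightarrow> (nat \<Rightarrow> 'v::ab_group_add set) \<Rightarrow> nat \<Rightarrow> 'v point2 set" where
  "center_zero scl V k = {(line scale2 (\<mu>, l), line scl w) | \<mu> l w.
     (\<mu>, l) \<noteq> (0, 0) \<and> w \<noteq> 0 \<and> l = 0 \<and> component V k 0 w = 0}"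

end

theory Submission
  imports Defs
    "HOL-Library.Function_Algebras"
    "HOL-Computational_Algebra.Fundamental_Theorem_Algebra"
    "HOL-Analysis.Continuum_Not_Denumerable"
begin

text \<open>
  On affine cones, the window equations amount to
  \<open>\<mu>^(\<beta> q - \<beta> j) w_j \<otimes> v_q = \<lambda>^(\<beta> q - \<beta> j) w_q \<otimes> v_j\<close> for \<open>j \<le> q\<close>.  For \<open>\<mu> \<lambda> \<noteq> 0\<close> they define the
  graph.  For \<open>\<mu> = 0\<close> they force \<open>v_j = 0\<close> below the highest nonzero component \<open>w_i\<close> of \<open>w\<close>, so that
  the point lies on \<open>E_infinity i\<close>, and each such point is a limit along a polynomial curve of points
  of the graph; exchanging \<open>\<mu>\<close> with \<open>\<lambda>\<close> and \<open>w\<close> with \<open>v\<close> gives the case \<open>\<lambda> = 0\<close>.  By the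
  Nullstellensatz, the radical of the ideal of the equations is then the ideal of the closure of the
  graph.  Writing \<open>W\<close> for the vector of generators of the center, the Rees algebra is the image of
  \<open>F \<mapsto> F (a, w, t W (a, w))\<close>, and the kernel of this map consists of the functions that vanish on the
  graph.

  Where \<open>w_i\<close> and \<open>v_i\<close> do not vanish, the equations express \<open>w_j\<close> for \<open>j > i\<close> and \<open>v_j\<close> for \<open>j < i\<close>
  as multiples of \<open>\<mu>\<close>; hence the section \<open>\<mu> = 0\<close> is generically reduced along \<open>E_infinity i\<close>.

  A chain of \<open>n + 1\<close> irreducible closed subsets of a closed set gives \<open>n + 3\<close> algebraically
  independent functions on its affine cone.  Counting monomials bounds their number by the number of
  parameters of the cone, which bounds the dimension from above.  Flags of graded subspaces give
  chains of the required length.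
\<close>

section \<open>Polynomial functions\<close>

text \<open>No coordinates are chosen: a vector is known through its functionals, a wedge equation
  through its 2x2 minors, and limits are taken along polynomial curves in one complex parameter,
  where vanishing off a finite set implies vanishing everywhere. The obstacle that shapes the proof
  is the irrelevant locus. The equations also hold at points of the affine zero set where the block
  \<open>a\<close>, \<open>w\<close> or \<open>v\<close> is zero, and such points need not be limits
  of the graph. The radical ideal is therefore compared with the ideal of the closure only after
  saturation, and auxiliary factors that vanish on this locus are multiplied in. Moreover, vanishing
  ideals contain all polynomial functions while the topology is given by trihomogeneous ones, so
  functions have to be split into homogeneous parts. The Nullstellensatz is within reach because the
  complex field is uncountable whereas polynomial functions are spanned by countably many monomials.
  The number 3 in the dimension count is that of the independent scalings of the cone.\<close>

abbreviation functional ::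
  "(complex \<Rightarrow> 'a \<Rightarrow> 'a) \<Rightarrow> ('a::ab_group_add \<Rightarrow> complex) \<Rightarrow> bool"
where
  "functional s \<equiv> Vector_Spaces.linear s (*)"

lemma vector_space_complex: "vector_space ((*) :: complex \<Rightarrow> complex \<Rightarrow> complex)"
  by unfold_locales (auto simp: algebra_simps)

lemma pair_scale_apply [simp]: "pair_scale s1 s2 c (x, y) = (s1 c x, s2 c y)"
  by (simp add: pair_scale_def)

lemma vector_space_pair_scale:
  assumes "vector_space s1" "vector_space s2"
  shows "vector_space (pair_scale s1 s2)"
  using assms unfolding vector_space_def by (auto simp: plus_prod_def)

lemma vector_space_scale2: "vector_space scale2"
  by (intro vector_space_pair_scale vector_space_complex)

lemma linear_functionalI:
  fixes f :: "'a::ab_group_add \<Rightarrow> complex"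
  assumes "vector_space s" "\<And>x y. f (x + y) = f x + f y" "\<And>c x. f (s c x) = c * f x"
  shows "functional s f"
  using assms vector_space_complex by (simp add: Vector_Spaces.linear_iff)

lemma linear_functionalD:
  fixes f :: "'a::ab_group_add \<Rightarrow> complex"
  assumes "functional s f"
  shows "f (x + y) = f x + f y" "f (s c x) = c * f x" "f 0 = 0" "f (x - y) = f x - f y"
    "f (sum g A) = (\<Sum>i\<in>A. f (g i))" "vector_space s"
proof -
  interpret Vector_Spaces.linear s "(*)" f by fact
  show "f (x + y) = f x + f y" "f (s c x) = c * f x" "f 0 = 0" "f (x - y) = f x - f y"
    "f (sum g A) = (\<Sum>i\<in>A. f (g i))"
    by (simp_all add: add scale diff sum)
  show "vector_space s" by (rule vs1.vector_space_axioms)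
qed

text \<open>Functionals separate vectors from 0, so vector equations can be checked after applying
  functionals. Normalizing the value to 1 makes the later computations free of division.\<close>

lemma functional_nonzero:
  assumes "vector_space s" "v \<noteq> 0"
  obtains \<phi> where "functional s \<phi>" "\<phi> v = (1::complex)"
proof -
  interpret vector_space_pair s "(*) :: complex \<Rightarrow> complex \<Rightarrow> complex"
    using assms vector_space_complex by (simp add: vector_space_pair_def)
  have "vs1.independent {v}" using assms by (simp add: vs1.independent_insert)
  from linear_independent_extend[OF this, of "\<lambda>_. 1"] show ?thesis using that by auto
qed

lemma poly_fun_uminus: "f \<in> poly_fun s \<Longrightarrow> (\<lambda>x. - f x) \<in> poly_fun s"
  using poly_fun.mult[OF poly_fun.const[of "-1"]] by simp

lemma poly_fun_diff: "f \<in> poly_fun s \<Longrightarrow> g \<in> poly_fun s \<Longrightarrow> (\<lambda>x. f x - g x) \<in> poly_fun s"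
  using poly_fun.add[OF _ poly_fun_uminus] by fastforce

lemma poly_fun_sum: "(\<And>i. i \<in> A \<Longrightarrow> f i \<in> poly_fun s) \<Longrightarrow> (\<lambda>x. \<Sum>i\<in>A. f i x) \<in> poly_fun s"
  by (induction A rule: infinite_finite_induct) (auto intro: poly_fun.intros)

lemma poly_fun_prod: "(\<And>i. i \<in> A \<Longrightarrow> f i \<in> poly_fun s) \<Longrightarrow> (\<lambda>x. \<Prod>i\<in>A. f i x) \<in> poly_fun s"
  by (induction A rule: infinite_finite_induct) (auto intro: poly_fun.intros)

lemma poly_fun_power: "f \<in> poly_fun s \<Longrightarrow> (\<lambda>x. f x ^ n) \<in> poly_fun s"
  by (induction n) (auto intro: poly_fun.intros)

lemmas poly_fun_intros =
  poly_fun.const poly_fun.add poly_fun.mult poly_fun_uminus poly_fun_diff poly_fun_sum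
  poly_fun_prod poly_fun_power

lemma poly_fun_complex_id: "(\<lambda>z. z) \<in> poly_fun (*)"
  by (rule poly_fun.functional) (simp add: Vector_Spaces.linear_iff vector_space_complex algebra_simps)

text \<open>In one variable a functional is multiplication by a constant, so the inductive class
  consists of the library polynomials and inherits the finiteness of zero sets.\<close>

lemma poly_fun_complex:
  assumes "f \<in> poly_fun ((*) :: complex \<Rightarrow> _)"
  obtains p where "f = poly p"
proof -
  from assms have "\<exists>p. f = poly p"
  proof induction
    case (const c)
    show ?case by (rule exI[of _ "[:c:]"]) auto
  next
    case (functional \<phi>)
    have "\<phi> z = poly [:0, \<phi> 1:] z" for z using linear_functionalD(2)[OF functional, of z 1] by simp
    then show ?case by blast
  next
    case (add f g)
    then obtain p q where "f = poly p" "g = poly q" by auto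
    then show ?case by (intro exI[of _ "p + q"]) auto
  next
    case (mult f g)
    then obtain p q where "f = poly p" "g = poly q" by auto
    then show ?case by (intro exI[of _ "p * q"]) auto
  qed
  then show ?thesis using that by blast
qed

lemma poly_fun_complex_finite_roots:
  assumes "f \<in> poly_fun (*)" "f z \<noteq> 0"
  shows "finite {x. f x = 0}"
  using assms poly_roots_finite by (metis poly_0 poly_fun_complex)

text \<open>Takes the place of limits: a degeneration is written as a polynomial curve, an identity
  is proved for general parameters and carried over to the finitely many special ones.\<close>

lemma poly_fun_complex_density:
  assumes "f \<in> poly_fun (*)" "finite S" "\<And>z. z \<notin> S \<Longrightarrow> f z = 0"
  shows "f z = 0"
proof (rule ccontr)
  assume "f z \<noteq> 0"
  with assms(1) have "finite {x. f x = 0}" by (rule poly_fun_complex_finite_roots)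
  with assms(2) have "finite ({x. f x = 0} \<union> S)" by (rule finite_UnI[rotated])
  moreover have "UNIV \<subseteq> {x. f x = 0} \<union> S" using assms(3) by blast
  ultimately have "finite (UNIV :: complex set)" by (rule rev_finite_subset)
  then show False using infinite_UNIV_char_0 by blast
qed

text \<open>Only linear coordinates of the target are tested. As \<open>poly_fun\<close> is
  generated by functionals, pullback of all polynomial functions follows by induction in
  \<open>poly_map_comp\<close>.\<close>

definition poly_map ::
  "(complex \<Rightarrow> 'a \<Rightarrow> 'a) \<Rightarrow> (complex \<Rightarrow> 'b \<Rightarrow> 'b) \<Rightarrow> ('a::ab_group_add \<Rightarrow> 'b::ab_group_add) \<Rightarrow> bool"
where
  "poly_map s1 s2 f \<longleftrightarrow> (\<forall>\<phi>. functional s2 \<phi> \<longrightarrow> (\<lambda>x. \<phi> (f x)) \<in> poly_fun s1)"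

lemma poly_map_comp:
  assumes "poly_map s1 s2 f" "F \<in> poly_fun s2"
  shows "(\<lambda>x. F (f x)) \<in> poly_fun s1"
  using assms(2) by induction (use assms(1) in \<open>auto simp: poly_map_def intro: poly_fun.intros\<close>)

lemma poly_map_compose: "poly_map s1 s2 f \<Longrightarrow> poly_map s2 s3 g \<Longrightarrow> poly_map s1 s3 (\<lambda>x. g (f x))"
  unfolding poly_map_def[of s1 s3] by (auto simp: poly_map_def[of s2 s3] intro: poly_map_comp[of s1 s2])

lemma poly_map_functional: "poly_map s1 s2 f \<Longrightarrow> functional s2 \<phi> \<Longrightarrow> (\<lambda>x. \<phi> (f x)) \<in> poly_fun s1"
  by (simp add: poly_map_def)

lemma poly_map_const: "poly_map s1 s2 (\<lambda>_. c)"
  by (simp add: poly_map_def poly_fun.const)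

lemma poly_map_add: "poly_map s1 s2 f \<Longrightarrow> poly_map s1 s2 g \<Longrightarrow> poly_map s1 s2 (\<lambda>x. f x + g x)"
  by (auto simp: poly_map_def linear_functionalD(1) intro: poly_fun.intros)

lemma poly_map_scale: "h \<in> poly_fun s1 \<Longrightarrow> poly_map s1 s2 f \<Longrightarrow> poly_map s1 s2 (\<lambda>x. s2 (h x) (f x))"
  by (auto simp: poly_map_def linear_functionalD(2) intro: poly_fun.intros)

lemma poly_map_sum: "(\<And>i. i \<in> A \<Longrightarrow> poly_map s1 s2 (f i)) \<Longrightarrow> poly_map s1 s2 (\<lambda>x. \<Sum>i\<in>A. f i x)"
  by (auto simp: poly_map_def linear_functionalD(5) intro!: poly_fun_sum)

lemma linear_compose_functional:
  "Vector_Spaces.linear s1 s2 f \<Longrightarrow> functional s2 \<phi> \<Longrightarrow> functional s1 (\<lambda>x. \<phi> (f x))"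
  by (simp add: Vector_Spaces.linear_iff)

lemma poly_map_linear: "Vector_Spaces.linear s1 s2 f \<Longrightarrow> poly_map s1 s2 f"
  by (auto simp: poly_map_def intro: poly_fun.functional linear_compose_functional)

lemma poly_map_ident: "poly_map s s (\<lambda>x. x)"
  by (auto simp: poly_map_def intro: poly_fun.functional)

section \<open>Functionals and polynomial maps on products\<close>

lemma linear_pair_scale_decompose:
  assumes "functional (pair_scale s1 s2) \<phi>" "vector_space s1" "vector_space s2"
  shows "functional s1 (\<lambda>x. \<phi> (x, 0))" "functional s2 (\<lambda>y. \<phi> (0, y))"
    "\<phi> (x, y) = \<phi> (x, 0) + \<phi> (0, y)"
proof -
  interpret v1: vector_space s1 by fact
  interpret v2: vector_space s2 by fact
  note l = linear_functionalD[OF assms(1)]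
  show "functional s1 (\<lambda>x. \<phi> (x, 0))"
    by (rule linear_functionalI[OF assms(2)]) (simp_all flip: l(1,2) add: plus_prod_def)
  show "functional s2 (\<lambda>y. \<phi> (0, y))"
    by (rule linear_functionalI[OF assms(3)]) (simp_all flip: l(1,2) add: plus_prod_def)
  show "\<phi> (x, y) = \<phi> (x, 0) + \<phi> (0, y)"
    by (simp flip: l(1) add: plus_prod_def)
qed

lemma poly_map_Pair:
  assumes "poly_map s s1 f" "poly_map s s2 g" "vector_space s1" "vector_space s2"
  shows "poly_map s (pair_scale s1 s2) (\<lambda>x. (f x, g x))"
  unfolding poly_map_def
proof (intro allI impI)
  fix \<phi> :: "'b \<times> 'c \<Rightarrow> complex" assume \<phi>: "functional (pair_scale s1 s2) \<phi>"
  note d = linear_pair_scale_decompose[OF \<phi> assms(3,4)]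
  show "(\<lambda>x. \<phi> (f x, g x)) \<in> poly_fun s"
    using poly_fun.add[OF poly_map_functional[OF assms(1) d(1)] poly_map_functional[OF assms(2) d(2)]]
    by (simp flip: d(3))
qed

lemma linear_fst: "vector_space s1 \<Longrightarrow> vector_space s2 \<Longrightarrow> Vector_Spaces.linear (pair_scale s1 s2) s1 fst"
  by (auto simp: Vector_Spaces.linear_iff vector_space_pair_scale plus_prod_def)

lemma linear_snd: "vector_space s1 \<Longrightarrow> vector_space s2 \<Longrightarrow> Vector_Spaces.linear (pair_scale s1 s2) s2 snd"
  by (auto simp: Vector_Spaces.linear_iff vector_space_pair_scale plus_prod_def)

lemma poly_map_fst: "poly_map s (pair_scale s1 s2) f \<Longrightarrow> vector_space s1 \<Longrightarrow> vector_space s2 \<Longrightarrow> poly_map s s1 (\<lambda>x. fst (f x))"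
  by (rule poly_map_compose[OF _ poly_map_linear[OF linear_fst]])

lemma poly_map_snd: "poly_map s (pair_scale s1 s2) f \<Longrightarrow> vector_space s1 \<Longrightarrow> vector_space s2 \<Longrightarrow> poly_map s s2 (\<lambda>x. snd (f x))"
  by (rule poly_map_compose[OF _ poly_map_linear[OF linear_snd]])

lemma poly_map_complex: "poly_map s (*) f \<longleftrightarrow> f \<in> poly_fun s"
proof
  assume "poly_map s (*) f"
  from poly_map_comp[OF this poly_fun_complex_id] show "f \<in> poly_fun s" .
next
  assume "f \<in> poly_fun s"
  then have "poly_map s (*) (\<lambda>x. f x * 1)" by (rule poly_map_scale[OF _ poly_map_const])
  then show "poly_map s (*) f" by simp
qed

lemma poly_map_segment:
  assumes "vector_space s"
  shows "poly_map (*) s (\<lambda>z. x + s z (y - x))"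
  by (intro poly_map_add poly_map_const poly_map_scale poly_fun_complex_id)

text \<open>On the line from \<open>x\<close> to \<open>y\<close> the function \<open>f\<close> is
  nonzero at parameter 0 and \<open>g\<close> at parameter 1. Each has finitely many zeros on the
  line, so some parameter avoids both. In other words, affine space is irreducible.\<close>

lemma poly_fun_domain:
  assumes "vector_space s" "f \<in> poly_fun s" "g \<in> poly_fun s" "f x \<noteq> 0" "g y \<noteq> 0"
  obtains z where "f z \<noteq> 0" "g z \<noteq> 0"
proof -
  interpret vector_space s by fact
  let ?l = "\<lambda>z. x + s z (y - x)"
  have "finite {z. f (?l z) = 0}" "finite {z. g (?l z) = 0}"
    using poly_map_comp[OF poly_map_segment[OF assms(1), of x y] assms(2)] assms(4)
      poly_map_comp[OF poly_map_segment[OF assms(1), of x y] assms(3)] assms(5)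
    by (auto intro: poly_fun_complex_finite_roots[of _ 0] poly_fun_complex_finite_roots[of _ 1])
  then have "finite ({z. f (?l z) = 0} \<union> {z. g (?l z) = 0})" by blast
  then obtain z where "z \<notin> {z. f (?l z) = 0} \<union> {z. g (?l z) = 0}"
    using infinite_UNIV_char_0[where 'a = complex] by (metis UNIV_eq_I)
  then show ?thesis using that by blast
qed

section \<open>Spaces of monomials\<close>

interpretation fn: vector_space "\<lambda>c (f :: 'a \<Rightarrow> complex) x. c * f x"
  by unfold_locales (auto simp: algebra_simps fun_eq_iff)

lemma sum_fun_app: "(\<Sum>i\<in>I. (F i :: 'a \<Rightarrow> complex)) p = (\<Sum>i\<in>I. F i p)"
  by (induction I rule: infinite_finite_induct) auto

text \<open>Linear dependence in the library concerns sets, while the relation sought is indexed by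
  \<open>I\<close>. If \<open>h\<close> repeats a value, the coefficients 1 and -1 give a relation;
  if it is injective, the set of its values is too large to be independent in the span of
  \<open>T\<close>.\<close>

lemma family_dependent:
  fixes h :: "'i \<Rightarrow> 'a \<Rightarrow> complex"
  assumes "finite T" "finite I" "card T < card I" "\<And>i. i \<in> I \<Longrightarrow> h i \<in> fn.span T"
  obtains a where "\<exists>i\<in>I. a i \<noteq> 0" "\<And>p. (\<Sum>i\<in>I. a i * h i p) = 0"
proof (cases "inj_on h I")
  case True
  have "fn.dependent (h ` I)"
  proof (rule ccontr)
    assume "\<not> fn.dependent (h ` I)"
    then have "card (h ` I) \<le> card T"
      using fn.independent_span_bound[OF assms(1)] assms(4) by blast
    with True assms(3) show False by (simp add: card_image)
  qed
  then obtain u where u: "\<exists>v\<in>h ` I. u v \<noteq> 0" "(\<Sum>v\<in>h ` I. (\<lambda>x. u v * v x)) = 0"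
    using fn.dependent_finite assms(2) by blast
  have "(\<Sum>i\<in>I. u (h i) * h i p) = 0" for p
    using fun_cong[OF u(2), of p] by (simp add: sum_fun_app sum.reindex[OF True])
  with u(1) show ?thesis using that[of "u \<circ> h"] by auto
next
  case False
  then obtain i j where ij: "i \<in> I" "j \<in> I" "i \<noteq> j" "h i = h j" by (auto simp: inj_on_def)
  define a where "a = (\<lambda>l. if l = i then 1 else if l = j then -1 else (0::complex))"
  have "(\<Sum>l\<in>I. a l * h l p) = (\<Sum>l\<in>{i, j}. a l * h l p)" for p
    by (rule sum.mono_neutral_right) (use assms(2) ij in \<open>auto simp: a_def\<close>)
  then have "(\<Sum>l\<in>I. a l * h l p) = 0" for p using ij by (simp add: a_def)
  moreover have "\<exists>l\<in>I. a l \<noteq> 0" using ij by (intro bexI[of _ i]) (simp add: a_def)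
  ultimately show ?thesis using that by blast
qed

definition monom_fun :: "(nat \<Rightarrow> 'a \<Rightarrow> complex) \<Rightarrow> nat \<Rightarrow> (nat \<Rightarrow> nat) \<Rightarrow> 'a \<Rightarrow> complex" where
  "monom_fun x d e = (\<lambda>p. \<Prod>i<d. x i p ^ e i)"

text \<open>Every exponent is bounded separately, not the total degree. The count is then at most
  the plain power \<open>(D + 1) ^ d\<close>, and bounds add under multiplication.\<close>

definition monomials :: "(nat \<Rightarrow> 'a \<Rightarrow> complex) \<Rightarrow> nat \<Rightarrow> nat \<Rightarrow> ('a \<Rightarrow> complex) set" where
  "monomials x d D = monom_fun x d ` ({..<d} \<rightarrow>\<^sub>E {..D})"

lemma finite_monomials: "finite (monomials x d D)"
  by (simp add: monomials_def finite_PiE)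

lemma card_monomials: "card (monomials x d D) \<le> (D + 1) ^ d"
  using card_image_le[of "{..<d} \<rightarrow>\<^sub>E {..D}" "monom_fun x d"]
  by (simp add: monomials_def finite_PiE card_PiE)

lemma monom_fun_in_monomials: "(\<And>i. i < d \<Longrightarrow> e i \<le> D) \<Longrightarrow> monom_fun x d e \<in> monomials x d D"
  unfolding monomials_def
  by (rule image_eqI[of _ _ "restrict e {..<d}"]) (auto simp: monom_fun_def)

lemma monomials_mult:
  assumes "f \<in> monomials x d D" "g \<in> monomials x d D'"
  shows "(\<lambda>p. f p * g p) \<in> monomials x d (D + D')"
proof -
  obtain e e' where e: "f = monom_fun x d e" "e \<in> {..<d} \<rightarrow>\<^sub>E {..D}"
    "g = monom_fun x d e'" "e' \<in> {..<d} \<rightarrow>\<^sub>E {..D'}"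
    using assms by (auto simp: monomials_def)
  then have "(\<lambda>p. f p * g p) = monom_fun x d (\<lambda>i. e i + e' i)"
    by (simp add: monom_fun_def power_add prod.distrib)
  moreover have "e i + e' i \<le> D + D'" if "i < d" for i
    using e(2,4) that by (intro add_mono) auto
  ultimately show ?thesis using monom_fun_in_monomials[of d "\<lambda>i. e i + e' i" "D + D'" x] by simp
qed

lemma monomials_mono: "D \<le> D' \<Longrightarrow> monomials x d D \<subseteq> monomials x d D'"
  unfolding monomials_def by (intro image_mono PiE_mono) auto

lemma span_monomials_mult:
  assumes f: "f \<in> fn.span (monomials x d D)" and g: "g \<in> fn.span (monomials x d D')"
  shows "(\<lambda>p. f p * g p) \<in> fn.span (monomials x d (D + D'))"
proof -
  have *: "(\<lambda>p. f p * m p) \<in> fn.span (monomials x d (D + D'))"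
    if m: "m \<in> monomials x d D'" for m
    using f
  proof (induction rule: fn.span_induct_alt)
    case base
    then show ?case using fn.span_zero by (simp add: zero_fun_def)
  next
    case (step c f1 f2)
    have "(\<lambda>p. c * (f1 p * m p)) + (\<lambda>p. f2 p * m p) \<in> fn.span (monomials x d (D + D'))"
      by (intro fn.span_add fn.span_scale fn.span_base monomials_mult step m)
    then show ?case by (simp add: plus_fun_def algebra_simps)
  qed
  show ?thesis using g
  proof (induction rule: fn.span_induct_alt)
    case base
    then show ?case using fn.span_zero by (simp add: zero_fun_def)
  next
    case (step c f1 f2)
    have "(\<lambda>p. c * (f p * f1 p)) + (\<lambda>p. f p * f2 p) \<in> fn.span (monomials x d (D + D'))"
      by (intro fn.span_add fn.span_scale * step)
    then show ?case by (simp add: plus_fun_def algebra_simps)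
  qed
qed

text \<open>A basis of the dual space: the third clause makes the \<open>x i\<close> span it, and
  the last, that all tuples of values occur, makes them independent. The Nullstellensatz uses the
  last clause to find a point with prescribed coordinates.\<close>

definition coordinates ::
  "(complex \<Rightarrow> 'a \<Rightarrow> 'a) \<Rightarrow> nat \<Rightarrow> (nat \<Rightarrow> 'a::ab_group_add \<Rightarrow> complex) \<Rightarrow> bool"
where
  "coordinates s d x \<longleftrightarrow> vector_space s \<and> (\<forall>i<d. functional s (x i)) \<and>
     (\<forall>\<phi>. functional s \<phi> \<longrightarrow> (\<exists>c. \<forall>p. \<phi> p = (\<Sum>i<d. c i * x i p))) \<and>
     (\<forall>c. \<exists>p. \<forall>i<d. x i p = c i)"

lemma coordinates_complex: "coordinates (*) 1 (\<lambda>_ z. z)"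
  unfolding coordinates_def
proof (intro conjI allI impI)
  fix \<phi> :: "complex \<Rightarrow> complex" assume "Vector_Spaces.linear (*) (*) \<phi>"
  then have "\<phi> p = (\<Sum>i<1. (\<lambda>_. \<phi> 1) (i::nat) * p)" for p
    using linear_functionalD(2)[of "(*)" \<phi> p 1] by (simp add: mult.commute)
  then show "\<exists>c. \<forall>p. \<phi> p = (\<Sum>i<(1::nat). c i * p)" by (intro exI[of _ "\<lambda>_. \<phi> 1"] allI)
qed (auto simp: vector_space_complex Vector_Spaces.linear_iff algebra_simps)

lemma coordinates_pair:
  assumes "coordinates s1 d1 x1" "coordinates s2 d2 x2"
  shows "coordinates (pair_scale s1 s2) (d1 + d2)
    (\<lambda>i p. if i < d1 then x1 i (fst p) else x2 (i - d1) (snd p))"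
  unfolding coordinates_def
proof (intro conjI allI impI)
  have vs: "vector_space s1" "vector_space s2" using assms by (auto simp: coordinates_def)
  show "vector_space (pair_scale s1 s2)" using vs by (rule vector_space_pair_scale)
  fix i assume "i < d1 + d2"
  then show "functional (pair_scale s1 s2)
      (\<lambda>p. if i < d1 then x1 i (fst p) else x2 (i - d1) (snd p))"
    using assms linear_compose_functional[OF linear_fst[OF vs], of "x1 i"]
      linear_compose_functional[OF linear_snd[OF vs], of "x2 (i - d1)"]
    by (cases "i < d1") (auto simp: coordinates_def)
next
  have vs: "vector_space s1" "vector_space s2" using assms by (auto simp: coordinates_def)
  fix \<phi> :: "'a \<times> 'b \<Rightarrow> complex" assume \<phi>: "functional (pair_scale s1 s2) \<phi>"
  note d = linear_pair_scale_decompose[OF \<phi> vs]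
  obtain c1 where c1: "\<And>p. \<phi> (p, 0) = (\<Sum>i<d1. c1 i * x1 i p)"
    using assms(1) d(1) unfolding coordinates_def by blast
  obtain c2 where c2: "\<And>p. \<phi> (0, p) = (\<Sum>i<d2. c2 i * x2 i p)"
    using assms(2) d(2) unfolding coordinates_def by blast
  have "\<phi> p = (\<Sum>i<d1 + d2. (if i < d1 then c1 i else c2 (i - d1)) *
      (if i < d1 then x1 i (fst p) else x2 (i - d1) (snd p)))" for p
  proof -
    have "\<phi> p = \<phi> (fst p, 0) + \<phi> (0, snd p)" using d(3)[of "fst p" "snd p"] by simp
    also have "\<dots> = (\<Sum>i<d1. c1 i * x1 i (fst p)) + (\<Sum>i<d2. c2 i * x2 i (snd p))"
      by (simp add: c1 c2)
    also have "\<dots> = (\<Sum>i\<in>{..<d1}. c1 i * x1 i (fst p)) + (\<Sum>i\<in>{d1..<d1+d2}. c2 (i - d1) * x2 (i - d1) (snd p))"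
      using sum.shift_bounds_nat_ivl[of "\<lambda>i. c2 (i - d1) * x2 (i - d1) (snd p)" 0 d1 d2]
      by (simp add: atLeast0LessThan add.commute)
    also have "\<dots> = (\<Sum>i\<in>{..<d1} \<union> {d1..<d1+d2}. (if i < d1 then c1 i else c2 (i - d1)) *
      (if i < d1 then x1 i (fst p) else x2 (i - d1) (snd p)))"
      by (subst sum.union_disjoint) auto
    also have "{..<d1} \<union> {d1..<d1+d2} = {..<d1+d2}" by auto
    finally show ?thesis .
  qed
  then show "\<exists>c. \<forall>p. \<phi> p = (\<Sum>i<d1 + d2. c i * (if i < d1 then x1 i (fst p) else x2 (i - d1) (snd p)))"
    by (intro exI[of _ "\<lambda>i. if i < d1 then c1 i else c2 (i - d1)"] allI)
next
  fix c :: "nat \<Rightarrow> complex"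
  obtain p1 where "\<forall>i<d1. x1 i p1 = c i" using assms(1) unfolding coordinates_def by blast
  moreover obtain p2 where "\<forall>i<d2. x2 i p2 = c (d1 + i)"
    using assms(2) unfolding coordinates_def by meson
  ultimately show "\<exists>p. \<forall>i<d1 + d2. (if i < d1 then x1 i (fst p) else x2 (i - d1) (snd p)) = c i"
    by (intro exI[of _ "(p1, p2)"]) auto
qed

lemma coordinates_finite_dimensional:
  assumes "finite_dimensional_vector_space s B"
  obtains x where "coordinates s (vector_space.dim s UNIV) x"
proof -
  interpret finite_dimensional_vector_space s B by fact
  obtain b where b: "bij_betw b {..<card B} B"
    using ex_bij_betw_nat_finite[OF finite_Basis] by (auto simp: atLeast0LessThan)
  let ?x = "\<lambda>i v. representation B v (b i)"
  have sp: "v \<in> span B" for v by (simp add: span_Basis)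
  have lin: "functional s (\<lambda>v. representation B v e)" for e
    by (rule linear_functionalI[OF vector_space_axioms])
      (simp_all add: representation_add representation_scale independent_Basis span_Basis)
  have "coordinates s (card B) ?x"
    unfolding coordinates_def
  proof (intro conjI allI impI lin vector_space_axioms)
    fix \<phi> :: "'a \<Rightarrow> complex" assume \<phi>: "functional s \<phi>"
    note l = linear_functionalD[OF \<phi>]
    have "\<phi> p = (\<Sum>i<card B. \<phi> (b i) * representation B p (b i))" for p
    proof -
      have "\<phi> p = \<phi> (\<Sum>e\<in>B. s (representation B p e) e)"
        using sum_representation_eq[OF independent_Basis sp finite_Basis order.refl, of p] by simp
      also have "\<dots> = (\<Sum>e\<in>B. representation B p e * \<phi> e)" by (simp add: l)
      also have "\<dots> = (\<Sum>i<card B. representation B p (b i) * \<phi> (b i))"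
        by (rule sum.reindex_bij_betw[OF b, symmetric])
      finally show ?thesis by (simp add: mult.commute)
    qed
    then show "\<exists>c. \<forall>p. \<phi> p = (\<Sum>i<card B. c i * representation B p (b i))"
      by (intro exI[of _ "\<lambda>i. \<phi> (b i)"] allI)
  next
    fix c :: "nat \<Rightarrow> complex"
    let ?p = "\<Sum>i<card B. s (c i) (b i)"
    have "representation B ?p (b j) = c j" if "j < card B" for j
    proof -
      note l = linear_functionalD[OF lin[of "b j"]]
      have "representation B ?p (b j) = (\<Sum>i<card B. c i * representation B (b i) (b j))"
        by (simp add: l)
      also have "\<dots> = (\<Sum>i<card B. if i = j then c i else 0)"
      proof (rule sum.cong)
        fix i assume i: "i \<in> {..<card B}"
        then have "b i \<in> B" "b i = b j \<longleftrightarrow> i = j"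
          using b that by (auto simp: bij_betw_def inj_on_def)
        then show "c i * representation B (b i) (b j) = (if i = j then c i else 0)"
          by (auto simp: representation_basis[OF independent_Basis])
      qed simp
      finally show ?thesis using that by simp
    qed
    then show "\<exists>p. \<forall>i<card B. representation B p (b i) = c i" by blast
  qed
  then show ?thesis using that by (simp add: dim_UNIV)
qed

lemma poly_fun_span_monomials:
  assumes "coordinates s d x" "f \<in> poly_fun s"
  obtains D where "f \<in> fn.span (monomials x d D)"
proof -
  have m0: "(\<lambda>_. c) \<in> fn.span (monomials x d 0)" for c
  proof -
    have "(\<lambda>p. c * monom_fun x d (\<lambda>_. 0) p) \<in> fn.span (monomials x d 0)"
      by (intro fn.span_scale fn.span_base monom_fun_in_monomials) auto
    then show ?thesis by (simp add: monom_fun_def)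
  qed
  have m1: "x i \<in> monomials x d 1" if "i < d" for i
  proof -
    have "monom_fun x d (\<lambda>j. if j = i then 1 else 0) \<in> monomials x d 1"
      by (intro monom_fun_in_monomials) auto
    also have "x j p ^ (if j = i then 1 else 0) = (if j = i then x i p else 1)" for j p by simp
    then have "monom_fun x d (\<lambda>j. if j = i then 1 else 0) = x i"
      using that by (simp add: monom_fun_def)
    finally show ?thesis .
  qed
  have mono: "g \<in> fn.span (monomials x d D')" if "g \<in> fn.span (monomials x d D)" "D \<le> D'" for g D D'
    using that fn.span_mono[OF monomials_mono] by blast
  have "\<exists>D. f \<in> fn.span (monomials x d D)" using assms(2)
  proof induction
    case (const c)
    then show ?case using m0 by blast
  next
    case (functional \<phi>)
    then obtain c where c: "\<And>p. \<phi> p = (\<Sum>i<d. c i * x i p)"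
      using assms(1) unfolding coordinates_def by blast
    have "(\<Sum>i<d. (\<lambda>p. c i * x i p)) \<in> fn.span (monomials x d 1)"
      by (intro fn.span_sum fn.span_scale fn.span_base m1) auto
    also have "(\<Sum>i<d. (\<lambda>p. c i * x i p)) = \<phi>" by (simp add: fun_eq_iff sum_fun_app c)
    finally show ?case by blast
  next
    case (add f g)
    then obtain D D' where "f \<in> fn.span (monomials x d D)" "g \<in> fn.span (monomials x d D')" by blast
    then have "f + g \<in> fn.span (monomials x d (max D D'))"
      by (intro fn.span_add) (auto intro: mono)
    then show ?case by (auto simp: plus_fun_def)
  next
    case (mult f g)
    then show ?case using span_monomials_mult by blast
  qed
  then show ?thesis using that by blast
qed

section \<open>Rings of functions and the Nullstellensatz\<close>

text \<open>Closure conditions in place of ring records. Computations with functions stay pointwise,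
  and \<open>cring_fun_ring\<close> and \<open>ideal_fun_ring\<close> translate to the algebra
  library. Negatives come from the constant -1.\<close>

definition fun_subalgebra :: "('a \<Rightarrow> complex) set \<Rightarrow> bool" where
  "fun_subalgebra A \<longleftrightarrow> (\<forall>c. (\<lambda>_. c) \<in> A) \<and> (\<forall>f\<in>A. \<forall>g\<in>A. (\<lambda>x. f x + g x) \<in> A) \<and>
     (\<forall>f\<in>A. \<forall>g\<in>A. (\<lambda>x. f x * g x) \<in> A)"

definition fun_ideal :: "('a \<Rightarrow> complex) set \<Rightarrow> ('a \<Rightarrow> complex) set \<Rightarrow> bool" where
  "fun_ideal A J \<longleftrightarrow> J \<subseteq> A \<and> (\<lambda>_. 0) \<in> J \<and> (\<forall>f\<in>J. \<forall>g\<in>J. (\<lambda>x. f x + g x) \<in> J) \<and>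
     (\<forall>f\<in>A. \<forall>g\<in>J. (\<lambda>x. f x * g x) \<in> J)"

lemma fun_ring_simps [simp]:
  "carrier (fun_ring A) = A" "f \<otimes>\<^bsub>fun_ring A\<^esub> g = (\<lambda>x. f x * g x)"
  "\<one>\<^bsub>fun_ring A\<^esub> = (\<lambda>_. 1)" "\<zero>\<^bsub>fun_ring A\<^esub> = (\<lambda>_. 0)" "f \<oplus>\<^bsub>fun_ring A\<^esub> g = (\<lambda>x. f x + g x)"
  by (simp_all add: fun_ring_def)

lemma fun_ring_pow [simp]: "f [^]\<^bsub>fun_ring A\<^esub> (n::nat) = (\<lambda>x. f x ^ n)"
  by (induction n) (simp_all add: mult.commute)

lemma fun_subalgebra_poly_fun: "fun_subalgebra (poly_fun s)"
  by (simp add: fun_subalgebra_def poly_fun.intros)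

lemma fun_subalgebraD:
  assumes "fun_subalgebra A"
  shows "(\<lambda>_. c) \<in> A" "f \<in> A \<Longrightarrow> g \<in> A \<Longrightarrow> (\<lambda>x. f x + g x) \<in> A"
    "f \<in> A \<Longrightarrow> g \<in> A \<Longrightarrow> (\<lambda>x. f x * g x) \<in> A" "f \<in> A \<Longrightarrow> (\<lambda>x. - f x) \<in> A"
proof -
  show 1: "(\<lambda>_. c) \<in> A" "f \<in> A \<Longrightarrow> g \<in> A \<Longrightarrow> (\<lambda>x. f x * g x) \<in> A" for c f g
    using assms by (auto simp: fun_subalgebra_def)
  show "f \<in> A \<Longrightarrow> g \<in> A \<Longrightarrow> (\<lambda>x. f x + g x) \<in> A" using assms by (auto simp: fun_subalgebra_def)
  show "f \<in> A \<Longrightarrow> (\<lambda>x. - f x) \<in> A" using 1(2)[OF 1(1)[of "-1"], of f] by simp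
qed

lemma cring_fun_ring:
  assumes "fun_subalgebra A"
  shows "cring (fun_ring A)"
proof (rule cringI)
  note A = fun_subalgebraD[OF assms]
  show "abelian_group (fun_ring A)"
  proof (rule abelian_groupI)
    fix f assume "f \<in> carrier (fun_ring A)"
    then show "\<exists>y\<in>carrier (fun_ring A). y \<oplus>\<^bsub>fun_ring A\<^esub> f = \<zero>\<^bsub>fun_ring A\<^esub>"
      using A(4)[of f] by (intro bexI[of _ "\<lambda>x. - f x"]) auto
  qed (use A in \<open>auto simp: add.assoc add.commute\<close>)
  show "comm_monoid (fun_ring A)"
    by (rule comm_monoidI) (use A in \<open>auto simp: mult.assoc mult.commute\<close>)
qed (auto simp: algebra_simps)

lemma fun_idealD:
  assumes "fun_ideal A J"
  shows "J \<subseteq> A" "(\<lambda>_. 0) \<in> J" "f \<in> J \<Longrightarrow> g \<in> J \<Longrightarrow> (\<lambda>x. f x + g x) \<in> J"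
    "f \<in> A \<Longrightarrow> g \<in> J \<Longrightarrow> (\<lambda>x. f x * g x) \<in> J"
  using assms by (auto simp: fun_ideal_def)

lemma ideal_fun_ring:
  assumes "fun_subalgebra A"
  shows "ideal J (fun_ring A) \<longleftrightarrow> fun_ideal A J"
proof
  interpret R: cring "fun_ring A" using assms by (rule cring_fun_ring)
  assume "ideal J (fun_ring A)"
  then interpret ideal J "fun_ring A" .
  have a: "(\<lambda>x. f x + g x) \<in> J" if "f \<in> J" "g \<in> J" for f g using a_closed[OF that] by simp
  have m: "(\<lambda>x. f x * g x) \<in> J" if "f \<in> A" "g \<in> J" for f g
    using I_l_closed[of g f] that by simp
  have z: "(\<lambda>_. 0) \<in> J" using additive_subgroup.zero_closed[OF additive_subgroup_axioms] by simp
  have "J \<subseteq> A" using a_subset by simp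
  then show "fun_ideal A J" unfolding fun_ideal_def by (intro conjI ballI z a m)
next
  interpret R: cring "fun_ring A" using assms by (rule cring_fun_ring)
  note A = fun_subalgebraD[OF assms]
  assume J: "fun_ideal A J"
  have neg: "(\<lambda>x. - f x) \<in> J" if "f \<in> J" for f
  proof -
    have "(\<lambda>x. (-1) * f x) \<in> J" by (rule fun_idealD(4)[OF J A(1) that])
    then show ?thesis by simp
  qed
  show "ideal J (fun_ring A)"
  proof (rule idealI)
    show "ring (fun_ring A)" by (rule R.ring_axioms)
    show "subgroup J (add_monoid (fun_ring A))"
    proof (rule R.add.subgroupI)
      show "J \<subseteq> carrier (fun_ring A)" "J \<noteq> {}" using J by (auto simp: fun_ideal_def)
      fix f g assume f: "f \<in> J" and g: "g \<in> J"
      have "f \<in> A" using f J by (auto simp: fun_ideal_def)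
      then have "\<ominus>\<^bsub>fun_ring A\<^esub> f = (\<lambda>x. - f x)"
        using A(4) by (intro R.minus_equality) auto
      then show "\<ominus>\<^bsub>fun_ring A\<^esub> f \<in> J" using neg[OF f] by simp
      show "f \<oplus>\<^bsub>fun_ring A\<^esub> g \<in> J" using J f g by (simp add: fun_ideal_def)
    qed
    fix a x assume ax: "a \<in> J" "x \<in> carrier (fun_ring A)"
    then show xa: "x \<otimes>\<^bsub>fun_ring A\<^esub> a \<in> J" using J by (simp add: fun_ideal_def)
    then show "a \<otimes>\<^bsub>fun_ring A\<^esub> x \<in> J" by (simp add: mult.commute)
  qed
qed

lemma fun_ideal_sum:
  assumes "fun_ideal A J" "\<And>i. i \<in> I \<Longrightarrow> f i \<in> J"
  shows "(\<lambda>x. \<Sum>i\<in>I. f i x) \<in> J"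
  using assms(2) by (induction I rule: infinite_finite_induct) (auto intro: fun_idealD[OF assms(1)])

text \<open>The ideal \<open>J + (y - c)\<close>, which cuts the zero set of \<open>J\<close> with
  the hypersurface \<open>y = c\<close>.\<close>

definition adjoin_zero ::
  "('a \<Rightarrow> complex) set \<Rightarrow> ('a \<Rightarrow> complex) set \<Rightarrow> ('a \<Rightarrow> complex) \<Rightarrow> complex \<Rightarrow> ('a \<Rightarrow> complex) set"
where
  "adjoin_zero A J y c = {\<lambda>p. j p + (y p - c) * h p | j h. j \<in> J \<and> h \<in> A}"

lemma fun_ideal_adjoin_zero:
  assumes A: "fun_subalgebra A" and J: "fun_ideal A J" and y: "y \<in> A"
  shows "fun_ideal A (adjoin_zero A J y c)"
    and "J \<subseteq> adjoin_zero A J y c"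
    and "(\<lambda>p. y p - c) \<in> adjoin_zero A J y c"
proof -
  note A' = fun_subalgebraD[OF A] and J' = fun_idealD[OF J]
  have yc: "(\<lambda>p. y p - c) \<in> A" using A'(2)[OF y A'(1)[of "- c"]] by simp
  show "J \<subseteq> adjoin_zero A J y c"
  proof
    fix j assume "j \<in> J"
    then show "j \<in> adjoin_zero A J y c" unfolding adjoin_zero_def
      using A'(1)[of 0] by (intro CollectI exI[of _ j] exI[of _ "\<lambda>_. 0"]) simp
  qed
  show "(\<lambda>p. y p - c) \<in> adjoin_zero A J y c" unfolding adjoin_zero_def
    using A'(1)[of 1] J'(2) by (intro CollectI exI[of _ "\<lambda>_. 0"] exI[of _ "\<lambda>_. 1"]) simp
  then have "j \<in> A \<Longrightarrow> h \<in> A \<Longrightarrow> (\<lambda>p. j p + (y p - c) * h p) \<in> A" for j h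
    using A'(2,3) yc by simp
  then have 1: "adjoin_zero A J y c \<subseteq> A" using J'(1) by (auto simp: adjoin_zero_def)
  have 2: "(\<lambda>p. f p + g p) \<in> adjoin_zero A J y c"
    if f: "f \<in> adjoin_zero A J y c" and g: "g \<in> adjoin_zero A J y c" for f g
  proof -
    obtain j h where "f = (\<lambda>p. j p + (y p - c) * h p)" "j \<in> J" "h \<in> A"
      using f unfolding adjoin_zero_def by blast
    moreover obtain j' h' where "g = (\<lambda>p. j' p + (y p - c) * h' p)" "j' \<in> J" "h' \<in> A"
      using g unfolding adjoin_zero_def by blast
    ultimately show ?thesis unfolding adjoin_zero_def
      using A'(2)[of h h'] J'(3)[of j j']
      by (intro CollectI exI[of _ "\<lambda>p. j p + j' p"] exI[of _ "\<lambda>p. h p + h' p"])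
        (simp add: algebra_simps)
  qed
  have 3: "(\<lambda>p. f p * g p) \<in> adjoin_zero A J y c" if f: "f \<in> A" and g: "g \<in> adjoin_zero A J y c" for f g
  proof -
    obtain j h where
      "g = (\<lambda>p. j p + (y p - c) * h p)" "j \<in> J" "h \<in> A"
      using g unfolding adjoin_zero_def by blast
    then show ?thesis unfolding adjoin_zero_def
      using A'(3)[of f h] J'(4)[of f j] f
      by (intro CollectI exI[of _ "\<lambda>p. f p * j p"] exI[of _ "\<lambda>p. f p * h p"])
        (simp add: algebra_simps)
  qed
  show "fun_ideal A (adjoin_zero A J y c)"
    unfolding fun_ideal_def
    by (intro conjI ballI 1 2 3 subsetD[OF \<open>J \<subseteq> adjoin_zero A J y c\<close> J'(2)])
qed

text \<open>Let \<open>b\<close> be a root of \<open>q\<close>, so that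
  \<open>q = (y - b) r\<close>. A relation \<open>f ^ k = j + (y - b) h\<close> trades the factor
  \<open>y - b\<close> for \<open>f ^ k\<close> modulo \<open>J\<close>. Repeating this lowers the
  degree of \<open>q\<close> until a nonzero constant remains, which is inverted.\<close>

lemma power_in_ideal_of_poly:
  assumes A: "fun_subalgebra A" and J: "fun_ideal A J" and f: "f \<in> A" and y: "y \<in> A"
    and c: "\<And>c. \<exists>n. (\<lambda>p. f p ^ n) \<in> adjoin_zero A J y c"
    and q: "q \<noteq> 0" "(\<lambda>p. f p ^ n * poly q (y p)) \<in> J"
  shows "\<exists>m. (\<lambda>p. f p ^ m) \<in> J"
  using q
proof (induction "degree q" arbitrary: q n)
  case 0
  then obtain a where a: "q = [:a:]" by (metis degree_eq_zeroE)
  with 0 have "a \<noteq> 0" by auto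
  have "(\<lambda>p. inverse a * (f p ^ n * poly q (y p))) \<in> J"
    by (rule fun_idealD(4)[OF J fun_subalgebraD(1)[OF A] 0(3)])
  also have "(\<lambda>p. inverse a * (f p ^ n * poly q (y p))) = (\<lambda>p. f p ^ n)"
    using \<open>a \<noteq> 0\<close> by (simp add: a fun_eq_iff)
  finally show ?case by blast
next
  case (Suc l)
  note A' = fun_subalgebraD[OF A] and J' = fun_idealD[OF J]
  have poly: "(\<lambda>p. poly r (y p)) \<in> A" for r
    by (induction r) (auto intro!: A' y)
  have pow: "(\<lambda>p. f p ^ k) \<in> A" for k
    by (induction k) (auto intro: A' f)
  have "\<not> constant (poly q)" using Suc(2) by (simp add: constant_degree)
  then obtain b where b: "poly q b = 0" using fundamental_theorem_of_algebra by blast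
  then obtain r where r: "q = [:-b, 1:] * r" by (metis dvdE poly_eq_0_iff_dvd)
  with Suc have "r \<noteq> 0" by auto
  then have "degree q = Suc (degree r)" unfolding r by (subst degree_mult_eq) auto
  obtain k j h where jh: "(\<lambda>p. f p ^ k) = (\<lambda>p. j p + (y p - b) * h p)" "j \<in> J" "h \<in> A"
    using c[of b] unfolding adjoin_zero_def by blast
  have "(\<lambda>p. (f p ^ n * poly r (y p)) * j p + h p * (f p ^ n * poly q (y p))) \<in> J"
    by (intro J'(3,4) A'(3) pow poly jh Suc)
  also have "(\<lambda>p. (f p ^ n * poly r (y p)) * j p + h p * (f p ^ n * poly q (y p))) =
      (\<lambda>p. f p ^ (n + k) * poly r (y p))"
    by (simp add: power_add r fun_cong[OF jh(1)] algebra_simps)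
  finally show ?case
    using Suc(1)[of r "n + k"] \<open>degree q = Suc (degree r)\<close> Suc(2) \<open>r \<noteq> 0\<close> by simp
qed

text \<open>If some power of \<open>f\<close> were in the ideal generated by \<open>J\<close> and \<open>y - c\<close> for every \<open>c\<close>, then
  \<open>1 / (y - c)\<close> would be uncountably many elements of the ring \<open>A[1/f]/J\<close>, whose dimension is
  countable; a linear relation between them is a polynomial equation for \<open>y\<close>.\<close>

lemma exists_adjoin_zero:
  assumes s: "coordinates s d x" and J: "fun_ideal (poly_fun s) J" and f: "f \<in> poly_fun s"
    and y: "y \<in> poly_fun s" and n: "\<And>n. (\<lambda>p. f p ^ n) \<notin> J"
  obtains c where "\<And>n. (\<lambda>p. f p ^ n) \<notin> adjoin_zero (poly_fun s) J y c"
proof (rule ccontr)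
  note A = fun_subalgebra_poly_fun[of s]
  note J' = fun_idealD[OF J]
  assume "\<not> thesis"
  then have ex: "\<exists>n. (\<lambda>p. f p ^ n) \<in> adjoin_zero (poly_fun s) J y c" for c using that by blast
  have "\<exists>n D h j. (\<forall>p. f p ^ n = j p + (y p - c) * h p) \<and> j \<in> J \<and>
      h \<in> fn.span (monomials x d D)" for c
  proof -
    obtain n j h where h: "(\<lambda>p. f p ^ n) = (\<lambda>p. j p + (y p - c) * h p)" "j \<in> J" "h \<in> poly_fun s"
      using ex[of c] unfolding adjoin_zero_def by blast
    moreover obtain D where "h \<in> fn.span (monomials x d D)"
      using poly_fun_span_monomials[OF s h(3)] .
    ultimately show ?thesis
      by (intro exI[of _ n] exI[of _ D] exI[of _ h] exI[of _ j]) (simp add: fun_eq_iff)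
  qed
  then obtain N D h j where N: "\<And>c p. f p ^ N c = j c p + (y p - c) * h c p"
    "\<And>c. j c \<in> J" "\<And>c. h c \<in> fn.span (monomials x d (D c))"
    by metis
  \<comment> \<open>There are only countably many pairs of an exponent and a degree bound but
    uncountably many \<open>c\<close>, so one pair serves infinitely many \<open>c\<close>.\<close>
  have "\<exists>a. infinite {c. (N c, D c) = a}"
  proof (rule ccontr)
    assume "\<not> ?thesis"
    then have "countable (\<Union>a. {c. (N c, D c) = a})" by (intro countable_UN) (auto intro: countable_finite)
    moreover have "(\<Union>a. {c. (N c, D c) = a}) = UNIV" by blast
    ultimately show False using uncountable_UNIV_complex by simp
  qed
  then obtain b where b: "infinite {c. (N c, D c) = b}" by (rule exE)
  define n where "n = fst b"
  define D0 where "D0 = snd b"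
  have "{c. (N c, D c) = b} = {c. N c = n \<and> D c = D0}" by (simp add: n_def D0_def prod_eq_iff)
  with b have "infinite {c. N c = n \<and> D c = D0}" by (simp only: not_False_eq_True)
  \<comment> \<open>One more function \<open>h c\<close> than there are monomials to span them,
    which forces a linear relation.\<close>
  from infinite_arbitrarily_large[OF this, of "Suc (card (monomials x d D0))"]
  obtain I where I: "finite I" "card I = Suc (card (monomials x d D0))" "I \<subseteq> {c. N c = n \<and> D c = D0}"
    by (elim exE conjE)
  then have ND: "N c = n" "D c = D0" if "c \<in> I" for c using that by blast+
  obtain a where a: "\<exists>i\<in>I. a i \<noteq> 0" "\<And>p. (\<Sum>i\<in>I. a i * h i p) = 0"
    by (rule family_dependent[OF finite_monomials[of x d D0] I(1), of h])
      (use I(2) in simp, metis N(3) ND(2), blast)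
  \<comment> \<open>The numerator of the sum of \<open>a c / (y - c)\<close> over \<open>c\<close>
    in \<open>I\<close>. At some \<open>b\<close> in \<open>I\<close> with \<open>a b\<close>
    nonzero only the summand of \<open>b\<close> survives, so \<open>q\<close> is nonzero.\<close>
  define q where "q = (\<Sum>c\<in>I. smult (a c) (\<Prod>l\<in>I - {c}. [:- l, 1:]))"
  obtain b where b: "b \<in> I" "a b \<noteq> 0" using a(1) by blast
  have "poly q b = (\<Sum>c\<in>I. a c * (\<Prod>l\<in>I - {c}. b - l))"
    by (simp add: q_def poly_sum poly_prod)
  also have "\<dots> = (\<Sum>c\<in>I. if c = b then a b * (\<Prod>l\<in>I - {b}. b - l) else 0)"
    using I(1) b(1) by (intro sum.cong) auto
  also have "\<dots> = a b * (\<Prod>l\<in>I - {b}. b - l)" using I(1) b(1) by simp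
  also have "\<dots> \<noteq> 0" using b(2) I(1) by auto
  finally have "q \<noteq> 0" by auto
  have "(\<lambda>p. \<Sum>c\<in>I. (a c * (\<Prod>l\<in>I - {c}. y p - l)) * j c p) \<in> J"
    by (intro fun_ideal_sum[OF J] J'(4) N poly_fun_intros y)
  also have "(\<lambda>p. \<Sum>c\<in>I. (a c * (\<Prod>l\<in>I - {c}. y p - l)) * j c p) = (\<lambda>p. f p ^ n * poly q (y p))"
  proof
    fix p
    have j: "j c p = f p ^ n - (y p - c) * h c p" if "c \<in> I" for c
      using N(1)[of p c] ND(1)[OF that] by simp
    have "(\<Sum>c\<in>I. (a c * (\<Prod>l\<in>I - {c}. y p - l)) * j c p) =
      (\<Sum>c\<in>I. f p ^ n * (a c * (\<Prod>l\<in>I - {c}. y p - l)) - (\<Prod>l\<in>I. y p - l) * (a c * h c p))"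
      by (rule sum.cong) (use I(1) in \<open>auto simp: j prod.remove[OF I(1)] algebra_simps\<close>)
    also have "\<dots> = f p ^ n * poly q (y p) - (\<Prod>l\<in>I. y p - l) * (\<Sum>c\<in>I. a c * h c p)"
      by (simp add: sum_subtractf q_def poly_sum poly_prod sum_distrib_left)
    finally show "(\<Sum>c\<in>I. (a c * (\<Prod>l\<in>I - {c}. y p - l)) * j c p) = f p ^ n * poly q (y p)"
      by (simp add: a(2))
  qed
  finally have "\<exists>m. (\<lambda>p. f p ^ m) \<in> J"
    using power_in_ideal_of_poly[OF A J f y ex \<open>q \<noteq> 0\<close>] by blast
  with n show False by blast
qed

text \<open>If no power of \<open>f\<close> lies in \<open>J\<close>, fix the coordinates one after
  the other, enlarging \<open>J\<close> each time but keeping all powers of \<open>f\<close> out.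
  The final ideal contains every \<open>x i - c i\<close>, so modulo it each function equals its
  value at the point \<open>p\<close> with coordinates \<open>c\<close>. Then \<open>p\<close> is a
  zero of \<open>J\<close>, and \<open>f p = 0\<close> puts \<open>f\<close> itself into the ideal,
  a contradiction.\<close>

theorem nullstellensatz:
  assumes s: "coordinates s d x" and J: "fun_ideal (poly_fun s) J" and f: "f \<in> poly_fun s"
    and zero: "\<And>p. (\<And>g. g \<in> J \<Longrightarrow> g p = 0) \<Longrightarrow> f p = 0"
  obtains n where "(\<lambda>p. f p ^ n) \<in> J"
proof (rule ccontr)
  note A = fun_subalgebra_poly_fun[of s]
  have x: "x i \<in> poly_fun s" if "i < d" for i
    using s that by (auto simp: coordinates_def intro: poly_fun.functional)
  assume "\<not> thesis"
  then have n: "(\<lambda>p. f p ^ n) \<notin> J" for n using that by blast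
  have "\<exists>c J'. fun_ideal (poly_fun s) J' \<and> J \<subseteq> J' \<and> (\<forall>i<m. (\<lambda>p. x i p - c i) \<in> J') \<and>
      (\<forall>n. (\<lambda>p. f p ^ n) \<notin> J')" if "m \<le> d" for m
    using that
  proof (induction m)
    case 0
    then show ?case using J n by blast
  next
    case (Suc m)
    then obtain c J' where J': "fun_ideal (poly_fun s) J'" "J \<subseteq> J'"
      "\<And>i. i < m \<Longrightarrow> (\<lambda>p. x i p - c i) \<in> J'" "\<And>n. (\<lambda>p. f p ^ n) \<notin> J'"
      by (metis Suc_leD)
    have xm: "x m \<in> poly_fun s" using Suc.prems x by simp
    obtain b where b: "\<And>n. (\<lambda>p. f p ^ n) \<notin> adjoin_zero (poly_fun s) J' (x m) b"
      using exists_adjoin_zero[OF s J'(1) f xm J'(4)] by blast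
    note adj = fun_ideal_adjoin_zero[OF A J'(1) xm, of b]
    have "(\<lambda>p. x i p - (c(m := b)) i) \<in> adjoin_zero (poly_fun s) J' (x m) b" if "i < Suc m" for i
      using that adj(2,3) J'(3)[of i] by (cases "i = m") auto
    then show ?case using adj b J'(2) by (intro exI[of _ "c(m := b)"] exI[of _ "adjoin_zero (poly_fun s) J' (x m) b"]) blast
  qed
  from this[OF order.refl] obtain c J' where J': "fun_ideal (poly_fun s) J'" "J \<subseteq> J'"
      "\<And>i. i < d \<Longrightarrow> (\<lambda>p. x i p - c i) \<in> J'" "\<And>n. (\<lambda>p. f p ^ n) \<notin> J'"
    by metis
  note J'' = fun_idealD[OF J'(1)]
  obtain p where p: "\<And>i. i < d \<Longrightarrow> x i p = c i"
    using s unfolding coordinates_def by meson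
  have ev: "(\<lambda>r. g r - g p) \<in> J'" if "g \<in> poly_fun s" for g
    using that
  proof induction
    case (const c)
    then show ?case using J''(2) by simp
  next
    case (functional \<phi>)
    then obtain a where a: "\<And>r. \<phi> r = (\<Sum>i<d. a i * x i r)"
      using s unfolding coordinates_def by blast
    have "(\<lambda>r. x i r - x i p) \<in> J'" if "i < d" for i using J'(3)[OF that] p[OF that] by simp
    then have "(\<lambda>r. \<Sum>i<d. a i * (x i r - x i p)) \<in> J'"
      by (intro fun_ideal_sum[OF J'(1)] J''(4) poly_fun.const) auto
    then show ?case by (simp add: a sum_subtractf right_diff_distrib)
  next
    case (add g h)
    have "(\<lambda>r. (g r - g p) + (h r - h p)) \<in> J'" by (intro J''(3) add)
    then show ?case by (simp add: algebra_simps)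
  next
    case (mult g h)
    have "(\<lambda>r. h r * (g r - g p) + g p * (h r - h p)) \<in> J'"
      by (intro J''(3,4) mult poly_fun.const)
    then show ?case by (simp add: algebra_simps)
  qed
  have "g p = 0" if "g \<in> J" for g
  proof (rule ccontr)
    assume "g p \<noteq> 0"
    have g: "g \<in> J'" "g \<in> poly_fun s" using that J'(2) J''(1) by auto
    \<comment> \<open>This combination is the constant 1, the zeroth power of
      \<open>f\<close>.\<close>
    have "(\<lambda>r. - inverse (g p) * (g r - g p) + inverse (g p) * g r) \<in> J'"
      by (intro J''(3,4) ev g poly_fun.const)
    then have "(\<lambda>r. f r ^ 0) \<in> J'" using \<open>g p \<noteq> 0\<close> by (simp add: algebra_simps)
    with J'(4) show False by blast
  qed
  then have "f p = 0" by (rule zero)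
  then have "(\<lambda>r. f r ^ 1) \<in> J'" using ev[OF f] by simp
  with J'(4) show False by blast
qed

section \<open>Localization of a ring of functions at a prime ideal\<close>

locale fun_prime_ideal =
  fixes A P :: "('a \<Rightarrow> complex) set"
  assumes A: "fun_subalgebra A" and P: "fun_ideal A P" and proper: "(\<lambda>_. 1) \<notin> P"
    and prime: "\<And>f g. f \<in> A \<Longrightarrow> g \<in> A \<Longrightarrow> (\<lambda>x. f x * g x) \<in> P \<Longrightarrow> f \<in> P \<or> g \<in> P"
begin

abbreviation "fr \<equiv> fraction (fun_ring A) P"
abbreviation "L \<equiv> localization (fun_ring A) P"

lemmas A_closed = fun_subalgebraD[OF A]
lemmas P_closed = fun_idealD[OF P]

lemma P_times: "f \<in> P \<Longrightarrow> g \<in> A \<Longrightarrow> (\<lambda>x. f x * g x) \<in> P"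
  using P_closed(4)[of g f] by (simp add: mult.commute)

lemma P_uminus: "f \<in> P \<Longrightarrow> (\<lambda>x. - f x) \<in> P"
  using P_closed(4)[OF A_closed(1)[of "-1"]] by simp

lemma S_one: "(\<lambda>_. 1) \<in> A - P"
  using A_closed(1) proper by simp

lemma S_mult: "s \<in> A - P \<Longrightarrow> t \<in> A - P \<Longrightarrow> (\<lambda>x. s x * t x) \<in> A - P"
  using prime A_closed(3) by blast

lemma fraction_rel_iff:
  "((a, s), (b, t)) \<in> fraction_rel (fun_ring A) P \<longleftrightarrow> a \<in> A \<and> b \<in> A \<and> s \<in> A - P \<and> t \<in> A - P \<and>
     (\<exists>u\<in>A - P. \<forall>x. u x * (a x * t x) = u x * (b x * s x))"
  by (simp add: fraction_rel_def fun_eq_iff)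

lemma equiv_fraction_rel: "equiv (A \<times> (A - P)) (fraction_rel (fun_ring A) P)"
proof (rule equivI)
  show "fraction_rel (fun_ring A) P \<subseteq> (A \<times> (A - P)) \<times> (A \<times> (A - P))"
    by (auto simp: fraction_rel_def)
  show "refl_on (A \<times> (A - P)) (fraction_rel (fun_ring A) P)"
  proof (rule refl_onI)
    fix q assume "q \<in> A \<times> (A - P)"
    then show "(q, q) \<in> fraction_rel (fun_ring A) P"
      using S_one by (cases q) (auto simp: fraction_rel_iff)
  qed
  show "sym (fraction_rel (fun_ring A) P)"
  proof (rule symI)
    fix p q assume "(p, q) \<in> fraction_rel (fun_ring A) P"
    then show "(q, p) \<in> fraction_rel (fun_ring A) P"
      by (cases p; cases q) (simp only: fraction_rel_iff, metis)
  qed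
  show "trans (fraction_rel (fun_ring A) P)"
  proof (rule transI)
    fix p q r assume pq: "(p, q) \<in> fraction_rel (fun_ring A) P" and qr: "(q, r) \<in> fraction_rel (fun_ring A) P"
    obtain a s b t c w where e: "p = (a, s)" "q = (b, t)" "r = (c, w)" by (cases p; cases q; cases r)
    note pq = pq[unfolded e fraction_rel_iff] and qr = qr[unfolded e fraction_rel_iff]
    obtain u where u: "u \<in> A - P" "\<And>x. u x * (a x * t x) = u x * (b x * s x)" using pq by blast
    obtain v where v: "v \<in> A - P" "\<And>x. v x * (b x * w x) = v x * (c x * t x)" using qr by blast
    \<comment> \<open>The middle denominator \<open>t\<close> joins the two multipliers; it lies
      outside \<open>P\<close> as well.\<close>
    have "(u x * v x * t x) * (a x * w x) = (u x * v x * t x) * (c x * s x)" for x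
    proof -
      have "(u x * v x * t x) * (a x * w x) = (u x * (a x * t x)) * (v x * w x)" by simp
      also have "\<dots> = (v x * (b x * w x)) * (u x * s x)" unfolding u(2) by simp
      also have "\<dots> = (u x * v x * t x) * (c x * s x)" unfolding v(2) by simp
      finally show ?thesis .
    qed
    moreover have "(\<lambda>x. u x * v x * t x) \<in> A - P" using u(1) v(1) pq by (intro S_mult) auto
    ultimately have "\<exists>u\<in>A - P. \<forall>x. u x * (a x * w x) = u x * (c x * s x)" by (intro bexI allI)
    then show "(p, r) \<in> fraction_rel (fun_ring A) P"
      unfolding e fraction_rel_iff using pq qr by simp
  qed
qed

lemma fraction_eq_iff:
  assumes "a \<in> A" "s \<in> A - P" "b \<in> A" "t \<in> A - P"
  shows "fr a s = fr b t \<longleftrightarrow> (\<exists>u\<in>A - P. \<forall>x. u x * (a x * t x) = u x * (b x * s x))"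
  unfolding fraction_def using assms
  by (subst eq_equiv_class_iff[OF equiv_fraction_rel]) (simp_all add: fraction_rel_iff)

lemma fraction_eqI_mult:
  assumes "a \<in> A" "s \<in> A - P" "b \<in> A" "t \<in> A - P" "u \<in> A - P"
    "\<And>x. u x * (a x * t x) = u x * (b x * s x)"
  shows "fr a s = fr b t"
  using assms by (subst fraction_eq_iff) auto

lemma fraction_eqI:
  assumes "a \<in> A" "s \<in> A - P" "b \<in> A" "t \<in> A - P" "\<And>x. a x * t x = b x * s x"
  shows "fr a s = fr b t"
  using assms S_one by (subst fraction_eq_iff) auto

lemma mem_fraction:
  assumes "a \<in> A" "s \<in> A - P"
  shows "(b, t) \<in> fr a s \<longleftrightarrow> b \<in> A \<and> t \<in> A - P \<and> (\<exists>u\<in>A - P. \<forall>x. u x * (a x * t x) = u x * (b x * s x))"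
  using assms by (simp add: fraction_def fraction_rel_iff)

lemma self_mem_fraction: "a \<in> A \<Longrightarrow> s \<in> A - P \<Longrightarrow> (a, s) \<in> fr a s"
  using S_one by (subst mem_fraction) auto

text \<open>The operations of \<open>localization\<close> are unions over all representatives. When
  the result does not depend on them, the union is the common value; the given pairs are among the
  representatives, so the union is not empty.\<close>

lemma UN_fraction:
  assumes "a \<in> A" "s \<in> A - P" "b \<in> A" "t \<in> A - P"
    and "\<And>a' s' b' t'. (a', s') \<in> fr a s \<Longrightarrow> (b', t') \<in> fr b t \<Longrightarrow> F a' s' b' t' = F a s b t"
  shows "(\<Union>(a, s)\<in>fr a s. \<Union>(b, t)\<in>fr b t. F a s b t) = F a s b t"
  using self_mem_fraction[OF assms(1,2)] self_mem_fraction[OF assms(3,4)] assms(5) by fast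

lemma fraction_mult:
  assumes "a \<in> A" "s \<in> A - P" "b \<in> A" "t \<in> A - P"
  shows "fr a s \<otimes>\<^bsub>L\<^esub> fr b t = fr (\<lambda>x. a x * b x) (\<lambda>x. s x * t x)"
proof -
  have "fr (\<lambda>x. a' x * b' x) (\<lambda>x. s' x * t' x) = fr (\<lambda>x. a x * b x) (\<lambda>x. s x * t x)"
    if p: "(a', s') \<in> fr a s" and q: "(b', t') \<in> fr b t" for a' s' b' t'
  proof -
    obtain u where u: "u \<in> A - P" "\<And>x. u x * (a x * s' x) = u x * (a' x * s x)"
      using p assms by (auto simp: mem_fraction)
    obtain v where v: "v \<in> A - P" "\<And>x. v x * (b x * t' x) = v x * (b' x * t x)"
      using q assms by (auto simp: mem_fraction)
    have "(u x * v x) * (a' x * b' x * (s x * t x)) = (u x * v x) * (a x * b x * (s' x * t' x))" for x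
    proof -
      have "(u x * v x) * (a' x * b' x * (s x * t x)) = (u x * (a' x * s x)) * (v x * (b' x * t x))" by simp
      also have "\<dots> = (u x * (a x * s' x)) * (v x * (b x * t' x))" unfolding u(2) v(2) ..
      also have "\<dots> = (u x * v x) * (a x * b x * (s' x * t' x))" by simp
      finally show ?thesis .
    qed
    moreover have uv: "(\<lambda>x. u x * v x) \<in> A - P" using u(1) v(1) by (rule S_mult)
    moreover have m: "a' \<in> A" "s' \<in> A - P" "b' \<in> A" "t' \<in> A - P"
      using p q assms by (auto simp: mem_fraction)
    moreover have "s \<in> A" "t \<in> A" "s' \<in> A" "t' \<in> A" using assms m by auto
    ultimately show ?thesis
      by (intro fraction_eqI_mult[OF _ _ _ _ uv] A_closed S_mult assms)
  qed
  then show ?thesis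
    unfolding localization_def using UN_fraction[OF assms, of "\<lambda>a s b t. fr (\<lambda>x. a x * b x) (\<lambda>x. s x * t x)"]
    by simp
qed

lemma fraction_add:
  assumes "a \<in> A" "s \<in> A - P" "b \<in> A" "t \<in> A - P"
  shows "fr a s \<oplus>\<^bsub>L\<^esub> fr b t = fr (\<lambda>x. a x * t x + b x * s x) (\<lambda>x. s x * t x)"
proof -
  have "fr (\<lambda>x. a' x * t' x + b' x * s' x) (\<lambda>x. s' x * t' x) = fr (\<lambda>x. a x * t x + b x * s x) (\<lambda>x. s x * t x)"
    if p: "(a', s') \<in> fr a s" and q: "(b', t') \<in> fr b t" for a' s' b' t'
  proof -
    obtain u where u: "u \<in> A - P" "\<And>x. u x * (a x * s' x) = u x * (a' x * s x)"
      using p assms by (auto simp: mem_fraction)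
    obtain v where v: "v \<in> A - P" "\<And>x. v x * (b x * t' x) = v x * (b' x * t x)"
      using q assms by (auto simp: mem_fraction)
    have "(u x * v x) * ((a' x * t' x + b' x * s' x) * (s x * t x)) =
        (u x * v x) * ((a x * t x + b x * s x) * (s' x * t' x))" for x
    proof -
      have "(u x * v x) * ((a' x * t' x + b' x * s' x) * (s x * t x)) =
          (u x * (a' x * s x)) * (v x * t' x * t x) + (v x * (b' x * t x)) * (u x * s' x * s x)"
        by (simp add: algebra_simps)
      also have "\<dots> = (u x * (a x * s' x)) * (v x * t' x * t x) + (v x * (b x * t' x)) * (u x * s' x * s x)"
        unfolding u(2) v(2) ..
      finally show ?thesis by (simp add: algebra_simps)
    qed
    moreover have uv: "(\<lambda>x. u x * v x) \<in> A - P" using u(1) v(1) by (rule S_mult)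
    moreover have m: "a' \<in> A" "s' \<in> A - P" "b' \<in> A" "t' \<in> A - P"
      using p q assms by (auto simp: mem_fraction)
    moreover have "s \<in> A" "t \<in> A" "s' \<in> A" "t' \<in> A" using assms m by auto
    ultimately show ?thesis
      by (intro fraction_eqI_mult[OF _ _ _ _ uv] A_closed S_mult assms)
  qed
  then show ?thesis
    unfolding localization_def
    using UN_fraction[OF assms, of "\<lambda>a s b t. fr (\<lambda>x. a x * t x + b x * s x) (\<lambda>x. s x * t x)"]
    by simp
qed

lemma carrier_localization: "carrier L = {fr a s | a s. a \<in> A \<and> s \<in> A - P}"
  by (simp add: localization_def)

lemma localization_one: "\<one>\<^bsub>L\<^esub> = fr (\<lambda>_. 1) (\<lambda>_. 1)"
  and localization_zero: "\<zero>\<^bsub>L\<^esub> = fr (\<lambda>_. 0) (\<lambda>_. 1)"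
  by (simp_all add: localization_def)

lemma fraction_in_carrier: "a \<in> A \<Longrightarrow> s \<in> A - P \<Longrightarrow> fr a s \<in> carrier L"
  by (auto simp: carrier_localization)

lemma fraction_cases:
  assumes "X \<in> carrier L"
  obtains a s where "X = fr a s" "a \<in> A" "s \<in> A - P"
  using assms by (auto simp: carrier_localization)

lemma fraction_add_uminus:
  assumes "a \<in> A" "s \<in> A - P"
  shows "fr (\<lambda>x. - a x) s \<oplus>\<^bsub>L\<^esub> fr a s = \<zero>\<^bsub>L\<^esub>"
proof -
  have s: "s \<in> A" using assms by simp
  show ?thesis
    unfolding localization_zero
    by (subst fraction_add, (intro A_closed assms)+, rule fraction_eqI)
      (intro A_closed S_mult S_one assms s | simp)+
qed

lemma cring_localization: "cring L"
proof (rule cringI)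
  note cl = A_closed S_mult S_one fraction_in_carrier
  show "abelian_group L"
  proof (rule abelian_groupI)
    show "\<zero>\<^bsub>L\<^esub> \<in> carrier L" unfolding localization_zero by (intro cl)
  next
    fix X Y assume "X \<in> carrier L" "Y \<in> carrier L"
    then obtain a s b t where e: "X = fr a s" "Y = fr b t" and m: "a \<in> A" "s \<in> A - P" "b \<in> A" "t \<in> A - P"
      by (metis fraction_cases)
    have st: "s \<in> A" "t \<in> A" using m by auto
    show "X \<oplus>\<^bsub>L\<^esub> Y \<in> carrier L" unfolding e fraction_add[OF m] by (intro cl m st)
    show "X \<oplus>\<^bsub>L\<^esub> Y = Y \<oplus>\<^bsub>L\<^esub> X"
      unfolding e fraction_add[OF m] fraction_add[OF m(3,4,1,2)] by (simp add: algebra_simps)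
    fix Z assume "Z \<in> carrier L"
    then obtain c w where z: "Z = fr c w" and m': "c \<in> A" "w \<in> A - P" by (metis fraction_cases)
    have w: "w \<in> A" using m' by auto
    show "X \<oplus>\<^bsub>L\<^esub> Y \<oplus>\<^bsub>L\<^esub> Z = X \<oplus>\<^bsub>L\<^esub> (Y \<oplus>\<^bsub>L\<^esub> Z)"
      unfolding e z fraction_add[OF m] fraction_add[OF m(3,4) m']
      by (subst (1 2) fraction_add) (intro cl m m' st w | simp add: algebra_simps)+
  next
    fix X assume "X \<in> carrier L"
    then obtain a s where e: "X = fr a s" and m: "a \<in> A" "s \<in> A - P"
      by (metis fraction_cases)
    show "\<zero>\<^bsub>L\<^esub> \<oplus>\<^bsub>L\<^esub> X = X"
      unfolding e localization_zero by (subst fraction_add) (intro cl m | simp)+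
    show "\<exists>Y\<in>carrier L. Y \<oplus>\<^bsub>L\<^esub> X = \<zero>\<^bsub>L\<^esub>"
      unfolding e using fraction_add_uminus[OF m] fraction_in_carrier[OF A_closed(4)[OF m(1)] m(2)]
      by (intro bexI)
  qed
  show "comm_monoid L"
  proof (rule comm_monoidI)
    show "\<one>\<^bsub>L\<^esub> \<in> carrier L" unfolding localization_one by (intro cl)
  next
    fix X Y assume "X \<in> carrier L" "Y \<in> carrier L"
    then obtain a s b t where e: "X = fr a s" "Y = fr b t" and m: "a \<in> A" "s \<in> A - P" "b \<in> A" "t \<in> A - P"
      by (metis fraction_cases)
    show "X \<otimes>\<^bsub>L\<^esub> Y \<in> carrier L" unfolding e fraction_mult[OF m] by (intro cl m)
    show "X \<otimes>\<^bsub>L\<^esub> Y = Y \<otimes>\<^bsub>L\<^esub> X"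
      unfolding e fraction_mult[OF m] fraction_mult[OF m(3,4,1,2)] by (simp add: algebra_simps)
    fix Z assume "Z \<in> carrier L"
    then obtain c w where z: "Z = fr c w" and m': "c \<in> A" "w \<in> A - P" by (metis fraction_cases)
    show "X \<otimes>\<^bsub>L\<^esub> Y \<otimes>\<^bsub>L\<^esub> Z = X \<otimes>\<^bsub>L\<^esub> (Y \<otimes>\<^bsub>L\<^esub> Z)"
      unfolding e z fraction_mult[OF m] fraction_mult[OF m(3,4) m']
      by (subst (1 2) fraction_mult) (intro cl m m' | simp add: algebra_simps)+
  next
    fix X assume "X \<in> carrier L"
    then obtain a s where e: "X = fr a s" and m: "a \<in> A" "s \<in> A - P"
      by (metis fraction_cases)
    show "\<one>\<^bsub>L\<^esub> \<otimes>\<^bsub>L\<^esub> X = X"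
      unfolding e localization_one by (subst fraction_mult) (intro cl m | simp)+
  qed
  fix X Y Z assume "X \<in> carrier L" "Y \<in> carrier L" "Z \<in> carrier L"
  then obtain a s b t c w where e: "X = fr a s" "Y = fr b t" "Z = fr c w"
    and m: "a \<in> A" "s \<in> A - P" "b \<in> A" "t \<in> A - P" and m': "c \<in> A" "w \<in> A - P"
    by (metis fraction_cases)
  have st: "s \<in> A" "t \<in> A" "w \<in> A" using m m' by auto
  show "(X \<oplus>\<^bsub>L\<^esub> Y) \<otimes>\<^bsub>L\<^esub> Z = X \<otimes>\<^bsub>L\<^esub> Z \<oplus>\<^bsub>L\<^esub> Y \<otimes>\<^bsub>L\<^esub> Z"
    unfolding e fraction_add[OF m] fraction_mult[OF m(1,2) m'] fraction_mult[OF m(3,4) m']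
    by (subst fraction_mult, (intro cl m m' st)+, subst fraction_add, (intro cl m m' st)+,
      rule fraction_eqI, (intro cl m m' st)+, simp add: algebra_simps)
qed

definition max_ideal where
  "max_ideal = {fr a s | a s. a \<in> P \<and> s \<in> A - P}"

lemma ideal_max_ideal: "ideal max_ideal L"
proof (rule idealI)
  interpret L: cring L by (rule cring_localization)
  have PA: "a \<in> P \<Longrightarrow> a \<in> A" for a using P_closed(1) by blast
  show "ring L" by (rule L.ring_axioms)
  show "subgroup max_ideal (add_monoid L)"
  proof (rule L.add.subgroupI)
    show "max_ideal \<subseteq> carrier L"
      unfolding max_ideal_def using PA fraction_in_carrier by blast
    show "max_ideal \<noteq> {}" unfolding max_ideal_def using P_closed(2) S_one by blast
    fix X assume "X \<in> max_ideal"
    then obtain a s where e: "X = fr a s" "a \<in> P" "s \<in> A - P" by (auto simp: max_ideal_def)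
    have "\<ominus>\<^bsub>L\<^esub> X = fr (\<lambda>x. - a x) s"
      unfolding e using e(2,3) PA
      by (intro L.minus_equality fraction_add_uminus fraction_in_carrier A_closed(4)) auto
    then show "\<ominus>\<^bsub>L\<^esub> X \<in> max_ideal"
      unfolding max_ideal_def using P_uminus[OF e(2)] e(3) by blast
    fix Y assume "Y \<in> max_ideal"
    then obtain b t where f: "Y = fr b t" "b \<in> P" "t \<in> A - P" by (auto simp: max_ideal_def)
    have "X \<oplus>\<^bsub>L\<^esub> Y = fr (\<lambda>x. a x * t x + b x * s x) (\<lambda>x. s x * t x)"
      unfolding e f using e f PA by (intro fraction_add) auto
    moreover have "(\<lambda>x. a x * t x + b x * s x) \<in> P" using e f by (intro P_closed(3) P_times) auto
    ultimately show "X \<oplus>\<^bsub>L\<^esub> Y \<in> max_ideal"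
      unfolding max_ideal_def using S_mult[OF e(3) f(3)] by blast
  qed
  fix X Y assume "X \<in> max_ideal" and Y: "Y \<in> carrier L"
  then obtain a s where e: "X = fr a s" "a \<in> P" "s \<in> A - P" by (auto simp: max_ideal_def)
  obtain b t where f: "Y = fr b t" "b \<in> A" "t \<in> A - P" using Y by (rule fraction_cases)
  have X: "X \<in> carrier L" unfolding e using e PA fraction_in_carrier by blast
  have "X \<otimes>\<^bsub>L\<^esub> Y = fr (\<lambda>x. a x * b x) (\<lambda>x. s x * t x)"
    unfolding e f using e f PA by (intro fraction_mult) auto
  then show "X \<otimes>\<^bsub>L\<^esub> Y \<in> max_ideal"
    unfolding max_ideal_def using S_mult[OF e(3) f(3)] P_times[OF e(2) f(2)] by blast
  then show "Y \<otimes>\<^bsub>L\<^esub> X \<in> max_ideal" using L.m_comm[OF X Y] by simp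
qed

lemma one_notin_max_ideal: "\<one>\<^bsub>L\<^esub> \<notin> max_ideal"
proof
  assume "\<one>\<^bsub>L\<^esub> \<in> max_ideal"
  then obtain a s where e: "fr (\<lambda>_. 1) (\<lambda>_. 1) = fr a s" "a \<in> P" "s \<in> A - P"
    by (auto simp: max_ideal_def localization_one)
  then have "a \<in> A" using P_closed(1) by blast
  with e obtain u where u: "u \<in> A - P" "\<And>x. u x * s x = u x * a x"
    using S_one by (auto simp: fraction_eq_iff)
  have "(\<lambda>x. u x * a x) \<in> P" using u(1) e(2) by (intro P_closed(4)) auto
  then have "(\<lambda>x. u x * s x) \<in> P" by (simp only: u(2))
  with S_mult[OF u(1) e(3)] show False by simp
qed

text \<open>A fraction \<open>a / s\<close> with \<open>a\<close> outside \<open>P\<close> has the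
  inverse \<open>s / a\<close>, so an ideal containing one is the whole ring.\<close>

lemma ideal_subset_max_ideal:
  assumes "ideal c L" "c \<noteq> carrier L"
  shows "c \<subseteq> max_ideal"
proof
  interpret ideal c L by fact
  fix X assume X: "X \<in> c"
  then obtain a s where e: "X = fr a s" "a \<in> A" "s \<in> A - P"
    using a_subset fraction_cases by blast
  have "a \<in> P"
  proof (rule ccontr)
    assume "a \<notin> P"
    with e have a: "a \<in> A - P" "s \<in> A" by auto
    then have "fr s a \<otimes>\<^bsub>L\<^esub> X \<in> c" by (intro I_l_closed X fraction_in_carrier)
    also have "fr s a \<otimes>\<^bsub>L\<^esub> X = \<one>\<^bsub>L\<^esub>"
      unfolding e localization_one
      by (subst fraction_mult, (intro a e)+, rule fraction_eqI) (intro A_closed S_mult S_one a e | simp)+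
    finally show False using one_imp_carrier assms(2) by blast
  qed
  then show "X \<in> max_ideal" unfolding max_ideal_def using e by blast
qed

text \<open>The factor \<open>s\<close> becomes a unit in the localization, so containing
  \<open>s a\<close> is as good as containing \<open>a\<close>.\<close>

lemma max_ideal_subset_ideal:
  assumes "ideal c L" "\<And>a. a \<in> P \<Longrightarrow> \<exists>s\<in>A - P. fr (\<lambda>x. s x * a x) (\<lambda>_. 1) \<in> c"
  shows "max_ideal \<subseteq> c"
proof
  interpret ideal c L by fact
  fix X assume "X \<in> max_ideal"
  then obtain a t where e: "X = fr a t" "a \<in> P" "t \<in> A - P" by (auto simp: max_ideal_def)
  then have a: "a \<in> A" using P_closed(1) by blast
  obtain s where s: "s \<in> A - P" "fr (\<lambda>x. s x * a x) (\<lambda>_. 1) \<in> c" using assms(2) e(2) by blast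
  have st: "s \<in> A" "t \<in> A" using s e by auto
  have "fr (\<lambda>_. 1) (\<lambda>x. s x * t x) \<otimes>\<^bsub>L\<^esub> fr (\<lambda>x. s x * a x) (\<lambda>_. 1) \<in> c"
    using s e by (intro I_l_closed fraction_in_carrier A_closed S_mult)
  also have "fr (\<lambda>_. 1) (\<lambda>x. s x * t x) \<otimes>\<^bsub>L\<^esub> fr (\<lambda>x. s x * a x) (\<lambda>_. 1) = X"
    unfolding e
    by (subst fraction_mult, (intro A_closed S_mult S_one s e a st)+, rule fraction_eqI)
      (intro A_closed S_mult S_one s e a st | simp)+
  finally show "X \<in> c" .
qed

text \<open>By \<open>gen\<close> the ideals \<open>I\<close> and \<open>P\<close> have the same
  extension to the localization, its maximal ideal. Only that ideal and the whole ring lie above it,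
  so chains have at most one strict inclusion, and this one occurs.\<close>

theorem length_at_eq_1:
  assumes I: "I \<subseteq> P" and gen: "\<And>a. a \<in> P \<Longrightarrow> \<exists>s\<in>A - P. (\<lambda>x. s x * a x) \<in> I"
  shows "length_at (fun_ring A) P I = 1"
proof -
  interpret L: cring L by (rule cring_localization)
  let ?G = "genideal L ((\<lambda>a. fr a \<one>\<^bsub>fun_ring A\<^esub>) ` I)"
  have PA: "a \<in> P \<Longrightarrow> a \<in> A" for a using P_closed(1) by blast
  have img: "(\<lambda>a. fr a \<one>\<^bsub>fun_ring A\<^esub>) ` I \<subseteq> carrier L"
    using I PA S_one by (auto intro: fraction_in_carrier)
  have "(\<lambda>a. fr a \<one>\<^bsub>fun_ring A\<^esub>) ` I \<subseteq> max_ideal"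
    unfolding max_ideal_def using I S_one by auto
  then have G: "?G \<subseteq> max_ideal" by (rule L.genideal_minimal[OF ideal_max_ideal])
  have M: "max_ideal \<subseteq> c" if c: "ideal c L" "?G \<subseteq> c" for c
  proof (rule max_ideal_subset_ideal[OF c(1)])
    fix a assume "a \<in> P"
    then obtain s where "s \<in> A - P" "(\<lambda>x. s x * a x) \<in> I" using gen by blast
    moreover have "(\<lambda>a. fr a \<one>\<^bsub>fun_ring A\<^esub>) ` I \<subseteq> c" using L.genideal_self[OF img] c(2) by blast
    ultimately show "\<exists>s\<in>A - P. fr (\<lambda>x. s x * a x) (\<lambda>_. 1) \<in> c" by auto
  qed
  let ?X = "{enat n | n. \<exists>c :: nat \<Rightarrow> (('a \<Rightarrow> complex) \<times> ('a \<Rightarrow> complex)) set set.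
     (\<forall>i\<le>n. ideal (c i) L \<and> ?G \<subseteq> c i) \<and> (\<forall>i<n. c i \<subset> c (Suc i))}"
  have "Sup ?X = 1"
  proof (rule antisym)
    show "Sup ?X \<le> 1"
    proof (rule Sup_least)
      fix N assume "N \<in> ?X"
      then obtain n c where n: "N = enat n" "\<And>i. i \<le> n \<Longrightarrow> ideal (c i) L \<and> ?G \<subseteq> c i"
        "\<And>i. i < n \<Longrightarrow> c i \<subset> c (Suc i)" by auto
      have "n \<le> 1"
      proof (rule ccontr)
        assume "\<not> n \<le> 1"
        \<comment> \<open>With two strict inclusions the middle ideal would be proper and strictly
          above \<open>c 0\<close>, which already contains the maximal ideal.\<close>
        then have "c 0 \<subset> c (Suc 0)" "c (Suc 0) \<subset> c (Suc (Suc 0))" using n(3) by auto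
        moreover have "c (Suc (Suc 0)) \<subseteq> carrier L"
          using n(2)[of "Suc (Suc 0)"] \<open>\<not> n \<le> 1\<close> ideal.Icarr by (metis Suc_leI not_less numeral_2_eq_2 one_add_one plus_1_eq_Suc subsetI)
        ultimately have "c (Suc 0) \<noteq> carrier L" by blast
        then have "c (Suc 0) \<subseteq> max_ideal"
          using ideal_subset_max_ideal n(2)[of "Suc 0"] \<open>\<not> n \<le> 1\<close> by simp
        moreover have "max_ideal \<subseteq> c 0" using M n(2)[of 0] by simp
        ultimately show False using \<open>c 0 \<subset> c (Suc 0)\<close> by blast
      qed
      then show "N \<le> 1" by (simp add: n(1) one_enat_def)
    qed
    show "1 \<le> Sup ?X"
    proof (rule Sup_upper)
      have "max_ideal \<subset> carrier L"
        using one_notin_max_ideal L.one_closed ideal.Icarr[OF ideal_max_ideal] by blast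
      moreover have "?G \<subseteq> carrier L" using G ideal.Icarr[OF ideal_max_ideal] by blast
      ultimately show "1 \<in> ?X"
        unfolding one_enat_def using G ideal_max_ideal L.oneideal
        by (intro CollectI exI[of _ 1] exI[of _ "\<lambda>i::nat. if i = 0 then max_ideal else carrier L"] conjI refl)
          (simp_all add: psubset_imp_subset)
    qed
  qed
  then show ?thesis by (simp add: length_at_def quotient_length_def)
qed

end

section \<open>The Zariski topology\<close>

lemma irreducible_in_finite_Union:
  assumes "irreducible_in T Z" "finite \<C>" "\<And>C. C \<in> \<C> \<Longrightarrow> closedin T C" "Z \<subseteq> \<Union>\<C>"
  obtains C where "C \<in> \<C>" "Z \<subseteq> C"
proof -
  have "\<exists>C\<in>\<C>. Z \<subseteq> C" using assms(2-4)
  proof (induction \<C> rule: finite_induct)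
    case empty
    then show ?case using assms(1) by (simp add: irreducible_in_def)
  next
    case (insert C \<C>)
    then have "closedin T C" "closedin T (\<Union>\<C>)" "Z \<subseteq> C \<union> \<Union>\<C>" by (auto intro: closedin_Union)
    then have "Z \<subseteq> C \<or> Z \<subseteq> \<Union>\<C>" using assms(1) by (simp add: irreducible_in_def)
    then show ?case using insert by auto
  qed
  then show ?thesis using that by blast
qed

lemma irreducible_components_finite_Union:
  assumes "finite \<C>" "\<And>C. C \<in> \<C> \<Longrightarrow> closedin T C" "\<And>C. C \<in> \<C> \<Longrightarrow> irreducible_in T C"
    and antichain: "\<And>C C'. C \<in> \<C> \<Longrightarrow> C' \<in> \<C> \<Longrightarrow> C \<subseteq> C' \<Longrightarrow> C = C'"
  shows "irreducible_components T (\<Union>\<C>) = \<C>"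
proof (intro equalityI subsetI)
  fix Z assume "Z \<in> irreducible_components T (\<Union>\<C>)"
  then have Z: "irreducible_in T Z" "Z \<subseteq> \<Union>\<C>"
    "\<And>Z'. irreducible_in T Z' \<Longrightarrow> Z' \<subseteq> \<Union>\<C> \<Longrightarrow> Z \<subseteq> Z' \<Longrightarrow> Z' = Z"
    by (auto simp: irreducible_components_def)
  obtain C where "C \<in> \<C>" "Z \<subseteq> C" using irreducible_in_finite_Union[OF Z(1) assms(1,2) Z(2)] .
  then show "Z \<in> \<C>" using Z(3)[of C] assms(3) by blast
next
  fix C assume C: "C \<in> \<C>"
  have "Z' = C" if Z': "irreducible_in T Z'" "Z' \<subseteq> \<Union>\<C>" "C \<subseteq> Z'" for Z'
  proof -
    obtain C' where "C' \<in> \<C>" "Z' \<subseteq> C'" using irreducible_in_finite_Union[OF Z'(1) assms(1,2) Z'(2)] .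
    then show ?thesis using antichain[OF C] Z'(3) by blast
  qed
  then show "C \<in> irreducible_components T (\<Union>\<C>)"
    using C assms(3) by (auto simp: irreducible_components_def)
qed

section \<open>Lines as points of projective space\<close>

lemma line_eq_iff:
  assumes "vector_space s" "v \<noteq> 0"
  shows "line s v = line s w \<longleftrightarrow> (\<exists>c. c \<noteq> 0 \<and> w = s c v)"
proof
  interpret vector_space s by fact
  assume e: "line s v = line s w"
  have "w \<in> line s w" unfolding line_def by (rule image_eqI[of _ _ 1]) auto
  then obtain c where c: "w = s c v" using e unfolding line_def by auto
  have "v \<in> line s v" unfolding line_def by (rule image_eqI[of _ _ 1]) auto
  then have "c \<noteq> 0" using c e assms(2) by (auto simp: line_def)
  with c show "\<exists>c. c \<noteq> 0 \<and> w = s c v" by blast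
next
  interpret vector_space s by fact
  assume "\<exists>c. c \<noteq> 0 \<and> w = s c v"
  then obtain c where c: "c \<noteq> 0" "w = s c v" by blast
  have "s d v \<in> line s w" for d
    unfolding line_def using c by (intro image_eqI[of _ _ "d / c"]) auto
  moreover have "s d w \<in> line s v" for d
    unfolding line_def using c by (intro image_eqI[of _ _ "d * c"]) auto
  ultimately show "line s v = line s w" unfolding line_def by blast
qed

lemma line_in_proj_iff:
  assumes "vector_space s"
  shows "line s v \<in> proj s UNIV \<longleftrightarrow> v \<noteq> 0"
proof -
  interpret vector_space s by fact
  have "line s v \<noteq> line s 0" if "v \<noteq> 0" for v
    using line_eq_iff[OF assms that, of 0] that by (auto simp: scale_eq_0_iff)
  then show ?thesis by (auto simp: proj_def)
qed

text \<open>The sum is the value at \<open>z\<close> of a polynomial whose coefficients at the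
  distinct exponents are the \<open>c t\<close>; vanishing at all nonzero \<open>z\<close> makes it
  the zero polynomial.\<close>

lemma sum_powers_eq_0:
  fixes c :: "'i \<Rightarrow> complex"
  assumes "finite T" "inj_on e T" "\<And>z. z \<noteq> 0 \<Longrightarrow> (\<Sum>t\<in>T. z ^ e t * c t) = 0" "t \<in> T"
  shows "c t = 0"
proof -
  define p where "p = (\<Sum>t\<in>T. monom (c t) (e t))"
  have "poly p z = (\<Sum>t\<in>T. z ^ e t * c t)" for z
    by (simp add: p_def poly_sum poly_monom mult.commute)
  with assms(3) have "UNIV - {0} \<subseteq> {z. poly p z = 0}" by auto
  moreover have "infinite (UNIV - {0 :: complex})" by (simp add: infinite_UNIV_char_0)
  ultimately have "p = 0" using poly_roots_finite[of p] finite_subset by blast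
  then have "0 = coeff p (e t)" by simp
  also have "\<dots> = (\<Sum>u\<in>T. if u = t then c t else 0)"
    unfolding p_def coeff_sum using assms(2,4) by (intro sum.cong) (auto simp: inj_on_def)
  also have "\<dots> = c t" using assms(1,4) by simp
  finally show ?thesis by simp
qed

locale product_of_projective_spaces = vector_space scl
  for scl :: "complex \<Rightarrow> 'v::ab_group_add \<Rightarrow> 'v"
begin

declare split_paired_All [simp del] split_paired_Ex [simp del]

abbreviation "scale3 \<equiv> pair_scale scale2 (pair_scale scl scl)"

abbreviation pt :: "C2 \<Rightarrow> 'v \<Rightarrow> 'v \<Rightarrow> 'v point3" where
  "pt a w v \<equiv> (line scale2 a, line scl w, line scl v)"

abbreviation trihomogeneous :: "(C2 \<times> 'v \<times> 'v \<Rightarrow> complex) \<Rightarrow> bool" where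
  "trihomogeneous F \<equiv> \<exists>d e f. trihom scl d e f F"

lemma vector_space_scl: "vector_space scl"
  by (rule vector_space_axioms)

lemma carrier_ring3 [simp]: "carrier (ring3 scl) = poly_fun scale3"
  by (simp add: ring3_def)

lemma cring_ring3: "cring (ring3 scl)"
  unfolding ring3_def by (rule cring_fun_ring[OF fun_subalgebra_poly_fun])

lemma ideal_ring3: "ideal J (ring3 scl) \<longleftrightarrow> fun_ideal (poly_fun scale3) J"
  unfolding ring3_def by (rule ideal_fun_ring[OF fun_subalgebra_poly_fun])

lemma linear_coord:
  "functional scale2 \<chi> \<Longrightarrow> functional scale3 (\<lambda>p. \<chi> (fst p))"
  "functional scl \<phi> \<Longrightarrow> functional scale3 (\<lambda>p. \<phi> (fst (snd p)))"
  "functional scl \<phi> \<Longrightarrow> functional scale3 (\<lambda>p. \<phi> (snd (snd p)))"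
proof -
  note vs = vector_space_scl vector_space_scale2 vector_space_pair_scale[OF vector_space_scl vector_space_scl]
  show "functional scale2 \<chi> \<Longrightarrow> functional scale3 (\<lambda>p. \<chi> (fst p))"
    by (rule linear_compose_functional[OF linear_fst[OF vs(2,3)]])
  show "functional scl \<phi> \<Longrightarrow> functional scale3 (\<lambda>p. \<phi> (fst (snd p)))"
    by (rule linear_compose_functional[OF linear_snd[OF vs(2,3)]
      linear_compose_functional[OF linear_fst[OF vs(1,1)]]])
  show "functional scl \<phi> \<Longrightarrow> functional scale3 (\<lambda>p. \<phi> (snd (snd p)))"
    by (rule linear_compose_functional[OF linear_snd[OF vs(2,3)]
      linear_compose_functional[OF linear_snd[OF vs(1,1)]]])
qed

lemma poly_fun_coord:
  "f \<in> poly_fun scale2 \<Longrightarrow> (\<lambda>p. f (fst p)) \<in> poly_fun scale3"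
  "g \<in> poly_fun scl \<Longrightarrow> (\<lambda>p. g (fst (snd p))) \<in> poly_fun scale3"
  "g \<in> poly_fun scl \<Longrightarrow> (\<lambda>p. g (snd (snd p))) \<in> poly_fun scale3"
proof -
  note vs = vector_space_scl vector_space_scale2 vector_space_pair_scale[OF vector_space_scl vector_space_scl]
  have 1: "poly_map scale3 scale2 fst" "poly_map scale3 (pair_scale scl scl) snd"
    using poly_map_linear[OF linear_fst[OF vs(2,3)]] poly_map_linear[OF linear_snd[OF vs(2,3)]] .
  show "f \<in> poly_fun scale2 \<Longrightarrow> (\<lambda>p. f (fst p)) \<in> poly_fun scale3" by (rule poly_map_comp[OF 1(1)])
  show "g \<in> poly_fun scl \<Longrightarrow> (\<lambda>p. g (fst (snd p))) \<in> poly_fun scale3"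
    by (rule poly_map_comp[OF poly_map_fst[OF 1(2) vs(1,1)]])
  show "g \<in> poly_fun scl \<Longrightarrow> (\<lambda>p. g (snd (snd p))) \<in> poly_fun scale3"
    by (rule poly_map_comp[OF poly_map_snd[OF 1(2) vs(1,1)]])
qed

lemma pt_in_points3 [simp]: "pt a w v \<in> points3 scl \<longleftrightarrow> a \<noteq> 0 \<and> w \<noteq> 0 \<and> v \<noteq> 0"
  by (simp add: points3_def line_in_proj_iff vector_space_scale2 vector_space_scl)

lemma points3_cases:
  assumes "p \<in> points3 scl"
  obtains a w v where "p = pt a w v" "a \<noteq> 0" "w \<noteq> 0" "v \<noteq> 0"
  using assms by (auto simp: points3_def proj_def)

lemma pt_eq_iff:
  assumes "a \<noteq> 0" "w \<noteq> 0" "v \<noteq> 0"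
  shows "pt a w v = pt a' w' v' \<longleftrightarrow>
    (\<exists>r s t. r \<noteq> 0 \<and> s \<noteq> 0 \<and> t \<noteq> 0 \<and> a' = scale2 r a \<and> w' = scl s w \<and> v' = scl t v)"
  using assms by (simp add: line_eq_iff vector_space_scale2 vector_space_scl) blast

lemma trihomD:
  assumes "trihom scl d e f F"
  shows "F \<in> poly_fun scale3" "F (scale2 r a, scl s w, scl t v) = r ^ d * s ^ e * t ^ f * F (a, w, v)"
  using assms unfolding trihom_def carrier_ring3 by blast+

lemma trihomogeneous_zero_iff:
  assumes "trihomogeneous F" "pt a w v = pt a' w' v'" "a \<noteq> 0" "w \<noteq> 0" "v \<noteq> 0"
  shows "F (a', w', v') = 0 \<longleftrightarrow> F (a, w, v) = 0"
  using assms(1,2) unfolding pt_eq_iff[OF assms(3-5)] by (elim exE conjE) (simp add: trihomD(2))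

lemma zeros3D: "p \<in> zeros3 scl S \<Longrightarrow> F \<in> S \<Longrightarrow> p = pt a w v \<Longrightarrow> F (a, w, v) = 0"
  by (simp add: zeros3_def)

lemma zeros3_subset: "zeros3 scl S \<subseteq> points3 scl"
  by (simp add: zeros3_def)

lemma zeros3I:
  "p \<in> points3 scl \<Longrightarrow> (\<And>F a w v. F \<in> S \<Longrightarrow> p = pt a w v \<Longrightarrow> F (a, w, v) = 0) \<Longrightarrow> p \<in> zeros3 scl S"
  by (simp add: zeros3_def)

lemma zeros3_antimono: "S \<subseteq> S' \<Longrightarrow> zeros3 scl S' \<subseteq> zeros3 scl S"
  by (rule subsetI, rule zeros3I) (use zeros3_subset zeros3D in \<open>blast+\<close>)

lemma ideal_of3D: "F \<in> ideal_of3 scl Z \<Longrightarrow> pt a w v \<in> Z \<Longrightarrow> F (a, w, v) = 0"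
  by (simp add: ideal_of3_def)

lemma ideal_of3_subset: "ideal_of3 scl Z \<subseteq> poly_fun scale3"
  by (auto simp: ideal_of3_def)

lemma ideal_of3I:
  "F \<in> poly_fun scale3 \<Longrightarrow> (\<And>a w v. pt a w v \<in> Z \<Longrightarrow> F (a, w, v) = 0) \<Longrightarrow> F \<in> ideal_of3 scl Z"
  by (simp add: ideal_of3_def)

text \<open>\<open>zeros3\<close> quantifies over all representatives of a point. For trihomogeneous
  functions they agree about vanishing, so one representative suffices.\<close>

lemma zeros3_pt:
  assumes "\<And>F. F \<in> S \<Longrightarrow> trihomogeneous F" "a \<noteq> 0" "w \<noteq> 0" "v \<noteq> 0"
  shows "pt a w v \<in> zeros3 scl S \<longleftrightarrow> (\<forall>F\<in>S. F (a, w, v) = 0)"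
proof
  assume *: "pt a w v \<in> zeros3 scl S"
  show "\<forall>F\<in>S. F (a, w, v) = 0" by (rule ballI, rule zeros3D[OF * _ refl])
next
  assume *: "\<forall>F\<in>S. F (a, w, v) = 0"
  show "pt a w v \<in> zeros3 scl S"
  proof (rule zeros3I)
    show "pt a w v \<in> points3 scl" using assms by simp
    fix F a' w' v' assume F: "F \<in> S" "pt a w v = pt a' w' v'"
    then show "F (a', w', v') = 0"
      using trihomogeneous_zero_iff[OF assms(1)[OF F(1)] F(2) assms(2-4)] * by simp
  qed
qed

lemma trihom_mult:
  "trihom scl d e f F \<Longrightarrow> trihom scl d' e' f' G \<Longrightarrow> trihom scl (d + d') (e + e') (f + f') (\<lambda>p. F p * G p)"
  by (auto simp: trihom_def power_add intro: poly_fun.mult)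

lemma trihom_const: "trihom scl 0 0 0 (\<lambda>_. c)"
  by (simp add: trihom_def poly_fun.const)

lemma trihom_zero: "trihom scl d e f (\<lambda>_. 0)"
  by (simp add: trihom_def poly_fun.const)

lemma trihom_add: "trihom scl d e f F \<Longrightarrow> trihom scl d e f G \<Longrightarrow> trihom scl d e f (\<lambda>p. F p + G p)"
  by (auto simp: trihom_def distrib_left intro: poly_fun.add)

lemma trihom_functional:
  "functional scale2 \<chi> \<Longrightarrow> trihom scl 1 0 0 (\<lambda>p. \<chi> (fst p))"
  "functional scl \<phi> \<Longrightarrow> trihom scl 0 1 0 (\<lambda>p. \<phi> (fst (snd p)))"
  "functional scl \<phi> \<Longrightarrow> trihom scl 0 0 1 (\<lambda>p. \<phi> (snd (snd p)))"
  by (auto simp: trihom_def linear_functionalD(2) intro: poly_fun.functional linear_coord)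

lemma topspace_zariski3: "topspace (zariski3 scl) = points3 scl"
proof -
  have "q \<notin> zeros3 scl {\<lambda>_. 1}" if "q \<in> points3 scl" for q
  proof -
    obtain a w v where q: "q = pt a w v" using \<open>q \<in> points3 scl\<close> by (rule points3_cases)
    show ?thesis using zeros3D[OF _ _ q, of "{\<lambda>_. 1}" "\<lambda>_. 1"] by auto
  qed
  then have "points3 scl - zeros3 scl {\<lambda>_. 1} = points3 scl" by blast
  then have "points3 scl \<in> {points3 scl - zeros3 scl {F} | F. trihomogeneous F}"
    using trihom_const by blast
  then have "\<Union>{points3 scl - zeros3 scl {F} | F. trihomogeneous F} = points3 scl"
    by (intro equalityI Union_least Union_upper) blast+
  then show ?thesis
    unfolding zariski3_def topology_generated_by_topspace .
qed

lemma openin_nonzero: "trihomogeneous F \<Longrightarrow> openin (zariski3 scl) (points3 scl - zeros3 scl {F})"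
  unfolding zariski3_def by (rule topology_generated_by_Basis) blast

lemma closedin_zeros3:
  assumes "\<And>F. F \<in> S \<Longrightarrow> trihomogeneous F"
  shows "closedin (zariski3 scl) (zeros3 scl S)"
proof -
  have "points3 scl - zeros3 scl S = (\<Union>F\<in>S. points3 scl - zeros3 scl {F})"
    unfolding zeros3_def by (simp, blast)
  also have "openin (zariski3 scl) \<dots>" using assms by (intro openin_Union) (auto intro: openin_nonzero)
  finally show ?thesis using zeros3_subset by (simp add: closedin_def topspace_zariski3)
qed

text \<open>The nonvanishing sets are declared only as a subbasis. The product of two trihomogeneous
  functions is trihomogeneous and its nonvanishing set is the intersection, so they form a
  basis.\<close>

lemma open_basis:
  assumes "openin (zariski3 scl) U" "p \<in> U"
  shows "\<exists>F. trihomogeneous F \<and> p \<in> points3 scl - zeros3 scl {F} \<and> points3 scl - zeros3 scl {F} \<subseteq> U"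
proof -
  have "generate_topology_on {points3 scl - zeros3 scl {F} | F. trihomogeneous F} U"
    using assms(1) unfolding zariski3_def openin_topology_generated_by_iff .
  then show ?thesis using assms(2)
  proof (induction arbitrary: p)
    case Empty
    then show ?case by simp
  next
    case (Int U V)
    then have "p \<in> U" "p \<in> V" by auto
    from Int.IH(1)[OF this(1)] Int.IH(2)[OF this(2)] obtain F G where
      FG: "trihomogeneous F" "p \<in> points3 scl - zeros3 scl {F}" "points3 scl - zeros3 scl {F} \<subseteq> U"
      "trihomogeneous G" "p \<in> points3 scl - zeros3 scl {G}" "points3 scl - zeros3 scl {G} \<subseteq> V"
      by (elim exE conjE) blast
    have hom: "trihomogeneous (\<lambda>p. F p * G p)" using FG(1,4) trihom_mult by blast
    have "q \<in> points3 scl - zeros3 scl {\<lambda>p. F p * G p} \<longleftrightarrow>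
        q \<in> points3 scl - zeros3 scl {F} \<and> q \<in> points3 scl - zeros3 scl {G}" for q
    proof (cases "q \<in> points3 scl")
      case True
      then obtain a w v where q: "q = pt a w v" "a \<noteq> 0" "w \<noteq> 0" "v \<noteq> 0" by (rule points3_cases)
      have "q \<in> zeros3 scl {H} \<longleftrightarrow> H (a, w, v) = 0" if "trihomogeneous H" for H
        unfolding q(1) by (subst zeros3_pt) (use that q in auto)
      with hom FG(1,4) True show ?thesis by auto
    qed auto
    then show ?case using hom FG by (intro exI[of _ "\<lambda>p. F p * G p"]) blast
  next
    case (UN K)
    then obtain k where "k \<in> K" "p \<in> k" by blast
    then show ?case using UN.IH[of k p] by blast
  next
    case (Basis U)
    then show ?case by blast
  qed
qed

lemma closed_separation:
  assumes "closedin (zariski3 scl) C" "pt a w v \<notin> C" "a \<noteq> 0" "w \<noteq> 0" "v \<noteq> 0"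
  shows "\<exists>F. trihomogeneous F \<and> F (a, w, v) \<noteq> 0 \<and>
    (\<forall>a w v. a \<noteq> 0 \<longrightarrow> w \<noteq> 0 \<longrightarrow> v \<noteq> 0 \<longrightarrow> pt a w v \<in> C \<longrightarrow> F (a, w, v) = 0)"
proof -
  have op: "openin (zariski3 scl) (points3 scl - C)"
    using assms(1) by (simp add: closedin_def topspace_zariski3)
  have mem: "pt a w v \<in> points3 scl - C" using assms by simp
  from open_basis[OF op mem] obtain F where F: "trihomogeneous F"
    "pt a w v \<in> points3 scl - zeros3 scl {F}" "points3 scl - zeros3 scl {F} \<subseteq> points3 scl - C"
    by (elim exE conjE) blast
  have iff: "pt a w v \<in> zeros3 scl {F} \<longleftrightarrow> F (a, w, v) = 0" if "a \<noteq> 0" "w \<noteq> 0" "v \<noteq> 0" for a w v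
    by (subst zeros3_pt) (use F(1) that in auto)
  show ?thesis
  proof (intro exI[of _ F] conjI F(1) allI impI)
    show "F (a, w, v) \<noteq> 0" using F(2) iff[OF assms(3-5)] by simp
    show "F (a, w, v) = 0" if nz: "a \<noteq> 0" "w \<noteq> 0" "v \<noteq> 0" and C: "pt a w v \<in> C" for a w v
    proof -
      have "pt a w v \<in> points3 scl" using nz by simp
      with F(3) C have "pt a w v \<in> zeros3 scl {F}" by blast
      with iff[OF nz] show ?thesis by simp
    qed
  qed
qed

section \<open>Vanishing ideals of sets of points\<close>

lemma ideal_of3_iff:
  assumes "Z \<subseteq> points3 scl"
  shows "F \<in> ideal_of3 scl Z \<longleftrightarrow> F \<in> poly_fun scale3 \<and>
    (\<forall>a w v. a \<noteq> 0 \<longrightarrow> w \<noteq> 0 \<longrightarrow> v \<noteq> 0 \<longrightarrow> pt a w v \<in> Z \<longrightarrow> F (a, w, v) = 0)"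
proof
  assume F: "F \<in> ideal_of3 scl Z"
  then show "F \<in> poly_fun scale3 \<and>
    (\<forall>a w v. a \<noteq> 0 \<longrightarrow> w \<noteq> 0 \<longrightarrow> v \<noteq> 0 \<longrightarrow> pt a w v \<in> Z \<longrightarrow> F (a, w, v) = 0)"
    using ideal_of3_subset by (auto intro: ideal_of3D)
next
  assume F: "F \<in> poly_fun scale3 \<and>
    (\<forall>a w v. a \<noteq> 0 \<longrightarrow> w \<noteq> 0 \<longrightarrow> v \<noteq> 0 \<longrightarrow> pt a w v \<in> Z \<longrightarrow> F (a, w, v) = 0)"
  show "F \<in> ideal_of3 scl Z"
  proof (rule ideal_of3I)
    fix a w v assume z: "pt a w v \<in> Z"
    then have "a \<noteq> 0 \<and> w \<noteq> 0 \<and> v \<noteq> 0" using assms pt_in_points3 by blast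
    then show "F (a, w, v) = 0" using F z by simp
  qed (use F in simp)
qed

lemma fun_ideal_ideal_of3: "fun_ideal (poly_fun scale3) (ideal_of3 scl Z)"
  unfolding fun_ideal_def
  by (intro conjI ballI ideal_of3_subset ideal_of3I poly_fun.const poly_fun.add poly_fun.mult)
    (simp_all add: ideal_of3_def)

lemma ideal_of3_mono: "Z \<subseteq> Z' \<Longrightarrow> ideal_of3 scl Z' \<subseteq> ideal_of3 scl Z"
  by (auto simp: ideal_of3_def)

lemma zeros3_ideal_of3:
  assumes "closedin (zariski3 scl) C"
  shows "zeros3 scl (ideal_of3 scl C) = C"
proof (intro equalityI subsetI)
  have C: "C \<subseteq> points3 scl" using assms closedin_subset topspace_zariski3 by blast
  fix p assume p: "p \<in> zeros3 scl (ideal_of3 scl C)"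
  then have "p \<in> points3 scl" using zeros3_subset by blast
  then obtain a w v where q: "p = pt a w v" "a \<noteq> 0" "w \<noteq> 0" "v \<noteq> 0" by (rule points3_cases)
  show "p \<in> C"
  proof (rule ccontr)
    assume "p \<notin> C"
    then have "pt a w v \<notin> C" using q(1) by simp
    from closed_separation[OF assms this q(2-4)] obtain F where F: "trihomogeneous F" "F (a, w, v) \<noteq> 0"
      "(\<forall>a w v. a \<noteq> 0 \<longrightarrow> w \<noteq> 0 \<longrightarrow> v \<noteq> 0 \<longrightarrow> pt a w v \<in> C \<longrightarrow> F (a, w, v) = 0)" by auto
    have "F \<in> poly_fun scale3" using F(1) trihomD(1) by blast
    then have "F \<in> ideal_of3 scl C" unfolding ideal_of3_iff[OF C] using F(3) by simp
    from zeros3D[OF p this q(1)] F(2) show False by simp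
  qed
next
  fix p assume "p \<in> C"
  then show "p \<in> zeros3 scl (ideal_of3 scl C)"
    using closedin_subset[OF assms] by (intro zeros3I) (auto simp: topspace_zariski3 intro: ideal_of3D)
qed

lemma zeros3_genideal:
  assumes "S \<subseteq> poly_fun scale3"
  shows "zeros3 scl (genideal (ring3 scl) S) = zeros3 scl S"
proof (intro equalityI subsetI)
  interpret R: cring "ring3 scl" by (rule cring_ring3)
  fix p
  show "p \<in> zeros3 scl (genideal (ring3 scl) S) \<Longrightarrow> p \<in> zeros3 scl S"
    using zeros3_antimono[OF R.genideal_self[of S]] assms by auto
  assume p: "p \<in> zeros3 scl S"
  have "ideal (ideal_of3 scl {p}) (ring3 scl)" by (simp add: ideal_ring3 fun_ideal_ideal_of3)
  moreover have "S \<subseteq> ideal_of3 scl {p}" using p assms by (auto intro!: ideal_of3I intro: zeros3D[of p S])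
  ultimately have "genideal (ring3 scl) S \<subseteq> ideal_of3 scl {p}" by (rule R.genideal_minimal)
  then show "p \<in> zeros3 scl (genideal (ring3 scl) S)" 
    using p zeros3_subset by (intro zeros3I) (auto intro: ideal_of3D)
qed

lemma ideal_radical_ring3:
  "ideal_radical (ring3 scl) J = {f \<in> poly_fun scale3. \<exists>n. (\<lambda>p. f p ^ n) \<in> J}"
  by (simp add: ideal_radical_def ring3_def)

lemma zeros3_ideal_radical:
  assumes "J \<subseteq> poly_fun scale3"
  shows "zeros3 scl (ideal_radical (ring3 scl) J) = zeros3 scl J"
proof (intro equalityI subsetI)
  fix p
  have "J \<subseteq> ideal_radical (ring3 scl) J" using assms by (auto simp: ideal_radical_ring3 intro!: exI[of _ 1])
  then show "p \<in> zeros3 scl (ideal_radical (ring3 scl) J) \<Longrightarrow> p \<in> zeros3 scl J"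
    using zeros3_antimono by blast
  assume p: "p \<in> zeros3 scl J"
  have "F (a, w, v) = 0" if F: "F \<in> ideal_radical (ring3 scl) J" and e: "p = pt a w v" for F a w v
  proof -
    obtain n where "(\<lambda>p. F p ^ n) \<in> J" using F by (auto simp: ideal_radical_ring3)
    then have "F (a, w, v) ^ n = 0" by (rule zeros3D[OF p _ e])
    then show ?thesis by simp
  qed
  then show "p \<in> zeros3 scl (ideal_radical (ring3 scl) J)"
    using subsetD[OF zeros3_subset p] by (intro zeros3I)
qed

text \<open>A functional on the product splits into three functionals, one per block, so every
  generator of \<open>poly_fun\<close> is a sum of trihomogeneous functions, and products of such
  functions are again trihomogeneous. It remains to collect equal degrees.\<close>

lemma homogeneous_components:
  assumes "F \<in> poly_fun scale3"
  shows "\<exists>T c. finite T \<and> (\<forall>d e f. trihom scl d e f (c (d, e, f))) \<and> (\<forall>p. F p = (\<Sum>t\<in>T. c t p))"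
proof -
  let ?H = "{F. trihomogeneous F}"
  have mult1: "(\<lambda>p. F p * G p) \<in> fn.span ?H" if F: "F \<in> fn.span ?H" and G: "G \<in> ?H" for F G
    using F
  proof (induction rule: fn.span_induct_alt)
    case base
    then show ?case using fn.span_zero by (simp add: zero_fun_def)
  next
    case (step c f1 f2)
    have "(\<lambda>p. f1 p * G p) \<in> ?H" using step(1) G trihom_mult by blast
    then have "(\<lambda>p. c * (f1 p * G p)) + (\<lambda>p. f2 p * G p) \<in> fn.span ?H"
      by (intro fn.span_add fn.span_scale step) (rule fn.span_base)
    then show ?case by (simp add: plus_fun_def algebra_simps)
  qed
  have mult: "(\<lambda>p. F p * G p) \<in> fn.span ?H" if F: "F \<in> fn.span ?H" and G: "G \<in> fn.span ?H" for F G
    using G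
  proof (induction rule: fn.span_induct_alt)
    case base
    then show ?case using fn.span_zero by (simp add: zero_fun_def)
  next
    case (step c f1 f2)
    have "(\<lambda>p. c * (F p * f1 p)) + (\<lambda>p. F p * f2 p) \<in> fn.span ?H"
      by (intro fn.span_add fn.span_scale mult1[OF F] step)
    then show ?case by (simp add: plus_fun_def algebra_simps)
  qed
  have "F \<in> fn.span ?H" using assms
  proof induction
    case (const c)
    then show ?case using trihom_const by (intro fn.span_base) blast
  next
    case (functional \<phi>)
    note d = linear_pair_scale_decompose[OF functional vector_space_scale2
        vector_space_pair_scale[OF vector_space_scl vector_space_scl]]
    note d' = linear_pair_scale_decompose[OF d(2) vector_space_scl vector_space_scl]
    have "(\<lambda>p. \<phi> (fst p, 0)) + (\<lambda>p. \<phi> (0, fst (snd p), 0)) + (\<lambda>p. \<phi> (0, 0, snd (snd p))) \<in> fn.span ?H"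
      using trihom_functional(1)[OF d(1)] trihom_functional(2)[OF d'(1)] trihom_functional(3)[OF d'(2)]
      by (intro fn.span_add fn.span_base CollectI) blast+
    also have "(\<lambda>p. \<phi> (fst p, 0)) + (\<lambda>p. \<phi> (0, fst (snd p), 0)) + (\<lambda>p. \<phi> (0, 0, snd (snd p))) = \<phi>"
    proof
      fix p
      show "((\<lambda>p. \<phi> (fst p, 0)) + (\<lambda>p. \<phi> (0, fst (snd p), 0)) + (\<lambda>p. \<phi> (0, 0, snd (snd p)))) p = \<phi> p"
        using d(3)[of "fst p" "snd p"] d'(3)[of "fst (snd p)" "snd (snd p)"] by simp
    qed
    finally show ?case .
  next
    case (add f g)
    then have "f + g \<in> fn.span ?H" by (intro fn.span_add)
    then show ?case by (simp add: plus_fun_def)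
  next
    case (mult f g)
    then show ?case using \<open>\<And>G F. F \<in> fn.span ?H \<Longrightarrow> G \<in> fn.span ?H \<Longrightarrow> _\<close> by simp
  qed
  \<comment> \<open>The additional clause that \<open>c\<close> vanishes off \<open>T\<close> allows
    a new function to be added to the component of its degree whether or not that degree already
    occurs.\<close>
  then have "\<exists>T c. finite T \<and> (\<forall>d e f. trihom scl d e f (c (d, e, f))) \<and> (\<forall>t. t \<notin> T \<longrightarrow> c t = (\<lambda>_. 0)) \<and>
      (\<forall>p. F p = (\<Sum>t\<in>T. c t p))"
  proof (induction rule: fn.span_induct_alt)
    case base
    show ?case by (rule exI[of _ "{}"], rule exI[of _ "\<lambda>_ _. 0"]) (simp add: trihom_zero)
  next
    case (step k G H)
    then obtain T c where T: "finite T" "\<And>d e f. trihom scl d e f (c (d, e, f))" "\<And>t. t \<notin> T \<Longrightarrow> c t = (\<lambda>_. 0)"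
      "\<And>p. H p = (\<Sum>t\<in>T. c t p)" by blast
    obtain d e f where G: "trihom scl d e f G" using step by blast
    let ?t = "(d, e, f)"
    let ?c = "c(?t := (\<lambda>p. k * G p + c ?t p))"
    have "trihom scl (0 + d) (0 + e) (0 + f) (\<lambda>p. k * G p)" by (rule trihom_mult[OF trihom_const G])
    then have hom: "trihom scl i j l (?c (i, j, l))" for i j l
      using T(2) trihom_add[of d e f "\<lambda>p. k * G p" "c ?t"] by auto
    have "(\<Sum>t\<in>insert ?t T. ?c t p) = k * G p + H p" for p
    proof -
      have "(\<Sum>t\<in>insert ?t T. ?c t p) = (k * G p + c ?t p) + (\<Sum>t\<in>T - {?t}. c t p)"
        using T(1) by (subst sum.insert_remove) (auto intro!: sum.cong)
      also have "c ?t p + (\<Sum>t\<in>T - {?t}. c t p) = (\<Sum>t\<in>insert ?t T. c t p)"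
        using T(1) by (simp add: sum.insert_remove)
      then have "(k * G p + c ?t p) + (\<Sum>t\<in>T - {?t}. c t p) = k * G p + (\<Sum>t\<in>insert ?t T. c t p)"
        by simp
      also have "(\<Sum>t\<in>insert ?t T. c t p) = (\<Sum>t\<in>T. c t p)"
        using T(1,3) by (intro sum.mono_neutral_right) auto
      finally show ?thesis by (simp add: T(4))
    qed
    moreover have "?c t = (\<lambda>_. 0)" if "t \<notin> insert ?t T" for t using that T(3) by auto
    ultimately show ?case
      using T(1) hom by (intro exI[of _ "insert ?t T"] exI[of _ ?c]) (simp add: plus_fun_def)
  qed
  then show ?thesis by blast
qed

text \<open>Kronecker substitution: with \<open>r = z ^ (M * M)\<close>, \<open>s = z ^ M\<close>
  and \<open>t = z\<close> a triple of degrees becomes one exponent, written in base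
  \<open>M\<close>. As \<open>M\<close> exceeds all degrees that occur, distinct triples give
  distinct exponents, and the values of the components are the coefficients of a polynomial in
  \<open>z\<close>.\<close>

lemma homogeneous_component_zero:
  assumes "finite T" "\<And>d e f. trihom scl d e f (c (d, e, f))"
    and "\<And>r s t. r \<noteq> 0 \<Longrightarrow> s \<noteq> 0 \<Longrightarrow> t \<noteq> 0 \<Longrightarrow> (\<Sum>u\<in>T. c u (scale2 r a, scl s w, scl t v)) = 0"
    and "u \<in> T"
  shows "c u (a, w, v) = 0"
proof -
  obtain M where M: "\<And>d e f. (d, e, f) \<in> T \<Longrightarrow> d < M \<and> e < M \<and> f < M"
  proof -
    define M where "M = Suc (\<Sum>(d, e, f)\<in>T. d + e + f)"
    have "d + e + f < M" if "(d, e, f) \<in> T" for d e f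
      using member_le_sum[OF that, of "\<lambda>(d, e, f). d + e + f"] assms(1) by (simp add: M_def)
    then show thesis using that[of M] by force
  qed
  let ?e = "\<lambda>(d, e, f). (d * M + e) * M + f"
  have inj: "inj_on ?e T"
  proof (rule inj_onI)
    fix x y assume xy: "x \<in> T" "y \<in> T" "?e x = ?e y"
    obtain d e f d' e' f' where e: "x = (d, e, f)" "y = (d', e', f')" by (cases x, cases y)
    have t: "(d, e, f) \<in> T" "(d', e', f') \<in> T" and eq: "(d * M + e) * M + f = (d' * M + e') * M + f'"
      using xy e by auto
    note m = M[OF t(1)] M[OF t(2)]
    have f: "f = f'" using arg_cong[OF eq, of "\<lambda>n. n mod M"] m by simp
    with eq m have "d * M + e = d' * M + e'" by auto
    moreover from this have "e = e'" using arg_cong[of _ _ "\<lambda>n. n mod M"] m by (metis mod_less mod_mult_self3)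
    ultimately show "x = y" unfolding e using f m by auto
  qed
  have "(\<Sum>u\<in>T. z ^ ?e u * c u (a, w, v)) = 0" if "z \<noteq> 0" for z
  proof -
    have "(\<Sum>u\<in>T. z ^ ?e u * c u (a, w, v)) = (\<Sum>u\<in>T. c u (scale2 (z ^ (M * M)) a, scl (z ^ M) w, scl z v))"
      by (intro sum.cong refl)
        (auto simp: trihomD(2)[OF assms(2)] power_add algebra_simps simp flip: power_mult)
    then show ?thesis using assms(3)[of "z ^ (M * M)" "z ^ M" z] that by simp
  qed
  from sum_powers_eq_0[OF assms(1) inj this assms(4)] show ?thesis .
qed

text \<open>Closed sets come from trihomogeneous functions but the ideal contains arbitrary ones.
  All rescaled representatives of a point of \<open>X\<close> are zeros of \<open>F\<close>; hence
  each homogeneous component of \<open>F\<close> vanishes on \<open>X\<close>, and its zero set is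
  closed.\<close>

lemma ideal_of3_closure:
  assumes "X \<subseteq> points3 scl"
  shows "ideal_of3 scl (zariski3 scl closure_of X) = ideal_of3 scl X"
proof
  show "ideal_of3 scl (zariski3 scl closure_of X) \<subseteq> ideal_of3 scl X"
    using assms by (intro ideal_of3_mono closure_of_subset) (simp add: topspace_zariski3)
  show "ideal_of3 scl X \<subseteq> ideal_of3 scl (zariski3 scl closure_of X)"
  proof
    fix F assume "F \<in> ideal_of3 scl X"
    then have F: "F \<in> poly_fun scale3" "\<And>a w v. pt a w v \<in> X \<Longrightarrow> F (a, w, v) = 0"
      using ideal_of3_subset ideal_of3D by blast+
    obtain T c where T: "finite T" "\<And>d e f. trihom scl d e f (c (d, e, f))" "\<And>p. F p = (\<Sum>t\<in>T. c t p)"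
      using homogeneous_components[OF F(1)] by (elim exE conjE) auto
    have hom: "trihomogeneous (c u)" for u using T(2) by (metis prod.exhaust)
    have "X \<subseteq> zeros3 scl {c u}" if "u \<in> T" for u
    proof
      fix p assume "p \<in> X"
      then obtain a w v where p: "p = pt a w v" "a \<noteq> 0" "w \<noteq> 0" "v \<noteq> 0"
        using assms points3_cases by blast
      have "c u (a, w, v) = 0"
      proof (rule homogeneous_component_zero[OF T(1,2) _ that])
        fix r s t :: complex assume "r \<noteq> 0" "s \<noteq> 0" "t \<noteq> 0"
        then have "pt a w v = pt (scale2 r a) (scl s w) (scl t v)" using p pt_eq_iff by blast
        then show "(\<Sum>u\<in>T. c u (scale2 r a, scl s w, scl t v)) = 0"
          using F(2) T(3) \<open>p \<in> X\<close> p(1) by metis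
      qed
      then show "p \<in> zeros3 scl {c u}" unfolding p(1) by (subst zeros3_pt) (use hom p in auto)
    qed
    then have closure: "zariski3 scl closure_of X \<subseteq> zeros3 scl {c u}" if "u \<in> T" for u
      using that hom by (intro closure_of_minimal closedin_zeros3) auto
    have "c u (a, w, v) = 0" if "pt a w v \<in> zariski3 scl closure_of X" "u \<in> T" for a w v u
      by (rule zeros3D[OF subsetD[OF closure[OF that(2)] that(1)] _ refl]) simp
    then show "F \<in> ideal_of3 scl (zariski3 scl closure_of X)"
      by (intro ideal_of3I F(1)) (simp add: T(3))
  qed
qed

text \<open>If \<open>Z\<close> were covered by \<open>A\<close> and \<open>B\<close> but contained
  in neither, a function vanishing on \<open>A\<close> and one vanishing on \<open>B\<close>, each
  nonzero somewhere on \<open>Z\<close>, would have a product in the ideal.\<close>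

lemma irreducible_in_zariski3I:
  assumes "Z \<subseteq> points3 scl" "Z \<noteq> {}"
    and prime: "\<And>F G. (\<lambda>p. F p * G p) \<in> ideal_of3 scl Z \<Longrightarrow> F \<in> poly_fun scale3 \<Longrightarrow> G \<in> poly_fun scale3 \<Longrightarrow>
      F \<in> ideal_of3 scl Z \<or> G \<in> ideal_of3 scl Z"
  shows "irreducible_in (zariski3 scl) Z"
  unfolding irreducible_in_def topspace_zariski3
proof (intro conjI allI impI assms(1,2))
  fix A B assume AB: "closedin (zariski3 scl) A \<and> closedin (zariski3 scl) B \<and> Z \<subseteq> A \<union> B"
  show "Z \<subseteq> A \<or> Z \<subseteq> B"
  proof (rule ccontr)
    assume "\<not> (Z \<subseteq> A \<or> Z \<subseteq> B)"
    then obtain p q where pq: "p \<in> Z" "p \<notin> A" "q \<in> Z" "q \<notin> B" by blast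
    obtain a w v where p: "p = pt a w v" "a \<noteq> 0" "w \<noteq> 0" "v \<noteq> 0" using pq assms(1) points3_cases by blast
    obtain a' w' v' where q: "q = pt a' w' v'" "a' \<noteq> 0" "w' \<noteq> 0" "v' \<noteq> 0" using pq assms(1) points3_cases by blast
    from closed_separation[of A a w v] AB pq p obtain F where F: "trihomogeneous F" "F (a, w, v) \<noteq> 0"
      "(\<forall>a w v. a \<noteq> 0 \<longrightarrow> w \<noteq> 0 \<longrightarrow> v \<noteq> 0 \<longrightarrow> pt a w v \<in> A \<longrightarrow> F (a, w, v) = 0)" by auto
    from closed_separation[of B a' w' v'] AB pq q obtain G where G: "trihomogeneous G" "G (a', w', v') \<noteq> 0"
      "(\<forall>a w v. a \<noteq> 0 \<longrightarrow> w \<noteq> 0 \<longrightarrow> v \<noteq> 0 \<longrightarrow> pt a w v \<in> B \<longrightarrow> G (a, w, v) = 0)" by auto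
    have FG: "F \<in> poly_fun scale3" "G \<in> poly_fun scale3" using F(1) G(1) trihomD(1) by auto
    have "(\<lambda>p. F p * G p) \<in> ideal_of3 scl Z"
      unfolding ideal_of3_iff[OF assms(1)]
    proof (intro conjI allI impI poly_fun.mult[OF FG])
      fix a w v assume nz: "a \<noteq> 0" "w \<noteq> 0" "v \<noteq> 0" and "pt a w v \<in> Z"
      then have "pt a w v \<in> A \<or> pt a w v \<in> B" using AB by blast
      then show "F (a, w, v) * G (a, w, v) = 0" using F(3) G(3) nz by auto
    qed
    then have "F \<in> ideal_of3 scl Z \<or> G \<in> ideal_of3 scl Z" using prime FG by blast
    then show False using F(2) G(2) p q pq(1,3) ideal_of3D by blast
  qed
qed

text \<open>Provides the cancellation that is required when \<open>F\<close> is adjoined to an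
  algebraically independent family. Where \<open>F\<close> does not vanish every component of
  \<open>H\<close> does, so \<open>Z\<close> is covered by the zero sets of \<open>F\<close> and of
  that component; irreducibility leaves only the second.\<close>

lemma ideal_of3_cancel:
  assumes Z: "irreducible_in (zariski3 scl) Z" and F: "trihomogeneous F" "F \<notin> ideal_of3 scl Z"
    and H: "H \<in> poly_fun scale3" "(\<lambda>p. F p * H p) \<in> ideal_of3 scl Z"
  shows "H \<in> ideal_of3 scl Z"
proof -
  have sub: "Z \<subseteq> points3 scl" using Z by (simp add: irreducible_in_def topspace_zariski3)
  obtain T c where T: "finite T" "\<And>d e f. trihom scl d e f (c (d, e, f))" "\<And>p. H p = (\<Sum>t\<in>T. c t p)"
    using homogeneous_components[OF H(1)] by (elim exE conjE) auto
  have hom: "trihomogeneous (c u)" for u using T(2) by (metis prod.exhaust)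
  have zF: "pt a w v \<in> zeros3 scl {G} \<longleftrightarrow> G (a, w, v) = 0"
    if "trihomogeneous G" "a \<noteq> 0" "w \<noteq> 0" "v \<noteq> 0" for a w v G
    by (subst zeros3_pt) (use that in auto)
  have "c u \<in> ideal_of3 scl Z" if u: "u \<in> T" for u
  proof -
    have "Z \<subseteq> zeros3 scl {F} \<union> zeros3 scl {c u}"
    proof
      fix p assume "p \<in> Z"
      then obtain a w v where p: "p = pt a w v" "a \<noteq> 0" "w \<noteq> 0" "v \<noteq> 0" using sub points3_cases by blast
      show "p \<in> zeros3 scl {F} \<union> zeros3 scl {c u}"
      proof (cases "F (a, w, v) = 0")
        case True
        then show ?thesis using zF[OF F(1) p(2-4)] p(1) by simp
      next
        case False
        have "c u (a, w, v) = 0"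
        proof (rule homogeneous_component_zero[OF T(1,2) _ u])
          fix r s t :: complex assume nz: "r \<noteq> 0" "s \<noteq> 0" "t \<noteq> 0"
          then have e: "pt a w v = pt (scale2 r a) (scl s w) (scl t v)" using p pt_eq_iff by blast
          have "F (scale2 r a, scl s w, scl t v) * H (scale2 r a, scl s w, scl t v) = 0"
            by (rule ideal_of3D[OF H(2)]) (use \<open>p \<in> Z\<close> p(1) e in simp)
          moreover have "F (scale2 r a, scl s w, scl t v) \<noteq> 0"
            using trihomogeneous_zero_iff[OF F(1) e p(2-4)] False by simp
          ultimately show "(\<Sum>u\<in>T. c u (scale2 r a, scl s w, scl t v)) = 0" by (simp add: T(3))
        qed
        then show ?thesis using zF[OF hom p(2-4)] p(1) by simp
      qed
    qed
    moreover have "closedin (zariski3 scl) (zeros3 scl {F})" "closedin (zariski3 scl) (zeros3 scl {c u})"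
      by (rule closedin_zeros3, use F(1) in simp, rule closedin_zeros3, use hom[of u] in simp)
    ultimately have "Z \<subseteq> zeros3 scl {F} \<or> Z \<subseteq> zeros3 scl {c u}"
      using Z unfolding irreducible_in_def by blast
    moreover have vanish: "G \<in> ideal_of3 scl Z" if "Z \<subseteq> zeros3 scl {G}" "trihomogeneous G" for G
      using that trihomD(1) by (intro ideal_of3I zeros3D[of _ "{G}"]) auto
    ultimately show ?thesis using F hom by blast
  qed
  then have "(\<lambda>p. \<Sum>u\<in>T. c u p) \<in> ideal_of3 scl Z" by (rule fun_ideal_sum[OF fun_ideal_ideal_of3])
  then show ?thesis by (simp flip: T(3))
qed

text \<open>Two points of \<open>Z\<close> with \<open>F \<noteq> 0\<close> at the one and \<open>G \<noteq> 0\<close> at the other are joined by a curve, on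
  which \<open>F * G\<close> has only finitely many zeros.\<close>

lemma fun_prime_ideal_of3:
  assumes "Z \<subseteq> points3 scl" "Z \<noteq> {}"
    and curve: "\<And>a w v a' w' v'. pt a w v \<in> Z \<Longrightarrow> pt a' w' v' \<in> Z \<Longrightarrow>
      \<exists>\<alpha> \<omega> \<nu>. poly_map (*) scale2 \<alpha> \<and> poly_map (*) scl \<omega> \<and> poly_map (*) scl \<nu> \<and>
        \<alpha> 0 = a \<and> \<omega> 0 = w \<and> \<nu> 0 = v \<and> \<alpha> 1 = a' \<and> \<omega> 1 = w' \<and> \<nu> 1 = v' \<and>
        (\<forall>z. \<alpha> z \<noteq> 0 \<longrightarrow> \<omega> z \<noteq> 0 \<longrightarrow> \<nu> z \<noteq> 0 \<longrightarrow> pt (\<alpha> z) (\<omega> z) (\<nu> z) \<in> Z)"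
  shows "fun_prime_ideal (poly_fun scale3) (ideal_of3 scl Z)"
proof
  show "fun_subalgebra (poly_fun scale3)" by (rule fun_subalgebra_poly_fun)
  show "fun_ideal (poly_fun scale3) (ideal_of3 scl Z)" by (rule fun_ideal_ideal_of3)
  show "(\<lambda>_. 1) \<notin> ideal_of3 scl Z" 
  proof
    assume one: "(\<lambda>_. 1) \<in> ideal_of3 scl Z"
    obtain p where "p \<in> Z" using assms(2) by blast
    then obtain a w v where "pt a w v \<in> Z" using assms(1) points3_cases by (metis subsetD)
    from ideal_of3D[OF one this] show False by simp
  qed
  fix F G assume FG: "F \<in> poly_fun scale3" "G \<in> poly_fun scale3" "(\<lambda>p. F p * G p) \<in> ideal_of3 scl Z"
  show "F \<in> ideal_of3 scl Z \<or> G \<in> ideal_of3 scl Z"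
  proof (rule ccontr)
    assume "\<not> ?thesis"
    then obtain a w v a' w' v' where p: "pt a w v \<in> Z" "F (a, w, v) \<noteq> 0" and q: "pt a' w' v' \<in> Z" "G (a', w', v') \<noteq> 0"
      using ideal_of3I[OF FG(1)] ideal_of3I[OF FG(2)] by metis
    have nz: "a \<noteq> 0" "w \<noteq> 0" "v \<noteq> 0" "a' \<noteq> 0" "w' \<noteq> 0" "v' \<noteq> 0" using p(1) q(1) assms(1) pt_in_points3 by blast+
    obtain \<alpha> \<omega> \<nu> where c: "poly_map (*) scale2 \<alpha>" "poly_map (*) scl \<omega>" "poly_map (*) scl \<nu>"
      "\<alpha> 0 = a" "\<omega> 0 = w" "\<nu> 0 = v" "\<alpha> 1 = a'" "\<omega> 1 = w'" "\<nu> 1 = v'"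
      "\<And>z. \<alpha> z \<noteq> 0 \<Longrightarrow> \<omega> z \<noteq> 0 \<Longrightarrow> \<nu> z \<noteq> 0 \<Longrightarrow> pt (\<alpha> z) (\<omega> z) (\<nu> z) \<in> Z"
      using curve[OF p(1) q(1)] by blast
    obtain \<chi> \<phi> \<psi> where x: "functional scale2 \<chi>" "\<chi> a = 1" "functional scl \<phi>" "\<phi> w = 1"
      "functional scl \<psi>" "\<psi> v = 1"
      using functional_nonzero[OF vector_space_scale2 nz(1)] functional_nonzero[OF vector_space_scl nz(2)]
        functional_nonzero[OF vector_space_scl nz(3)] by metis
    have "poly_map (*) scale3 (\<lambda>z. (\<alpha> z, \<omega> z, \<nu> z))"
      by (intro poly_map_Pair c vector_space_scale2 vector_space_scl vector_space_pair_scale)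
    \<comment> \<open>The three functionals are 1 at parameter 0. Where their product is nonzero, so
      are the three vectors, and the curve passes through an actual point of
      \<open>Z\<close>.\<close>
    then have "(\<lambda>z. F (\<alpha> z, \<omega> z, \<nu> z) * (\<chi> (\<alpha> z) * \<phi> (\<omega> z) * \<psi> (\<nu> z))) \<in> poly_fun (*)"
      "(\<lambda>z. G (\<alpha> z, \<omega> z, \<nu> z)) \<in> poly_fun (*)"
      using FG by (auto intro!: poly_fun_intros poly_map_comp[OF _ FG(1)] poly_map_comp[OF _ FG(2)]
          poly_map_functional[OF c(1) x(1)] poly_map_functional[OF c(2) x(3)] poly_map_functional[OF c(3) x(5)])
    then obtain z where z: "F (\<alpha> z, \<omega> z, \<nu> z) * (\<chi> (\<alpha> z) * \<phi> (\<omega> z) * \<psi> (\<nu> z)) \<noteq> 0" "G (\<alpha> z, \<omega> z, \<nu> z) \<noteq> 0"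
      by (rule poly_fun_domain[OF vector_space_complex, of _ _ 0 1]) (use p q c x in auto)
    then have "\<alpha> z \<noteq> 0" "\<omega> z \<noteq> 0" "\<nu> z \<noteq> 0"
      using linear_functionalD(3)[OF x(1)] linear_functionalD(3)[OF x(3)] linear_functionalD(3)[OF x(5)] by auto
    then have "pt (\<alpha> z) (\<omega> z) (\<nu> z) \<in> Z" by (rule c(10))
    then have "F (\<alpha> z, \<omega> z, \<nu> z) * G (\<alpha> z, \<omega> z, \<nu> z) = 0" by (rule ideal_of3D[OF FG(3)])
    with z show False by auto
  qed
qed

end

section \<open>Bounding the dimension\<close>

lemma span_monomials_power:
  assumes "f \<in> fn.span (monomials x d D)"
  shows "(\<lambda>p. f p ^ n) \<in> fn.span (monomials x d (n * D))"
proof (induction n)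
  case 0
  have "monom_fun x d (\<lambda>_. 0) \<in> fn.span (monomials x d 0)"
    by (intro fn.span_base monom_fun_in_monomials) auto
  then show ?case by (simp add: monom_fun_def)
next
  case (Suc n)
  from span_monomials_mult[OF assms Suc] show ?case by simp
qed

lemma span_monomials_prod:
  fixes m :: nat
  assumes "\<And>i. i < m \<Longrightarrow> h i \<in> fn.span (monomials x d (D i))"
  shows "(\<lambda>p. \<Prod>i<m. h i p) \<in> fn.span (monomials x d (\<Sum>i<m. D i))"
  using assms
proof (induction m)
  case 0
  have "monom_fun x d (\<lambda>_. 0) \<in> fn.span (monomials x d 0)"
    by (intro fn.span_base monom_fun_in_monomials) auto
  then show ?case by (simp add: monom_fun_def)
next
  case (Suc m)
  have "(\<lambda>p. (\<Prod>i<m. h i p) * h m p) \<in> fn.span (monomials x d ((\<Sum>i<m. D i) + D m))"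
    by (rule span_monomials_mult[OF Suc.IH Suc.prems]) (use Suc.prems in auto)
  then show ?case by simp
qed

lemma span_monomials_mono:
  "g \<in> fn.span (monomials x d D) \<Longrightarrow> D \<le> D' \<Longrightarrow> g \<in> fn.span (monomials x d D')"
  using fn.span_mono[OF monomials_mono] by blast

text \<open>Algebraic independence in the quotient by \<open>J\<close>. Exponent vectors are
  extensional functions, so distinct members of \<open>I\<close> are distinct monomials and a
  nonzero coefficient means a nonzero polynomial.\<close>

definition alg_indep :: "('a \<Rightarrow> complex) set \<Rightarrow> nat \<Rightarrow> (nat \<Rightarrow> 'a \<Rightarrow> complex) \<Rightarrow> bool" where
  "alg_indep J m f \<longleftrightarrow> (\<forall>I a. finite I \<and> I \<subseteq> {..<m} \<rightarrow>\<^sub>E UNIV \<and> (\<exists>e\<in>I. a e \<noteq> 0) \<longrightarrow>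
     (\<lambda>p. \<Sum>e\<in>I. a e * monom_fun f m e p) \<notin> J)"

lemma alg_indepD:
  "alg_indep J m f \<Longrightarrow> finite I \<Longrightarrow> I \<subseteq> {..<m} \<rightarrow>\<^sub>E UNIV \<Longrightarrow> \<exists>e\<in>I. a e \<noteq> 0 \<Longrightarrow>
    (\<lambda>p. \<Sum>e\<in>I. a e * monom_fun f m e p) \<notin> J"
  unfolding alg_indep_def by simp

lemma alg_indep_antimono: "alg_indep J m f \<Longrightarrow> J' \<subseteq> J \<Longrightarrow> alg_indep J' m f"
  by (fastforce simp: alg_indep_def)

lemma alg_indep_0:
  assumes A: "fun_subalgebra A" and J: "fun_ideal A J" and proper: "(\<lambda>_. 1) \<notin> J"
  shows "alg_indep J 0 f"
  unfolding alg_indep_def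
proof (intro allI impI notI)
  fix I :: "(nat \<Rightarrow> nat) set" and a :: "(nat \<Rightarrow> nat) \<Rightarrow> complex"
  assume I: "finite I \<and> I \<subseteq> {..<0} \<rightarrow>\<^sub>E UNIV \<and> (\<exists>e\<in>I. a e \<noteq> 0)"
    and J': "(\<lambda>p. \<Sum>e\<in>I. a e * monom_fun f 0 e p) \<in> J"
  have "I = {\<lambda>_. undefined}" using I by auto
  with I J' have a: "a (\<lambda>_. undefined) \<noteq> 0" "(\<lambda>_. a (\<lambda>_. undefined)) \<in> J" by (auto simp: monom_fun_def)
  have "(\<lambda>x. inverse (a (\<lambda>_. undefined)) * a (\<lambda>_. undefined)) \<in> J"
    by (rule fun_idealD(4)[OF J fun_subalgebraD(1)[OF A] a(2)])
  with a(1) proper show False by simp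
qed

lemma monom_fun_poly_fun: "(\<And>i. i < m \<Longrightarrow> f i \<in> poly_fun s) \<Longrightarrow> monom_fun f m e \<in> poly_fun s"
  unfolding monom_fun_def by (intro poly_fun_intros) auto

text \<open>Divide a relation between the \<open>f i\<close> and \<open>g\<close> by the highest possible power of \<open>g\<close> and reduce it
  modulo \<open>J\<close>.\<close>

lemma alg_indep_Suc:
  assumes ind: "alg_indep J m f" and J: "fun_ideal (poly_fun s) J" and "J' \<subseteq> J" and g: "g \<in> J"
    and f: "\<And>i. i < m \<Longrightarrow> f i \<in> poly_fun s"
    and cancel: "\<And>h. h \<in> poly_fun s \<Longrightarrow> (\<lambda>p. g p * h p) \<in> J' \<Longrightarrow> h \<in> J'"
  shows "alg_indep J' (Suc m) (f(m := g))"
  unfolding alg_indep_def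
proof (intro allI impI notI)
  fix I :: "(nat \<Rightarrow> nat) set" and a :: "(nat \<Rightarrow> nat) \<Rightarrow> complex"
  assume I: "finite I \<and> I \<subseteq> {..<Suc m} \<rightarrow>\<^sub>E UNIV \<and> (\<exists>e\<in>I. a e \<noteq> 0)"
    and rel: "(\<lambda>p. \<Sum>e\<in>I. a e * monom_fun (f(m := g)) (Suc m) e p) \<in> J'"
  have gp: "g \<in> poly_fun s" using g fun_idealD(1)[OF J] by blast
  define I' where "I' = {e \<in> I. a e \<noteq> 0}"
  have I': "finite I'" "I' \<noteq> {}" using I by (auto simp: I'_def)
  \<comment> \<open>The lowest power of \<open>g\<close> in the relation. Cancelling
    \<open>g ^ n\<close>, one factor at a time, leaves a relation with some terms free of
    \<open>g\<close>.\<close>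
  define n where "n = Min ((\<lambda>e. e m) ` I')"
  have n: "n \<le> e m" if "e \<in> I'" for e using I' that by (simp add: n_def)
  have "n \<in> (\<lambda>e. e m) ` I'" unfolding n_def using I' by (intro Min_in) auto
  then obtain e0 where e0: "e0 \<in> I'" "e0 m = n" by auto
  have mon: "monom_fun (f(m := g)) (Suc m) e p = monom_fun f m e p * g p ^ e m" for e p
    by (simp add: monom_fun_def)
  define h where "h = (\<lambda>p. \<Sum>e\<in>I'. a e * monom_fun f m e p * g p ^ (e m - n))"
  have h_poly: "h \<in> poly_fun s"
    unfolding h_def by (intro poly_fun_intros monom_fun_poly_fun f gp)
  have "(\<Sum>e\<in>I. a e * monom_fun (f(m := g)) (Suc m) e p) = g p ^ n * h p" for p
  proof -
    have "(\<Sum>e\<in>I. a e * monom_fun (f(m := g)) (Suc m) e p) = (\<Sum>e\<in>I'. a e * monom_fun f m e p * g p ^ e m)"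
      unfolding mon I'_def using I by (intro sum.mono_neutral_cong_right) auto
    also have "\<dots> = (\<Sum>e\<in>I'. g p ^ n * (a e * monom_fun f m e p * g p ^ (e m - n)))"
    proof (rule sum.cong)
      fix e assume "e \<in> I'"
      then have "g p ^ e m = g p ^ n * g p ^ (e m - n)" using n by (simp flip: power_add)
      then show "a e * monom_fun f m e p * g p ^ e m = g p ^ n * (a e * monom_fun f m e p * g p ^ (e m - n))"
        by simp
    qed simp
    finally show ?thesis by (simp add: h_def sum_distrib_left)
  qed
  with rel have gh: "(\<lambda>p. g p ^ n * h p) \<in> J'" by simp
  have "h \<in> J'" if "(\<lambda>p. g p ^ n * h p) \<in> J'" for n
    using that
  proof (induction n)
    case (Suc n)
    have "(\<lambda>p. g p ^ n * h p) \<in> poly_fun s" by (intro poly_fun_intros gp h_poly)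
    then show ?case using Suc cancel[of "\<lambda>p. g p ^ n * h p"] by (simp add: mult.assoc)
  qed simp
  then have hJ: "h \<in> J" using gh \<open>J' \<subseteq> J\<close> by blast
  \<comment> \<open>Modulo \<open>J\<close>, which contains \<open>g\<close>, only the terms with
    exponent exactly \<open>n\<close> survive; they form a relation among the \<open>f i\<close>
    alone.\<close>
  define K where "K = {e \<in> I'. e m = n}"
  define r where "r = (\<lambda>p. \<Sum>e\<in>I' - K. a e * monom_fun f m e p * g p ^ (e m - n - 1))"
  have r_poly: "r \<in> poly_fun s"
    unfolding r_def by (intro poly_fun_intros monom_fun_poly_fun f gp)
  have h_split: "h p = (\<Sum>e\<in>K. a e * monom_fun f m e p) + r p * g p" for p
  proof -
    have "h p = (\<Sum>e\<in>K. a e * monom_fun f m e p * g p ^ (e m - n)) +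
        (\<Sum>e\<in>I' - K. a e * monom_fun f m e p * g p ^ (e m - n))"
      unfolding h_def using I'(1) by (subst sum.subset_diff[of K]) (auto simp: K_def)
    also have "(\<Sum>e\<in>K. a e * monom_fun f m e p * g p ^ (e m - n)) = (\<Sum>e\<in>K. a e * monom_fun f m e p)"
      by (rule sum.cong) (auto simp: K_def)
    also have "(\<Sum>e\<in>I' - K. a e * monom_fun f m e p * g p ^ (e m - n)) = r p * g p"
      unfolding r_def sum_distrib_right
    proof (rule sum.cong)
      fix e assume "e \<in> I' - K"
      then have "e m - n = Suc (e m - n - 1)" using n[of e] by (auto simp: K_def)
      then show "a e * monom_fun f m e p * g p ^ (e m - n) = a e * monom_fun f m e p * g p ^ (e m - n - 1) * g p"
        by (metis mult.assoc mult.commute power_Suc)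
    qed simp
    finally show ?thesis .
  qed
  have "(\<lambda>p. (- r p) * g p) \<in> J" by (intro fun_idealD(4)[OF J] poly_fun_intros r_poly g)
  from fun_idealD(3)[OF J hJ this] have K: "(\<lambda>p. \<Sum>e\<in>K. a e * monom_fun f m e p) \<in> J"
    by (simp add: h_split)
  let ?res = "\<lambda>e. restrict e {..<m}"
  \<comment> \<open>All exponent vectors in \<open>K\<close> have the value \<open>n\<close> at
    \<open>m\<close>, so they are determined by their first \<open>m\<close> entries.\<close>
  have inj: "inj_on ?res K"
  proof (rule inj_onI)
    fix e e' assume e: "e \<in> K" "e' \<in> K" "?res e = ?res e'"
    then have ext: "e \<in> {..<Suc m} \<rightarrow>\<^sub>E UNIV" "e' \<in> {..<Suc m} \<rightarrow>\<^sub>E UNIV" and m: "e m = e' m"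
      using I by (auto simp: K_def I'_def)
    show "e = e'"
    proof
      fix i show "e i = e' i"
      proof (cases "i < m")
        case True
        then show ?thesis using fun_cong[OF e(3), of i] by simp
      next
        case False
        then have "i = m \<or> i \<notin> {..<Suc m}" by auto
        then show ?thesis using m PiE_arb[OF ext(1), of i] PiE_arb[OF ext(2), of i] by auto
      qed
    qed
  qed
  define b where "b = (\<lambda>e. a (the_inv_into K ?res e))"
  have b: "b (?res e) = a e" if "e \<in> K" for e
    unfolding b_def the_inv_into_f_f[OF inj that] ..
  have "(\<Sum>e\<in>?res ` K. b e * monom_fun f m e p) = (\<Sum>e\<in>K. a e * monom_fun f m e p)" for p
    unfolding sum.reindex[OF inj] by (rule sum.cong) (auto simp: b monom_fun_def)
  with K have "(\<lambda>p. \<Sum>e\<in>?res ` K. b e * monom_fun f m e p) \<in> J" by simp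
  moreover have "finite (?res ` K)" using I'(1) by (simp add: K_def)
  moreover have "?res ` K \<subseteq> {..<m} \<rightarrow>\<^sub>E UNIV" by (intro image_subsetI restrict_PiE_iff[THEN iffD2]) auto
  moreover have "\<exists>e\<in>?res ` K. b e \<noteq> 0"
    using e0 b[of e0] by (intro bexI[of _ "?res e0"]) (auto simp: K_def I'_def)
  ultimately show False using alg_indepD[OF ind, of "?res ` K" b] by argo
qed

text \<open>The monomials in the \<open>f i\<close> with exponents below \<open>N\<close> number \<open>N ^ m\<close>, and their pullbacks are
  polynomials of degree \<open>O(N)\<close> in \<open>d\<close> variables.\<close>

lemma alg_indep_le:
  assumes s: "coordinates s d x" and \<Phi>: "poly_map s s' \<Phi>"
    and f: "\<And>i. i < m \<Longrightarrow> f i \<in> poly_fun s'" and ind: "alg_indep J m f"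
    and dom: "\<And>F. F \<in> poly_fun s' \<Longrightarrow> (\<And>u. F (\<Phi> u) = 0) \<Longrightarrow> F \<in> J"
  shows "m \<le> d"
proof (rule ccontr)
  assume "\<not> m \<le> d"
  then have md: "Suc d \<le> m" by simp
  have "\<exists>D. \<forall>i<m. (\<lambda>u. f i (\<Phi> u)) \<in> fn.span (monomials x d D)"
  proof -
    have "\<exists>D. (\<lambda>u. f i (\<Phi> u)) \<in> fn.span (monomials x d D)" if "i < m" for i
      using poly_fun_span_monomials[OF s poly_map_comp[OF \<Phi> f[OF that]]] by blast
    then obtain D where D: "\<And>i. i < m \<Longrightarrow> (\<lambda>u. f i (\<Phi> u)) \<in> fn.span (monomials x d (D i))" by metis
    have "(\<lambda>u. f i (\<Phi> u)) \<in> fn.span (monomials x d (\<Sum>i<m. D i))" if "i < m" for i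
      by (rule span_monomials_mono[OF D[OF that]]) (use that in \<open>auto intro: member_le_sum\<close>)
    then show ?thesis by blast
  qed
  then obtain D where D: "\<And>i. i < m \<Longrightarrow> (\<lambda>u. f i (\<Phi> u)) \<in> fn.span (monomials x d D)" by blast
  \<comment> \<open>\<open>C\<close> is chosen so that the number of available monomials is at most
    \<open>(C * N) ^ d\<close>. Taking \<open>N\<close> above \<open>C ^ d\<close> makes this
    smaller than \<open>N ^ (d + 1)\<close>, hence smaller than the number \<open>N ^ m\<close> of
    products of the \<open>f i\<close>.\<close>
  define C where "C = m * D + 1"
  define N where "N = C ^ d + 1"
  let ?I = "{..<m} \<rightarrow>\<^sub>E {..<N}"
  have mon: "(\<lambda>u. monom_fun f m e (\<Phi> u)) \<in> fn.span (monomials x d (m * N * D))" if e: "e \<in> ?I" for e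
  proof -
    have "(\<lambda>u. \<Prod>i<m. f i (\<Phi> u) ^ e i) \<in> fn.span (monomials x d (\<Sum>i<m. e i * D))"
      by (intro span_monomials_prod span_monomials_power D)
    moreover have "(\<Sum>i<m. e i * D) \<le> (\<Sum>i<m. N * D)"
      using e by (intro sum_mono mult_right_mono) (auto simp: PiE_iff intro: less_imp_le)
    ultimately show ?thesis unfolding monom_fun_def by (auto elim: span_monomials_mono simp: mult.assoc)
  qed
  have "card (monomials x d (m * N * D)) \<le> (m * N * D + 1) ^ d" by (rule card_monomials)
  also have "\<dots> \<le> (C * N) ^ d" by (intro power_mono) (auto simp: C_def N_def algebra_simps)
  also have "\<dots> = C ^ d * N ^ d" by (rule power_mult_distrib)
  also have "\<dots> < N * N ^ d" by (rule mult_strict_right_mono) (auto simp: N_def)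
  also have "\<dots> \<le> N ^ m" using power_increasing[OF md, of N] by (simp add: N_def)
  also have "\<dots> = card ?I" by (simp add: card_PiE)
  finally have card: "card (monomials x d (m * N * D)) < card ?I" .
  obtain a where a: "\<exists>e\<in>?I. a e \<noteq> 0" "\<And>u. (\<Sum>e\<in>?I. a e * monom_fun f m e (\<Phi> u)) = 0"
    by (rule family_dependent[OF finite_monomials _ card mon]) (auto intro: finite_PiE)
  have "(\<lambda>p. \<Sum>e\<in>?I. a e * monom_fun f m e p) \<in> J"
    by (rule dom) (use a(2) in \<open>auto intro!: poly_fun_intros monom_fun_poly_fun f\<close>)
  moreover have "finite ?I" "?I \<subseteq> {..<m} \<rightarrow>\<^sub>E UNIV" by (auto intro: finite_PiE)
  ultimately show False using alg_indepD[OF ind _ _ a(1)] by argo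
qed

section \<open>Independent functions from chains of irreducible closed sets\<close>

context product_of_projective_spaces
begin

text \<open>The affine cone over one point is the product of three lines, with coordinates given by
  functionals that are 1 at \<open>a\<close>, \<open>w\<close> and \<open>v\<close>. It is built up
  from the origin one scaling direction at a time, each step adjoining the functional that vanishes
  on the previous stage.\<close>

lemma alg_indep_point:
  assumes nz: "a \<noteq> 0" "w \<noteq> 0" "v \<noteq> 0"
  obtains f where "\<And>i. i < 3 \<Longrightarrow> f i \<in> poly_fun scale3"
    "alg_indep {F \<in> poly_fun scale3. \<forall>r s t. F (scale2 r a, scl s w, scl t v) = 0} 3 f"
proof -
  let ?J = "\<lambda>A. {F \<in> poly_fun scale3. \<forall>r s t. (r, s, t) \<in> A \<longrightarrow> F (scale2 r a, scl s w, scl t v) = 0}"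
  obtain \<chi> where \<chi>: "functional scale2 \<chi>" "\<chi> a = 1" by (rule functional_nonzero[OF vector_space_scale2 nz(1)])
  obtain \<phi> where \<phi>: "functional scl \<phi>" "\<phi> w = 1" by (rule functional_nonzero[OF vector_space_scl nz(2)])
  obtain \<psi> where \<psi>: "functional scl \<psi>" "\<psi> v = 1" by (rule functional_nonzero[OF vector_space_scl nz(3)])
  define f :: "nat \<Rightarrow> C2 \<times> 'v \<times> 'v \<Rightarrow> complex" where
    "f = (\<lambda>_ _. 0)(0 := \<lambda>p. \<chi> (fst p), Suc 0 := \<lambda>p. \<phi> (fst (snd p)), Suc (Suc 0) := \<lambda>p. \<psi> (snd (snd p)))"
  have lin: "(\<lambda>p. \<chi> (fst p)) \<in> poly_fun scale3" "(\<lambda>p. \<phi> (fst (snd p))) \<in> poly_fun scale3"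
    "(\<lambda>p. \<psi> (snd (snd p))) \<in> poly_fun scale3"
    using linear_coord(1)[OF \<chi>(1)] linear_coord(2)[OF \<phi>(1)] linear_coord(3)[OF \<psi>(1)] by (auto intro: poly_fun.functional)
  note ev = linear_functionalD(2)[OF \<chi>(1)] linear_functionalD(2)[OF \<phi>(1)] linear_functionalD(2)[OF \<psi>(1)] \<chi>(2) \<phi>(2) \<psi>(2)
    linear_functionalD(3)[OF \<phi>(1)] linear_functionalD(3)[OF \<psi>(1)]
  have ideal: "fun_ideal (poly_fun scale3) (?J A)" for A
    unfolding fun_ideal_def by (intro conjI ballI subsetI CollectI) (simp_all add: poly_fun.intros)
  have pm: "poly_map (*) scale3 (\<lambda>z. (scale2 (\<alpha> z) a, scl (\<beta> z) w, scl (\<gamma> z) v))"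
    if "\<alpha> \<in> poly_fun (*)" "\<beta> \<in> poly_fun (*)" "\<gamma> \<in> poly_fun (*)" for \<alpha> \<beta> \<gamma>
    by (intro poly_map_Pair poly_map_scale poly_map_const that vector_space_scale2 vector_space_scl vector_space_pair_scale)
  have "alg_indep (?J {(0, 0, 0)}) 0 (\<lambda>_ _. 0)"
    by (rule alg_indep_0[OF fun_subalgebra_poly_fun ideal]) simp
  then have "alg_indep (?J {(r, 0, 0) | r. True}) (Suc 0) ((\<lambda>_ _. 0)(0 := \<lambda>p. \<chi> (fst p)))"
  proof (rule alg_indep_Suc[OF _ ideal])
    fix H assume H: "H \<in> poly_fun scale3" "(\<lambda>p. \<chi> (fst p) * H p) \<in> ?J {(r, 0, 0) | r. True}"
    have "H (scale2 r a, scl 0 w, scl 0 v) = 0" for r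
    proof (rule poly_fun_complex_density[of "\<lambda>r. H (scale2 r a, scl 0 w, scl 0 v)" "{0}"])
      show "(\<lambda>r. H (scale2 r a, scl 0 w, scl 0 v)) \<in> poly_fun (*)"
        by (rule poly_map_comp[OF pm H(1)]) (intro poly_fun_complex_id poly_fun.const)+
      fix r :: complex assume "r \<notin> {0}"
      then show "H (scale2 r a, scl 0 w, scl 0 v) = 0" using H(2) by (auto simp: ev)
    qed simp
    then show "H \<in> ?J {(r, 0, 0) | r. True}" using H(1) by auto
  qed (use lin in \<open>auto simp: ev\<close>)
  then have "alg_indep (?J {(r, s, 0) | r s. True}) (Suc (Suc 0)) ((\<lambda>_ _. 0)(0 := \<lambda>p. \<chi> (fst p), Suc 0 := \<lambda>p. \<phi> (fst (snd p))))"
  proof (rule alg_indep_Suc[OF _ ideal])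
    fix H assume H: "H \<in> poly_fun scale3" "(\<lambda>p. \<phi> (fst (snd p)) * H p) \<in> ?J {(r, s, 0) | r s. True}"
    have "H (scale2 r a, scl s w, scl 0 v) = 0" for r s
    proof (rule poly_fun_complex_density[of "\<lambda>s. H (scale2 r a, scl s w, scl 0 v)" "{0}"])
      show "(\<lambda>s. H (scale2 r a, scl s w, scl 0 v)) \<in> poly_fun (*)"
        by (rule poly_map_comp[OF pm H(1)]) (intro poly_fun_complex_id poly_fun.const)+
      fix s :: complex assume "s \<notin> {0}"
      then show "H (scale2 r a, scl s w, scl 0 v) = 0" using H(2) by (auto simp: ev)
    qed simp
    then show "H \<in> ?J {(r, s, 0) | r s. True}" using H(1) by auto
  next
    show "?J {(r, s, 0) | r s. True} \<subseteq> ?J {(r, 0, 0) | r. True}" by blast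
  qed (use lin in \<open>auto simp: ev less_Suc_eq\<close>)
  then have "alg_indep (?J UNIV) (Suc (Suc (Suc 0))) f"
    unfolding f_def
  proof (rule alg_indep_Suc[OF _ ideal])
    fix H assume H: "H \<in> poly_fun scale3" "(\<lambda>p. \<psi> (snd (snd p)) * H p) \<in> ?J UNIV"
    have "H (scale2 r a, scl s w, scl t v) = 0" for r s t
    proof (rule poly_fun_complex_density[of "\<lambda>t. H (scale2 r a, scl s w, scl t v)" "{0}"])
      show "(\<lambda>t. H (scale2 r a, scl s w, scl t v)) \<in> poly_fun (*)"
        by (rule poly_map_comp[OF pm H(1)]) (intro poly_fun_complex_id poly_fun.const)+
      fix t :: complex assume "t \<notin> {0}"
      then show "H (scale2 r a, scl s w, scl t v) = 0" using H(2) by (auto simp: ev)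
    qed simp
    then show "H \<in> ?J UNIV" using H(1) by auto
  next
    show "?J UNIV \<subseteq> ?J {(r, s, 0) | r s. True}" by blast
  qed (use lin in \<open>auto simp: ev less_Suc_eq\<close>)
  then have "alg_indep {F \<in> poly_fun scale3. \<forall>r s t. F (scale2 r a, scl s w, scl t v) = 0} 3 f"
    by (simp add: numeral_3_eq_3)
  moreover have "f i \<in> poly_fun scale3" for i using lin by (simp add: f_def poly_fun.const)
  ultimately show ?thesis using that by blast
qed

lemma ideal_of3_vanishes_on_cone:
  assumes F: "F \<in> ideal_of3 scl Z" and p: "pt a w v \<in> Z" "a \<noteq> 0" "w \<noteq> 0" "v \<noteq> 0"
  shows "F (scale2 r a, scl s w, scl t v) = 0"
proof -
  have Fp: "F \<in> poly_fun scale3" using F ideal_of3_subset by blast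
  have pm: "poly_map (*) scale3 (\<lambda>z. (scale2 (\<alpha> z) a, scl (\<beta> z) w, scl (\<gamma> z) v))"
    if "\<alpha> \<in> poly_fun (*)" "\<beta> \<in> poly_fun (*)" "\<gamma> \<in> poly_fun (*)" for \<alpha> \<beta> \<gamma>
    by (intro poly_map_Pair poly_map_scale poly_map_const that vector_space_scale2 vector_space_scl vector_space_pair_scale)
  have 1: "F (scale2 r a, scl s w, scl t v) = 0" if nz: "r \<noteq> 0" "s \<noteq> 0" "t \<noteq> 0" for r s t
  proof -
    have "pt a w v = pt (scale2 r a) (scl s w) (scl t v)" unfolding pt_eq_iff[OF p(2-4)] using nz by blast
    then show ?thesis using ideal_of3D[OF F] p(1) by simp
  qed
  have 2: "F (scale2 r a, scl s w, scl t v) = 0" if nz: "r \<noteq> 0" "s \<noteq> 0" for r s t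
    by (rule poly_fun_complex_density[OF poly_map_comp[OF pm Fp], of "\<lambda>_. r" "\<lambda>_. s" "\<lambda>t. t" "{0}"])
      (auto intro!: poly_fun_complex_id poly_fun.const 1 nz)
  have 3: "F (scale2 r a, scl s w, scl t v) = 0" if nz: "r \<noteq> 0" for r s t
    by (rule poly_fun_complex_density[OF poly_map_comp[OF pm Fp], of "\<lambda>_. r" "\<lambda>s. s" "\<lambda>_. t" "{0}"])
      (auto intro!: poly_fun_complex_id poly_fun.const 2 nz)
  show ?thesis
    by (rule poly_fun_complex_density[OF poly_map_comp[OF pm Fp], of "\<lambda>r. r" "\<lambda>_. s" "\<lambda>_. t" "{0}"])
      (auto intro!: poly_fun_complex_id poly_fun.const 3)
qed

text \<open>A point of \<open>c 0\<close> gives three functions. For every strict inclusion a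
  trihomogeneous function vanishing on the smaller set but not on the larger is adjoined;
  irreducibility of the larger set allows it to be cancelled there.\<close>

lemma alg_indep_chain:
  assumes c: "\<And>i. i \<le> n \<Longrightarrow> closedin (zariski3 scl) (c i)" "\<And>i. i \<le> n \<Longrightarrow> irreducible_in (zariski3 scl) (c i)"
    "\<And>i. i < n \<Longrightarrow> c i \<subset> c (Suc i)"
  shows "\<exists>f. (\<forall>i<3 + n. f i \<in> poly_fun scale3) \<and> alg_indep (ideal_of3 scl (c n)) (3 + n) f"
proof -
  have sub: "c i \<subseteq> points3 scl" if "i \<le> n" for i
    using c(2)[OF that] by (simp add: irreducible_in_def topspace_zariski3)
  have "\<exists>f. (\<forall>i<3 + m. f i \<in> poly_fun scale3) \<and> alg_indep (ideal_of3 scl (c m)) (3 + m) f" if "m \<le> n" for m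
    using that
  proof (induction m)
    case 0
    obtain p where "p \<in> c 0" using c(2)[of 0] by (auto simp: irreducible_in_def)
    then obtain a w v where p: "pt a w v \<in> c 0" "a \<noteq> 0" "w \<noteq> 0" "v \<noteq> 0"
      using points3_cases sub[of 0] by (metis le0 subsetD)
    obtain f where f: "\<And>i. i < 3 \<Longrightarrow> f i \<in> poly_fun scale3"
      "alg_indep {F \<in> poly_fun scale3. \<forall>r s t. F (scale2 r a, scl s w, scl t v) = 0} 3 f"
      using alg_indep_point[OF p(2-4)] by blast
    have "ideal_of3 scl (c 0) \<subseteq> {F \<in> poly_fun scale3. \<forall>r s t. F (scale2 r a, scl s w, scl t v) = 0}"
      using ideal_of3_vanishes_on_cone[OF _ p] ideal_of3_subset by blast
    then show ?case using alg_indep_antimono[OF f(2)] f(1) by (intro exI[of _ f]) auto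
  next
    case (Suc m)
    then obtain f where f: "\<And>i. i < 3 + m \<Longrightarrow> f i \<in> poly_fun scale3" "alg_indep (ideal_of3 scl (c m)) (3 + m) f"
      by auto
    obtain q where q: "q \<in> c (Suc m)" "q \<notin> c m" using c(3)[of m] Suc.prems by auto
    then obtain a w v where p: "q = pt a w v" "a \<noteq> 0" "w \<noteq> 0" "v \<noteq> 0"
      using points3_cases sub[OF Suc.prems] by (metis subsetD)
    obtain G where G: "trihomogeneous G" "G (a, w, v) \<noteq> 0"
      "\<forall>a w v. a \<noteq> 0 \<longrightarrow> w \<noteq> 0 \<longrightarrow> v \<noteq> 0 \<longrightarrow> pt a w v \<in> c m \<longrightarrow> G (a, w, v) = 0"
      using closed_separation[OF c(1)[of m], of a w v] q(2) p Suc.prems by auto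
    have Gp: "G \<in> poly_fun scale3" using G(1) trihomD(1) by blast
    have Gm: "G \<in> ideal_of3 scl (c m)" using G(3) Gp sub[of m] Suc.prems by (simp add: ideal_of3_iff)
    have GS: "G \<notin> ideal_of3 scl (c (Suc m))"
    proof
      assume "G \<in> ideal_of3 scl (c (Suc m))"
      from ideal_of3D[OF this] q(1) p(1) G(2) show False by simp
    qed
    have "alg_indep (ideal_of3 scl (c (Suc m))) (Suc (3 + m)) (f(3 + m := G))"
    proof (rule alg_indep_Suc[OF f(2) fun_ideal_ideal_of3 ideal_of3_mono Gm f(1)])
      show "c m \<subseteq> c (Suc m)" using c(3)[of m] Suc.prems by auto
      show "H \<in> ideal_of3 scl (c (Suc m))"
        if "H \<in> poly_fun scale3" "(\<lambda>p. G p * H p) \<in> ideal_of3 scl (c (Suc m))" for H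
        by (rule ideal_of3_cancel[OF c(2)[OF Suc.prems] G(1) GS that])
    qed
    moreover have "\<forall>i<Suc (3 + m). (f(3 + m := G)) i \<in> poly_fun scale3" using f(1) Gp by auto
    ultimately show ?case unfolding add_Suc_right by blast
  qed
  then show ?thesis by blast
qed

text \<open>\<open>\<Phi>\<close> parametrizes the cone over \<open>E\<close> up to closure, which
  is what \<open>dom\<close> says. There are at most as many independent functions as parameters;
  the three scalings occur in both counts and cancel.\<close>

theorem krull_dim_le:
  assumes E: "closedin (zariski3 scl) E" and s: "coordinates s (3 + d) x" and \<Phi>: "poly_map s scale3 \<Phi>"
    and dom: "\<And>F. F \<in> poly_fun scale3 \<Longrightarrow> (\<And>u. F (\<Phi> u) = 0) \<Longrightarrow> F \<in> ideal_of3 scl E"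
  shows "krull_dim (zariski3 scl) E \<le> enat d"
  unfolding krull_dim_def
proof (rule Sup_least)
  fix N assume "N \<in> {enat n | n. \<exists>c. (\<forall>i\<le>n. closedin (subtopology (zariski3 scl) E) (c i) \<and>
      irreducible_in (zariski3 scl) (c i)) \<and> (\<forall>i<n. c i \<subset> c (Suc i))}"
  then obtain n c where n: "N = enat n" and c: "\<And>i. i \<le> n \<Longrightarrow> closedin (subtopology (zariski3 scl) E) (c i)"
    "\<And>i. i \<le> n \<Longrightarrow> irreducible_in (zariski3 scl) (c i)" "\<And>i. i < n \<Longrightarrow> c i \<subset> c (Suc i)" by auto
  have cl: "closedin (zariski3 scl) (c i)" if "i \<le> n" for i
    using c(1)[OF that] E closedin_trans_full by blast
  obtain f where f: "\<And>i. i < 3 + n \<Longrightarrow> f i \<in> poly_fun scale3" "alg_indep (ideal_of3 scl (c n)) (3 + n) f"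
    using alg_indep_chain[of n c] cl c(2,3) by blast
  have "c n \<subseteq> E" using closedin_subset[OF c(1)[OF order.refl]] by simp
  then have "alg_indep (ideal_of3 scl E) (3 + n) f" by (intro alg_indep_antimono[OF f(2)] ideal_of3_mono)
  then have "3 + n \<le> 3 + d"
    using alg_indep_le[where m = "3 + n" and f = f and J = "ideal_of3 scl E", OF s \<Phi>] f(1) dom by blast
  then show "N \<le> enat d" by (simp add: n)
qed

end

section \<open>Components of a graded vector space\<close>

locale graded_vector_space = product_of_projective_spaces scl
  for scl :: "complex \<Rightarrow> 'v::ab_group_add \<Rightarrow> 'v" +
  fixes Bs :: "'v set" and V :: "nat \<Rightarrow> 'v set" and k :: nat
  assumes finite_dimensional: "finite_dimensional_vector_space scl Bs"
    and decomposition: "direct_sum_decomposition scl V k"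
    and nontrivial: "\<And>i. i \<le> k \<Longrightarrow> V i \<noteq> {0}"
begin

abbreviation "cpt \<equiv> component V k"

lemma subspace_V: "i \<le> k \<Longrightarrow> subspace (V i)"
  using decomposition by (simp add: direct_sum_decomposition_def)

lemma decomposition_unique: "\<exists>!u. (\<forall>i\<le>k. u i \<in> V i) \<and> (\<forall>i>k. u i = 0) \<and> v = (\<Sum>i\<le>k. u i)"
  using decomposition unfolding direct_sum_decomposition_def by blast

lemma comp_properties: "(\<forall>i\<le>k. cpt i v \<in> V i) \<and> (\<forall>i>k. cpt i v = 0) \<and> v = (\<Sum>i\<le>k. cpt i v)"
  using theI'[OF decomposition_unique[of v]] unfolding component_def .

lemma comp_in_V: "i \<le> k \<Longrightarrow> cpt i v \<in> V i"
  and comp_beyond: "k < i \<Longrightarrow> cpt i v = 0"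
  and sum_comp: "(\<Sum>i\<le>k. cpt i v) = v"
  using comp_properties[of v] by auto

lemma comp_eqI:
  assumes "\<And>j. j \<le> k \<Longrightarrow> u j \<in> V j" "\<And>j. j > k \<Longrightarrow> u j = 0" "v = (\<Sum>j\<le>k. u j)"
  shows "cpt i v = u i"
  unfolding component_def by (subst the1_equality[OF decomposition_unique, of u v]) (use assms in auto)

lemma comp_add [simp]: "cpt i (x + y) = cpt i x + cpt i y"
  by (rule comp_eqI)
    (simp_all add: subspace_add subspace_V comp_in_V comp_beyond sum.distrib sum_comp)

lemma comp_scale [simp]: "cpt i (scl c x) = scl c (cpt i x)"
  by (rule comp_eqI)
    (simp_all add: subspace_scale subspace_V comp_in_V comp_beyond sum_comp flip: scale_sum_right)

lemma linear_comp: "Vector_Spaces.linear scl scl (cpt i)"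
  by (simp add: Vector_Spaces.linear_iff vector_space_scl)

lemma comp_zero [simp]: "cpt i 0 = 0"
  using comp_scale[of i 0 0] by simp

lemma comp_diff [simp]: "cpt i (x - y) = cpt i x - cpt i y"
  using comp_add[of i "x - y" y] by (simp add: algebra_simps)

lemma comp_sum [simp]: "cpt i (sum f A) = (\<Sum>a\<in>A. cpt i (f a))"
  by (induction A rule: infinite_finite_induct) auto

lemma comp_of_V: "v \<in> V i \<Longrightarrow> i \<le> k \<Longrightarrow> cpt j v = (if j = i then v else 0)"
  by (rule comp_eqI) (auto simp: subspace_0 subspace_V)

lemma comp_comp [simp]: "cpt j (cpt i v) = (if j = i then cpt i v else 0)"
  by (cases "i \<le> k") (simp_all add: comp_of_V[OF comp_in_V] comp_beyond)

lemma cpt_ext: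
  assumes "\<And>i. cpt i v = cpt i w"
  shows "v = w"
proof -
  have "(\<Sum>i\<le>k. cpt i v) = (\<Sum>i\<le>k. cpt i w)" by (simp only: assms)
  then show ?thesis unfolding sum_comp .
qed

definition proj_on :: "nat set \<Rightarrow> 'v \<Rightarrow> 'v" where
  "proj_on S v = (\<Sum>j\<in>{..k} \<inter> S. cpt j v)"

lemma comp_proj_on [simp]: "cpt i (proj_on S v) = (if i \<in> S then cpt i v else 0)"
proof -
  have "cpt i (proj_on S v) = (\<Sum>j\<in>{..k} \<inter> S. if i = j then cpt j v else 0)"
    by (simp add: proj_on_def)
  also have "\<dots> = (if i \<in> S then cpt i v else 0)"
    by (cases "i \<le> k") (auto simp: comp_beyond)
  finally show ?thesis .
qed

lemma linear_proj_on: "Vector_Spaces.linear scl scl (proj_on S)"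
  by (simp add: Vector_Spaces.linear_iff vector_space_scl proj_on_def sum.distrib scale_sum_right)

lemma proj_on_id: "(\<And>j. j \<notin> S \<Longrightarrow> cpt j v = 0) \<Longrightarrow> proj_on S v = v"
  by (rule cpt_ext) auto

lemma V_plus_iff:
  assumes "i \<le> k"
  shows "v \<in> V_plus scl V i \<longleftrightarrow> (\<forall>j. j \<notin> {..i} \<longrightarrow> cpt j v = 0)"
proof
  have "subspace {v. \<forall>j. j \<notin> {..i} \<longrightarrow> cpt j v = 0}" by (auto simp: subspace_def)
  then have "V_plus scl V i \<subseteq> {v. \<forall>j. j \<notin> {..i} \<longrightarrow> cpt j v = 0}"
    unfolding V_plus_def using assms by (intro span_minimal) (auto simp: comp_of_V)
  then show "v \<in> V_plus scl V i \<Longrightarrow> \<forall>j. j \<notin> {..i} \<longrightarrow> cpt j v = 0" by blast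
next
  assume "\<forall>j. j \<notin> {..i} \<longrightarrow> cpt j v = 0"
  then have "v = proj_on {..i} v" by (intro proj_on_id[symmetric]) auto
  also have "\<dots> \<in> V_plus scl V i"
    unfolding proj_on_def V_plus_def by (intro span_sum span_base) (auto intro: comp_in_V)
  finally show "v \<in> V_plus scl V i" .
qed

lemma V_minus_iff: "v \<in> V_minus scl V k i \<longleftrightarrow> (\<forall>j. j \<notin> {i..} \<longrightarrow> cpt j v = 0)"
proof
  have "subspace {v. \<forall>j. j \<notin> {i..} \<longrightarrow> cpt j v = 0}" by (auto simp: subspace_def)
  then have "V_minus scl V k i \<subseteq> {v. \<forall>j. j \<notin> {i..} \<longrightarrow> cpt j v = 0}"
    unfolding V_minus_def by (intro span_minimal) (auto simp: comp_of_V)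
  then show "v \<in> V_minus scl V k i \<Longrightarrow> \<forall>j. j \<notin> {i..} \<longrightarrow> cpt j v = 0" by blast
next
  assume "\<forall>j. j \<notin> {i..} \<longrightarrow> cpt j v = 0"
  then have "v = proj_on {i..} v" by (intro proj_on_id[symmetric]) auto
  also have "\<dots> \<in> V_minus scl V k i"
    unfolding proj_on_def V_minus_def by (intro span_sum span_base) (auto intro: comp_in_V)
  finally show "v \<in> V_minus scl V k i" .
qed

section \<open>Linear dependence of two vectors\<close>

lemma lin_dep_cases:
  assumes "lin_dep scl x y"
  obtains s where "y = scl s x" | "x = 0"
proof -
  obtain r s where rs: "(r, s) \<noteq> (0, 0)" "scl r x + scl s y = 0" using assms by (auto simp: lin_dep_def)
  show thesis
  proof (cases "s = 0")
    case True
    with rs have "x = 0" by (simp add: scale_eq_0_iff)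
    then show ?thesis using that by blast
  next
    case False
    have "scl s y = - scl r x" using rs(2) by (simp add: eq_neg_iff_add_eq_0 add.commute)
    then have "scl (inverse s) (scl s y) = scl (inverse s) (- scl r x)" by simp
    then have "y = scl (- (r / s)) x" using False by (simp add: field_simps)
    then show ?thesis using that by blast
  qed
qed

text \<open>A parametrization of dependent pairs that is symmetric in \<open>x\<close> and
  \<open>y\<close> and also covers zero vectors. Having \<open>u\<close> among the two vectors keeps
  it in every subspace, and in the graded piece, that contains both.\<close>

lemma lin_dep_obtain:
  assumes "lin_dep scl x y"
  obtains u s t where "x = scl s u" "y = scl t u" "u = x \<or> u = y"
  using assms
proof (cases rule: lin_dep_cases)
  case (1 s)
  then show ?thesis using that[of 1 x s] by simp
next
  case 2
  then show ?thesis using that[of 0 y 1] by simp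
qed

lemma lin_dep_scale: "lin_dep scl (scl s u) (scl t u)"
proof (cases "(s, t) = (0, 0)")
  case True
  then show ?thesis unfolding lin_dep_def by (intro exI[of _ 1]) auto
next
  case False
  have "scl t (scl s u) + scl (- s) (scl t u) = 0" by (simp add: mult.commute)
  then show ?thesis unfolding lin_dep_def using False by (intro exI[of _ t] exI[of _ "- s"]) auto
qed

text \<open>These are the 2x2 minors. If \<open>x\<close> is nonzero and
  \<open>\<phi> x = 1\<close>, the minors with \<open>\<phi>\<close> say that every functional kills
  \<open>y - scl (\<phi> y) x\<close>.\<close>

lemma lin_dep_iff:
  "lin_dep scl x y \<longleftrightarrow> (\<forall>\<phi> \<psi>. functional scl \<phi> \<longrightarrow> functional scl \<psi> \<longrightarrow> \<phi> x * \<psi> y = \<psi> x * \<phi> y)"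
proof
  assume "lin_dep scl x y"
  then obtain u s t where "x = scl s u" "y = scl t u" by (rule lin_dep_obtain)
  then show "\<forall>\<phi> \<psi>. functional scl \<phi> \<longrightarrow> functional scl \<psi> \<longrightarrow> \<phi> x * \<psi> y = \<psi> x * \<phi> y"
    by (simp add: linear_functionalD(2))
next
  assume *: "\<forall>\<phi> \<psi>. functional scl \<phi> \<longrightarrow> functional scl \<psi> \<longrightarrow> \<phi> x * \<psi> y = \<psi> x * \<phi> y"
  show "lin_dep scl x y"
  proof (cases "x = 0")
    case True
    then show ?thesis using lin_dep_scale[of 0 y 1] by simp
  next
    case False
    obtain \<phi> where \<phi>: "functional scl \<phi>" "\<phi> x = 1"
      by (rule functional_nonzero[OF vector_space_scl False])
    have "y - scl (\<phi> y) x = 0"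
    proof (rule ccontr)
      assume "y - scl (\<phi> y) x \<noteq> 0"
      then obtain \<psi> where \<psi>: "functional scl \<psi>" "\<psi> (y - scl (\<phi> y) x) = 1"
        by (rule functional_nonzero[OF vector_space_scl])
      have "\<phi> x * \<psi> y = \<psi> x * \<phi> y" using * \<phi>(1) \<psi>(1) by blast
      with \<psi>(2) \<phi>(2) show False by (simp add: linear_functionalD[OF \<psi>(1)])
    qed
    then have "y = scl (\<phi> y) x" by simp
    then show ?thesis using lin_dep_scale[of 1 x "\<phi> y"] by simp
  qed
qed

lemma lin_dep_scale_both: "lin_dep scl x y \<Longrightarrow> lin_dep scl (scl r x) (scl s y)"
  by (auto simp: lin_dep_iff linear_functionalD(2))

text \<open>The sets \<open>{a0} \<times> C_infinity\<close> and \<open>{a0} \<times> C_zero\<close> are the cases \<open>S = {..i}\<close>, \<open>S' = {i..}\<close> and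
  \<open>S = {i..}\<close>, \<open>S' = {..i}\<close>.  Their intersections with \<open>P(T) \<times> P(T)\<close> for a flag of graded subspaces
  \<open>T\<close> form a maximal chain of irreducible closed sets.\<close>

definition incidence :: "C2 \<Rightarrow> nat set \<Rightarrow> nat set \<Rightarrow> nat \<Rightarrow> 'v set \<Rightarrow> 'v point3 set" where
  "incidence a S S' i T = {pt a w v | w v. w \<in> T \<and> v \<in> T \<and> w \<noteq> 0 \<and> v \<noteq> 0 \<and>
     (\<forall>j. j \<notin> S \<longrightarrow> cpt j w = 0) \<and> (\<forall>j. j \<notin> S' \<longrightarrow> cpt j v = 0) \<and> lin_dep scl (cpt i w) (cpt i v)}"

lemma E_infinity_eq: "i \<le> k \<Longrightarrow> E_infinity scl V k i = incidence (0, 1) {..i} {i..} i UNIV"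
  unfolding E_infinity_def C_infinity_def incidence_def
  by (auto simp: V_plus_iff V_minus_iff)

lemma E_zero_eq: "i \<le> k \<Longrightarrow> E_zero scl V k i = incidence (1, 0) {i..} {..i} i UNIV"
  unfolding E_zero_def C_zero_def incidence_def
  by (auto simp: V_plus_iff V_minus_iff)

text \<open>Equivalently, \<open>T\<close> is the direct sum of its intersections with the
  \<open>V i\<close>.\<close>

definition graded_subspace :: "'v set \<Rightarrow> bool" where
  "graded_subspace T \<longleftrightarrow> subspace T \<and> (\<forall>v\<in>T. \<forall>i. cpt i v \<in> T)"

lemma graded_subspace_UNIV: "graded_subspace UNIV"
  by (simp add: graded_subspace_def subspace_UNIV)

lemma incidence_subset_points3: "a \<noteq> 0 \<Longrightarrow> incidence a S S' i T \<subseteq> points3 scl"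
  by (auto simp: incidence_def)

lemma incidence_mono: "T \<subseteq> T' \<Longrightarrow> incidence a S S' i T \<subseteq> incidence a S S' i T'"
  unfolding incidence_def by blast

lemma pt_in_incidence_iff:
  assumes "subspace T" "a0 \<noteq> 0" "a \<noteq> 0" "w \<noteq> 0" "v \<noteq> 0"
  shows "pt a w v \<in> incidence a0 S S' i T \<longleftrightarrow> (\<exists>c. a = scale2 c a0) \<and> w \<in> T \<and> v \<in> T \<and>
     (\<forall>j. j \<notin> S \<longrightarrow> cpt j w = 0) \<and> (\<forall>j. j \<notin> S' \<longrightarrow> cpt j v = 0) \<and> lin_dep scl (cpt i w) (cpt i v)"
    (is "_ \<longleftrightarrow> ?R")
proof
  assume "pt a w v \<in> incidence a0 S S' i T"
  then obtain w' v' where e: "pt a0 w' v' = pt a w v" and w': "w' \<in> T" "v' \<in> T" "w' \<noteq> 0" "v' \<noteq> 0"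
    "\<forall>j. j \<notin> S \<longrightarrow> cpt j w' = 0" "\<forall>j. j \<notin> S' \<longrightarrow> cpt j v' = 0" "lin_dep scl (cpt i w') (cpt i v')"
    by (auto simp: incidence_def)
  from e obtain r s t where "a = scale2 r a0" "w = scl s w'" "v = scl t v'"
    unfolding pt_eq_iff[OF assms(2) w'(3,4)] by blast
  then show ?R using w' lin_dep_scale_both by (auto intro: subspace_scale[OF assms(1)])
next
  assume R: ?R
  then obtain c where c: "a = scale2 c a0" by blast
  with assms have "c \<noteq> 0" by (auto simp: pair_scale_def zero_prod_def split: prod.splits)
  then have "line scale2 a0 = line scale2 a"
    unfolding line_eq_iff[OF vector_space_scale2 assms(2)] using c by blast
  then have "pt a w v = pt a0 w v" by simp
  then show "pt a w v \<in> incidence a0 S S' i T" unfolding incidence_def using R assms by blast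
qed

lemma functional_separates:
  assumes "subspace T" "w \<notin> T"
  obtains \<phi> where "functional scl \<phi>" "\<And>t. t \<in> T \<Longrightarrow> \<phi> t = 0" "\<phi> w = (1::complex)"
proof -
  interpret vp: vector_space_pair scl "(*) :: complex \<Rightarrow> complex \<Rightarrow> complex"
    using vector_space_scl vector_space_complex by (simp add: vector_space_pair_def)
  obtain B where B: "B \<subseteq> T" "independent B" "T \<subseteq> span B"
    using maximal_independent_subset[of T] by blast
  have "span B \<subseteq> T" by (rule span_minimal[OF B(1) assms(1)])
  then have "w \<notin> span B" using assms(2) by blast
  then have "independent (insert w B)" "w \<notin> B" using B(2) by (auto simp: independent_insert span_base)
  then obtain \<phi> where \<phi>: "functional scl \<phi>" "\<And>x. x \<in> insert w B \<Longrightarrow> \<phi> x = (if x = w then 1 else 0)"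
    using vp.linear_independent_extend[of "insert w B" "\<lambda>x. if x = w then 1 else 0"] by blast
  have "subspace {x. \<phi> x = 0}" by (auto simp: subspace_def linear_functionalD[OF \<phi>(1)])
  moreover have "B \<subseteq> {x. \<phi> x = 0}" using \<phi>(2) \<open>w \<notin> B\<close> by auto
  ultimately have "span B \<subseteq> {x. \<phi> x = 0}" by (intro span_minimal)
  with B(3) have "\<phi> t = 0" if "t \<in> T" for t using that by blast
  moreover have "\<phi> w = 1" using \<phi>(2)[of w] by simp
  ultimately show ?thesis by (rule that[OF \<phi>(1)])
qed

lemma mem_subspace_iff:
  assumes "subspace T"
  shows "w \<in> T \<longleftrightarrow> (\<forall>\<phi>. functional scl \<phi> \<and> (\<forall>t\<in>T. \<phi> t = 0) \<longrightarrow> \<phi> w = (0::complex))"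
  using functional_separates[OF assms, of w] by (metis zero_neq_one)

lemma eq_0_iff_functional: "x = 0 \<longleftrightarrow> (\<forall>\<phi>. functional scl \<phi> \<longrightarrow> \<phi> x = (0::complex))"
  using functional_nonzero[OF vector_space_scl, of x] by (metis linear_functionalD(3) zero_neq_one)

text \<open>All conditions are multilinear: a determinant for the point of the projective line,
  functionals vanishing on \<open>T\<close> for membership, functionals of single components for the
  supports, and 2x2 minors for the dependence.\<close>

lemma closedin_incidence:
  assumes "subspace T" "a0 \<noteq> 0"
  shows "closedin (zariski3 scl) (incidence a0 S S' i T)"
proof -
  obtain x0 y0 where a0: "a0 = (x0, y0)" by (cases a0)
  \<comment> \<open>Up to sign the determinant of \<open>a0\<close> and \<open>a\<close>, which
    vanishes exactly on the line of \<open>a0\<close>.\<close>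
  define \<chi> where "\<chi> = (\<lambda>a :: C2. y0 * fst a - x0 * snd a)"
  have \<chi>: "functional scale2 \<chi>"
    by (rule linear_functionalI[OF vector_space_scale2]) (auto simp: \<chi>_def algebra_simps)
  have \<chi>_0: "\<chi> a = 0 \<longleftrightarrow> (\<exists>c. a = scale2 c a0)" for a
  proof
    assume "\<chi> a = 0"
    then have e: "y0 * fst a = x0 * snd a" by (simp add: \<chi>_def)
    show "\<exists>c. a = scale2 c a0"
    proof (cases "x0 = 0")
      case True
      with assms(2) a0 have "y0 \<noteq> 0" by (auto simp: zero_prod_def)
      with e True show ?thesis by (intro exI[of _ "snd a / y0"]) (simp add: a0 prod_eq_iff)
    next
      case False
      with e show ?thesis by (intro exI[of _ "fst a / x0"]) (simp add: a0 prod_eq_iff field_simps)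
    qed
  qed (auto simp: \<chi>_def a0)
  define L where "L = {\<phi> :: 'v \<Rightarrow> complex. functional scl \<phi>}"
  define K1 :: "(C2 \<times> 'v \<times> 'v \<Rightarrow> complex) set" where "K1 = (\<lambda>\<phi> p. \<phi> (fst (snd p)) :: complex) ` {\<phi> \<in> L. \<forall>t\<in>T. \<phi> t = 0}"
  define K2 :: "(C2 \<times> 'v \<times> 'v \<Rightarrow> complex) set" where "K2 = (\<lambda>\<phi> p. \<phi> (snd (snd p)) :: complex) ` {\<phi> \<in> L. \<forall>t\<in>T. \<phi> t = 0}"
  define K3 :: "(C2 \<times> 'v \<times> 'v \<Rightarrow> complex) set" where "K3 = (\<lambda>(j, \<phi>) p. \<phi> (cpt j (fst (snd p))) :: complex) ` ((- S) \<times> L)"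
  define K4 :: "(C2 \<times> 'v \<times> 'v \<Rightarrow> complex) set" where "K4 = (\<lambda>(j, \<phi>) p. \<phi> (cpt j (snd (snd p))) :: complex) ` ((- S') \<times> L)"
  define K5 :: "(C2 \<times> 'v \<times> 'v \<Rightarrow> complex) set" where "K5 = (\<lambda>(\<phi>, \<psi>) p. \<phi> (cpt i (fst (snd p))) * \<psi> (cpt i (snd (snd p))) +
      (- 1) * (\<psi> (cpt i (fst (snd p))) * \<phi> (cpt i (snd (snd p)))) :: complex) ` (L \<times> L)"
  define K where "K = insert (\<lambda>p :: C2 \<times> 'v \<times> 'v. \<chi> (fst p)) (K1 \<union> K2 \<union> K3 \<union> K4 \<union> K5)"
  have Lc: "(\<lambda>x. \<phi> (cpt j x)) \<in> L" if "\<phi> \<in> L" for j \<phi>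
    using that linear_compose_functional[OF linear_comp] by (simp add: L_def)
  have t2: "trihom scl 0 1 0 (\<lambda>p. \<phi> (fst (snd p)))" and t3: "trihom scl 0 0 1 (\<lambda>p. \<phi> (snd (snd p)))" if "\<phi> \<in> L" for \<phi>
    using trihom_functional(2,3)[of \<phi>] that by (simp_all add: L_def)
  have t5: "trihom scl (0 + 0) (1 + 0) (0 + 1) (\<lambda>p. \<phi> (cpt i (fst (snd p))) * \<psi> (cpt i (snd (snd p))))"
    if "\<phi> \<in> L" "\<psi> \<in> L" for \<phi> \<psi>
    by (intro trihom_mult t2[OF Lc[OF that(1)]] t3[OF Lc[OF that(2)]])
  have "trihom scl (0 + (0 + 0)) (0 + (1 + 0)) (0 + (0 + 1)) (\<lambda>p. (- 1) * (\<psi> (cpt i (fst (snd p))) * \<phi> (cpt i (snd (snd p)))))"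
    if "\<phi> \<in> L" "\<psi> \<in> L" for \<phi> \<psi>
    by (intro trihom_mult[OF trihom_const] t5 that)
  with t5 have t5': "trihom scl 0 1 1 (\<lambda>p. \<phi> (cpt i (fst (snd p))) * \<psi> (cpt i (snd (snd p))) +
      (- 1) * (\<psi> (cpt i (fst (snd p))) * \<phi> (cpt i (snd (snd p)))))" if "\<phi> \<in> L" "\<psi> \<in> L" for \<phi> \<psi>
    using that by (intro trihom_add) simp_all
  have hom: "trihomogeneous F" if "F \<in> K" for F
  proof -
    have "F \<in> insert (\<lambda>p. \<chi> (fst p)) K1 \<or> F \<in> K2 \<or> F \<in> K3 \<or> F \<in> K4 \<or> F \<in> K5" using that by (auto simp: K_def)
    then show ?thesis
    proof (elim disjE insertE)
      assume "F = (\<lambda>p. \<chi> (fst p))"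
      then show ?thesis using trihom_functional(1)[OF \<chi>] by blast
    next
      assume "F \<in> K1"
      then show ?thesis using t2 unfolding K1_def by blast
    next
      assume "F \<in> K2"
      then show ?thesis using t3 unfolding K2_def by blast
    next
      assume "F \<in> K3"
      then show ?thesis using t2[OF Lc] unfolding K3_def by (auto simp: image_iff) blast
    next
      assume "F \<in> K4"
      then show ?thesis using t3[OF Lc] unfolding K4_def by (auto simp: image_iff) blast
    next
      assume "F \<in> K5"
      then obtain \<phi> \<psi> where "\<phi> \<in> L" "\<psi> \<in> L" "F = (\<lambda>p. \<phi> (cpt i (fst (snd p))) * \<psi> (cpt i (snd (snd p))) +
          (- 1) * (\<psi> (cpt i (fst (snd p))) * \<phi> (cpt i (snd (snd p)))))"
        unfolding K5_def by auto
      then show ?thesis using t5'[of \<phi> \<psi>] by blast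
    qed
  qed
  have zero: "(\<forall>F\<in>K. F (a, w, v) = 0) \<longleftrightarrow> (\<exists>c. a = scale2 c a0) \<and> w \<in> T \<and> v \<in> T \<and>
      (\<forall>j. j \<notin> S \<longrightarrow> cpt j w = 0) \<and> (\<forall>j. j \<notin> S' \<longrightarrow> cpt j v = 0) \<and> lin_dep scl (cpt i w) (cpt i v)" for a w v
  proof -
    have "(\<forall>F\<in>K1. F (a, w, v) = 0) \<longleftrightarrow> w \<in> T" "(\<forall>F\<in>K2. F (a, w, v) = 0) \<longleftrightarrow> v \<in> T"
      unfolding mem_subspace_iff[OF assms(1)] by (auto simp: K1_def K2_def L_def)
    moreover have "(\<forall>F\<in>K3. F (a, w, v) = 0) \<longleftrightarrow> (\<forall>j. j \<notin> S \<longrightarrow> cpt j w = 0)"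
      "(\<forall>F\<in>K4. F (a, w, v) = 0) \<longleftrightarrow> (\<forall>j. j \<notin> S' \<longrightarrow> cpt j v = 0)"
      unfolding eq_0_iff_functional[of "cpt _ _"] by (auto simp: K3_def K4_def L_def)
    moreover have "(\<forall>F\<in>K5. F (a, w, v) = 0) \<longleftrightarrow> lin_dep scl (cpt i w) (cpt i v)"
      unfolding lin_dep_iff by (auto simp: K5_def L_def)
    ultimately show ?thesis by (simp add: K_def ball_Un \<chi>_0)
  qed
  have "incidence a0 S S' i T = zeros3 scl K"
  proof (intro equalityI subsetI)
    fix p assume p: "p \<in> incidence a0 S S' i T"
    then have "p \<in> points3 scl" using incidence_subset_points3[OF assms(2)] by blast
    then obtain a w v where q: "p = pt a w v" "a \<noteq> 0" "w \<noteq> 0" "v \<noteq> 0" by (rule points3_cases)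
    show "p \<in> zeros3 scl K"
      using p pt_in_incidence_iff[OF assms q(2-4)] zeros3_pt[OF hom q(2-4)] zero unfolding q(1) by simp
  next
    fix p assume p: "p \<in> zeros3 scl K"
    then have "p \<in> points3 scl" using zeros3_subset by blast
    then obtain a w v where q: "p = pt a w v" "a \<noteq> 0" "w \<noteq> 0" "v \<noteq> 0" by (rule points3_cases)
    show "p \<in> incidence a0 S S' i T"
      using p pt_in_incidence_iff[OF assms q(2-4)] zeros3_pt[OF hom q(2-4)] zero unfolding q(1) by simp
  qed
  then show ?thesis using closedin_zeros3[OF hom] by simp
qed

lemma poly_map_segment_scl: "poly_map (*) scl (\<lambda>z. x + scl z (y - x))"
  by (rule poly_map_segment[OF vector_space_scl])

text \<open>Two points are joined inside the set. All components other than the \<open>i\<close>-th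
  move linearly. The two \<open>i\<close>-th components stay dependent because they are written as
  multiples of a common vector, and this vector and both scalars are interpolated separately. The
  vector \<open>x\<close> shows that the set is not empty.\<close>

lemma fun_prime_incidence:
  assumes T: "graded_subspace T" and a0: "a0 \<noteq> 0" and i: "i \<in> S" "i \<in> S'"
    and x: "x \<in> T" "x \<in> V i" "x \<noteq> 0" "i \<le> k"
  shows "fun_prime_ideal (poly_fun scale3) (ideal_of3 scl (incidence a0 S S' i T))"
proof (rule fun_prime_ideal_of3)
  have sub: "subspace T" using T by (simp add: graded_subspace_def)
  show "incidence a0 S S' i T \<subseteq> points3 scl" by (rule incidence_subset_points3[OF a0])
  have "pt a0 x x \<in> incidence a0 S S' i T"
    unfolding pt_in_incidence_iff[OF sub a0 a0 x(3,3)]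
    using x i lin_dep_scale[of 1 x 1] by (auto simp: comp_of_V pair_scale_def intro!: exI[of _ 1] split: prod.splits)
  then show "incidence a0 S S' i T \<noteq> {}" by blast
  fix a w v a' w' v' assume p: "pt a w v \<in> incidence a0 S S' i T" and p': "pt a' w' v' \<in> incidence a0 S S' i T"
  have nz: "a \<noteq> 0" "w \<noteq> 0" "v \<noteq> 0" "a' \<noteq> 0" "w' \<noteq> 0" "v' \<noteq> 0"
    using p p' incidence_subset_points3[OF a0] pt_in_points3 by blast+
  note mem = pt_in_incidence_iff[OF sub a0 nz(1-3), THEN iffD1, OF p]
    and mem' = pt_in_incidence_iff[OF sub a0 nz(4-6), THEN iffD1, OF p']
  obtain c where c: "a = scale2 c a0" using mem by blast
  obtain c' where c': "a' = scale2 c' a0" using mem' by blast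
  have cT: "cpt j y \<in> T" if "y \<in> T" for j y using T that by (simp add: graded_subspace_def)
  have "lin_dep scl (cpt i w) (cpt i v)" using mem by simp
  then obtain u s t where u: "cpt i w = scl s u" "cpt i v = scl t u" "u = cpt i w \<or> u = cpt i v"
    by (rule lin_dep_obtain)
  have "lin_dep scl (cpt i w') (cpt i v')" using mem' by simp
  then obtain u' s' t' where u': "cpt i w' = scl s' u'" "cpt i v' = scl t' u'" "u' = cpt i w' \<or> u' = cpt i v'"
    by (rule lin_dep_obtain)
  have uT: "u \<in> T" "u' \<in> T" using u(3) u'(3) mem mem' cT by auto
  have uc: "cpt j u = (if j = i then u else 0)" "cpt j u' = (if j = i then u' else 0)" for j
    using u(3) u'(3) by auto
  let ?seg = "\<lambda>x y z. x + scl z (y - x)"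
  let ?lin = "\<lambda>x y z :: complex. x + z * (y - x)"
  define \<alpha> where "\<alpha> = (\<lambda>z. scale2 (?lin c c' z) a0)"
  define \<omega> where "\<omega> = (\<lambda>z. ?seg (w - cpt i w) (w' - cpt i w') z + scl (?lin s s' z) (?seg u u' z))"
  define \<nu> where "\<nu> = (\<lambda>z. ?seg (v - cpt i v) (v' - cpt i v') z + scl (?lin t t' z) (?seg u u' z))"
  have lin: "?lin y y' \<in> poly_fun (*)" for y y'
    by (intro poly_fun_intros poly_fun_complex_id)
  have "poly_map (*) scale2 \<alpha>" unfolding \<alpha>_def by (intro poly_map_scale lin poly_map_const)
  moreover have "poly_map (*) scl \<omega>" "poly_map (*) scl \<nu>"
    unfolding \<omega>_def \<nu>_def by (intro poly_map_add poly_map_scale[OF lin] poly_map_segment_scl)+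
  moreover have "\<alpha> 0 = a" "\<alpha> 1 = a'" "\<omega> 0 = w" "\<omega> 1 = w'" "\<nu> 0 = v" "\<nu> 1 = v'"
    by (simp_all add: \<alpha>_def \<omega>_def \<nu>_def c c' u(1,2) u'(1,2))
  moreover have "pt (\<alpha> z) (\<omega> z) (\<nu> z) \<in> incidence a0 S S' i T" if "\<alpha> z \<noteq> 0" "\<omega> z \<noteq> 0" "\<nu> z \<noteq> 0" for z
    unfolding pt_in_incidence_iff[OF sub a0 that]
  proof (intro conjI allI impI)
    show "\<exists>c. \<alpha> z = scale2 c a0" by (auto simp: \<alpha>_def)
    show "\<omega> z \<in> T" "\<nu> z \<in> T"
      unfolding \<omega>_def \<nu>_def using mem mem' uT cT
      by (intro subspace_add[OF sub] subspace_scale[OF sub] subspace_diff[OF sub]; simp)+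
    show "cpt j (\<omega> z) = 0" if "j \<notin> S" for j
      using that mem mem' i by (auto simp: \<omega>_def uc)
    show "cpt j (\<nu> z) = 0" if "j \<notin> S'" for j
      using that mem mem' i by (auto simp: \<nu>_def uc)
    have "cpt i (\<omega> z) = scl (?lin s s' z) (?seg u u' z)" "cpt i (\<nu> z) = scl (?lin t t' z) (?seg u u' z)"
      by (simp_all add: \<omega>_def \<nu>_def uc)
    then show "lin_dep scl (cpt i (\<omega> z)) (cpt i (\<nu> z))" using lin_dep_scale by simp
  qed
  ultimately show "\<exists>\<alpha> \<omega> \<nu>. poly_map (*) scale2 \<alpha> \<and> poly_map (*) scl \<omega> \<and> poly_map (*) scl \<nu> \<and>
      \<alpha> 0 = a \<and> \<omega> 0 = w \<and> \<nu> 0 = v \<and> \<alpha> 1 = a' \<and> \<omega> 1 = w' \<and> \<nu> 1 = v' \<and>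
      (\<forall>z. \<alpha> z \<noteq> 0 \<longrightarrow> \<omega> z \<noteq> 0 \<longrightarrow> \<nu> z \<noteq> 0 \<longrightarrow> pt (\<alpha> z) (\<omega> z) (\<nu> z) \<in> incidence a0 S S' i T)"
    by (intro exI[of _ \<alpha>] exI[of _ \<omega>] exI[of _ \<nu>]) simp
qed

lemma irreducible_incidence:
  assumes "graded_subspace T" "a0 \<noteq> 0" "i \<in> S" "i \<in> S'" "x \<in> T" "x \<in> V i" "x \<noteq> 0" "i \<le> k"
  shows "irreducible_in (zariski3 scl) (incidence a0 S S' i T)"
proof -
  interpret P: fun_prime_ideal "poly_fun scale3" "ideal_of3 scl (incidence a0 S S' i T)"
    by (rule fun_prime_incidence[OF assms])
  show ?thesis
  proof (rule irreducible_in_zariski3I)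
    show "incidence a0 S S' i T \<subseteq> points3 scl" by (rule incidence_subset_points3[OF assms(2)])
    show "incidence a0 S S' i T \<noteq> {}"
      using P.proper poly_fun.const[of 1 scale3] by (auto simp: ideal_of3_def)
    show "F \<in> ideal_of3 scl (incidence a0 S S' i T) \<or> G \<in> ideal_of3 scl (incidence a0 S S' i T)"
      if "(\<lambda>p. F p * G p) \<in> ideal_of3 scl (incidence a0 S S' i T)" "F \<in> poly_fun scale3" "G \<in> poly_fun scale3" for F G
      by (rule P.prime[OF that(2,3,1)])
  qed
qed

end

section \<open>The dimension of the exceptional components\<close>

context graded_vector_space
begin

lemma graded_subspace_span_insert:
  assumes T: "graded_subspace T" and y: "y \<in> V j" "j \<le> k"
  shows "graded_subspace (span (insert y T))"
proof -
  have "subspace {z. \<forall>i. cpt i z \<in> span (insert y T)}"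
    by (auto simp: subspace_def span_zero intro: span_add span_scale)
  moreover have "insert y T \<subseteq> {z. \<forall>i. cpt i z \<in> span (insert y T)}"
  proof -
    have "cpt i y \<in> span (insert y T)" for i
      using comp_of_V[OF y, of i] span_base[of y "insert y T"] span_zero by simp
    moreover have "cpt i z \<in> span (insert y T)" if "z \<in> T" for z i
      using T that by (intro span_base) (simp add: graded_subspace_def)
    ultimately show ?thesis by blast
  qed
  ultimately have "span (insert y T) \<subseteq> {z. \<forall>i. cpt i z \<in> span (insert y T)}" by (intro span_minimal)
  then show ?thesis by (auto simp: graded_subspace_def subspace_span)
qed

text \<open>A proper graded subspace misses a vector of some \<open>V j\<close>; adding it keeps the
  subspace graded and raises the dimension by one. Every member contains \<open>x\<close>, so that
  the incidence sets formed with them are nonempty and irreducible.\<close>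

lemma graded_flag:
  assumes x: "x \<in> V i" "x \<noteq> 0" "i \<le> k" and m: "m < dim UNIV"
  shows "\<exists>T. (\<forall>j\<le>m. graded_subspace (T j) \<and> x \<in> T j \<and> dim (T j) = Suc j) \<and> (\<forall>j<m. T j \<subset> T (Suc j))"
  using m
proof (induction m)
  interpret fd: finite_dimensional_vector_space scl Bs by (rule finite_dimensional)
  case 0
  have "graded_subspace {0}" by (simp add: graded_subspace_def subspace_single_0)
  from graded_subspace_span_insert[OF this x(1,3)]
  have "graded_subspace (span (insert x {0}))" .
  moreover have "x \<in> span (insert x {0})" by (rule span_base) simp
  moreover have "dim (span (insert x {0})) = Suc 0"
    using x(2) by (simp add: fd.dim_insert)
  ultimately show ?case by (intro exI[of _ "\<lambda>_. span (insert x {0})"]) simp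
next
  interpret fd: finite_dimensional_vector_space scl Bs by (rule finite_dimensional)
  case (Suc m)
  then obtain T where T: "\<And>j. j \<le> m \<Longrightarrow> graded_subspace (T j) \<and> x \<in> T j \<and> dim (T j) = Suc j"
    "\<And>j. j < m \<Longrightarrow> T j \<subset> T (Suc j)" by auto
  have sub: "subspace (T m)" using T(1)[of m] by (simp add: graded_subspace_def)
  have "\<exists>j\<le>k. \<exists>y\<in>V j. y \<notin> T m"
  proof (rule ccontr)
    assume "\<not> ?thesis"
    then have "cpt j v \<in> T m" if "j \<le> k" for j v using comp_in_V[OF that] that by blast
    then have "(\<Sum>j\<le>k. cpt j v) \<in> T m" for v by (intro subspace_sum[OF sub]) auto
    then have "T m = UNIV" by (auto simp: sum_comp)
    then show False using T(1)[of m] Suc.prems by simp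
  qed
  then obtain j y where y: "j \<le> k" "y \<in> V j" "y \<notin> T m" by blast
  let ?T = "span (insert y (T m))"
  have "graded_subspace ?T" using T(1)[of m] y by (intro graded_subspace_span_insert) auto
  moreover have "x \<in> ?T" using T(1)[of m] by (intro span_base) simp
  moreover have "dim ?T = Suc (Suc m)"
    using T(1)[of m] y(3) by (simp add: fd.dim_insert span_eq_iff[THEN iffD2, OF sub])
  moreover have "T m \<subset> ?T" using y(3) span_superset[of "insert y (T m)"] by blast
  ultimately have "(\<forall>j\<le>Suc m. graded_subspace ((T(Suc m := ?T)) j) \<and> x \<in> (T(Suc m := ?T)) j \<and>
      dim ((T(Suc m := ?T)) j) = Suc j) \<and> (\<forall>j<Suc m. (T(Suc m := ?T)) j \<subset> (T(Suc m := ?T)) (Suc j))"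
    using T by (simp add: le_Suc_eq less_Suc_eq)
  then show ?case by blast
qed

text \<open>Some homogeneous \<open>z\<close> of degree \<open>j\<close> lies in \<open>T'\<close>
  but not in \<open>T\<close>. As \<open>j\<close> is in \<open>S\<close> or \<open>S'\<close>, it
  can be placed in the \<open>w\<close> or in the \<open>v\<close> slot. If \<open>j\<close> differs
  from \<open>i\<close>, pair \<open>x + z\<close> with \<open>x\<close>: both have
  \<open>i\<close>-th component \<open>x\<close>, hence dependent ones. If \<open>j = i\<close>, the
  pair \<open>(z, z)\<close> serves.\<close>

lemma incidence_strict_mono:
  assumes T: "graded_subspace T" "graded_subspace T'" "T \<subset> T'" and a0: "a0 \<noteq> 0"
    and i: "i \<in> S" "i \<in> S'" "i \<le> k" and S: "S \<union> S' = UNIV" and x: "x \<in> T" "x \<in> V i" "x \<noteq> 0"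
  shows "incidence a0 S S' i T \<subset> incidence a0 S S' i T'"
proof -
  have sub: "subspace T" "subspace T'" using T by (auto simp: graded_subspace_def)
  obtain y where y: "y \<in> T'" "y \<notin> T" using T(3) by blast
  have "\<exists>j\<le>k. cpt j y \<notin> T"
  proof (rule ccontr)
    assume "\<not> ?thesis"
    then have "(\<Sum>j\<le>k. cpt j y) \<in> T" by (intro subspace_sum[OF sub(1)]) auto
    with y(2) show False by (simp add: sum_comp)
  qed
  then obtain j where j: "j \<le> k" "cpt j y \<notin> T" by blast
  define z where "z = cpt j y"
  have z: "z \<in> T'" "z \<notin> T" "z \<noteq> 0" "\<And>l. cpt l z = (if l = j then z else 0)"
    using j y T(2) subspace_0[OF sub(1)] by (auto simp: z_def graded_subspace_def)
  have xc: "cpt l x = (if l = i then x else 0)" for l using comp_of_V[OF x(2) i(3)] .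
  have xT: "x \<in> T'" using x T by blast
  have xz: "x + z \<in> T'" "x + z \<notin> T"
    using subspace_add[OF sub(2) xT z(1)] subspace_diff[OF sub(1), of "x + z" x] x(1) z(2) by auto
  have nz: "x + z \<noteq> 0" using xz(2) subspace_0[OF sub(1)] by auto
  have one: "\<exists>c. a0 = scale2 c a0" by (rule exI[of _ 1]) (simp add: pair_scale_def split: prod.splits)
  have dep: "lin_dep scl u u" for u using lin_dep_scale[of 1 u 1] by simp
  obtain w v where wv: "w \<noteq> 0" "v \<noteq> 0" "pt a0 w v \<in> incidence a0 S S' i T'" "w \<notin> T \<or> v \<notin> T"
  proof -
    consider "j = i" | "j \<noteq> i" "j \<in> S" | "j \<noteq> i" "j \<in> S'" using S by blast
    then show thesis
    proof cases
      case 1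
      have "pt a0 z z \<in> incidence a0 S S' i T'"
        unfolding pt_in_incidence_iff[OF sub(2) a0 a0 z(3,3)] using one dep z(1,4) 1 i by auto
      with z show ?thesis using that by blast
    next
      case 2
      have "pt a0 (x + z) x \<in> incidence a0 S S' i T'"
        unfolding pt_in_incidence_iff[OF sub(2) a0 a0 nz x(3)] using one dep z(4) 2 i xc xz xT by auto
      with nz x(3) xz(2) show ?thesis using that by blast
    next
      case 3
      have "pt a0 x (x + z) \<in> incidence a0 S S' i T'"
        unfolding pt_in_incidence_iff[OF sub(2) a0 a0 x(3) nz] using one dep z(4) 3 i xc xz xT by auto
      with nz x(3) xz(2) show ?thesis using that by blast
    qed
  qed
  have "pt a0 w v \<notin> incidence a0 S S' i T"
    unfolding pt_in_incidence_iff[OF sub(1) a0 a0 wv(1,2)] using wv(4) by blast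
  with wv(3) incidence_mono[of T T'] T(3) show ?thesis by blast
qed

lemma dim_pos: "0 < dim UNIV"
proof -
  interpret fd: finite_dimensional_vector_space scl Bs by (rule finite_dimensional)
  obtain x where "x \<in> V 0" "x \<noteq> 0" using nontrivial[of 0] subspace_0[OF subspace_V[of 0]] by blast
  then have "\<not> UNIV \<subseteq> {0 :: 'v}" by blast
  then show ?thesis using fd.dim_eq_0 by blast
qed

lemma krull_dim_incidence_ge:
  assumes a0: "a0 \<noteq> 0" and i: "i \<in> S" "i \<in> S'" "i \<le> k" and S: "S \<union> S' = UNIV"
  shows "enat (dim UNIV - 1) \<le> krull_dim (zariski3 scl) (incidence a0 S S' i UNIV)"
proof -
  obtain x where x: "x \<in> V i" "x \<noteq> 0" using nontrivial[OF i(3)] subspace_0[OF subspace_V[OF i(3)]] by blast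
  let ?m = "dim UNIV - 1"
  obtain T where T: "\<And>j. j \<le> ?m \<Longrightarrow> graded_subspace (T j) \<and> x \<in> T j" "\<And>j. j < ?m \<Longrightarrow> T j \<subset> T (Suc j)"
    using graded_flag[OF x i(3), of ?m] dim_pos by auto
  let ?E = "incidence a0 S S' i UNIV"
  have "closedin (zariski3 scl) ?E" by (rule closedin_incidence[OF subspace_UNIV a0])
  then have "closedin (subtopology (zariski3 scl) ?E) (incidence a0 S S' i (T j))" if "j \<le> ?m" for j
    using T(1)[OF that] closedin_incidence[OF _ a0] incidence_mono[of "T j" UNIV]
    by (simp add: closedin_closed_subtopology graded_subspace_def)
  moreover have "irreducible_in (zariski3 scl) (incidence a0 S S' i (T j))" if "j \<le> ?m" for j
    using T(1)[OF that] x i by (intro irreducible_incidence[OF _ a0, of _ _ _ _ x]) auto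
  moreover have "incidence a0 S S' i (T j) \<subset> incidence a0 S S' i (T (Suc j))" if "j < ?m" for j
    using T(1)[of j] T(1)[of "Suc j"] T(2)[OF that] that x i
    by (intro incidence_strict_mono[OF _ _ _ a0 _ _ _ S, where x = x]) auto
  ultimately have "\<exists>c. (\<forall>j\<le>?m. closedin (subtopology (zariski3 scl) ?E) (c j) \<and> irreducible_in (zariski3 scl) (c j)) \<and>
      (\<forall>j<?m. c j \<subset> c (Suc j))" by (intro exI[of _ "\<lambda>j. incidence a0 S S' i (T j)"]) simp
  then show ?thesis unfolding krull_dim_def by (intro Sup_upper) blast
qed

text \<open>One vector \<open>u\<close> encodes both factors: its components in \<open>S\<close>
  give \<open>w\<close>, those in \<open>S'\<close> other than \<open>i\<close> give
  \<open>v\<close>, whose \<open>i\<close>-th component is \<open>t\<close> times that of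
  \<open>w\<close>. With the scaling of \<open>a0\<close> this makes
  \<open>2 + dim UNIV = 3 + (dim UNIV - 1)\<close> parameters.\<close>

lemma krull_dim_incidence_le:
  assumes a0: "a0 \<noteq> 0" and i: "S \<inter> S' = {i}"
  shows "krull_dim (zariski3 scl) (incidence a0 S S' i UNIV) \<le> enat (dim UNIV - 1)"
proof -
  let ?E = "incidence a0 S S' i UNIV"
  let ?s = "pair_scale (*) (pair_scale (*) scl) :: complex \<Rightarrow> complex \<times> complex \<times> 'v \<Rightarrow> _"
  have vs: "vector_space (pair_scale ((*) :: complex \<Rightarrow> complex \<Rightarrow> complex) scl)"
    by (intro vector_space_pair_scale vector_space_complex vector_space_scl)
  obtain x where "coordinates scl (dim UNIV) x"
    using coordinates_finite_dimensional[OF finite_dimensional] .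
  then obtain y where "coordinates ?s (1 + (1 + dim UNIV)) y"
    using coordinates_pair[OF coordinates_complex coordinates_pair[OF coordinates_complex]] by blast
  moreover have "1 + (1 + dim UNIV) = 3 + (dim UNIV - 1)" using dim_pos by simp
  ultimately have s: "coordinates ?s (3 + (dim UNIV - 1)) y" by simp
  have iS: "i \<in> S" "i \<in> S'" using i by auto
  define \<Phi> where "\<Phi> = (\<lambda>u. (scale2 (fst u) a0, proj_on S (snd (snd u)),
      scl (fst (snd u)) (cpt i (snd (snd u))) + proj_on (S' - {i}) (snd (snd u))))"
  have id: "poly_map ?s ?s (\<lambda>u. u)" by (rule poly_map_ident)
  have p1: "(\<lambda>u. fst u) \<in> poly_fun ?s"
    using poly_map_fst[OF id vector_space_complex vs] by (simp add: poly_map_complex)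
  have p2: "(\<lambda>u. fst (snd u)) \<in> poly_fun ?s"
    using poly_map_fst[OF poly_map_snd[OF id vector_space_complex vs] vector_space_complex vector_space_scl]
    by (simp add: poly_map_complex)
  have p3: "poly_map ?s scl (\<lambda>u. snd (snd u))"
    by (rule poly_map_snd[OF poly_map_snd[OF id vector_space_complex vs] vector_space_complex vector_space_scl])
  have \<Phi>: "poly_map ?s scale3 \<Phi>"
    unfolding \<Phi>_def
    by (intro poly_map_Pair poly_map_scale poly_map_add poly_map_const p1 p2 vector_space_scale2 vector_space_scl
        vector_space_pair_scale poly_map_compose[OF p3 poly_map_linear[OF linear_proj_on]]
        poly_map_compose[OF p3 poly_map_linear[OF linear_comp]])
  show ?thesis
  proof (rule krull_dim_le[OF closedin_incidence[OF subspace_UNIV a0] s \<Phi>])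
    fix F assume F: "F \<in> poly_fun scale3" "\<And>u. F (\<Phi> u) = 0"
    have generic: "F (scale2 c a0, w, v) = 0"
      if w: "\<And>j. j \<notin> S \<Longrightarrow> cpt j w = 0" and v: "\<And>j. j \<notin> S' \<Longrightarrow> cpt j v = 0" "cpt i v = scl t (cpt i w)" for c w v t
    proof -
      let ?u = "w + proj_on (S' - {i}) v"
      have j: "j \<notin> S \<or> j \<notin> S' - {i}" for j using i by blast
      have "proj_on S ?u = w"
        by (rule cpt_ext) (use w j in auto)
      moreover have "scl t (cpt i ?u) + proj_on (S' - {i}) ?u = v"
        by (rule cpt_ext) (use w v j in auto)
      ultimately have "\<Phi> (c, t, ?u) = (scale2 c a0, w, v)" by (simp add: \<Phi>_def)
      with F(2)[of "(c, t, ?u)"] show ?thesis by simp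
    qed
    show "F \<in> ideal_of3 scl ?E"
    proof (rule ideal_of3I[OF F(1)])
      fix a w v assume p: "pt a w v \<in> ?E"
      then have nz: "a \<noteq> 0" "w \<noteq> 0" "v \<noteq> 0" using incidence_subset_points3[OF a0] pt_in_points3 by blast+
      note mem = pt_in_incidence_iff[OF subspace_UNIV a0 nz, THEN iffD1, OF p]
      obtain c where c: "a = scale2 c a0" using mem by blast
      have wS: "\<And>j. j \<notin> S \<Longrightarrow> cpt j w = 0" and vS: "\<And>j. j \<notin> S' \<Longrightarrow> cpt j v = 0" using mem by auto
      have "lin_dep scl (cpt i w) (cpt i v)" using mem by simp
      then show "F (a, w, v) = 0"
      proof (cases rule: lin_dep_cases)
        case (1 t)
        then show ?thesis unfolding c by (intro generic wS vS)
      next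
        case 2
        \<comment> \<open>With \<open>w_i = 0\<close> the vector \<open>v_i\<close> need not be a
          multiple of \<open>w_i\<close>, so such points escape the parametrization; they are limits
          of pairs with \<open>w_i = z v_i\<close>.\<close>
        have zero: "F (scale2 c a0, w + scl z (cpt i v), v) = 0" if "z \<notin> {0}" for z
        proof (rule generic[of _ _ "inverse z"])
          show "cpt i v = scl (inverse z) (cpt i (w + scl z (cpt i v)))" using 2 that by simp
        qed (use wS vS iS in auto)
        have "(\<lambda>z. F (scale2 c a0, w + scl z (cpt i v), v)) \<in> poly_fun (*)"
          by (rule poly_map_comp[OF _ F(1)])
            (intro poly_map_Pair poly_map_scale poly_map_add poly_map_const poly_fun_complex_id
              vector_space_scale2 vector_space_scl vector_space_pair_scale)
        from poly_fun_complex_density[OF this, of "{0}" 0] zero show ?thesis by (simp add: c)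
      qed
    qed
  qed
qed

theorem krull_dim_incidence:
  assumes "a0 \<noteq> 0" "i \<le> k" "S \<inter> S' = {i}" "S \<union> S' = UNIV"
  shows "krull_dim (zariski3 scl) (incidence a0 S S' i UNIV) = enat (dim UNIV - 1)"
proof (rule antisym[OF krull_dim_incidence_le[OF assms(1,3)] krull_dim_incidence_ge[OF assms(1) _ _ assms(2,4)]])
qed (use assms(3) in auto)

end

section \<open>The closure of the graph\<close>

locale torus_action = graded_vector_space scl Bs V k
  for scl :: "complex \<Rightarrow> 'v::ab_group_add \<Rightarrow> 'v" and Bs :: "'v set" and V :: "nat \<Rightarrow> 'v set" and k :: nat +
  fixes \<beta> :: "nat \<Rightarrow> nat"
  assumes beta_0: "\<beta> 0 = 0"
    and beta_Suc: "\<And>i. i < k \<Longrightarrow> \<beta> i < \<beta> (Suc i)"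
begin

section \<open>The window equations and their affine zero set\<close>

lemma beta_less: "i < j \<Longrightarrow> j \<le> k \<Longrightarrow> \<beta> i < \<beta> j"
proof (induction j)
  case (Suc j)
  then have "\<beta> j < \<beta> (Suc j)" using beta_Suc[of j] by simp
  with Suc show ?case by (cases "i = j") auto
qed simp

lemma beta_le: "i \<le> j \<Longrightarrow> j \<le> k \<Longrightarrow> \<beta> i \<le> \<beta> j"
  using beta_less[of i j] by (cases "i = j") auto

definition minor ::
  "nat \<Rightarrow> nat \<Rightarrow> ('v \<Rightarrow> complex) \<Rightarrow> ('v \<Rightarrow> complex) \<Rightarrow> C2 \<times> 'v \<times> 'v \<Rightarrow> complex"
where
  "minor m N \<phi> \<psi> = (\<lambda>((\<mu>, l), w, v).
     \<phi> (window_left scl V k \<beta> m N \<mu> l w) * \<psi> (window_right V k m N v)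
     - \<psi> (window_left scl V k \<beta> m N \<mu> l w) * \<phi> (window_right V k m N v))"

definition minors :: "(C2 \<times> 'v \<times> 'v \<Rightarrow> complex) set" where
  "minors = {minor m N \<phi> \<psi> | m N \<phi> \<psi>. m \<le> N \<and> N \<le> k \<and>
     functional scl \<phi> \<and> functional scl \<psi>}"

lemma G_ideal_eq: "G_ideal scl V k \<beta> = ideal_radical (ring3 scl) (genideal (ring3 scl) minors)"
  unfolding G_ideal_def minors_def minor_def ..

text \<open>The window equations are equivalent to relations between pairs of components which are
  visibly invariant under exchanging \<open>\<mu>\<close> with \<open>\<lambda>\<close> and \<open>w\<close> with \<open>v\<close>.\<close>

definition cone :: "(C2 \<times> 'v \<times> 'v) set" where
  "cone = {((\<mu>, l), w, v). \<forall>j q \<phi> \<psi>. j \<le> q \<and> q \<le> k \<and>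
     functional scl \<phi> \<and> functional scl \<psi> \<longrightarrow>
     \<mu> ^ (\<beta> q - \<beta> j) * (\<phi> (cpt j w) * \<psi> (cpt q v)) = l ^ (\<beta> q - \<beta> j) * (\<psi> (cpt q w) * \<phi> (cpt j v))}"

lemma coneD:
  assumes "((\<mu>, l), w, v) \<in> cone" "j \<le> q" "q \<le> k"
    "functional scl \<phi>" "functional scl \<psi>"
  shows "\<mu> ^ (\<beta> q - \<beta> j) * (\<phi> (cpt j w) * \<psi> (cpt q v)) = l ^ (\<beta> q - \<beta> j) * (\<psi> (cpt q w) * \<phi> (cpt j v))"
  using assms unfolding cone_def by simp

lemma coneI:
  assumes "\<And>j q \<phi> \<psi>. j \<le> q \<Longrightarrow> q \<le> k \<Longrightarrow> functional scl \<phi> \<Longrightarrow> functional scl \<psi> \<Longrightarrow>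
    \<mu> ^ (\<beta> q - \<beta> j) * (\<phi> (cpt j w) * \<psi> (cpt q v)) = l ^ (\<beta> q - \<beta> j) * (\<psi> (cpt q w) * \<phi> (cpt j v))"
  shows "((\<mu>, l), w, v) \<in> cone"
  unfolding cone_def using assms by simp

lemma cone_swap:
  assumes "((\<mu>, l), w, v) \<in> cone"
  shows "((l, \<mu>), v, w) \<in> cone"
  by (rule coneI) (use coneD[OF assms] in \<open>simp add: mult.commute\<close>)

lemma window_left_functional:
  "functional scl \<phi> \<Longrightarrow> \<phi> (window_left scl V k \<beta> m N \<mu> l w) =
    (\<Sum>j=m..N. \<mu> ^ (\<beta> N - \<beta> j) * l ^ (\<beta> j - \<beta> m) * \<phi> (cpt j w))"
  by (simp add: window_left_def linear_functionalD)

lemma window_right_functional: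
  "functional scl \<phi> \<Longrightarrow> \<phi> (window_right V k m N v) = (\<Sum>j=m..N. \<phi> (cpt j v))"
  by (simp add: window_right_def linear_functionalD)

lemma cpt_window_left:
  "j \<in> {m..N} \<Longrightarrow> cpt j (window_left scl V k \<beta> m N \<mu> l w) = scl (\<mu> ^ (\<beta> N - \<beta> j) * l ^ (\<beta> j - \<beta> m)) (cpt j w)"
proof -
  assume j: "j \<in> {m..N}"
  have "cpt j (window_left scl V k \<beta> m N \<mu> l w) =
      (\<Sum>i=m..N. if j = i then scl (\<mu> ^ (\<beta> N - \<beta> i) * l ^ (\<beta> i - \<beta> m)) (cpt i w) else 0)"
    unfolding window_left_def comp_sum by (rule sum.cong) auto
  with j show ?thesis by simp
qed

lemma cpt_window_right: "j \<in> {m..N} \<Longrightarrow> cpt j (window_right V k m N v) = cpt j v"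
  unfolding window_right_def comp_sum by simp

text \<open>A pair relation is the minor of the window from \<open>j\<close> to \<open>q\<close>,
  taken on functionals of the two end components. Conversely, the product of the two sums in a minor
  expands into terms indexed by pairs, and each pair relation, multiplied by a monomial in \<mu> and
  \<lambda>, rewrites one term into its counterpart with \<open>\<phi>\<close> and
  \<open>\<psi>\<close> exchanged.\<close>

lemma minors_vanish_iff: "(\<forall>F\<in>minors. F p = 0) \<longleftrightarrow> p \<in> cone"
proof -
  obtain \<mu> l w v where p: "p = ((\<mu>, l), w, v)" by (metis prod.exhaust)
  show ?thesis
  proof
    assume zero: "\<forall>F\<in>minors. F p = 0"
    show "p \<in> cone" unfolding p
    proof (rule coneI)
      fix j q \<phi> \<psi> assume jq: "j \<le> q" "q \<le> k"
        and lin: "functional scl \<phi>" "functional scl \<psi>"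
      have "minor j q (\<lambda>x. \<phi> (cpt j x)) (\<lambda>x. \<psi> (cpt q x)) \<in> minors"
        unfolding minors_def using jq lin linear_compose_functional[OF linear_comp] by blast
      from bspec[OF zero this]
      show "\<mu> ^ (\<beta> q - \<beta> j) * (\<phi> (cpt j w) * \<psi> (cpt q v)) = l ^ (\<beta> q - \<beta> j) * (\<psi> (cpt q w) * \<phi> (cpt j v))"
        using jq by (simp add: p minor_def cpt_window_left cpt_window_right linear_functionalD(2)[OF lin(1)]
            linear_functionalD(2)[OF lin(2)] mult.assoc)
    qed
  next
    assume cone: "p \<in> cone"
    show "\<forall>F\<in>minors. F p = 0"
    proof
      fix F assume "F \<in> minors"
      then obtain m N \<phi> \<psi> where F: "F = minor m N \<phi> \<psi>" and mN: "m \<le> N" "N \<le> k"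
        and lin: "functional scl \<phi>" "functional scl \<psi>"
        unfolding minors_def by blast
      let ?c = "\<lambda>j. \<mu> ^ (\<beta> N - \<beta> j) * l ^ (\<beta> j - \<beta> m)"
      have split: "\<mu> ^ (\<beta> N - \<beta> j) = \<mu> ^ (\<beta> N - \<beta> q) * \<mu> ^ (\<beta> q - \<beta> j)"
        "l ^ (\<beta> q - \<beta> m) = l ^ (\<beta> j - \<beta> m) * l ^ (\<beta> q - \<beta> j)"
        if "m \<le> j" "j \<le> q" "q \<le> N" for j q
        using beta_le[of j q] beta_le[of q N] beta_le[of m j] that mN by (simp_all flip: power_add)
      have pair: "?c j * \<phi> (cpt j w) * \<psi> (cpt q v) = ?c q * \<psi> (cpt q w) * \<phi> (cpt j v)"
        if "m \<le> j" "j \<le> q" "q \<le> N" and lin: "functional scl \<phi>" "functional scl \<psi>" for j q \<phi> \<psi>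
      proof -
        have "?c j * \<phi> (cpt j w) * \<psi> (cpt q v) =
            \<mu> ^ (\<beta> N - \<beta> q) * l ^ (\<beta> j - \<beta> m) * (\<mu> ^ (\<beta> q - \<beta> j) * (\<phi> (cpt j w) * \<psi> (cpt q v)))"
          unfolding split(1)[OF that(1-3)] by (simp only: mult_ac)
        also have "\<dots> = \<mu> ^ (\<beta> N - \<beta> q) * l ^ (\<beta> j - \<beta> m) * (l ^ (\<beta> q - \<beta> j) * (\<psi> (cpt q w) * \<phi> (cpt j v)))"
          using coneD[OF cone[unfolded p] that(2) _ lin] that(3) mN by simp
        also have "\<dots> = ?c q * \<psi> (cpt q w) * \<phi> (cpt j v)"
          unfolding split(2)[OF that(1-3)] by (simp only: mult_ac)
        finally show ?thesis .
      qed
      have "\<phi> (window_left scl V k \<beta> m N \<mu> l w) * \<psi> (window_right V k m N v) =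
          (\<Sum>j=m..N. \<Sum>q=m..N. ?c j * \<phi> (cpt j w) * \<psi> (cpt q v))"
        unfolding window_left_functional[OF lin(1)] window_right_functional[OF lin(2)] sum_product ..
      also have "\<dots> = (\<Sum>j=m..N. \<Sum>q=m..N. ?c q * \<psi> (cpt q w) * \<phi> (cpt j v))"
      proof (intro sum.cong refl)
        fix j q assume "j \<in> {m..N}" "q \<in> {m..N}"
        then show "?c j * \<phi> (cpt j w) * \<psi> (cpt q v) = ?c q * \<psi> (cpt q w) * \<phi> (cpt j v)"
          using pair[of j q \<phi> \<psi>] pair[of q j \<psi> \<phi>] lin by (cases "j \<le> q") simp_all
      qed
      also have "\<dots> = (\<Sum>q=m..N. \<Sum>j=m..N. ?c q * \<psi> (cpt q w) * \<phi> (cpt j v))"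
        by (rule sum.swap)
      also have "\<dots> = \<psi> (window_left scl V k \<beta> m N \<mu> l w) * \<phi> (window_right V k m N v)"
        unfolding window_left_functional[OF lin(2)] window_right_functional[OF lin(1)] sum_product ..
      finally show "F p = 0" by (simp add: F p minor_def)
    qed
  qed
qed

lemma poly_fun_coord_mu: "(\<lambda>p. fst (fst p)) \<in> poly_fun scale3"
  and poly_fun_coord_lambda: "(\<lambda>p. snd (fst p)) \<in> poly_fun scale3"
proof -
  have "fst \<in> poly_fun scale2" "snd \<in> poly_fun scale2"
    by (auto intro!: poly_fun.functional linear_fst linear_snd vector_space_complex)
  then show "(\<lambda>p. fst (fst p)) \<in> poly_fun scale3" "(\<lambda>p. snd (fst p)) \<in> poly_fun scale3"
    using poly_fun_coord(1) by auto
qed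

lemma poly_fun_cpt:
  assumes "functional scl \<phi>"
  shows "(\<lambda>p. \<phi> (cpt j (fst (snd p)))) \<in> poly_fun scale3" "(\<lambda>p. \<phi> (cpt j (snd (snd p)))) \<in> poly_fun scale3"
  using poly_fun_coord(2,3)[OF poly_fun.functional[OF linear_compose_functional[OF linear_comp assms]]] by auto

lemma trihom_minor:
  assumes "m \<le> N" "N \<le> k" "functional scl \<phi>" "functional scl \<psi>"
  shows "trihom scl (\<beta> N - \<beta> m) 1 1 (minor m N \<phi> \<psi>)"
  unfolding trihom_def carrier_ring3
proof (intro conjI allI)
  have "minor m N \<phi> \<psi> = (\<lambda>p.
      (\<Sum>j=m..N. fst (fst p) ^ (\<beta> N - \<beta> j) * snd (fst p) ^ (\<beta> j - \<beta> m) * \<phi> (cpt j (fst (snd p)))) *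
        (\<Sum>j=m..N. \<psi> (cpt j (snd (snd p)))) -
      (\<Sum>j=m..N. fst (fst p) ^ (\<beta> N - \<beta> j) * snd (fst p) ^ (\<beta> j - \<beta> m) * \<psi> (cpt j (fst (snd p)))) *
        (\<Sum>j=m..N. \<phi> (cpt j (snd (snd p)))))"
    by (simp add: minor_def split_beta fun_eq_iff window_left_functional[OF assms(3)] window_left_functional[OF assms(4)]
        window_right_functional[OF assms(3)] window_right_functional[OF assms(4)])
  then show "minor m N \<phi> \<psi> \<in> poly_fun scale3"
    by (simp only:) (intro poly_fun_intros poly_fun_coord_mu poly_fun_coord_lambda poly_fun_cpt assms)
  fix r s t :: complex and a :: C2 and w v :: 'v
  obtain \<mu> l where a: "a = (\<mu>, l)" by (cases a)
  have wl: "\<phi> (window_left scl V k \<beta> m N (r * \<mu>) (r * l) (scl s w)) = r ^ (\<beta> N - \<beta> m) * s * \<phi> (window_left scl V k \<beta> m N \<mu> l w)"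
    if "functional scl \<phi>" for \<phi>
    unfolding window_left_functional[OF that] sum_distrib_left
  proof (rule sum.cong)
    fix j assume "j \<in> {m..N}"
    then have "r ^ (\<beta> N - \<beta> m) = r ^ (\<beta> N - \<beta> j) * r ^ (\<beta> j - \<beta> m)"
      using beta_le[of m j] beta_le[of j N] assms(2) by (simp flip: power_add)
    then show "(r * \<mu>) ^ (\<beta> N - \<beta> j) * (r * l) ^ (\<beta> j - \<beta> m) * \<phi> (cpt j (scl s w)) =
        r ^ (\<beta> N - \<beta> m) * s * (\<mu> ^ (\<beta> N - \<beta> j) * l ^ (\<beta> j - \<beta> m) * \<phi> (cpt j w))"
      by (simp add: linear_functionalD(2)[OF that] power_mult_distrib)
  qed simp
  have wr: "\<phi> (window_right V k m N (scl t v)) = t * \<phi> (window_right V k m N v)"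
    if "functional scl \<phi>" for \<phi>
    unfolding window_right_functional[OF that] by (simp add: sum_distrib_left linear_functionalD(2)[OF that])
  show "minor m N \<phi> \<psi> (scale2 r a, scl s w, scl t v) = r ^ (\<beta> N - \<beta> m) * s ^ 1 * t ^ 1 * minor m N \<phi> \<psi> (a, w, v)"
    by (simp add: minor_def a wl[OF assms(3)] wl[OF assms(4)] wr[OF assms(3)] wr[OF assms(4)])
      (simp add: algebra_simps)
qed

lemma trihomogeneous_minors: "F \<in> minors \<Longrightarrow> trihomogeneous F"
  unfolding minors_def using trihom_minor by blast

lemma minors_subset: "minors \<subseteq> poly_fun scale3"
  using trihomogeneous_minors trihomD(1) by blast

lemma coordinates_scale3: "\<exists>d x. coordinates scale3 d x"
proof -
  obtain x where x: "coordinates scl (dim UNIV) x" using coordinates_finite_dimensional[OF finite_dimensional] .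
  show ?thesis
    using coordinates_pair[OF coordinates_pair[OF coordinates_complex coordinates_complex] coordinates_pair[OF x x]] by blast
qed

text \<open>The Nullstellensatz in the affine space of triples. Vanishing is required on the entire
  affine zero set, including the points where \<open>a\<close>, \<open>w\<close> or \<open>v\<close>
  is 0, which represent no point of the variety.\<close>

theorem G_ideal_eq_vanishing: "G_ideal scl V k \<beta> = {F \<in> poly_fun scale3. \<forall>p\<in>cone. F p = 0}"
proof -
  interpret R: cring "ring3 scl" by (rule cring_ring3)
  let ?J = "genideal (ring3 scl) minors"
  have sub: "minors \<subseteq> carrier (ring3 scl)" using minors_subset by simp
  have J: "fun_ideal (poly_fun scale3) ?J" using R.genideal_ideal[OF sub] by (simp add: ideal_ring3)
  have zero: "(\<forall>g\<in>?J. g p = 0) \<longleftrightarrow> p \<in> cone" for p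
  proof
    assume "\<forall>g\<in>?J. g p = 0"
    then have "\<forall>g\<in>minors. g p = 0" using R.genideal_self[OF sub] by blast
    then show "p \<in> cone" by (simp only: minors_vanish_iff)
  next
    assume "p \<in> cone"
    then have "minors \<subseteq> {F \<in> poly_fun scale3. F p = 0}" using minors_vanish_iff[of p] minors_subset by blast
    moreover have "ideal {F \<in> poly_fun scale3. F p = 0} (ring3 scl)"
      unfolding ideal_ring3 fun_ideal_def by (intro conjI ballI subsetI CollectI) (simp_all add: poly_fun.intros)
    ultimately have "?J \<subseteq> {F \<in> poly_fun scale3. F p = 0}" by (intro R.genideal_minimal)
    then show "\<forall>g\<in>?J. g p = 0" by blast
  qed
  obtain d x where x: "coordinates scale3 d x" using coordinates_scale3 by blast
  show ?thesis
    unfolding G_ideal_eq ideal_radical_ring3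
  proof (intro equalityI subsetI CollectI conjI)
    fix F assume F: "F \<in> {f \<in> poly_fun scale3. \<exists>n. (\<lambda>p. f p ^ n) \<in> ?J}"
    then show "F \<in> poly_fun scale3" by simp
    obtain n where n: "(\<lambda>p. F p ^ n) \<in> ?J" using F by blast
    show "\<forall>p\<in>cone. F p = 0"
    proof
      fix p assume "p \<in> cone"
      then have "\<forall>g\<in>?J. g p = 0" by (simp only: zero)
      from bspec[OF this n] show "F p = 0" by simp
    qed
  next
    fix F assume F: "F \<in> {F \<in> poly_fun scale3. \<forall>p\<in>cone. F p = 0}"
    then show "F \<in> poly_fun scale3" by simp
    have "F p = 0" if "\<And>g. g \<in> ?J \<Longrightarrow> g p = 0" for p
      using F zero[of p] that by blast
    then obtain n where "(\<lambda>p. F p ^ n) \<in> ?J"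
      using nullstellensatz[OF x J, of F] F by blast
    then show "\<exists>n. (\<lambda>p. F p ^ n) \<in> ?J" by blast
  qed
qed

lemma G_idealD: "F \<in> G_ideal scl V k \<beta> \<Longrightarrow> p \<in> cone \<Longrightarrow> F p = 0"
  and G_ideal_subset: "G_ideal scl V k \<beta> \<subseteq> poly_fun scale3"
  and G_idealI: "F \<in> poly_fun scale3 \<Longrightarrow> (\<And>p. p \<in> cone \<Longrightarrow> F p = 0) \<Longrightarrow> F \<in> G_ideal scl V k \<beta>"
  unfolding G_ideal_eq_vanishing by auto

lemma G_variety_eq: "G_variety scl V k \<beta> = zeros3 scl minors"
proof -
  interpret R: cring "ring3 scl" by (rule cring_ring3)
  have "genideal (ring3 scl) minors \<subseteq> poly_fun scale3"
    using ideal.Icarr[OF R.genideal_ideal] minors_subset by fastforce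
  then show ?thesis
    by (simp add: G_variety_def G_ideal_eq zeros3_ideal_radical zeros3_genideal minors_subset)
qed

lemma pt_in_G_variety_iff:
  assumes "a \<noteq> 0" "w \<noteq> 0" "v \<noteq> 0"
  shows "pt a w v \<in> G_variety scl V k \<beta> \<longleftrightarrow> (a, w, v) \<in> cone"
  using zeros3_pt[of minors a w v] trihomogeneous_minors assms minors_vanish_iff by (simp add: G_variety_eq)

lemma closedin_G_variety: "closedin (zariski3 scl) (G_variety scl V k \<beta>)"
  unfolding G_variety_eq by (rule closedin_zeros3[OF trihomogeneous_minors])

section \<open>The graph of the action inside the affine zero set, and its closure\<close>

lemma cpt_act [simp]: "cpt j (act scl V k \<beta> l w) = scl (l ^ \<beta> j) (cpt j w)"
proof -
  have "cpt j (act scl V k \<beta> l w) = (\<Sum>i\<le>k. if j = i then scl (l ^ \<beta> i) (cpt i w) else 0)"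
    unfolding act_def comp_sum by (rule sum.cong) auto
  then show ?thesis by (cases "j \<le> k") (simp_all add: comp_beyond)
qed

lemma nonzero_component:
  assumes "w \<noteq> 0"
  shows "\<exists>j\<le>k. cpt j w \<noteq> 0"
proof (rule ccontr)
  assume "\<not> ?thesis"
  then have "cpt j w = cpt j 0" for j by (cases "j \<le> k") (auto simp: comp_beyond)
  then have "w = 0" by (rule cpt_ext)
  with assms show False by simp
qed

lemma act_eq_0_iff: "l \<noteq> 0 \<Longrightarrow> act scl V k \<beta> l w = 0 \<longleftrightarrow> w = 0"
proof
  assume l: "l \<noteq> 0" and "act scl V k \<beta> l w = 0"
  then have "scl (l ^ \<beta> j) (cpt j w) = 0" for j using cpt_act[of j l w] by simp
  then have "cpt j w = cpt j 0" for j using l by simp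
  then show "w = 0" by (rule cpt_ext)
next
  assume "w = 0"
  then have "cpt j (act scl V k \<beta> l w) = cpt j 0" for j by simp
  then show "act scl V k \<beta> l w = 0" by (rule cpt_ext)
qed

lemma action_graph_subset: "action_graph scl V k \<beta> \<subseteq> points3 scl"
  unfolding action_graph_def by (auto simp: act_eq_0_iff zero_prod_def)

lemma graph_in_cone:
  assumes "\<mu> \<noteq> 0"
  shows "((\<mu>, l), w, scl c (act scl V k \<beta> (l / \<mu>) w)) \<in> cone"
proof (rule coneI)
  fix j q \<phi> \<psi> assume jq: "j \<le> q" "q \<le> k"
    and lin: "functional scl \<phi>" "functional scl \<psi>"
  have b: "\<beta> q = (\<beta> q - \<beta> j) + \<beta> j" using beta_le[OF jq] by simp
  have "\<mu> ^ (\<beta> q - \<beta> j) * (l / \<mu>) ^ \<beta> q = l ^ (\<beta> q - \<beta> j) * (l / \<mu>) ^ \<beta> j"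
    by (subst (2) b) (use assms in \<open>simp add: power_add power_divide\<close>)
  then have "\<mu> ^ (\<beta> q - \<beta> j) * (l / \<mu>) ^ \<beta> q * (c * \<phi> (cpt j w) * \<psi> (cpt q w)) =
      l ^ (\<beta> q - \<beta> j) * (l / \<mu>) ^ \<beta> j * (c * \<phi> (cpt j w) * \<psi> (cpt q w))" by simp
  then show "\<mu> ^ (\<beta> q - \<beta> j) * (\<phi> (cpt j w) * \<psi> (cpt q (scl c (act scl V k \<beta> (l / \<mu>) w)))) =
      l ^ (\<beta> q - \<beta> j) * (\<psi> (cpt q w) * \<phi> (cpt j (scl c (act scl V k \<beta> (l / \<mu>) w))))"
    by (simp add: linear_functionalD(2)[OF lin(1)] linear_functionalD(2)[OF lin(2)] mult_ac)
qed

lemma cone_in_graph: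
  assumes cone: "((\<mu>, l), w, v) \<in> cone" and nz: "\<mu> \<noteq> 0" "l \<noteq> 0" "w \<noteq> 0" "v \<noteq> 0"
  shows "pt (\<mu>, l) w v \<in> action_graph scl V k \<beta>"
proof -
  obtain j where j: "cpt j w \<noteq> 0" "j \<le> k" using nonzero_component[OF nz(3)] by blast
  obtain \<phi> where \<phi>: "functional scl \<phi>" "\<phi> (cpt j w) = 1"
    by (rule functional_nonzero[OF vector_space_scl j(1)])
  let ?A = "act scl V k \<beta> (l / \<mu>) w"
  \<comment> \<open>Forced by the \<open>j\<close>-th components, where \<open>w\<close> does not
    vanish: \<open>v_j\<close> has to be \<open>c\<close> times
    \<open>(l / \<mu>) ^ \<beta> j\<close> times \<open>w_j\<close>. The pair relations involving
    \<open>j\<close> then determine all other components of \<open>v\<close>.\<close>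
  define c where "c = \<phi> (cpt j v) * (\<mu> / l) ^ \<beta> j"
  have "\<psi> (cpt q v) = \<psi> (scl c (cpt q ?A))" if q: "q \<le> k" and \<psi>: "functional scl \<psi>" for q \<psi>
  proof (cases "j \<le> q")
    case True
    have b: "\<beta> q = (\<beta> q - \<beta> j) + \<beta> j" using beta_le[OF True q] by simp
    have "\<mu> ^ (\<beta> q - \<beta> j) * \<psi> (cpt q v) = l ^ (\<beta> q - \<beta> j) * (\<psi> (cpt q w) * \<phi> (cpt j v))"
      using coneD[OF cone True q \<phi>(1) \<psi>] \<phi>(2) by simp
    then have "\<psi> (cpt q v) = (l / \<mu>) ^ (\<beta> q - \<beta> j) * (\<psi> (cpt q w) * \<phi> (cpt j v))"
      using nz by (simp add: field_simps power_divide)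
    also have "(l / \<mu>) ^ (\<beta> q - \<beta> j) = (l / \<mu>) ^ \<beta> q * (\<mu> / l) ^ \<beta> j"
      by (subst (2) b) (use nz in \<open>simp add: power_add power_divide\<close>)
    finally show ?thesis by (simp add: c_def linear_functionalD(2)[OF \<psi>])
  next
    case False
    then have qj: "q \<le> j" by simp
    have b: "\<beta> j = (\<beta> j - \<beta> q) + \<beta> q" using beta_le[OF qj j(2)] by simp
    have "\<mu> ^ (\<beta> j - \<beta> q) * (\<psi> (cpt q w) * \<phi> (cpt j v)) = l ^ (\<beta> j - \<beta> q) * \<psi> (cpt q v)"
      using coneD[OF cone qj j(2) \<psi> \<phi>(1)] \<phi>(2) by simp
    then have "\<psi> (cpt q v) = (\<mu> / l) ^ (\<beta> j - \<beta> q) * (\<psi> (cpt q w) * \<phi> (cpt j v))"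
      using nz by (simp add: field_simps power_divide)
    also have "(\<mu> / l) ^ (\<beta> j - \<beta> q) = (l / \<mu>) ^ \<beta> q * (\<mu> / l) ^ \<beta> j"
      by (subst (2) b) (use nz in \<open>simp add: power_add power_divide\<close>)
    finally show ?thesis by (simp add: c_def linear_functionalD(2)[OF \<psi>])
  qed
  then have "\<psi> (cpt q v - scl c (cpt q ?A)) = 0" if "q \<le> k" "functional scl \<psi>" for q \<psi>
    using that by (simp only: linear_functionalD(4)[OF that(2)]) simp
  then have "cpt q v - scl c (cpt q ?A) = 0" if "q \<le> k" for q
    using that eq_0_iff_functional[of "cpt q v - scl c (cpt q ?A)"] by blast
  then have "cpt q v = cpt q (scl c ?A)" for q by (cases "q \<le> k") (auto simp: comp_beyond)
  then have v: "v = scl c ?A" by (rule cpt_ext)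
  with nz have c: "c \<noteq> 0" by auto
  have lm: "l / \<mu> \<noteq> 0" using nz by simp
  have A: "?A \<noteq> 0" using act_eq_0_iff[OF lm] nz by simp
  have one: "(1, l / \<mu>) \<noteq> (0 :: C2)" by (simp add: zero_prod_def)
  have "\<exists>r s t. r \<noteq> 0 \<and> s \<noteq> 0 \<and> t \<noteq> 0 \<and> (\<mu>, l) = scale2 r (1, l / \<mu>) \<and> w = scl s w \<and> v = scl t ?A"
    using nz(1,2) c by (intro exI[of _ \<mu>] exI[of _ 1] exI[of _ c] conjI v) simp_all
  then have "pt (1, l / \<mu>) w ?A = pt (\<mu>, l) w v" by (rule pt_eq_iff[THEN iffD2, OF one nz(3) A])
  then have "pt (\<mu>, l) w v = pt (1, l / \<mu>) w ?A" by simp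
  then show ?thesis unfolding action_graph_def using lm nz(3) by blast
qed

lemma cone_mu_0:
  assumes cone: "((0, l), w, v) \<in> cone" and nz: "l \<noteq> 0" "w \<noteq> 0" "v \<noteq> 0"
  obtains i where "i \<le> k" "cpt i w \<noteq> 0" "pt (0, l) w v \<in> incidence (0, 1) {..i} {i..} i UNIV"
proof -
  define I where "I = {j. j \<le> k \<and> cpt j w \<noteq> 0}"
  have "I \<noteq> {}" using nonzero_component[OF nz(2)] by (auto simp: I_def)
  moreover have "finite I" by (simp add: I_def)
  ultimately have i: "Max I \<in> I" "\<And>j. j \<in> I \<Longrightarrow> j \<le> Max I" by auto
  define i where "i = Max I"
  have ik: "i \<le> k" "cpt i w \<noteq> 0" using i(1) by (auto simp: I_def i_def)
  have above: "cpt j w = 0" if "j \<notin> {..i}" for j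
  proof (rule ccontr)
    assume "cpt j w \<noteq> 0"
    moreover from this have "j \<le> k" using comp_beyond[of j w] by (cases "k < j") auto
    ultimately have "j \<in> I" by (simp add: I_def)
    with i(2)[of j] that show False by (simp add: i_def)
  qed
  obtain \<psi> where \<psi>: "functional scl \<psi>" "\<psi> (cpt i w) = 1"
    by (rule functional_nonzero[OF vector_space_scl ik(2)])
  have below: "cpt j v = 0" if "j \<notin> {i..}" for j
  proof -
    have ji: "j < i" using that by simp
    have "\<phi> (cpt j v) = 0" if "functional scl \<phi>" for \<phi>
      using coneD[OF cone less_imp_le[OF ji] ik(1) that \<psi>(1)] beta_less[OF ji ik(1)] nz(1) \<psi>(2)
      by (simp add: power_0_left)
    then show ?thesis using eq_0_iff_functional by blast
  qed
  have dep: "lin_dep scl (cpt i w) (cpt i v)"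
    unfolding lin_dep_iff
  proof (intro allI impI)
    fix \<phi> \<psi> assume "functional scl \<phi>" "functional scl \<psi>"
    from coneD[OF cone order.refl ik(1) this]
    show "\<phi> (cpt i w) * \<psi> (cpt i v) = \<psi> (cpt i w) * \<phi> (cpt i v)" by simp
  qed
  have a: "(0, 1) \<noteq> (0 :: C2)" "(0, l) \<noteq> (0 :: C2)" using nz(1) by (auto simp: zero_prod_def)
  have "pt (0, l) w v \<in> incidence (0, 1) {..i} {i..} i UNIV"
    unfolding pt_in_incidence_iff[OF subspace_UNIV a nz(2,3)] using above below dep
    by (intro conjI exI[of _ l]) auto
  then show ?thesis using that ik by blast
qed

lemma incidence_in_cone:
  assumes p: "pt a w v \<in> incidence (0, 1) {..i} {i..} i UNIV" and ik: "i \<le> k"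
  shows "fst a = 0" "snd a \<noteq> 0" "(a, w, v) \<in> cone"
proof -
  have a01: "(0, 1) \<noteq> (0 :: C2)" by (simp add: zero_prod_def)
  have nz: "a \<noteq> 0" "w \<noteq> 0" "v \<noteq> 0" using p incidence_subset_points3[OF a01] pt_in_points3 by blast+
  note mem = pt_in_incidence_iff[OF subspace_UNIV a01 nz, THEN iffD1, OF p]
  then obtain l where a: "a = (0, l)" by auto
  then show "fst a = 0" "snd a \<noteq> 0" using nz(1) by (auto simp: zero_prod_def)
  have w: "cpt j w = 0" if "i < j" for j using mem that by simp
  have v: "cpt j v = 0" if "j < i" for j using mem that by simp
  have dep: "lin_dep scl (cpt i w) (cpt i v)" using mem by simp
  show "(a, w, v) \<in> cone" unfolding a
  proof (rule coneI)
    fix j q \<phi> \<psi> assume jq: "j \<le> q" "q \<le> k"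
      and lin: "functional scl \<phi>" "functional scl \<psi>"
    note z = linear_functionalD(3)[OF lin(1)] linear_functionalD(3)[OF lin(2)]
    \<comment> \<open>Apart from \<open>j = q = i\<close> both sides vanish: \<open>v_j = 0\<close>
      for \<open>j < i\<close>, \<open>w_q = 0\<close> for \<open>i < q\<close>, and for
      \<open>j < q\<close> the power of 0 kills the left side.\<close>
    consider "j = q" "q = i" | "j < i" | "i < q" | "j = q" "q \<noteq> i" using jq by linarith
    then show "0 ^ (\<beta> q - \<beta> j) * (\<phi> (cpt j w) * \<psi> (cpt q v)) = l ^ (\<beta> q - \<beta> j) * (\<psi> (cpt q w) * \<phi> (cpt j v))"
    proof cases
      case 1
      then show ?thesis using dep lin unfolding lin_dep_iff by simp
    next
      case 2
      then show ?thesis using v[of j] v[of q] beta_less[of j q] jq z by (cases "j = q") (auto simp: power_0_left)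
    next
      case 3
      then show ?thesis using w[of q] w[of j] beta_less[of j q] jq z by (cases "j = q") (auto simp: power_0_left)
    next
      case 4
      then show ?thesis using w[of q] v[of q] z by (cases "i < q") auto
    qed
  qed
qed

lemma poly_map_triple:
  assumes "\<alpha> \<in> poly_fun s" "\<alpha>' \<in> poly_fun s" "poly_map s scl \<omega>" "poly_map s scl \<nu>"
  shows "poly_map s scale3 (\<lambda>z. ((\<alpha> z, \<alpha>' z), \<omega> z, \<nu> z))"
  using assms by (intro poly_map_Pair vector_space_complex vector_space_scl vector_space_scale2
      vector_space_pair_scale) (simp_all add: poly_map_complex)

text \<open>If \<open>w\<close> and \<open>v\<close> have components \<open>s u\<close> and \<open>t u\<close> in \<open>V i\<close> with \<open>s, t \<noteq> 0\<close>, the remaining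
  components of a point of the graph over \<open>\<mu> = z\<close> are determined by those of \<open>w\<close> below and those of
  \<open>v\<close> above \<open>i\<close>; the resulting curve is polynomial in \<open>z\<close>.\<close>

lemma vanishes_on_incidence:
  assumes H: "H \<in> poly_fun scale3"
    and zero: "\<And>\<mu> l w v. ((\<mu>, l), w, v) \<in> cone \<Longrightarrow> \<mu> \<noteq> 0 \<Longrightarrow> l \<noteq> 0 \<Longrightarrow> H ((\<mu>, l), w, v) = 0"
    and p: "pt a w v \<in> incidence (0, 1) {..i} {i..} i UNIV" and ik: "i \<le> k"
  shows "H (a, w, v) = 0"
proof -
  have a01: "(0, 1) \<noteq> (0 :: C2)" by (simp add: zero_prod_def)
  have nz: "a \<noteq> 0" "w \<noteq> 0" "v \<noteq> 0" using p incidence_subset_points3[OF a01] pt_in_points3 by blast+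
  note mem = pt_in_incidence_iff[OF subspace_UNIV a01 nz, THEN iffD1, OF p]
  then obtain l where a: "a = (0, l)" by auto
  with nz(1) have l: "l \<noteq> 0" by (auto simp: zero_prod_def)
  have generic: "H ((0, l), w, v) = 0"
    if w: "\<And>j. i < j \<Longrightarrow> cpt j w = 0" and v: "\<And>j. j < i \<Longrightarrow> cpt j v = 0"
      and u: "cpt i w = scl s u" "cpt i v = scl t u" and st: "s \<noteq> 0" "t \<noteq> 0" for w v u s t
  proof -
    \<comment> \<open>The added components, above \<open>i\<close> for \<open>w\<close> and below
      \<open>i\<close> for \<open>v\<close>, carry positive powers of \<open>z\<close>, so they
      disappear at \<open>z = 0\<close>. The ratios \<open>s / t\<close> and \<open>t / s\<close>
      account for the different multiples of \<open>u\<close>.\<close>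
    define \<omega> where "\<omega> = (\<lambda>z. w + (\<Sum>j\<in>{i<..k}. scl ((z / l) ^ (\<beta> j - \<beta> i) * (s / t)) (cpt j v)))"
    define \<nu> where "\<nu> = (\<lambda>z. v + (\<Sum>j<i. scl ((z / l) ^ (\<beta> i - \<beta> j) * (t / s)) (cpt j w)))"
    have c\<omega>: "cpt q (\<omega> z) = (if i < q then scl ((z / l) ^ (\<beta> q - \<beta> i) * (s / t)) (cpt q v) else cpt q w)" for q z
    proof -
      have "cpt q (\<omega> z) = cpt q w + (\<Sum>j\<in>{i<..k}. if q = j then scl ((z / l) ^ (\<beta> j - \<beta> i) * (s / t)) (cpt j v) else 0)"
        unfolding \<omega>_def comp_add comp_sum by (intro arg_cong2[where f = "(+)"] sum.cong) auto
      then show ?thesis using w by (cases "q \<le> k") (auto simp: comp_beyond)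
    qed
    have c\<nu>: "cpt q (\<nu> z) = (if q < i then scl ((z / l) ^ (\<beta> i - \<beta> q) * (t / s)) (cpt q w) else cpt q v)" for q z
    proof -
      have "cpt q (\<nu> z) = cpt q v + (\<Sum>j<i. if q = j then scl ((z / l) ^ (\<beta> i - \<beta> j) * (t / s)) (cpt j w) else 0)"
        unfolding \<nu>_def comp_add comp_sum by (intro arg_cong2[where f = "(+)"] sum.cong) auto
      then show ?thesis using v by auto
    qed
    have "H ((z, l), \<omega> z, \<nu> z) = 0" if z: "z \<noteq> 0" for z
    proof (rule zero[OF _ z l])
      let ?c = "t / s * (z / l) ^ \<beta> i"
      have "\<nu> z = scl ?c (act scl V k \<beta> (l / z) (\<omega> z))"
      proof (rule cpt_ext)
        fix q
        consider "q < i" | "q = i" | "i < q" "q \<le> k" | "k < q" by linarith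
        then show "cpt q (\<nu> z) = cpt q (scl ?c (act scl V k \<beta> (l / z) (\<omega> z)))"
        proof cases
          case 1
          have b: "\<beta> i = (\<beta> i - \<beta> q) + \<beta> q" using beta_le[of q i] 1 ik by simp
          have "(z / l) ^ \<beta> i * (l / z) ^ \<beta> q = (z / l) ^ (\<beta> i - \<beta> q)"
            by (subst b) (use z l in \<open>simp add: power_add power_divide\<close>)
          then show ?thesis using 1 by (simp add: c\<omega> c\<nu> mult_ac)
        next
          case 2
          have "(z / l) ^ \<beta> i * (l / z) ^ \<beta> i = 1" using z l by (simp flip: power_mult_distrib)
          then show ?thesis using 2 st by (simp add: c\<omega> c\<nu> u mult_ac)
        next
          case 3
          have b: "\<beta> q = (\<beta> q - \<beta> i) + \<beta> i" using beta_le[of i q] 3 by simp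
          have "(z / l) ^ \<beta> i * (l / z) ^ \<beta> q * (z / l) ^ (\<beta> q - \<beta> i) = 1"
            by (subst b) (use z l in \<open>simp add: power_add power_divide\<close>)
          then show ?thesis using 3 st by (simp add: c\<omega> c\<nu> mult_ac)
        next
          case 4
          then show ?thesis using ik by (simp add: comp_beyond)
        qed
      qed
      then show "((z, l), \<omega> z, \<nu> z) \<in> cone" using graph_in_cone[OF z] by simp
    qed
    moreover have "(\<lambda>z. H ((z, l), \<omega> z, \<nu> z)) \<in> poly_fun (*)"
    proof (rule poly_map_comp[OF poly_map_triple H])
      have 1: "(\<lambda>z. (z / l) ^ n * c) \<in> poly_fun (*)" for n c
        unfolding divide_inverse by (intro poly_fun_intros poly_fun_complex_id)
      show "poly_map (*) scl \<omega>" "poly_map (*) scl \<nu>"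
        unfolding \<omega>_def \<nu>_def by (intro poly_map_add poly_map_sum poly_map_scale poly_map_const 1)+
    qed (rule poly_fun_complex_id poly_fun.const)+
    ultimately have "H ((0, l), \<omega> 0, \<nu> 0) = 0"
      using poly_fun_complex_density[of "\<lambda>z. H ((z, l), \<omega> z, \<nu> z)" "{0}" 0] by simp
    moreover have "\<omega> 0 = w"
    proof (rule cpt_ext)
      fix q show "cpt q (\<omega> 0) = cpt q w"
        using beta_less[of i q] w[of q] by (cases "q \<le> k") (auto simp: c\<omega> comp_beyond)
    qed
    moreover have "\<nu> 0 = v"
    proof (rule cpt_ext)
      fix q show "cpt q (\<nu> 0) = cpt q v"
        using beta_less[of q i] ik v[of q] by (auto simp: c\<nu>)
    qed
    ultimately show ?thesis by simp
  qed
  have "lin_dep scl (cpt i w) (cpt i v)" using mem by simp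
  then obtain u s t where u: "cpt i w = scl s u" "cpt i v = scl t u" "u = cpt i w \<or> u = cpt i v"
    by (rule lin_dep_obtain)
  have uc: "cpt j u = (if j = i then u else 0)" for j using u(3) by auto
  \<comment> \<open>Adding \<open>z u\<close> to both vectors makes both scalars nonzero for all but
    at most two values of \<open>z\<close>; the value \<open>z = 0\<close> is recovered by
    density.\<close>
  have "H ((0, l), w + scl z u, v + scl z u) = 0" if "z \<notin> {- s, - t}" for z
  proof (rule generic)
    show "cpt i (w + scl z u) = scl (s + z) u" "cpt i (v + scl z u) = scl (t + z) u"
      using u uc[of i] by (simp_all add: scale_left_distrib)
    show "s + z \<noteq> 0" "t + z \<noteq> 0" using that by (auto simp: add_eq_0_iff add.commute)
  qed (use mem uc in auto)
  moreover have "(\<lambda>z. H ((0, l), w + scl z u, v + scl z u)) \<in> poly_fun (*)"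
    by (rule poly_map_comp[OF poly_map_triple H])
      (intro poly_fun.const poly_map_add poly_map_const poly_map_scale poly_fun_complex_id)+
  ultimately have "H ((0, l), w + scl 0 u, v + scl 0 u) = 0"
    using poly_fun_complex_density[of "\<lambda>z. H ((0, l), w + scl z u, v + scl z u)" "{- s, - t}" 0] by simp
  then show ?thesis by (simp add: a)
qed

lemma vanishes_on_cone:
  assumes H: "H \<in> poly_fun scale3"
    and zero: "\<And>\<mu> l w v. ((\<mu>, l), w, v) \<in> cone \<Longrightarrow> \<mu> \<noteq> 0 \<Longrightarrow> l \<noteq> 0 \<Longrightarrow> H ((\<mu>, l), w, v) = 0"
    and p: "(a, w, v) \<in> cone" and nz: "a \<noteq> 0" "w \<noteq> 0" "v \<noteq> 0"
  shows "H (a, w, v) = 0"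
proof -
  have mu_0: "H ((0, l), w, v) = 0"
    if H: "H \<in> poly_fun scale3" and zero: "\<And>\<mu> l w v. ((\<mu>, l), w, v) \<in> cone \<Longrightarrow> \<mu> \<noteq> 0 \<Longrightarrow> l \<noteq> 0 \<Longrightarrow> H ((\<mu>, l), w, v) = 0"
      and p: "((0, l), w, v) \<in> cone" and nz: "l \<noteq> 0" "w \<noteq> 0" "v \<noteq> 0" for H l w v
  proof -
    obtain i where "i \<le> k" "pt (0, l) w v \<in> incidence (0, 1) {..i} {i..} i UNIV"
      using cone_mu_0[OF p nz] by blast
    then show ?thesis using vanishes_on_incidence[OF H zero] by blast
  qed
  obtain \<mu> l where a: "a = (\<mu>, l)" by (cases a)
  consider "\<mu> \<noteq> 0" "l \<noteq> 0" | "\<mu> = 0" "l \<noteq> 0" | "l = 0" "\<mu> \<noteq> 0" using nz(1) a by (auto simp: zero_prod_def)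
  then show ?thesis
  proof cases
    case 1
    then show ?thesis using zero p a by simp
  next
    case 2
    then show ?thesis using mu_0[OF H zero, of l w v] p nz a by simp
  next
    case 3
    \<comment> \<open>The exchange of \<mu> with \<lambda> and of \<open>w\<close> with
      \<open>v\<close>; pulling \<open>H\<close> back along it reduces to the case of vanishing
      first coordinate.\<close>
    let ?\<sigma> = "\<lambda>p. ((snd (fst p), fst (fst p)), snd (snd p), fst (snd p))"
    have vs: "vector_space (pair_scale scl scl)" by (intro vector_space_pair_scale vector_space_scl)
    have "poly_map scale3 scale3 ?\<sigma>"
      by (intro poly_map_triple poly_fun_coord_mu poly_fun_coord_lambda
          poly_map_fst[OF poly_map_snd[OF poly_map_ident vector_space_scale2 vs] vector_space_scl vector_space_scl]
          poly_map_snd[OF poly_map_snd[OF poly_map_ident vector_space_scale2 vs] vector_space_scl vector_space_scl])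
    then have H\<sigma>: "(\<lambda>p. H (?\<sigma> p)) \<in> poly_fun scale3" by (rule poly_map_comp[OF _ H])
    have p': "((0, \<mu>), v, w) \<in> cone" using p a 3 cone_swap by blast
    have "H (?\<sigma> ((\<mu>, l), w, v)) = 0" if "((\<mu>, l), w, v) \<in> cone" "\<mu> \<noteq> 0" "l \<noteq> 0" for \<mu> l w v
      using zero[OF cone_swap[OF that(1)] that(3,2)] by simp
    from mu_0[OF H\<sigma> this p' 3(2) nz(3,2)] show ?thesis using a 3 by simp
  qed
qed

lemma ideal_of3_graph: "ideal_of3 scl (action_graph scl V k \<beta>) = ideal_of3 scl (G_variety scl V k \<beta>)"
proof
  show "ideal_of3 scl (action_graph scl V k \<beta>) \<subseteq> ideal_of3 scl (G_variety scl V k \<beta>)"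
  proof
    fix F assume F: "F \<in> ideal_of3 scl (action_graph scl V k \<beta>)"
    then have Fp: "F \<in> poly_fun scale3" using ideal_of3_subset by blast
    show "F \<in> ideal_of3 scl (G_variety scl V k \<beta>)"
    proof (rule ideal_of3I[OF Fp])
      fix a w v assume p: "pt a w v \<in> G_variety scl V k \<beta>"
      then have nz: "a \<noteq> 0" "w \<noteq> 0" "v \<noteq> 0" using zeros3_subset pt_in_points3 unfolding G_variety_def by blast+
      have cone: "(a, w, v) \<in> cone" using p pt_in_G_variety_iff[OF nz] by simp
      obtain \<phi> where \<phi>: "functional scl \<phi>" "\<phi> w = 1" by (rule functional_nonzero[OF vector_space_scl nz(2)])
      obtain \<psi> where \<psi>: "functional scl \<psi>" "\<psi> v = 1" by (rule functional_nonzero[OF vector_space_scl nz(3)])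
      \<comment> \<open>The factor makes \<open>H\<close> vanish at the points of the affine zero
        set with \<open>w = 0\<close> or \<open>v = 0\<close>, which belong to no point of the
        graph; at the given point it is 1.\<close>
      define H where "H = (\<lambda>p. F p * (\<phi> (fst (snd p)) * \<psi> (snd (snd p))))"
      have "H \<in> poly_fun scale3"
        unfolding H_def by (intro poly_fun.mult Fp poly_fun.functional linear_coord \<phi> \<psi>)
      moreover have "H ((\<mu>, l), w, v) = 0" if "((\<mu>, l), w, v) \<in> cone" "\<mu> \<noteq> 0" "l \<noteq> 0" for \<mu> l w v
      proof (cases "w = 0 \<or> v = 0")
        case True
        then show ?thesis using linear_functionalD(3)[OF \<phi>(1)] linear_functionalD(3)[OF \<psi>(1)] by (auto simp: H_def)
      next
        case False
        then have "pt (\<mu>, l) w v \<in> action_graph scl V k \<beta>" using that by (intro cone_in_graph) auto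
        from ideal_of3D[OF F this] show ?thesis by (simp add: H_def)
      qed
      ultimately have "H (a, w, v) = 0" using vanishes_on_cone cone nz by blast
      then show "F (a, w, v) = 0" by (simp add: H_def \<phi> \<psi>)
    qed
  qed
  have "action_graph scl V k \<beta> \<subseteq> G_variety scl V k \<beta>"
  proof
    fix p assume "p \<in> action_graph scl V k \<beta>"
    then obtain l w where p: "p = pt (1, l) w (act scl V k \<beta> l w)" "l \<noteq> 0" "w \<noteq> 0"
      unfolding action_graph_def by blast
    have "((1, l), w, act scl V k \<beta> l w) \<in> cone" using graph_in_cone[of 1 l w 1] by simp
    then show "p \<in> G_variety scl V k \<beta>"
      unfolding p(1) by (subst pt_in_G_variety_iff) (use p act_eq_0_iff in \<open>auto simp: zero_prod_def\<close>)
  qed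
  then show "ideal_of3 scl (G_variety scl V k \<beta>) \<subseteq> ideal_of3 scl (action_graph scl V k \<beta>)"
    by (rule ideal_of3_mono)
qed

theorem closure_of_action_graph: "zariski3 scl closure_of action_graph scl V k \<beta> = G_variety scl V k \<beta>"
proof -
  have "zariski3 scl closure_of action_graph scl V k \<beta> =
      zeros3 scl (ideal_of3 scl (zariski3 scl closure_of action_graph scl V k \<beta>))"
    by (rule zeros3_ideal_of3[symmetric]) simp
  also have "\<dots> = zeros3 scl (ideal_of3 scl (G_variety scl V k \<beta>))"
    unfolding ideal_of3_closure[OF action_graph_subset] ideal_of3_graph ..
  also have "\<dots> = G_variety scl V k \<beta>" by (rule zeros3_ideal_of3[OF closedin_G_variety])
  finally show ?thesis .
qed

end

section \<open>The exceptional divisor and the sections of the variety\<close>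

context torus_action
begin

section \<open>The center of the blow-up and the sections by \<mu> and \<lambda>\<close>

abbreviation scale12 :: "complex \<Rightarrow> C2 \<times> 'v \<Rightarrow> C2 \<times> 'v" where
  "scale12 \<equiv> pair_scale scale2 scl"

lemma vector_space_scale12: "vector_space scale12"
  by (intro vector_space_pair_scale vector_space_complex vector_space_scl)

lemma carrier_ring2 [simp]: "carrier (ring2 scl) = poly_fun scale12"
  by (simp add: ring2_def)

lemma cring_ring2: "cring (ring2 scl)"
  unfolding ring2_def by (rule cring_fun_ring[OF fun_subalgebra_poly_fun])

lemma ideal_ring2: "ideal J (ring2 scl) \<longleftrightarrow> fun_ideal (poly_fun scale12) J"
  unfolding ring2_def by (rule ideal_fun_ring[OF fun_subalgebra_poly_fun])

lemma pr12_apply [simp]: "pr12 (x, y, z) = (x, y)"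
  by (simp add: pr12_def)

lemma poly_map_pr12: "poly_map scale3 scale12 pr12"
proof -
  have vs: "vector_space (pair_scale scl scl)" by (intro vector_space_pair_scale vector_space_scl)
  have "poly_map scale3 scale12 (\<lambda>p. (fst p, fst (snd p)))"
    by (intro poly_map_Pair vector_space_scale2 vector_space_scl poly_map_fst[OF poly_map_ident vector_space_scale2 vs]
        poly_map_fst[OF poly_map_snd[OF poly_map_ident vector_space_scale2 vs] vector_space_scl vector_space_scl])
  moreover have "pr12 = (\<lambda>p :: C2 \<times> 'v \<times> 'v. (fst p, fst (snd p)))"
    by (rule ext) (simp add: pr12_def split_beta)
  ultimately show ?thesis by simp
qed

lemma poly_fun_pr12: "g \<in> poly_fun scale12 \<Longrightarrow> g \<circ> pr12 \<in> poly_fun scale3"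
  using poly_map_comp[OF poly_map_pr12] by (simp add: comp_def)

definition center_gen :: "nat \<Rightarrow> ('v \<Rightarrow> complex) \<Rightarrow> C2 \<times> 'v \<Rightarrow> complex" where
  "center_gen i \<phi> = (\<lambda>((\<mu>, l), w). \<mu> ^ (\<beta> k - \<beta> i) * l ^ \<beta> i * \<phi> (cpt i w))"

definition center_gens :: "(C2 \<times> 'v \<Rightarrow> complex) set" where
  "center_gens = {center_gen i \<phi> | i \<phi>. i \<le> k \<and> functional scl \<phi>}"

lemma center_ideal_eq: "center_ideal scl V k \<beta> = genideal (ring2 scl) center_gens"
  unfolding center_ideal_def center_gens_def center_gen_def ..

lemma poly_fun_scale12_coord:
  "(\<lambda>p. fst (fst p)) \<in> poly_fun scale12" "(\<lambda>p. snd (fst p)) \<in> poly_fun scale12"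
  "poly_map scale12 scl snd"
proof -
  have 1: "poly_map scale12 scale2 fst" by (intro poly_map_linear linear_fst vector_space_scale2 vector_space_scl)
  show "poly_map scale12 scl snd" by (intro poly_map_linear linear_snd vector_space_scale2 vector_space_scl)
  show "(\<lambda>p. fst (fst p)) \<in> poly_fun scale12" "(\<lambda>p. snd (fst p)) \<in> poly_fun scale12"
    using poly_map_fst[OF 1 vector_space_complex vector_space_complex]
      poly_map_snd[OF 1 vector_space_complex vector_space_complex] by (simp_all add: poly_map_complex)
qed

lemma center_gens_subset: "center_gens \<subseteq> poly_fun scale12"
proof
  fix g assume "g \<in> center_gens"
  then obtain i \<phi> where g: "g = center_gen i \<phi>" and \<phi>: "functional scl \<phi>"
    unfolding center_gens_def by blast
  have "g = (\<lambda>p. fst (fst p) ^ (\<beta> k - \<beta> i) * snd (fst p) ^ \<beta> i * \<phi> (cpt i (snd p)))"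
    by (simp add: g center_gen_def split_beta fun_eq_iff)
  also have "\<dots> \<in> poly_fun scale12"
    by (intro poly_fun_intros poly_fun_scale12_coord(1,2)
        poly_map_functional[OF poly_map_compose[OF poly_fun_scale12_coord(3) poly_map_linear[OF linear_comp]] \<phi>])
  finally show "g \<in> poly_fun scale12" .
qed

lemma center_ideal_subset: "center_ideal scl V k \<beta> \<subseteq> poly_fun scale12"
proof -
  interpret R: cring "ring2 scl" by (rule cring_ring2)
  have "ideal (center_ideal scl V k \<beta>) (ring2 scl)"
    unfolding center_ideal_eq by (rule R.genideal_ideal) (simp add: center_gens_subset)
  then show ?thesis using ideal.Icarr by fastforce
qed

lemma center_ideal_vanishes_iff:
  "(\<forall>g\<in>center_ideal scl V k \<beta>. g ((\<mu>, l), w) = 0) \<longleftrightarrow> (\<forall>i\<le>k. \<mu> ^ (\<beta> k - \<beta> i) * l ^ \<beta> i = 0 \<or> cpt i w = 0)"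
proof -
  interpret R: cring "ring2 scl" by (rule cring_ring2)
  have gens: "(\<forall>g\<in>center_gens. g ((\<mu>, l), w) = 0) \<longleftrightarrow> (\<forall>i\<le>k. \<mu> ^ (\<beta> k - \<beta> i) * l ^ \<beta> i = 0 \<or> cpt i w = 0)"
    unfolding eq_0_iff_functional[of "cpt _ _"] center_gens_def center_gen_def by fastforce
  have "(\<forall>g\<in>center_ideal scl V k \<beta>. g ((\<mu>, l), w) = 0) \<longleftrightarrow> (\<forall>g\<in>center_gens. g ((\<mu>, l), w) = 0)"
  proof
    assume "\<forall>g\<in>center_ideal scl V k \<beta>. g ((\<mu>, l), w) = 0"
    moreover have "center_gens \<subseteq> center_ideal scl V k \<beta>"
      unfolding center_ideal_eq by (rule R.genideal_self) (simp add: center_gens_subset)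
    ultimately show "\<forall>g\<in>center_gens. g ((\<mu>, l), w) = 0" by blast
  next
    assume "\<forall>g\<in>center_gens. g ((\<mu>, l), w) = 0"
    then have "center_gens \<subseteq> {g \<in> poly_fun scale12. g ((\<mu>, l), w) = 0}" using center_gens_subset by blast
    moreover have "ideal {g \<in> poly_fun scale12. g ((\<mu>, l), w) = 0} (ring2 scl)"
      unfolding ideal_ring2 fun_ideal_def by (intro conjI ballI subsetI CollectI) (simp_all add: poly_fun.intros)
    ultimately have "center_ideal scl V k \<beta> \<subseteq> {g \<in> poly_fun scale12. g ((\<mu>, l), w) = 0}"
      unfolding center_ideal_eq by (intro R.genideal_minimal)
    then show "\<forall>g\<in>center_ideal scl V k \<beta>. g ((\<mu>, l), w) = 0" by blast
  qed
  with gens show ?thesis by simp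
qed

lemma lin_dep_commute: "lin_dep scl x y \<longleftrightarrow> lin_dep scl y x"
  unfolding lin_dep_iff by (metis mult.commute)

lemma incidence_swap:
  assumes "(x, y) \<noteq> (0 :: C2)" "pt (\<mu>, l) w v \<in> incidence (x, y) S S' i UNIV"
  shows "pt (l, \<mu>) v w \<in> incidence (y, x) S' S i UNIV"
proof -
  have nz: "(\<mu>, l) \<noteq> (0 :: C2)" "w \<noteq> 0" "v \<noteq> 0"
    using assms(2) incidence_subset_points3[OF assms(1)] pt_in_points3 by blast+
  have nz': "(l, \<mu>) \<noteq> (0 :: C2)" "(y, x) \<noteq> (0 :: C2)" using nz(1) assms(1) by (auto simp: zero_prod_def)
  show ?thesis
    using pt_in_incidence_iff[OF subspace_UNIV assms(1) nz, THEN iffD1, OF assms(2)] lin_dep_commute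
    unfolding pt_in_incidence_iff[OF subspace_UNIV nz'(2,1) nz(3,2)] by auto
qed

lemma cone_lambda_0:
  assumes cone: "((\<mu>, 0), w, v) \<in> cone" and nz: "\<mu> \<noteq> 0" "w \<noteq> 0" "v \<noteq> 0"
  obtains i where "i \<le> k" "pt (\<mu>, 0) w v \<in> incidence (1, 0) {i..} {..i} i UNIV"
proof -
  obtain i where i: "i \<le> k" "pt (0, \<mu>) v w \<in> incidence (0, 1) {..i} {i..} i UNIV"
    using cone_mu_0[OF cone_swap[OF cone] nz(1,3,2)] by blast
  have "(0, 1) \<noteq> (0 :: C2)" by (simp add: zero_prod_def)
  from incidence_swap[OF this i(2)] i(1) show ?thesis using that by blast
qed

lemma incidence_zero_in_cone:
  assumes p: "pt a w v \<in> incidence (1, 0) {i..} {..i} i UNIV" and ik: "i \<le> k"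
  shows "snd a = 0" "fst a \<noteq> 0" "(a, w, v) \<in> cone"
proof -
  obtain \<mu> l where a: "a = (\<mu>, l)" by (cases a)
  have "(1, 0) \<noteq> (0 :: C2)" by (simp add: zero_prod_def)
  from incidence_in_cone[OF incidence_swap[OF this p[unfolded a]] ik]
  show "snd a = 0" "fst a \<noteq> 0" "(a, w, v) \<in> cone" using cone_swap by (auto simp: a)
qed

lemma coord_mu_eq: "coord_mu = (\<lambda>p :: C2 \<times> 'v \<times> 'v. fst (fst p))"
  and coord_lambda_eq: "coord_lambda = (\<lambda>p :: C2 \<times> 'v \<times> 'v. snd (fst p))"
  by (rule ext, simp add: coord_mu_def coord_lambda_def split_beta)+

lemma zeros3_section_mu:
  "zeros3 scl (G_section_ideal scl V k \<beta> coord_mu) = (\<Union>i\<le>k. E_infinity scl V k i)"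
proof -
  have mu: "coord_mu (a, w, v) = fst a" for a :: C2 and w v :: 'v by (simp add: coord_mu_eq)
  have "(coord_mu :: C2 \<times> 'v \<times> 'v \<Rightarrow> complex) \<in> poly_fun scale3"
    using poly_fun_coord_mu by (simp add: coord_mu_eq)
  then have "insert coord_mu (G_ideal scl V k \<beta>) \<subseteq> poly_fun scale3" using G_ideal_subset by simp
  then have eq: "zeros3 scl (G_section_ideal scl V k \<beta> coord_mu) = zeros3 scl (insert coord_mu (G_ideal scl V k \<beta>))"
    unfolding G_section_ideal_def by (rule zeros3_genideal)
  show ?thesis unfolding eq
  proof (intro equalityI subsetI)
    fix p assume p: "p \<in> zeros3 scl (insert coord_mu (G_ideal scl V k \<beta>))"
    then obtain a w v where q: "p = pt a w v" "a \<noteq> 0" "w \<noteq> 0" "v \<noteq> 0"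
      using zeros3_subset points3_cases by (metis subsetD)
    have "fst a = 0" using zeros3D[OF p _ q(1), of coord_mu] mu by simp
    then obtain l where a: "a = (0, l)" "l \<noteq> 0" using q(2) by (cases a) (auto simp: zero_prod_def)
    have "p \<in> G_variety scl V k \<beta>"
      unfolding G_variety_def using p zeros3_antimono[of "G_ideal scl V k \<beta>" "insert coord_mu (G_ideal scl V k \<beta>)"] by blast
    then have "((0, l), w, v) \<in> cone" using pt_in_G_variety_iff[OF q(2-4)] q(1) a(1) by simp
    then obtain i where "i \<le> k" "pt (0, l) w v \<in> incidence (0, 1) {..i} {i..} i UNIV"
      using cone_mu_0[OF _ a(2) q(3,4)] by blast
    then show "p \<in> (\<Union>i\<le>k. E_infinity scl V k i)" using E_infinity_eq q(1) a(1) by auto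
  next
    fix p assume "p \<in> (\<Union>i\<le>k. E_infinity scl V k i)"
    then obtain i where i: "i \<le> k" "p \<in> incidence (0, 1) {..i} {i..} i UNIV" using E_infinity_eq by auto
    have a01: "(0, 1) \<noteq> (0 :: C2)" by (simp add: zero_prod_def)
    show "p \<in> zeros3 scl (insert coord_mu (G_ideal scl V k \<beta>))"
    proof (rule zeros3I)
      show "p \<in> points3 scl" using i(2) incidence_subset_points3[OF a01] by blast
      fix F a w v assume F: "F \<in> insert coord_mu (G_ideal scl V k \<beta>)" and p: "p = pt a w v"
      note c = incidence_in_cone[OF i(2)[unfolded p] i(1)]
      show "F (a, w, v) = 0" using F c(1) G_idealD[OF _ c(3)] by (auto simp: coord_mu_eq)
    qed
  qed
qed

lemma zeros3_section_lambda:
  "zeros3 scl (G_section_ideal scl V k \<beta> coord_lambda) = (\<Union>i\<le>k. E_zero scl V k i)"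
proof -
  have la: "coord_lambda (a, w, v) = snd a" for a :: C2 and w v :: 'v by (simp add: coord_lambda_eq)
  have "(coord_lambda :: C2 \<times> 'v \<times> 'v \<Rightarrow> complex) \<in> poly_fun scale3"
    using poly_fun_coord_lambda by (simp add: coord_lambda_eq)
  then have "insert coord_lambda (G_ideal scl V k \<beta>) \<subseteq> poly_fun scale3" using G_ideal_subset by simp
  then have eq: "zeros3 scl (G_section_ideal scl V k \<beta> coord_lambda) = zeros3 scl (insert coord_lambda (G_ideal scl V k \<beta>))"
    unfolding G_section_ideal_def by (rule zeros3_genideal)
  show ?thesis unfolding eq
  proof (intro equalityI subsetI)
    fix p assume p: "p \<in> zeros3 scl (insert coord_lambda (G_ideal scl V k \<beta>))"
    then obtain a w v where q: "p = pt a w v" "a \<noteq> 0" "w \<noteq> 0" "v \<noteq> 0"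
      using zeros3_subset points3_cases by (metis subsetD)
    have "snd a = 0" using zeros3D[OF p _ q(1), of coord_lambda] la by simp
    then obtain \<mu> where a: "a = (\<mu>, 0)" "\<mu> \<noteq> 0" using q(2) by (cases a) (auto simp: zero_prod_def)
    have "p \<in> G_variety scl V k \<beta>"
      unfolding G_variety_def using p zeros3_antimono[of "G_ideal scl V k \<beta>" "insert coord_lambda (G_ideal scl V k \<beta>)"] by blast
    then have "((\<mu>, 0), w, v) \<in> cone" using pt_in_G_variety_iff[OF q(2-4)] q(1) a(1) by simp
    then obtain i where "i \<le> k" "pt (\<mu>, 0) w v \<in> incidence (1, 0) {i..} {..i} i UNIV"
      using cone_lambda_0[OF _ a(2) q(3,4)] by blast
    then show "p \<in> (\<Union>i\<le>k. E_zero scl V k i)" using E_zero_eq q(1) a(1) by auto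
  next
    fix p assume "p \<in> (\<Union>i\<le>k. E_zero scl V k i)"
    then obtain i where i: "i \<le> k" "p \<in> incidence (1, 0) {i..} {..i} i UNIV" using E_zero_eq by auto
    have a10: "(1, 0) \<noteq> (0 :: C2)" by (simp add: zero_prod_def)
    show "p \<in> zeros3 scl (insert coord_lambda (G_ideal scl V k \<beta>))"
    proof (rule zeros3I)
      show "p \<in> points3 scl" using i(2) incidence_subset_points3[OF a10] by blast
      fix F a w v assume F: "F \<in> insert coord_lambda (G_ideal scl V k \<beta>)" and p: "p = pt a w v"
      note c = incidence_zero_in_cone[OF i(2)[unfolded p] i(1)]
      show "F (a, w, v) = 0" using F c(1) G_idealD[OF _ c(3)] by (auto simp: coord_lambda_eq)
    qed
  qed
qed

lemma a01: "(0, 1) \<noteq> (0 :: C2)" and a10: "(1, 0) \<noteq> (0 :: C2)"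
  by (simp_all add: zero_prod_def)

section \<open>The irreducible components\<close>

lemma obtain_V:
  assumes "i \<le> k"
  obtains x where "x \<in> V i" "x \<noteq> 0" "\<And>j. cpt j x = (if j = i then x else 0)"
proof -
  obtain x where "x \<in> V i" "x \<noteq> 0" using nontrivial[OF assms] subspace_0[OF subspace_V[OF assms]] by blast
  then show ?thesis using that comp_of_V[of x i] assms by blast
qed

lemma E_infinity_iff:
  assumes "i \<le> k" "a \<noteq> 0" "w \<noteq> 0" "v \<noteq> 0"
  shows "pt a w v \<in> E_infinity scl V k i \<longleftrightarrow> fst a = 0 \<and> (\<forall>j>i. cpt j w = 0) \<and> (\<forall>j<i. cpt j v = 0) \<and>
    lin_dep scl (cpt i w) (cpt i v)"
  unfolding E_infinity_eq[OF assms(1)] pt_in_incidence_iff[OF subspace_UNIV a01 assms(2-4)]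
  by (cases a) auto

lemma E_zero_iff:
  assumes "i \<le> k" "a \<noteq> 0" "w \<noteq> 0" "v \<noteq> 0"
  shows "pt a w v \<in> E_zero scl V k i \<longleftrightarrow> snd a = 0 \<and> (\<forall>j<i. cpt j w = 0) \<and> (\<forall>j>i. cpt j v = 0) \<and>
    lin_dep scl (cpt i w) (cpt i v)"
  unfolding E_zero_eq[OF assms(1)] pt_in_incidence_iff[OF subspace_UNIV a10 assms(2-4)]
  by (cases a) auto

lemma E_infinity_subset_points3: "i \<le> k \<Longrightarrow> E_infinity scl V k i \<subseteq> points3 scl"
  and E_zero_subset_points3: "i \<le> k \<Longrightarrow> E_zero scl V k i \<subseteq> points3 scl"
  using E_infinity_eq E_zero_eq incidence_subset_points3[OF a01] incidence_subset_points3[OF a10] by simp_all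

lemma E_infinity_cases:
  assumes "p \<in> E_infinity scl V k i" "i \<le> k"
  obtains a w v where "p = pt a w v" "a \<noteq> 0" "w \<noteq> 0" "v \<noteq> 0" "fst a = 0" "\<forall>j>i. cpt j w = 0" "\<forall>j<i. cpt j v = 0"
proof -
  obtain a w v where q: "p = pt a w v" "a \<noteq> 0" "w \<noteq> 0" "v \<noteq> 0"
    using assms E_infinity_subset_points3 points3_cases by (metis subsetD)
  with assms E_infinity_iff[OF assms(2) q(2-4)] show ?thesis by (intro that[OF q]) auto
qed

lemma E_zero_cases:
  assumes "p \<in> E_zero scl V k i" "i \<le> k"
  obtains a w v where "p = pt a w v" "a \<noteq> 0" "w \<noteq> 0" "v \<noteq> 0" "snd a = 0" "\<forall>j<i. cpt j w = 0" "\<forall>j>i. cpt j v = 0"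
proof -
  obtain a w v where q: "p = pt a w v" "a \<noteq> 0" "w \<noteq> 0" "v \<noteq> 0"
    using assms E_zero_subset_points3 points3_cases by (metis subsetD)
  with assms E_zero_iff[OF assms(2) q(2-4)] show ?thesis by (intro that[OF q]) auto
qed

lemma closedin_E_infinity: "i \<le> k \<Longrightarrow> closedin (zariski3 scl) (E_infinity scl V k i)"
  and closedin_E_zero: "i \<le> k \<Longrightarrow> closedin (zariski3 scl) (E_zero scl V k i)"
  by (simp_all add: E_infinity_eq E_zero_eq closedin_incidence subspace_UNIV a01 a10)

lemma irreducible_E_infinity: "i \<le> k \<Longrightarrow> irreducible_in (zariski3 scl) (E_infinity scl V k i)"
  and irreducible_E_zero: "i \<le> k \<Longrightarrow> irreducible_in (zariski3 scl) (E_zero scl V k i)"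
proof -
  assume i: "i \<le> k"
  obtain x where x: "x \<in> V i" "x \<noteq> 0" using obtain_V[OF i] by blast
  show "irreducible_in (zariski3 scl) (E_infinity scl V k i)"
    unfolding E_infinity_eq[OF i] by (rule irreducible_incidence[OF graded_subspace_UNIV a01 _ _ _ x i]) auto
  show "irreducible_in (zariski3 scl) (E_zero scl V k i)"
    unfolding E_zero_eq[OF i] by (rule irreducible_incidence[OF graded_subspace_UNIV a10 _ _ _ x i]) auto
qed

text \<open>For nonzero \<open>x\<close> in \<open>V i\<close> the pair \<open>(x, x)\<close> lies
  on the component of index \<open>i\<close> only: on that of index \<open>j\<close> the two support
  conditions together force all components of \<open>x\<close> other than the \<open>j\<close>-th to
  vanish.\<close>

lemma E_infinity_antichain:
  assumes "i \<le> k" "j \<le> k" "E_infinity scl V k i \<subseteq> E_infinity scl V k j"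
  shows "i = j"
proof -
  obtain x where x: "x \<noteq> 0" "\<And>j. cpt j x = (if j = i then x else 0)" using obtain_V[OF assms(1)] by blast
  have "lin_dep scl x x" using lin_dep_scale[of 1 x 1] by simp
  then have "pt (0, 1) x x \<in> E_infinity scl V k i" using E_infinity_iff[OF assms(1) a01 x(1,1)] x by simp
  then have "pt (0, 1) x x \<in> E_infinity scl V k j" using assms(3) by blast
  then have "\<forall>q>j. cpt q x = 0" "\<forall>q<j. cpt q x = 0" using E_infinity_iff[OF assms(2) a01 x(1,1)] by auto
  then show ?thesis using x by (metis linorder_neqE_nat)
qed

lemma E_zero_antichain:
  assumes "i \<le> k" "j \<le> k" "E_zero scl V k i \<subseteq> E_zero scl V k j"
  shows "i = j"
proof -
  obtain x where x: "x \<noteq> 0" "\<And>j. cpt j x = (if j = i then x else 0)" using obtain_V[OF assms(1)] by blast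
  have "lin_dep scl x x" using lin_dep_scale[of 1 x 1] by simp
  then have "pt (1, 0) x x \<in> E_zero scl V k i" using E_zero_iff[OF assms(1) a10 x(1,1)] x by simp
  then have "pt (1, 0) x x \<in> E_zero scl V k j" using assms(3) by blast
  then have "\<forall>q>j. cpt q x = 0" "\<forall>q<j. cpt q x = 0" using E_zero_iff[OF assms(2) a10 x(1,1)] by auto
  then show ?thesis using x by (metis linorder_neqE_nat)
qed

lemma E_infinity_E_zero_disjoint:
  assumes "i \<le> k" "j \<le> k"
  shows "E_infinity scl V k i \<inter> E_zero scl V k j = {}"
proof (rule ccontr)
  assume "\<not> ?thesis"
  then obtain p where p: "p \<in> E_infinity scl V k i" "p \<in> E_zero scl V k j" by blast
  obtain a w v where q: "p = pt a w v" "a \<noteq> 0" "w \<noteq> 0" "v \<noteq> 0" "fst a = 0"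
    using E_infinity_cases[OF p(1) assms(1)] by blast
  then have "snd a = 0" using p(2) E_zero_iff[OF assms(2) q(2-4)] by simp
  with q show False by (cases a) (auto simp: zero_prod_def)
qed

lemma E_infinity_nonempty: "i \<le> k \<Longrightarrow> E_infinity scl V k i \<noteq> {}"
  and E_zero_nonempty: "i \<le> k \<Longrightarrow> E_zero scl V k i \<noteq> {}"
  using irreducible_E_infinity irreducible_E_zero by (auto simp: irreducible_in_def)

lemma inj_on_E_infinity: "inj_on (E_infinity scl V k) {..k}"
  and inj_on_E_zero: "inj_on (E_zero scl V k) {..k}"
  using E_infinity_antichain E_zero_antichain by (auto intro!: inj_onI)

lemma irreducible_components_Union_E:
  assumes I: "I \<subseteq> {..k}" and J: "J \<subseteq> {..k}"
  shows "irreducible_components (zariski3 scl) ((\<Union>i\<in>I. E_infinity scl V k i) \<union> (\<Union>i\<in>J. E_zero scl V k i)) =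
    E_infinity scl V k ` I \<union> E_zero scl V k ` J"
proof -
  have "irreducible_components (zariski3 scl) (\<Union>(E_infinity scl V k ` I \<union> E_zero scl V k ` J)) =
    E_infinity scl V k ` I \<union> E_zero scl V k ` J"
  proof (rule irreducible_components_finite_Union)
    show "finite (E_infinity scl V k ` I \<union> E_zero scl V k ` J)"
      using I J finite_subset[of _ "{..k}"] by auto
  next
    fix C assume "C \<in> E_infinity scl V k ` I \<union> E_zero scl V k ` J"
    then show "closedin (zariski3 scl) C" "irreducible_in (zariski3 scl) C"
      using I J closedin_E_infinity closedin_E_zero irreducible_E_infinity irreducible_E_zero by auto
  next
    have ii: "E_infinity scl V k i = E_infinity scl V k j"
      if "i \<in> I" "j \<in> I" "E_infinity scl V k i \<subseteq> E_infinity scl V k j" for i j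
      using E_infinity_antichain[of i j] that I by auto
    have zz: "E_zero scl V k i = E_zero scl V k j"
      if "i \<in> J" "j \<in> J" "E_zero scl V k i \<subseteq> E_zero scl V k j" for i j
      using E_zero_antichain[of i j] that J by auto
    have iz: False if "i \<in> I" "j \<in> J" "E_infinity scl V k i \<subseteq> E_zero scl V k j" for i j
      using E_infinity_E_zero_disjoint[of i j] E_infinity_nonempty[of i] that I J by blast
    have zi: False if "i \<in> J" "j \<in> I" "E_zero scl V k i \<subseteq> E_infinity scl V k j" for i j
      using E_infinity_E_zero_disjoint[of j i] E_zero_nonempty[of i] that I J by blast
    fix C C' assume "C \<in> E_infinity scl V k ` I \<union> E_zero scl V k ` J" "C' \<in> E_infinity scl V k ` I \<union> E_zero scl V k ` J"
      and "C \<subseteq> C'"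
    then show "C = C'" by (auto dest: ii zz iz zi)
  qed
  then show ?thesis by (simp only: Union_Un_distrib)
qed

section \<open>The zero set of the exceptional ideal\<close>

lemma exceptional_ideal_subset:
  "G_ideal scl V k \<beta> \<union> (\<lambda>g. g \<circ> pr12) ` center_ideal scl V k \<beta> \<subseteq> poly_fun scale3"
  using G_ideal_subset poly_fun_pr12 center_ideal_subset by blast

theorem zeros3_exceptional:
  "zeros3 scl (exceptional_ideal scl V k \<beta>) =
    (\<Union>i\<in>{..<k}. E_infinity scl V k i) \<union> (\<Union>i\<in>{1..k}. E_zero scl V k i)"
proof -
  let ?gens = "G_ideal scl V k \<beta> \<union> (\<lambda>g. g \<circ> pr12) ` center_ideal scl V k \<beta>"
  have eq: "zeros3 scl (exceptional_ideal scl V k \<beta>) = zeros3 scl ?gens"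
    unfolding exceptional_ideal_def inverse_image_ideal_def
    by (rule zeros3_genideal[OF exceptional_ideal_subset])
  \<comment> \<open>In the generators the exponent of \<mu> is zero only for \<open>i = k\<close>
    and that of \<lambda> only for \<open>i = 0\<close>; so over \<mu> = 0 only \<open>w_k\<close>,
    over \<lambda> = 0 only \<open>w_0\<close> is constrained.\<close>
  have b: "\<beta> k - \<beta> i = 0 \<longleftrightarrow> i = k" "\<beta> i = 0 \<longleftrightarrow> i = 0" if "i \<le> k" for i
    using beta_less[of i k] beta_less[of 0 i] that beta_0 by (cases "i = k"; cases "i = 0"; auto)+
  show ?thesis unfolding eq
  proof (intro equalityI subsetI)
    fix p assume p: "p \<in> zeros3 scl ?gens"
    then obtain a w v where q: "p = pt a w v" "a \<noteq> 0" "w \<noteq> 0" "v \<noteq> 0"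
      using zeros3_subset points3_cases by (metis subsetD)
    obtain \<mu> l where a: "a = (\<mu>, l)" by (cases a)
    have "p \<in> G_variety scl V k \<beta>"
      unfolding G_variety_def using p zeros3_antimono[of "G_ideal scl V k \<beta>" ?gens] by blast
    then have cone: "((\<mu>, l), w, v) \<in> cone" using pt_in_G_variety_iff[OF q(2-4)] q(1) a by simp
    have "g ((\<mu>, l), w) = 0" if "g \<in> center_ideal scl V k \<beta>" for g
      using zeros3D[OF p _ q(1), of "g \<circ> pr12"] that by (simp add: a)
    then have W: "\<mu> ^ (\<beta> k - \<beta> i) * l ^ \<beta> i = 0 \<or> cpt i w = 0" if "i \<le> k" for i
      using center_ideal_vanishes_iff[of \<mu> l w] that by blast
    consider "\<mu> \<noteq> 0" "l \<noteq> 0" | "\<mu> = 0" "l \<noteq> 0" | "l = 0" "\<mu> \<noteq> 0" using q(2) a by (auto simp: zero_prod_def)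
    then show "p \<in> (\<Union>i\<in>{..<k}. E_infinity scl V k i) \<union> (\<Union>i\<in>{1..k}. E_zero scl V k i)"
    proof cases
      case 1
      then have "cpt i w = 0" if "i \<le> k" for i using W[OF that] by simp
      with nonzero_component[OF q(3)] show ?thesis by blast
    next
      case 2
      have "cpt k w = 0" using W[of k] 2 by simp
      obtain i where i: "i \<le> k" "cpt i w \<noteq> 0" "pt (0, l) w v \<in> incidence (0, 1) {..i} {i..} i UNIV"
        using cone_mu_0[OF cone[unfolded 2(1)] 2(2) q(3,4)] by blast
      with \<open>cpt k w = 0\<close> have "i < k" by (cases "i = k") auto
      then show ?thesis using i(3) E_infinity_eq[OF i(1)] q(1) a 2(1) by blast
    next
      case 3
      have w0: "cpt 0 w = 0" using W[of 0] 3 by (simp add: beta_0)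
      obtain i where i: "i \<le> k" "pt (\<mu>, 0) w v \<in> incidence (1, 0) {i..} {..i} i UNIV"
        using cone_lambda_0[OF cone[unfolded 3(1)] 3(2) q(3,4)] by blast
      have iE: "p \<in> E_zero scl V k i" using i E_zero_eq q(1) a 3(1) by simp
      show ?thesis
      \<comment> \<open>Unlike for \<mu> = 0, the component \<open>w_i\<close> may vanish, so
        \<open>w_0 = 0\<close> does not rule out \<open>i = 0\<close>. In that case \<open>v\<close>
        lies in \<open>V 0\<close>, its component of index 1 is 0, and the point also lies on the
        component of index 1.\<close>
      proof (cases "i = 0")
        case True
        have "k \<noteq> 0" using w0 nonzero_component[OF q(3)] by (metis le_0_eq)
        then have k1: "1 \<le> k" by simp
        have "\<forall>j>0. cpt j v = 0" using iE E_zero_iff[OF i(1) q(2-4)] q(1) True by simp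
        moreover have "lin_dep scl (cpt 1 w) 0" using lin_dep_scale[of 1 "cpt 1 w" 0] by simp
        ultimately have "p \<in> E_zero scl V k 1"
          using E_zero_iff[OF k1 q(2-4)] q(1) a 3(1) w0 by simp
        then show ?thesis using k1 by auto
      next
        case False
        then show ?thesis using iE i(1) by auto
      qed
    qed
  next
    fix p assume p: "p \<in> (\<Union>i\<in>{..<k}. E_infinity scl V k i) \<union> (\<Union>i\<in>{1..k}. E_zero scl V k i)"
    have inG: "F (a, w, v) = 0" if cone: "(a, w, v) \<in> cone" and F: "F \<in> ?gens"
      and W: "\<forall>j\<le>k. fst a ^ (\<beta> k - \<beta> j) * snd a ^ \<beta> j = 0 \<or> cpt j w = 0" for a w v F
    proof -
      have "\<forall>g\<in>center_ideal scl V k \<beta>. g (a, w) = 0"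
        using center_ideal_vanishes_iff[of "fst a" "snd a" w] W by simp
      with F G_idealD[OF _ cone] show ?thesis by auto
    qed
    from p show "p \<in> zeros3 scl ?gens"
    proof
      assume "p \<in> (\<Union>i\<in>{..<k}. E_infinity scl V k i)"
      then obtain i where i: "i < k" "p \<in> E_infinity scl V k i" by auto
      then have ik: "i \<le> k" by simp
      have i': "p \<in> incidence (0, 1) {..i} {i..} i UNIV" using i(2) E_infinity_eq[OF ik] by simp
      show ?thesis
      proof (rule zeros3I)
        show "p \<in> points3 scl" using i' incidence_subset_points3[OF a01] by blast
        fix F a w v assume F: "F \<in> ?gens" and q: "p = pt a w v"
        have nz: "a \<noteq> 0" "w \<noteq> 0" "v \<noteq> 0" using \<open>p \<in> points3 scl\<close> q by auto
        note c = incidence_in_cone[OF i'[unfolded q] ik]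
        have "cpt k w = 0" using i q E_infinity_iff[OF ik nz] by simp
        then have "\<forall>j\<le>k. fst a ^ (\<beta> k - \<beta> j) * snd a ^ \<beta> j = 0 \<or> cpt j w = 0"
          using b(1) c(1) by (auto simp: power_0_left)
        with inG[OF c(3) F] show "F (a, w, v) = 0" by blast
      qed
    next
      assume "p \<in> (\<Union>i\<in>{1..k}. E_zero scl V k i)"
      then obtain i where i: "0 < i" "i \<le> k" "p \<in> E_zero scl V k i" by (auto simp: Suc_le_eq)
      have i': "p \<in> incidence (1, 0) {i..} {..i} i UNIV" using i(3) E_zero_eq[OF i(2)] by simp
      show ?thesis
      proof (rule zeros3I)
        show "p \<in> points3 scl" using i' incidence_subset_points3[OF a10] by blast
        fix F a w v assume F: "F \<in> ?gens" and q: "p = pt a w v"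
        have nz: "a \<noteq> 0" "w \<noteq> 0" "v \<noteq> 0" using \<open>p \<in> points3 scl\<close> q by auto
        note c = incidence_zero_in_cone[OF i'[unfolded q] i(2)]
        have "cpt 0 w = 0" using i q E_zero_iff[OF i(2) nz] by simp
        then have "\<forall>j\<le>k. fst a ^ (\<beta> k - \<beta> j) * snd a ^ \<beta> j = 0 \<or> cpt j w = 0"
          using b(2) c(1) by (auto simp: power_0_left)
        with inG[OF c(3) F] show "F (a, w, v) = 0" by blast
      qed
    qed
  qed
qed

section \<open>The two collections over the two parts of the center\<close>

lemma center_infinity_iff:
  assumes "a \<noteq> 0" "w \<noteq> 0"
  shows "(line scale2 a, line scl w) \<in> center_infinity scl V k \<longleftrightarrow> fst a = 0 \<and> cpt k w = 0"
proof
  assume "(line scale2 a, line scl w) \<in> center_infinity scl V k"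
  then obtain l w' where e: "line scale2 a = line scale2 (0, l)" "line scl w = line scl w'" "cpt k w' = 0" "w' \<noteq> 0" "l \<noteq> 0"
    by (auto simp: center_infinity_def)
  have "\<exists>c. c \<noteq> 0 \<and> (0, l) = scale2 c a" using e(1) line_eq_iff[OF vector_space_scale2 assms(1)] by blast
  moreover have "\<exists>c. c \<noteq> 0 \<and> w' = scl c w" using e(2) line_eq_iff[OF vector_space_scl assms(2)] by blast
  ultimately show "fst a = 0 \<and> cpt k w = 0" using e(3) by (cases a) (auto simp: scale_eq_0_iff)
next
  assume "fst a = 0 \<and> cpt k w = 0"
  then show "(line scale2 a, line scl w) \<in> center_infinity scl V k"
    using assms unfolding center_infinity_def by (cases a) (auto simp: zero_prod_def)
qed

lemma center_zero_iff:
  assumes "a \<noteq> 0" "w \<noteq> 0"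
  shows "(line scale2 a, line scl w) \<in> center_zero scl V k \<longleftrightarrow> snd a = 0 \<and> cpt 0 w = 0"
proof
  assume "(line scale2 a, line scl w) \<in> center_zero scl V k"
  then obtain l w' where e: "line scale2 a = line scale2 (l, 0)" "line scl w = line scl w'" "cpt 0 w' = 0" "w' \<noteq> 0" "l \<noteq> 0"
    by (auto simp: center_zero_def)
  have "\<exists>c. c \<noteq> 0 \<and> (l, 0) = scale2 c a" using e(1) line_eq_iff[OF vector_space_scale2 assms(1)] by blast
  moreover have "\<exists>c. c \<noteq> 0 \<and> w' = scl c w" using e(2) line_eq_iff[OF vector_space_scl assms(2)] by blast
  ultimately show "snd a = 0 \<and> cpt 0 w = 0" using e(3) by (cases a) (auto simp: scale_eq_0_iff)
next
  assume "snd a = 0 \<and> cpt 0 w = 0"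
  then show "(line scale2 a, line scl w) \<in> center_zero scl V k"
    using assms unfolding center_zero_def by (cases a) (auto simp: zero_prod_def)
qed

lemma pr12_E_infinity:
  assumes "i < k" "z \<in> E_infinity scl V k i"
  shows "pr12 z \<in> center_infinity scl V k" "pr12 z \<notin> center_zero scl V k"
proof -
  have ik: "i \<le> k" using assms by simp
  obtain a w v where q: "z = pt a w v" "a \<noteq> 0" "w \<noteq> 0" "v \<noteq> 0" "fst a = 0" "\<forall>j>i. cpt j w = 0"
    using E_infinity_cases[OF assms(2) ik] by blast
  have "snd a \<noteq> 0" using q(2,5) by (cases a) (auto simp: zero_prod_def)
  then show "pr12 z \<in> center_infinity scl V k" "pr12 z \<notin> center_zero scl V k"
    using q assms(1) by (simp_all add: center_infinity_iff center_zero_iff)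
qed

lemma pr12_E_zero:
  assumes "1 \<le> i" "i \<le> k" "z \<in> E_zero scl V k i"
  shows "pr12 z \<in> center_zero scl V k" "pr12 z \<notin> center_infinity scl V k"
proof -
  obtain a w v where q: "z = pt a w v" "a \<noteq> 0" "w \<noteq> 0" "v \<noteq> 0" "snd a = 0" "\<forall>j<i. cpt j w = 0"
    using E_zero_cases[OF assms(3,2)] by blast
  have "fst a \<noteq> 0" using q(2,5) by (cases a) (auto simp: zero_prod_def)
  then show "pr12 z \<in> center_zero scl V k" "pr12 z \<notin> center_infinity scl V k"
    using q assms(1) by (simp_all add: center_infinity_iff center_zero_iff)
qed

lemma Union_E_infinity_eq:
  "(\<Union>i\<in>{..<k}. E_infinity scl V k i) =
    {z \<in> zeros3 scl (exceptional_ideal scl V k \<beta>). pr12 z \<in> center_infinity scl V k}"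
  unfolding zeros3_exceptional using pr12_E_infinity pr12_E_zero by auto

lemma Union_E_zero_eq:
  "(\<Union>i\<in>{1..k}. E_zero scl V k i) =
    {z \<in> zeros3 scl (exceptional_ideal scl V k \<beta>). pr12 z \<in> center_zero scl V k}"
  unfolding zeros3_exceptional using pr12_E_infinity pr12_E_zero by auto

text \<open>Over a point with \<open>w_k = 0\<close> take index \<open>k - 1\<close> and a nonzero
  \<open>v\<close> in \<open>V k\<close>: the component of \<open>v\<close> of index
  \<open>k - 1\<close> is 0, which makes the dependence automatic.\<close>

lemma image_pr12_E_infinity: "pr12 ` (\<Union>i\<in>{..<k}. E_infinity scl V k i) = center_infinity scl V k"
proof (intro equalityI subsetI)
  fix q assume "q \<in> pr12 ` (\<Union>i\<in>{..<k}. E_infinity scl V k i)"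
  then show "q \<in> center_infinity scl V k" using pr12_E_infinity by auto
next
  fix q assume "q \<in> center_infinity scl V k"
  then obtain l w where q: "q = (line scale2 (0, l), line scl w)" "(0, l) \<noteq> (0 :: C2)" "w \<noteq> 0" "cpt k w = 0"
    unfolding center_infinity_def by (auto simp: zero_prod_def)
  have "k \<noteq> 0" using nonzero_component[OF q(3)] q(4) by (metis le_0_eq)
  then have k1: "k - 1 < k" "k - 1 \<le> k" by auto
  obtain x where x: "x \<noteq> 0" "\<And>j. cpt j x = (if j = k then x else 0)" using obtain_V[of k] by blast
  have w: "\<forall>j>k - 1. cpt j w = 0"
  proof (intro allI impI)
    fix j assume "k - 1 < j"
    then have "j = k \<or> k < j" by linarith
    then show "cpt j w = 0" using q(4) comp_beyond by blast
  qed
  have "lin_dep scl (cpt (k - 1) w) 0" using lin_dep_scale[of 1 "cpt (k - 1) w" 0] by simp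
  then have "pt (0, l) w x \<in> E_infinity scl V k (k - 1)"
    using E_infinity_iff[OF k1(2) q(2,3) x(1)] w x(2) k1 by simp
  moreover have "pr12 (pt (0, l) w x) = q" using q(1) by simp
  ultimately show "q \<in> pr12 ` (\<Union>i\<in>{..<k}. E_infinity scl V k i)" using k1(1) by blast
qed

text \<open>Over a point with \<open>w_0 = 0\<close> take index 1 and a nonzero \<open>v\<close> in
  \<open>V 0\<close>.\<close>

lemma image_pr12_E_zero: "pr12 ` (\<Union>i\<in>{1..k}. E_zero scl V k i) = center_zero scl V k"
proof (intro equalityI subsetI)
  fix q assume "q \<in> pr12 ` (\<Union>i\<in>{1..k}. E_zero scl V k i)"
  then show "q \<in> center_zero scl V k" using pr12_E_zero by auto
next
  fix q assume "q \<in> center_zero scl V k"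
  then obtain \<mu> w where q: "q = (line scale2 (\<mu>, 0), line scl w)" "(\<mu>, 0) \<noteq> (0 :: C2)" "w \<noteq> 0" "cpt 0 w = 0"
    unfolding center_zero_def by (auto simp: zero_prod_def)
  have "k \<noteq> 0" using nonzero_component[OF q(3)] q(4) by (metis le_0_eq)
  then have k1: "1 \<le> k" by simp
  obtain x where x: "x \<noteq> 0" "\<And>j. cpt j x = (if j = 0 then x else 0)" using obtain_V[of 0] by blast
  have "lin_dep scl (cpt 1 w) 0" using lin_dep_scale[of 1 "cpt 1 w" 0] by simp
  then have "pt (\<mu>, 0) w x \<in> E_zero scl V k 1"
    using E_zero_iff[OF k1 q(2,3) x(1)] q(4) x(2) by simp
  then have "pt (\<mu>, 0) w x \<in> (\<Union>i\<in>{1..k}. E_zero scl V k i)" using k1 by (intro UN_I[of 1]) auto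
  then show "q \<in> pr12 ` (\<Union>i\<in>{1..k}. E_zero scl V k i)" by (rule image_eqI[rotated]) (simp add: q(1))
qed

end

section \<open>Multiplicities\<close>

context torus_action
begin

text \<open>The retraction \<open>\<pi>\<close> of the cone to \<open>E\<close> differs from the identity by a multiple of \<open>h / D\<close>.  So
  a function vanishing on \<open>E\<close> is a multiple of \<open>h\<close> where \<open>D\<close> does not vanish.\<close>

lemma multiplicity_along_eq_1:
  assumes prime: "fun_prime_ideal (poly_fun scale3) (ideal_of3 scl E)"
    and h: "h \<in> ideal_of3 scl E" and G: "G_ideal scl V k \<beta> \<subseteq> ideal_of3 scl E"
    and D: "D \<in> poly_fun scale3" "D \<notin> ideal_of3 scl E" and \<pi>: "poly_map scale3 scale3 \<pi>"
    and functional: "\<And>F. functional scale3 F \<Longrightarrow>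
      \<exists>H\<in>poly_fun scale3. \<forall>p\<in>cone. D p * (F p - F (\<pi> p)) = h p * H p"
    and retract: "\<And>F p. F \<in> ideal_of3 scl E \<Longrightarrow> p \<in> cone \<Longrightarrow> D p \<noteq> 0 \<Longrightarrow> F (\<pi> p) = 0"
  shows "multiplicity_along scl (G_section_ideal scl V k \<beta> h) E = 1"
proof -
  interpret P: fun_prime_ideal "poly_fun scale3" "ideal_of3 scl E" by (rule prime)
  interpret R: cring "ring3 scl" by (rule cring_ring3)
  let ?I = "G_section_ideal scl V k \<beta> h"
  have hp: "h \<in> poly_fun scale3" using h ideal_of3_subset by blast
  have gens: "insert h (G_ideal scl V k \<beta>) \<subseteq> carrier (ring3 scl)" using hp G_ideal_subset by simp
  have I: "fun_ideal (poly_fun scale3) ?I"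
    unfolding G_section_ideal_def using R.genideal_ideal[OF gens] by (simp add: ideal_ring3)
  have hI: "h \<in> ?I" and GI: "G_ideal scl V k \<beta> \<subseteq> ?I"
    unfolding G_section_ideal_def using R.genideal_self[OF gens] by auto
  \<comment> \<open>For a product, \<open>F F' - (F F') \<circ> \<pi>\<close> is split as \<open>F'
    (F - F \<circ> \<pi>) + (F \<circ> \<pi>) (F' - F' \<circ> \<pi>)\<close>. So the property
    passes from functionals to all polynomial functions, with growing powers of
    \<open>D\<close>.\<close>
  have expand: "\<exists>n. \<exists>H\<in>poly_fun scale3. \<forall>p\<in>cone. D p ^ n * (F p - F (\<pi> p)) = h p * H p" if "F \<in> poly_fun scale3" for F
    using that
  proof induction
    case (const c)
    show ?case by (rule exI[of _ 0], rule bexI[of _ "\<lambda>_. 0"]) (auto intro: poly_fun.const)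
  next
    case (functional F)
    then obtain H where "H \<in> poly_fun scale3" "\<forall>p\<in>cone. D p * (F p - F (\<pi> p)) = h p * H p"
      using assms(7) by blast
    then show ?case by (intro exI[of _ 1] bexI[of _ H]) auto
  next
    case (add F F')
    obtain n H where H: "H \<in> poly_fun scale3" "\<forall>p\<in>cone. D p ^ n * (F p - F (\<pi> p)) = h p * H p"
      using add.IH(1) by (elim exE bexE)
    obtain n' H' where H': "H' \<in> poly_fun scale3" "\<forall>p\<in>cone. D p ^ n' * (F' p - F' (\<pi> p)) = h p * H' p"
      using add.IH(2) by (elim exE bexE)
    show ?case
    proof (rule exI[of _ "n + n'"], rule bexI[of _ "\<lambda>p. D p ^ n' * H p + D p ^ n * H' p"], rule ballI)
      fix p assume p: "p \<in> cone"
      have "D p ^ (n + n') * (F p + F' p - (F (\<pi> p) + F' (\<pi> p))) =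
          D p ^ n' * (D p ^ n * (F p - F (\<pi> p))) + D p ^ n * (D p ^ n' * (F' p - F' (\<pi> p)))"
        by (simp add: power_add algebra_simps)
      also have "\<dots> = h p * (D p ^ n' * H p + D p ^ n * H' p)"
        using bspec[OF H(2) p] bspec[OF H'(2) p] by (simp add: algebra_simps)
      finally show "D p ^ (n + n') * (F p + F' p - (F (\<pi> p) + F' (\<pi> p))) = h p * (D p ^ n' * H p + D p ^ n * H' p)" .
    qed (intro poly_fun_intros D H H')
  next
    case (mult F F')
    obtain n H where H: "H \<in> poly_fun scale3" "\<forall>p\<in>cone. D p ^ n * (F p - F (\<pi> p)) = h p * H p"
      using mult.IH(1) by (elim exE bexE)
    obtain n' H' where H': "H' \<in> poly_fun scale3" "\<forall>p\<in>cone. D p ^ n' * (F' p - F' (\<pi> p)) = h p * H' p"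
      using mult.IH(2) by (elim exE bexE)
    have F\<pi>: "(\<lambda>p. F (\<pi> p)) \<in> poly_fun scale3" by (rule poly_map_comp[OF \<pi> mult.hyps(1)])
    show ?case
    proof (rule exI[of _ "n + n'"], rule bexI[of _ "\<lambda>p. D p ^ n' * F' p * H p + D p ^ n * F (\<pi> p) * H' p"], rule ballI)
      fix p assume p: "p \<in> cone"
      have "D p ^ (n + n') * (F p * F' p - F (\<pi> p) * F' (\<pi> p)) =
          D p ^ n' * F' p * (D p ^ n * (F p - F (\<pi> p))) + D p ^ n * F (\<pi> p) * (D p ^ n' * (F' p - F' (\<pi> p)))"
        by (simp add: power_add algebra_simps)
      also have "\<dots> = h p * (D p ^ n' * F' p * H p + D p ^ n * F (\<pi> p) * H' p)"
        unfolding bspec[OF H(2) p] bspec[OF H'(2) p] by (simp add: algebra_simps)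
      finally show "D p ^ (n + n') * (F p * F' p - F (\<pi> p) * F' (\<pi> p)) =
          h p * (D p ^ n' * F' p * H p + D p ^ n * F (\<pi> p) * H' p)" .
    qed (intro poly_fun_intros D H H' mult.hyps F\<pi>)
  qed
  have "length_at (fun_ring (poly_fun scale3)) (ideal_of3 scl E) ?I = 1"
  proof (rule P.length_at_eq_1)
    have "ideal (ideal_of3 scl E) (ring3 scl)" by (simp add: ideal_ring3 fun_ideal_ideal_of3)
    then show "?I \<subseteq> ideal_of3 scl E"
      unfolding G_section_ideal_def by (rule R.genideal_minimal) (use h G in auto)
  next
    fix F assume F: "F \<in> ideal_of3 scl E"
    then have Fp: "F \<in> poly_fun scale3" using ideal_of3_subset by blast
    obtain n H where H: "H \<in> poly_fun scale3" "\<forall>p\<in>cone. D p ^ n * (F p - F (\<pi> p)) = h p * H p"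
      using expand[OF Fp] by (elim exE bexE)
    \<comment> \<open>The additional factor \<open>D\<close> covers the points of the cone with
      \<open>D p = 0\<close>, about which \<open>retract\<close> says nothing.\<close>
    let ?r = "\<lambda>p. D p ^ Suc n * F p - (D p * H p) * h p"
    have "?r \<in> G_ideal scl V k \<beta>"
    proof (rule G_idealI)
      show "?r \<in> poly_fun scale3" by (intro poly_fun_intros D H Fp hp)
      fix p assume p: "p \<in> cone"
      have "D p * F (\<pi> p) = 0" using retract[OF F p] by auto
      moreover have "D p ^ Suc n * F p = D p * (D p ^ n * (F p - F (\<pi> p))) + D p ^ n * (D p * F (\<pi> p))"
        by (simp add: algebra_simps)
      ultimately have "D p ^ Suc n * F p = D p * (D p ^ n * (F p - F (\<pi> p)))" by simp
      also have "\<dots> = (D p * H p) * h p" unfolding bspec[OF H(2) p] by simp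
      finally show "D p ^ Suc n * F p - (D p * H p) * h p = 0" by simp
    qed
    then have r: "?r \<in> ?I" using GI by blast
    have "(\<lambda>p. (D p * H p) * h p) \<in> ?I" by (rule fun_idealD(4)[OF I poly_fun.mult[OF D(1) H(1)] hI])
    from fun_idealD(3)[OF I r this] have "(\<lambda>p. D p ^ Suc n * F p) \<in> ?I" by simp
    moreover have "(\<lambda>p. D p ^ m) \<in> poly_fun scale3 - ideal_of3 scl E" for m
    proof (induction m)
      case 0
      show ?case using P.S_one by simp
    next
      case (Suc m)
      from P.S_mult[OF _ Suc, of D] D show ?case by simp
    qed
    ultimately show "\<exists>s\<in>poly_fun scale3 - ideal_of3 scl E. (\<lambda>p. s p * F p) \<in> ?I" by (intro bexI)
  qed
  then show ?thesis by (simp add: multiplicity_along_def ring3_def)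
qed

text \<open>Both families of components at once: \<open>m\<close> and \<open>n\<close> are the coordinates \<open>\<mu>\<close> and \<open>\<lambda>\<close>, in this
  order for \<open>E_infinity\<close>.\<close>

lemma multiplicity_incidence:
  assumes ik: "i \<le> k" and S: "i \<in> S" "i \<in> S'" and a0: "a0 \<noteq> 0"
    and m: "functional scale2 m" and n: "functional scale2 n"
    and ma0: "m a0 = 0" and na0: "n a0 = 1" and split: "\<And>a. a = scale2 (n a) a0 + scale2 (m a) b"
    and G: "G_ideal scl V k \<beta> \<subseteq> ideal_of3 scl (incidence a0 S S' i UNIV)"
    and w: "\<And>j a w v \<phi> \<psi>. j \<le> k \<Longrightarrow> j \<notin> S \<Longrightarrow> (a, w, v) \<in> cone \<Longrightarrow>
      functional scl \<phi> \<Longrightarrow> functional scl \<psi> \<Longrightarrow>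
      n a ^ e j * (\<phi> (cpt j w) * \<psi> (cpt i v)) = m a ^ e j * (\<psi> (cpt i w) * \<phi> (cpt j v))"
    and v: "\<And>j a w v \<phi> \<psi>. j \<le> k \<Longrightarrow> j \<notin> S' \<Longrightarrow> (a, w, v) \<in> cone \<Longrightarrow>
      functional scl \<phi> \<Longrightarrow> functional scl \<psi> \<Longrightarrow>
      n a ^ e j * (\<psi> (cpt i w) * \<phi> (cpt j v)) = m a ^ e j * (\<phi> (cpt j w) * \<psi> (cpt i v))"
    and e: "\<And>j. j \<le> k \<Longrightarrow> j \<noteq> i \<Longrightarrow> 0 < e j \<and> e j \<le> N"
    and dep: "\<And>a w v. (a, w, v) \<in> cone \<Longrightarrow> lin_dep scl (cpt i w) (cpt i v)"
  shows "multiplicity_along scl (G_section_ideal scl V k \<beta> (\<lambda>p. m (fst p))) (incidence a0 S S' i UNIV) = 1"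
proof -
  let ?E = "incidence a0 S S' i UNIV"
  obtain x where x: "x \<in> V i" "x \<noteq> 0" "\<And>j. cpt j x = (if j = i then x else 0)" using obtain_V[OF ik] by blast
  obtain \<xi> where \<xi>: "functional scl \<xi>" "\<xi> x = 1" by (rule functional_nonzero[OF vector_space_scl x(2)])
  \<comment> \<open>The power of \<open>n\<close> clears every \<open>n ^ e j\<close>, and the
    summand 1 in the exponent makes \<open>D p \<noteq> 0\<close> imply
    \<open>n a \<noteq> 0\<close> even if \<open>N = 0\<close>. The factors with
    \<open>\<xi>\<close> are the \<open>i\<close>-th components by which the equations are solved
    for the others.\<close>
  define D where "D = (\<lambda>p. n (fst p) ^ (N + 1) * \<xi> (cpt i (fst (snd p))) * \<xi> (cpt i (snd (snd p))))"
  \<comment> \<open>Drops the \<open>m\<close>-part of \<open>a\<close> and the components outside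
    \<open>S\<close> and \<open>S'\<close>, that is, the coordinates which vanish on the incidence
    set.\<close>
  define \<pi> where "\<pi> = (\<lambda>p. (scale2 (n (fst p)) a0, proj_on S (fst (snd p)), proj_on S' (snd (snd p))))"
  have pm: "(\<lambda>p. m (fst p)) \<in> poly_fun scale3" and pn: "(\<lambda>p. n (fst p)) \<in> poly_fun scale3"
    using poly_fun.functional[OF m] poly_fun.functional[OF n] poly_fun_coord(1) by auto
  have vs: "vector_space (pair_scale scl scl)" by (intro vector_space_pair_scale vector_space_scl)
  have p2: "poly_map scale3 scl (\<lambda>p. fst (snd p))" and p3: "poly_map scale3 scl (\<lambda>p. snd (snd p))"
    by (rule poly_map_fst[OF poly_map_snd[OF poly_map_ident vector_space_scale2 vs] vector_space_scl vector_space_scl],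
      rule poly_map_snd[OF poly_map_snd[OF poly_map_ident vector_space_scale2 vs] vector_space_scl vector_space_scl])
  show ?thesis
  proof (rule multiplicity_along_eq_1[where D = D and \<pi> = \<pi>])
    show "fun_prime_ideal (poly_fun scale3) (ideal_of3 scl ?E)"
      by (rule fun_prime_incidence[OF graded_subspace_UNIV a0 S _ x(1,2) ik]) simp
    show "(\<lambda>p. m (fst p)) \<in> ideal_of3 scl ?E"
    proof (rule ideal_of3I[OF pm])
      fix a w v assume p: "pt a w v \<in> ?E"
      then have nz: "a \<noteq> 0" "w \<noteq> 0" "v \<noteq> 0" using incidence_subset_points3[OF a0] pt_in_points3 by blast+
      then obtain c where "a = scale2 c a0" using pt_in_incidence_iff[OF subspace_UNIV a0 nz] p by blast
      then show "m (fst (a, w, v)) = 0" using linear_functionalD(2)[OF m, of c a0] ma0 by simp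
    qed
    show "G_ideal scl V k \<beta> \<subseteq> ideal_of3 scl ?E" by (rule G)
    show Dp: "D \<in> poly_fun scale3"
      unfolding D_def by (intro poly_fun_intros pn poly_fun_cpt \<xi>(1))
    have one: "\<exists>c. a0 = scale2 c a0" by (rule exI[of _ 1]) (cases a0, simp)
    have "lin_dep scl x x" using lin_dep_scale[of 1 x 1] by simp
    then have "pt a0 x x \<in> ?E"
      unfolding pt_in_incidence_iff[OF subspace_UNIV a0 a0 x(2,2)] using one x(3) S by auto
    moreover have "D (a0, x, x) \<noteq> 0" using x(3)[of i] \<xi>(2) na0 by (simp add: D_def)
    ultimately show "D \<notin> ideal_of3 scl ?E" using ideal_of3D by blast
    show "poly_map scale3 scale3 \<pi>"
      unfolding \<pi>_def
      by (intro poly_map_Pair poly_map_scale poly_map_const pn vector_space_scale2 vector_space_scl vs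
          poly_map_compose[OF p2 poly_map_linear[OF linear_proj_on]]
          poly_map_compose[OF p3 poly_map_linear[OF linear_proj_on]])
    show "F (\<pi> p) = 0" if F: "F \<in> ideal_of3 scl ?E" and p: "p \<in> cone" "D p \<noteq> 0" for F p
    proof -
      obtain a w v where q: "p = (a, w, v)" by (metis prod.exhaust)
      have nz: "n a \<noteq> 0" "cpt i w \<noteq> 0" "cpt i v \<noteq> 0"
        using p(2) linear_functionalD(3)[OF \<xi>(1)] by (auto simp: D_def q)
      have "proj_on S w \<noteq> 0" "proj_on S' v \<noteq> 0"
        using nz(2,3) S comp_proj_on comp_zero by metis+
      moreover have "scale2 (n a) a0 \<noteq> 0" using nz(1) a0 by (cases a0) (auto simp: zero_prod_def)
      ultimately have "pt (scale2 (n a) a0) (proj_on S w) (proj_on S' v) \<in> ?E"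
        using pt_in_incidence_iff[OF subspace_UNIV a0] dep p(1) q S by auto
      from ideal_of3D[OF F this] show ?thesis by (simp add: \<pi>_def q)
    qed
    fix F assume F: "functional scale3 F"
    note d = linear_pair_scale_decompose[OF F vector_space_scale2 vs]
    note d' = linear_pair_scale_decompose[OF d(2) vector_space_scl vector_space_scl]
    let ?\<chi> = "\<lambda>a. F (a, 0)" and ?\<phi> = "\<lambda>w. F (0, w, 0)" and ?\<psi> = "\<lambda>v. F (0, 0, v)"
    \<comment> \<open>The quotient by \<open>m\<close>, one summand per block. In the first,
      \<open>a\<close> differs from its retraction by \<open>m a\<close> times \<open>b\<close>. In
      the others the equations turn \<open>n ^ e j\<close> times a component outside
      \<open>S\<close> or \<open>S'\<close> into a multiple of \<open>m ^ e j\<close>, and one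
      factor \<open>m\<close> is removed since \<open>e j\<close> is positive.\<close>
    define H where "H = (\<lambda>p. D p * ?\<chi> b +
      (\<Sum>j\<in>{..k} - S. n (fst p) ^ (N + 1 - e j) * \<xi> (cpt i (fst (snd p))) * m (fst p) ^ (e j - 1) *
         (\<xi> (cpt i (fst (snd p))) * ?\<phi> (cpt j (snd (snd p))))) +
      (\<Sum>j\<in>{..k} - S'. n (fst p) ^ (N + 1 - e j) * \<xi> (cpt i (snd (snd p))) * m (fst p) ^ (e j - 1) *
         (?\<psi> (cpt j (fst (snd p))) * \<xi> (cpt i (snd (snd p))))))"
    have "H \<in> poly_fun scale3"
      unfolding H_def by (intro poly_fun_intros Dp pn pm poly_fun_cpt \<xi>(1) d'(1,2))
    moreover have "D p * (F p - F (\<pi> p)) = m (fst p) * H p" if p: "p \<in> cone" for p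
    proof -
      obtain a w' v' where q: "p = (a, w', v')" by (metis prod.exhaust)
      have c: "(a, w', v') \<in> cone" using p q by simp
      have "F p - F (\<pi> p) = (?\<chi> a - ?\<chi> (scale2 (n a) a0)) + (?\<phi> w' - ?\<phi> (proj_on S w')) + (?\<psi> v' - ?\<psi> (proj_on S' v'))"
        using d(3)[of a "(w', v')"] d'(3)[of w' v'] d(3)[of "scale2 (n a) a0" "(proj_on S w', proj_on S' v')"]
          d'(3)[of "proj_on S w'" "proj_on S' v'"] by (simp add: q \<pi>_def)
      moreover have "?\<chi> a - ?\<chi> (scale2 (n a) a0) = m a * ?\<chi> b"
      proof -
        have "?\<chi> a = ?\<chi> (scale2 (n a) a0 + scale2 (m a) b)" using split[of a] by simp
        also have "\<dots> = ?\<chi> (scale2 (n a) a0) + m a * ?\<chi> b" by (simp only: linear_functionalD(1,2)[OF d(1)])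
        finally show ?thesis by simp
      qed
      moreover have diff: "f u - f (proj_on T u) = (\<Sum>j\<in>{..k} - T. f (cpt j u))"
        if f: "functional scl f" for f :: "'v \<Rightarrow> complex" and T u
      proof -
        have "f u = (\<Sum>j\<le>k. f (cpt j u))" by (subst sum_comp[of u, symmetric]) (simp only: linear_functionalD(5)[OF f])
        moreover have "f (proj_on T u) = (\<Sum>j\<in>{..k} \<inter> T. f (cpt j u))"
          by (simp add: proj_on_def linear_functionalD(5)[OF f])
        moreover have "(\<Sum>j\<le>k. f (cpt j u)) = (\<Sum>j\<in>{..k} \<inter> T. f (cpt j u)) + (\<Sum>j\<in>{..k} - T. f (cpt j u))"
          by (rule sum.Int_Diff) simp
        ultimately show ?thesis by simp
      qed
      ultimately have Fp: "F p - F (\<pi> p) = m a * ?\<chi> b + (\<Sum>j\<in>{..k} - S. ?\<phi> (cpt j w')) + (\<Sum>j\<in>{..k} - S'. ?\<psi> (cpt j v'))"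
        using diff[OF d'(1), of w' S] diff[OF d'(2), of v' S'] by simp
      have pow: "n a ^ (N + 1) = n a ^ (N + 1 - e j) * n a ^ e j" "m a ^ e j = m a * m a ^ (e j - 1)"
        if "j \<le> k" "j \<noteq> i" for j
        using e[OF that] by (simp_all flip: power_add power_Suc)
      have 1: "D p * ?\<phi> (cpt j w') = m a * (n a ^ (N + 1 - e j) * \<xi> (cpt i w') * m a ^ (e j - 1) * (\<xi> (cpt i w') * ?\<phi> (cpt j v')))"
        if j: "j \<in> {..k} - S" for j
      proof -
        have jk: "j \<le> k" "j \<noteq> i" "j \<notin> S" using j S by auto
        have "D p * ?\<phi> (cpt j w') = n a ^ (N + 1 - e j) * \<xi> (cpt i w') * (n a ^ e j * (?\<phi> (cpt j w') * \<xi> (cpt i v')))"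
          unfolding D_def q fst_conv snd_conv pow(1)[OF jk(1,2)] by (simp only: mult_ac)
        also have "\<dots> = n a ^ (N + 1 - e j) * \<xi> (cpt i w') * ((m a * m a ^ (e j - 1)) * (\<xi> (cpt i w') * ?\<phi> (cpt j v')))"
          unfolding w[OF jk(1,3) c d'(1) \<xi>(1)] pow(2)[OF jk(1,2)] ..
        finally show ?thesis by (simp only: mult_ac)
      qed
      have 2: "D p * ?\<psi> (cpt j v') = m a * (n a ^ (N + 1 - e j) * \<xi> (cpt i v') * m a ^ (e j - 1) * (?\<psi> (cpt j w') * \<xi> (cpt i v')))"
        if j: "j \<in> {..k} - S'" for j
      proof -
        have jk: "j \<le> k" "j \<noteq> i" "j \<notin> S'" using j S by auto
        have "D p * ?\<psi> (cpt j v') = n a ^ (N + 1 - e j) * \<xi> (cpt i v') * (n a ^ e j * (\<xi> (cpt i w') * ?\<psi> (cpt j v')))"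
          unfolding D_def q fst_conv snd_conv pow(1)[OF jk(1,2)] by (simp only: mult_ac)
        also have "\<dots> = n a ^ (N + 1 - e j) * \<xi> (cpt i v') * ((m a * m a ^ (e j - 1)) * (?\<psi> (cpt j w') * \<xi> (cpt i v')))"
          unfolding v[OF jk(1,3) c d'(2) \<xi>(1)] pow(2)[OF jk(1,2)] ..
        finally show ?thesis by (simp only: mult_ac)
      qed
      have "D p * (F p - F (\<pi> p)) = D p * (m a * ?\<chi> b) + (\<Sum>j\<in>{..k} - S. D p * ?\<phi> (cpt j w')) +
          (\<Sum>j\<in>{..k} - S'. D p * ?\<psi> (cpt j v'))"
        unfolding Fp by (simp only: distrib_left sum_distrib_left)
      also have "(\<Sum>j\<in>{..k} - S. D p * ?\<phi> (cpt j w')) = (\<Sum>j\<in>{..k} - S. m a *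
          (n a ^ (N + 1 - e j) * \<xi> (cpt i w') * m a ^ (e j - 1) * (\<xi> (cpt i w') * ?\<phi> (cpt j v'))))"
        by (rule sum.cong[OF refl 1])
      also have "(\<Sum>j\<in>{..k} - S'. D p * ?\<psi> (cpt j v')) = (\<Sum>j\<in>{..k} - S'. m a *
          (n a ^ (N + 1 - e j) * \<xi> (cpt i v') * m a ^ (e j - 1) * (?\<psi> (cpt j w') * \<xi> (cpt i v'))))"
        by (rule sum.cong[OF refl 2])
      also have "D p * (m a * ?\<chi> b) = m a * (D p * ?\<chi> b)" by (simp only: mult_ac)
      finally show ?thesis
        unfolding H_def q fst_conv snd_conv by (simp only: distrib_left sum_distrib_left)
    qed
    ultimately show "\<exists>H\<in>poly_fun scale3. \<forall>p\<in>cone. D p * (F p - F (\<pi> p)) = m (fst p) * H p" by (intro bexI ballI)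
  qed
qed

lemma cone_lin_dep:
  assumes "(a, w, v) \<in> cone" "i \<le> k"
  shows "lin_dep scl (cpt i w) (cpt i v)"
proof -
  obtain \<mu> l where a: "a = (\<mu>, l)" by (cases a)
  show ?thesis unfolding lin_dep_iff
  proof (intro allI impI)
    fix \<phi> \<psi> assume "functional scl \<phi>" "functional scl \<psi>"
    from coneD[OF assms(1)[unfolded a] order.refl assms(2) this]
    show "\<phi> (cpt i w) * \<psi> (cpt i v) = \<psi> (cpt i w) * \<phi> (cpt i v)" by simp
  qed
qed

lemma linear_fst_C2: "functional scale2 (fst :: C2 \<Rightarrow> complex)"
  and linear_snd_C2: "functional scale2 (snd :: C2 \<Rightarrow> complex)"
  by (auto intro: linear_fst linear_snd vector_space_complex)

theorem multiplicity_E_infinity: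
  assumes ik: "i \<le> k"
  shows "multiplicity_along scl (G_section_ideal scl V k \<beta> coord_mu) (E_infinity scl V k i) = 1"
proof -
  \<comment> \<open>The absolute value of \<open>\<beta> j - \<beta> i\<close>, arranged for natural
    subtraction.\<close>
  let ?e = "\<lambda>j. if i < j then \<beta> j - \<beta> i else \<beta> i - \<beta> j"
  have "multiplicity_along scl (G_section_ideal scl V k \<beta> (\<lambda>p. fst (fst p))) (incidence (0, 1) {..i} {i..} i UNIV) = 1"
  proof (rule multiplicity_incidence[where n = snd and b = "(1, 0)" and e = ?e and N = "\<beta> k"])
    show "G_ideal scl V k \<beta> \<subseteq> ideal_of3 scl (incidence (0, 1) {..i} {i..} i UNIV)"
    proof
      fix F assume F: "F \<in> G_ideal scl V k \<beta>"
      show "F \<in> ideal_of3 scl (incidence (0, 1) {..i} {i..} i UNIV)"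
        by (rule ideal_of3I) (use F G_ideal_subset G_idealD[OF F] incidence_in_cone(3)[OF _ ik] in blast)+
    qed
    fix j a w v \<phi> \<psi> assume j: "j \<le> k" and c: "(a, w, v) \<in> cone"
      and lin: "functional scl \<phi>" "functional scl \<psi>"
    obtain \<mu> l where a: "a = (\<mu>, l)" by (cases a)
    show "snd a ^ ?e j * (\<phi> (cpt j w) * \<psi> (cpt i v)) = fst a ^ ?e j * (\<psi> (cpt i w) * \<phi> (cpt j v))" if "j \<notin> {..i}"
      using coneD[OF c[unfolded a] _ j lin(2,1), of i] that by (simp add: a)
    show "snd a ^ ?e j * (\<psi> (cpt i w) * \<phi> (cpt j v)) = fst a ^ ?e j * (\<phi> (cpt j w) * \<psi> (cpt i v))" if "j \<notin> {i..}"
      using coneD[OF c[unfolded a] _ ik lin, of j] that by (simp add: a)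
  next
    fix j assume "j \<le> k" "j \<noteq> i"
    then show "0 < ?e j \<and> ?e j \<le> \<beta> k"
      using beta_less[of i j] beta_less[of j i] beta_le[of j k] beta_le[of i k] ik by auto
  qed (use ik cone_lin_dep linear_fst_C2 linear_snd_C2 in \<open>auto simp: zero_prod_def\<close>)
  then show ?thesis by (simp only: E_infinity_eq[OF ik] coord_mu_eq)
qed

theorem multiplicity_E_zero:
  assumes ik: "i \<le> k"
  shows "multiplicity_along scl (G_section_ideal scl V k \<beta> coord_lambda) (E_zero scl V k i) = 1"
proof -
  let ?e = "\<lambda>j. if i < j then \<beta> j - \<beta> i else \<beta> i - \<beta> j"
  have "multiplicity_along scl (G_section_ideal scl V k \<beta> (\<lambda>p. snd (fst p))) (incidence (1, 0) {i..} {..i} i UNIV) = 1"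
  proof (rule multiplicity_incidence[where n = fst and b = "(0, 1)" and e = ?e and N = "\<beta> k"])
    show "G_ideal scl V k \<beta> \<subseteq> ideal_of3 scl (incidence (1, 0) {i..} {..i} i UNIV)"
    proof
      fix F assume F: "F \<in> G_ideal scl V k \<beta>"
      show "F \<in> ideal_of3 scl (incidence (1, 0) {i..} {..i} i UNIV)"
        by (rule ideal_of3I) (use F G_ideal_subset G_idealD[OF F] incidence_zero_in_cone(3)[OF _ ik] in blast)+
    qed
    fix j a w v \<phi> \<psi> assume j: "j \<le> k" and c: "(a, w, v) \<in> cone"
      and lin: "functional scl \<phi>" "functional scl \<psi>"
    obtain \<mu> l where a: "a = (\<mu>, l)" by (cases a)
    show "fst a ^ ?e j * (\<phi> (cpt j w) * \<psi> (cpt i v)) = snd a ^ ?e j * (\<psi> (cpt i w) * \<phi> (cpt j v))" if "j \<notin> {i..}"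
      using coneD[OF c[unfolded a] _ ik lin, of j] that by (simp add: a)
    show "fst a ^ ?e j * (\<psi> (cpt i w) * \<phi> (cpt j v)) = snd a ^ ?e j * (\<phi> (cpt j w) * \<psi> (cpt i v))" if "j \<notin> {..i}"
      using coneD[OF c[unfolded a] _ j lin(2,1), of i] that by (simp add: a)
  next
    fix j assume "j \<le> k" "j \<noteq> i"
    then show "0 < ?e j \<and> ?e j \<le> \<beta> k"
      using beta_less[of i j] beta_less[of j i] beta_le[of j k] beta_le[of i k] ik by auto
  qed (use ik cone_lin_dep linear_fst_C2 linear_snd_C2 in \<open>auto simp: zero_prod_def\<close>)
  then show ?thesis by (simp only: E_zero_eq[OF ik] coord_lambda_eq)
qed

end

section \<open>The blow-up\<close>

context torus_action
begin

section \<open>Saturation by the irrelevant ideal\<close>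

lemma ring3_simps [simp]:
  "f \<otimes>\<^bsub>ring3 scl\<^esub> g = (\<lambda>x. f x * g x)" "f \<oplus>\<^bsub>ring3 scl\<^esub> g = (\<lambda>x. f x + g x)"
  "\<one>\<^bsub>ring3 scl\<^esub> = (\<lambda>_. 1)" "f [^]\<^bsub>ring3 scl\<^esub> (n::nat) = (\<lambda>x. f x ^ n)"
  by (simp_all add: ring3_def)

lemma ring2_simps [simp]:
  "f \<otimes>\<^bsub>ring2 scl\<^esub> g = (\<lambda>x. f x * g x)" "f \<oplus>\<^bsub>ring2 scl\<^esub> g = (\<lambda>x. f x + g x)"
  by (simp_all add: ring2_def)

text \<open>Each generator has a factor from every block. So multiplication by an element of this
  ideal takes care of the points of the affine zero set with a zero block.\<close>

lemma irrelevant3_vanishes: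
  assumes "g \<in> irrelevant3 scl" "a = 0 \<or> w = 0 \<or> v = 0"
  shows "g (a, w, v) = 0" "g \<in> poly_fun scale3"
proof -
  interpret R: cring "ring3 scl" by (rule cring_ring3)
  let ?gens = "{(\<lambda>(a, w, v). \<chi> a * \<phi> w * \<psi> v) | \<chi> \<phi> \<psi>.
     functional scale2 \<chi> \<and> functional scl \<phi> \<and> functional scl \<psi>}"
  have "?gens \<subseteq> {g \<in> poly_fun scale3. g (a, w, v) = 0}"
  proof
    fix g assume "g \<in> ?gens"
    then obtain \<chi> \<phi> \<psi> where g: "g = (\<lambda>(a, w, v). \<chi> a * \<phi> w * \<psi> v)" and lin: "functional scale2 \<chi>"
      "functional scl \<phi>" "functional scl \<psi>" by blast
    have "g = (\<lambda>p. \<chi> (fst p) * \<phi> (fst (snd p)) * \<psi> (snd (snd p)))"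
      by (rule ext) (simp add: g split_beta)
    also have "\<dots> \<in> poly_fun scale3" by (intro poly_fun.mult poly_fun.functional linear_coord lin)
    finally have "g \<in> poly_fun scale3" .
    moreover have "g (a, w, v) = 0"
      using assms(2) linear_functionalD(3)[OF lin(1)] linear_functionalD(3)[OF lin(2)] linear_functionalD(3)[OF lin(3)]
      by (auto simp: g)
    ultimately show "g \<in> {g \<in> poly_fun scale3. g (a, w, v) = 0}" by blast
  qed
  moreover have "ideal {g \<in> poly_fun scale3. g (a, w, v) = 0} (ring3 scl)"
    unfolding ideal_ring3 fun_ideal_def by (intro conjI ballI subsetI CollectI) (simp_all add: poly_fun.intros)
  ultimately have "irrelevant3 scl \<subseteq> {g \<in> poly_fun scale3. g (a, w, v) = 0}"
    unfolding irrelevant3_def by (intro R.genideal_minimal)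
  with assms(1) show "g (a, w, v) = 0" "g \<in> poly_fun scale3" by blast+
qed

lemma G_ideal_subset_ideal_of3: "G_ideal scl V k \<beta> \<subseteq> ideal_of3 scl (G_variety scl V k \<beta>)"
proof
  fix F assume F: "F \<in> G_ideal scl V k \<beta>"
  show "F \<in> ideal_of3 scl (G_variety scl V k \<beta>)"
  proof (rule ideal_of3I)
    fix a w v assume p: "pt a w v \<in> G_variety scl V k \<beta>"
    then have "a \<noteq> 0" "w \<noteq> 0" "v \<noteq> 0" using zeros3_subset pt_in_points3 unfolding G_variety_def by blast+
    from pt_in_G_variety_iff[OF this] p show "F (a, w, v) = 0" using G_idealD[OF F] by blast
  qed (use F G_ideal_subset in blast)
qed

text \<open>The ideal of the variety tests only nonzero \<open>a\<close>, \<open>w\<close>,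
  \<open>v\<close>, whereas \<open>G_ideal\<close> tests the entire affine zero set. Passing from
  the first to the second costs one more factor \<open>g\<close>, hence the exponent
  \<open>Suc n\<close>, which is positive also for \<open>n = 0\<close>.\<close>

lemma same_subscheme_G: "same_subscheme scl (ideal_of3 scl (G_variety scl V k \<beta>)) (G_ideal scl V k \<beta>)"
  unfolding same_subscheme_def saturation_def
proof (intro equalityI subsetI CollectI conjI ballI)
  fix F assume F: "F \<in> {f \<in> carrier (ring3 scl). \<forall>g\<in>irrelevant3 scl. \<exists>n::nat.
      g [^]\<^bsub>ring3 scl\<^esub> n \<otimes>\<^bsub>ring3 scl\<^esub> f \<in> ideal_of3 scl (G_variety scl V k \<beta>)}"
  then show "F \<in> carrier (ring3 scl)" by blast
  fix g assume g: "g \<in> irrelevant3 scl"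
  then obtain n where n: "(\<lambda>x. g x ^ n * F x) \<in> ideal_of3 scl (G_variety scl V k \<beta>)" using F by auto
  have gp: "g \<in> poly_fun scale3" using irrelevant3_vanishes(2)[OF g, of 0 0 0] by simp
  have Fp: "F \<in> poly_fun scale3" using F by simp
  have "(\<lambda>x. g x ^ Suc n * F x) \<in> G_ideal scl V k \<beta>"
  proof (rule G_idealI)
    show "(\<lambda>x. g x ^ Suc n * F x) \<in> poly_fun scale3" by (intro poly_fun_intros gp Fp)
    fix p assume p: "p \<in> cone"
    obtain a w v where q: "p = (a, w, v)" by (metis prod.exhaust)
    show "g p ^ Suc n * F p = 0"
    proof (cases "a = 0 \<or> w = 0 \<or> v = 0")
      case True
      then show ?thesis using irrelevant3_vanishes(1)[OF g True] by (simp add: q)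
    next
      case False
      then have "pt a w v \<in> G_variety scl V k \<beta>" using pt_in_G_variety_iff p q by blast
      from ideal_of3D[OF n this] show ?thesis by (simp add: q)
    qed
  qed
  then show "\<exists>n::nat. g [^]\<^bsub>ring3 scl\<^esub> n \<otimes>\<^bsub>ring3 scl\<^esub> F \<in> G_ideal scl V k \<beta>" by (intro exI[of _ "Suc n"]) (simp add: mult_ac)
next
  fix F assume F: "F \<in> {f \<in> carrier (ring3 scl). \<forall>g\<in>irrelevant3 scl. \<exists>n::nat.
      g [^]\<^bsub>ring3 scl\<^esub> n \<otimes>\<^bsub>ring3 scl\<^esub> f \<in> G_ideal scl V k \<beta>}"
  then show "F \<in> carrier (ring3 scl)" by blast
  fix g assume "g \<in> irrelevant3 scl"
  then show "\<exists>n::nat. g [^]\<^bsub>ring3 scl\<^esub> n \<otimes>\<^bsub>ring3 scl\<^esub> F \<in> ideal_of3 scl (G_variety scl V k \<beta>)"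
    using F G_ideal_subset_ideal_of3 by blast
qed

section \<open>Powers of the center ideal and the Rees algebra\<close>

definition center_power :: "nat \<Rightarrow> (C2 \<times> 'v \<Rightarrow> complex) set" where
  "center_power n = center_ideal scl V k \<beta> [^]\<^bsub>ideals_set (ring2 scl)\<^esub> n"

lemma center_power_0: "center_power 0 = poly_fun scale12"
  by (simp add: center_power_def ideals_set_def)

lemma center_power_Suc: "center_power (Suc n) = ideal_prod (ring2 scl) (center_power n) (center_ideal scl V k \<beta>)"
  by (simp add: center_power_def ideals_set_def)

lemma ideal_center_ideal: "ideal (center_ideal scl V k \<beta>) (ring2 scl)"
proof -
  interpret R: cring "ring2 scl" by (rule cring_ring2)
  show ?thesis unfolding center_ideal_eq by (rule R.genideal_ideal) (simp add: center_gens_subset)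
qed

lemma ideal_center_power: "fun_ideal (poly_fun scale12) (center_power n)"
proof -
  interpret R: cring "ring2 scl" by (rule cring_ring2)
  have "ideal (center_power n) (ring2 scl)"
  proof (induction n)
    case 0
    show ?case using R.oneideal by (simp add: center_power_0)
  next
    case (Suc n)
    show ?case unfolding center_power_Suc by (rule R.ideal_prod_is_ideal[OF Suc ideal_center_ideal])
  qed
  then show ?thesis by (simp add: ideal_ring2)
qed

lemma center_power_prod:
  assumes "f \<in> center_power n" "g \<in> center_ideal scl V k \<beta>"
  shows "(\<lambda>x. f x * g x) \<in> center_power (Suc n)"
  using ideal_prod.prod[OF assms, of "ring2 scl"] by (simp add: center_power_Suc)

lemma center_power_mult:
  assumes f: "f \<in> center_power n" and g: "g \<in> center_power m"
  shows "(\<lambda>x. f x * g x) \<in> center_power (n + m)"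
  using g
proof (induction m arbitrary: g)
  case 0
  then have "(\<lambda>x. g x * f x) \<in> center_power n"
    by (intro fun_idealD(4)[OF ideal_center_power] f) (simp add: center_power_0)
  then show ?case by (simp add: mult.commute)
next
  case (Suc m)
  from Suc.prems have "g \<in> ideal_prod (ring2 scl) (center_power m) (center_ideal scl V k \<beta>)"
    by (simp add: center_power_Suc)
  then show ?case
  proof (induction rule: ideal_prod.induct)
    case (prod i j)
    from center_power_prod[OF Suc.IH[OF prod(1)] prod(2)] show ?case by (simp add: mult.assoc)
  next
    case (sum s1 s2)
    have "(\<lambda>x. f x * s1 x + f x * s2 x) \<in> center_power (n + Suc m)"
      by (rule fun_idealD(3)[OF ideal_center_power sum.IH])
    then show ?case by (simp add: distrib_left)
  qed
qed

definition rees_elem :: "nat \<Rightarrow> (nat \<Rightarrow> C2 \<times> 'v \<Rightarrow> complex) \<Rightarrow> (C2 \<times> 'v) \<times> complex \<Rightarrow> complex" where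
  "rees_elem N g = (\<lambda>q. \<Sum>n\<le>N. g n (fst q) * snd q ^ n)"

definition rees :: "((C2 \<times> 'v) \<times> complex \<Rightarrow> complex) set" where
  "rees = {rees_elem N g | N g. \<forall>n. g n \<in> center_power n}"

lemma rees_algebra_eq: "rees_algebra scl (center_ideal scl V k \<beta>) = fun_ring rees"
proof -
  have "rees_elem N g = (\<lambda>(x, t). \<Sum>n\<le>N. g n x * t ^ n)" for N g
    by (rule ext) (simp add: rees_elem_def split_beta)
  then show ?thesis by (simp add: rees_algebra_def rees_def center_power_def)
qed

text \<open>Coefficients beyond \<open>N\<close> are set to 0. Two elements can then be brought to a
  common length, and their product has the Cauchy products of the coefficients.\<close>

lemma rees_cases:
  assumes "f \<in> rees"
  shows "\<exists>N g. f = rees_elem N g \<and> (\<forall>n. g n \<in> center_power n) \<and> (\<forall>n>N. g n = (\<lambda>_. 0))"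
proof -
  obtain N g where f: "f = rees_elem N g" "\<forall>n. g n \<in> center_power n" using assms by (auto simp: rees_def)
  let ?g = "\<lambda>n. if n \<le> N then g n else (\<lambda>_. 0)"
  have "f = rees_elem N ?g" unfolding f rees_elem_def by (intro ext sum.cong) auto
  moreover have "\<forall>n. ?g n \<in> center_power n" using f(2) fun_idealD(2)[OF ideal_center_power] by simp
  ultimately show ?thesis by (intro exI[of _ N] exI[of _ ?g]) auto
qed

lemma rees_elem_extend:
  assumes "\<forall>n>N. g n = (\<lambda>_. 0)" "N \<le> M"
  shows "rees_elem N g = rees_elem M g"
  unfolding rees_elem_def by (rule ext, rule sum.mono_neutral_left) (use assms in auto)

lemma rees_add: "f \<in> rees \<Longrightarrow> h \<in> rees \<Longrightarrow> (\<lambda>q. f q + h q) \<in> rees"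
proof -
  assume fh: "f \<in> rees" "h \<in> rees"
  obtain N g where f: "f = rees_elem N g" "\<forall>n. g n \<in> center_power n" "\<forall>n>N. g n = (\<lambda>_. 0)"
    using rees_cases[OF fh(1)] by (elim exE conjE)
  obtain M g' where h: "h = rees_elem M g'" "\<forall>n. g' n \<in> center_power n" "\<forall>n>M. g' n = (\<lambda>_. 0)"
    using rees_cases[OF fh(2)] by (elim exE conjE)
  have "f = rees_elem (N + M) g" "h = rees_elem (N + M) g'"
    using rees_elem_extend[OF f(3), of "N + M"] rees_elem_extend[OF h(3), of "N + M"] f(1) h(1) by simp_all
  then have "(\<lambda>q. f q + h q) = rees_elem (N + M) (\<lambda>n x. g n x + g' n x)"
    by (simp add: rees_elem_def distrib_right sum.distrib)
  moreover have "\<forall>n. (\<lambda>x. g n x + g' n x) \<in> center_power n"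
    using f(2) h(2) fun_idealD(3)[OF ideal_center_power] by simp
  ultimately show ?thesis unfolding rees_def by (intro CollectI exI[of _ "N + M"] exI[of _ "\<lambda>n x. g n x + g' n x"]) simp
qed

lemma rees_mult: "f \<in> rees \<Longrightarrow> h \<in> rees \<Longrightarrow> (\<lambda>q. f q * h q) \<in> rees"
proof -
  assume fh: "f \<in> rees" "h \<in> rees"
  obtain N g where f: "f = rees_elem N g" "\<forall>n. g n \<in> center_power n" "\<forall>n>N. g n = (\<lambda>_. 0)"
    using rees_cases[OF fh(1)] by (elim exE conjE)
  obtain M g' where h: "h = rees_elem M g'" "\<forall>n. g' n \<in> center_power n" "\<forall>n>M. g' n = (\<lambda>_. 0)"
    using rees_cases[OF fh(2)] by (elim exE conjE)
  let ?c = "\<lambda>r x. \<Sum>i\<le>r. g i x * g' (r - i) x"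
  have "(\<lambda>q. f q * h q) = rees_elem (N + M) ?c"
  proof
    fix q
    show "f q * h q = rees_elem (N + M) ?c q"
      unfolding f(1) h(1) rees_elem_def by (rule polynomial_product) (use f(3) h(3) in auto)
  qed
  moreover have "?c r \<in> center_power r" for r
  proof (rule fun_ideal_sum[OF ideal_center_power])
    fix i assume "i \<in> {..r}"
    then show "(\<lambda>x. g i x * g' (r - i) x) \<in> center_power r"
      using center_power_mult[OF spec[OF f(2), of i] spec[OF h(2), of "r - i"]] by simp
  qed
  ultimately show ?thesis unfolding rees_def by (intro CollectI exI[of _ "N + M"] exI[of _ ?c]) simp
qed

lemma rees_monomial:
  assumes "g \<in> center_power n"
  shows "(\<lambda>q. g (fst q) * snd q ^ n) \<in> rees"
proof -
  let ?g = "\<lambda>m. if m = n then g else (\<lambda>_. 0)"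
  have "(\<Sum>m\<le>n. ?g m (fst q) * snd q ^ m) = (\<Sum>m\<in>{n}. ?g m (fst q) * snd q ^ m)" for q :: "(C2 \<times> 'v) \<times> complex"
    by (rule sum.mono_neutral_right) auto
  then have "(\<lambda>q. g (fst q) * snd q ^ n) = rees_elem n ?g" unfolding rees_elem_def by (intro ext) simp
  moreover have "\<forall>m. ?g m \<in> center_power m" using assms fun_idealD(2)[OF ideal_center_power] by simp
  ultimately show ?thesis unfolding rees_def by (intro CollectI exI[of _ n] exI[of _ ?g]) simp
qed

text \<open>The vector on the left of the equation for the full interval from 0 to \<open>k\<close>.
  The functionals of its components are the generators of the center ideal.\<close>

definition window :: "C2 \<times> 'v \<Rightarrow> 'v" where
  "window x = window_left scl V k \<beta> 0 k (fst (fst x)) (snd (fst x)) (snd x)"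

lemma poly_map_window: "poly_map scale12 scl window"
  unfolding window_def window_left_def
  by (intro poly_map_sum poly_map_scale poly_fun_intros poly_fun_scale12_coord
      poly_map_compose[OF poly_fun_scale12_coord(3) poly_map_linear[OF linear_comp]])

lemma cpt_window: "i \<le> k \<Longrightarrow> cpt i (window ((\<mu>, l), w)) = scl (\<mu> ^ (\<beta> k - \<beta> i) * l ^ \<beta> i) (cpt i w)"
  unfolding window_def by (simp add: cpt_window_left beta_0)

lemma functional_window:
  assumes "functional scl \<psi>"
  shows "(\<lambda>x. \<psi> (window x)) \<in> center_ideal scl V k \<beta>"
proof -
  interpret R: cring "ring2 scl" by (rule cring_ring2)
  have gen: "center_gen j \<psi> \<in> center_ideal scl V k \<beta>" if "j \<le> k" for j
    using R.genideal_self[of center_gens] center_gens_subset that assms unfolding center_ideal_eq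
    by (auto simp: center_gens_def)
  have "(\<lambda>x. \<Sum>j=0..k. center_gen j \<psi> x) \<in> center_ideal scl V k \<beta>"
    by (rule fun_ideal_sum[OF ideal_center_ideal[unfolded ideal_ring2]]) (use gen in simp)
  also have "(\<lambda>x. \<Sum>j=0..k. center_gen j \<psi> x) = (\<lambda>x. \<psi> (window x))"
    unfolding window_def window_left_functional[OF assms] by (simp add: center_gen_def split_beta beta_0)
  finally show ?thesis .
qed

definition presentation :: "(C2 \<times> 'v \<times> 'v \<Rightarrow> complex) \<Rightarrow> (C2 \<times> 'v) \<times> complex \<Rightarrow> complex" where
  "presentation F = (\<lambda>q. F (fst (fst q), snd (fst q), scl (snd q) (window (fst q))))"

section \<open>The image of the presentation\<close>

lemma presentation_in_rees: "F \<in> poly_fun scale3 \<Longrightarrow> presentation F \<in> rees"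
proof (induction rule: poly_fun.induct)
  case (const c)
  have "(\<lambda>_. c) \<in> center_power 0" by (simp add: center_power_0 poly_fun.const)
  from rees_monomial[OF this] show ?case by (simp add: presentation_def)
next
  case (functional F)
  have vs: "vector_space (pair_scale scl scl)" by (intro vector_space_pair_scale vector_space_scl)
  note d = linear_pair_scale_decompose[OF functional vector_space_scale2 vs]
  note d' = linear_pair_scale_decompose[OF d(2) vector_space_scl vector_space_scl]
  have "poly_map scale12 scale2 fst" by (intro poly_map_linear linear_fst vector_space_scale2 vector_space_scl)
  then have "(\<lambda>x. F (fst x, 0) + F (0, snd x, 0)) \<in> center_power 0"
    unfolding center_power_0
    by (intro poly_fun.add poly_map_functional[OF _ d(1)] poly_map_functional[OF poly_fun_scale12_coord(3) d'(1)])
  note 1 = rees_monomial[OF this]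
  have "(\<lambda>x. 1 * F (0, 0, window x)) \<in> center_power (Suc 0)"
    by (rule center_power_prod[OF _ functional_window[OF d'(2)]]) (simp add: center_power_0 poly_fun.const)
  note 2 = rees_monomial[OF this]
  have "presentation F = (\<lambda>q. (F (fst (fst q), 0) + F (0, snd (fst q), 0)) * snd q ^ 0 +
      (1 * F (0, 0, window (fst q))) * snd q ^ Suc 0)"
  proof
    fix q :: "(C2 \<times> 'v) \<times> complex"
    show "presentation F q = (F (fst (fst q), 0) + F (0, snd (fst q), 0)) * snd q ^ 0 +
      (1 * F (0, 0, window (fst q))) * snd q ^ Suc 0"
      using d(3)[of "fst (fst q)" "(snd (fst q), scl (snd q) (window (fst q)))"]
        d'(3)[of "snd (fst q)" "scl (snd q) (window (fst q))"] linear_functionalD(2)[OF d'(2), of "snd q" "window (fst q)"]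
      by (simp add: presentation_def)
  qed
  with rees_add[OF 1 2] show ?case by simp
next
  case (add F G)
  from rees_add[OF add.IH] show ?case by (simp add: presentation_def)
next
  case (mult F G)
  from rees_mult[OF mult.IH] show ?case by (simp add: presentation_def)
qed

lemma presentation_pr12: "presentation (g \<circ> pr12) = g \<circ> fst"
  by (rule ext) (simp add: presentation_def)

text \<open>The coefficients \<open>g\<close> for which \<open>g t ^ n\<close> is in the image.
  Surjectivity is reduced to showing that \<open>hits n\<close> contains the \<open>n\<close>-th
  power of the center ideal.\<close>

definition hits :: "nat \<Rightarrow> (C2 \<times> 'v \<Rightarrow> complex) set" where
  "hits n = {g. \<exists>F\<in>poly_fun scale3. presentation F = (\<lambda>q. g (fst q) * snd q ^ n)}"

lemma hitsI: "F \<in> poly_fun scale3 \<Longrightarrow> presentation F = (\<lambda>q. g (fst q) * snd q ^ n) \<Longrightarrow> g \<in> hits n"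
  unfolding hits_def by blast

lemma hits_0: "poly_fun scale12 \<subseteq> hits 0"
proof
  fix g assume "g \<in> poly_fun scale12"
  then show "g \<in> hits 0" using presentation_pr12[of g] by (intro hitsI[OF poly_fun_pr12]) (simp_all add: comp_def)
qed

lemma hits_mult: "f \<in> hits n \<Longrightarrow> g \<in> hits m \<Longrightarrow> (\<lambda>x. f x * g x) \<in> hits (n + m)"
proof -
  assume "f \<in> hits n" "g \<in> hits m"
  then obtain F G where F: "F \<in> poly_fun scale3" "presentation F = (\<lambda>q. f (fst q) * snd q ^ n)"
    and G: "G \<in> poly_fun scale3" "presentation G = (\<lambda>q. g (fst q) * snd q ^ m)"
    unfolding hits_def by (elim CollectE bexE) blast
  show ?thesis
  proof (rule hitsI[OF poly_fun.mult[OF F(1) G(1)]])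
    show "presentation (\<lambda>p. F p * G p) = (\<lambda>q. f (fst q) * g (fst q) * snd q ^ (n + m))"
      using fun_cong[OF F(2)] fun_cong[OF G(2)] by (intro ext) (simp add: presentation_def power_add)
  qed
qed

lemma hits_add: "f \<in> hits n \<Longrightarrow> g \<in> hits n \<Longrightarrow> (\<lambda>x. f x + g x) \<in> hits n"
proof -
  assume "f \<in> hits n" "g \<in> hits n"
  then obtain F G where F: "F \<in> poly_fun scale3" "presentation F = (\<lambda>q. f (fst q) * snd q ^ n)"
    and G: "G \<in> poly_fun scale3" "presentation G = (\<lambda>q. g (fst q) * snd q ^ n)"
    unfolding hits_def by (elim CollectE bexE) blast
  show ?thesis
  proof (rule hitsI[OF poly_fun.add[OF F(1) G(1)]])
    show "presentation (\<lambda>p. F p + G p) = (\<lambda>q. (f (fst q) + g (fst q)) * snd q ^ n)"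
      using fun_cong[OF F(2)] fun_cong[OF G(2)] by (intro ext) (simp add: presentation_def distrib_right)
  qed
qed

lemma center_ideal_hits: "center_ideal scl V k \<beta> \<subseteq> hits 1"
proof -
  interpret R: cring "ring2 scl" by (rule cring_ring2)
  have "fun_ideal (poly_fun scale12) (hits 1 \<inter> poly_fun scale12)"
    unfolding fun_ideal_def
  proof (intro conjI ballI)
    show "(\<lambda>_. 0) \<in> hits 1 \<inter> poly_fun scale12"
      by (intro IntI hitsI[of "\<lambda>_. 0"] poly_fun.const) (simp add: presentation_def)
  next
    fix f g assume "f \<in> hits 1 \<inter> poly_fun scale12" "g \<in> hits 1 \<inter> poly_fun scale12"
    then show "(\<lambda>x. f x + g x) \<in> hits 1 \<inter> poly_fun scale12" using hits_add poly_fun.add by blast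
  next
    fix f g assume f: "f \<in> poly_fun scale12" and g: "g \<in> hits 1 \<inter> poly_fun scale12"
    have "(\<lambda>x. f x * g x) \<in> hits (0 + 1)" by (rule hits_mult) (use hits_0 f g in auto)
    then show "(\<lambda>x. f x * g x) \<in> hits 1 \<inter> poly_fun scale12" using poly_fun.mult[of f _ g] f g by simp
  qed simp
  moreover have "center_gens \<subseteq> hits 1 \<inter> poly_fun scale12"
  proof
    fix g assume g: "g \<in> center_gens"
    then obtain i \<phi> where i: "g = center_gen i \<phi>" "i \<le> k" and \<phi>: "functional scl \<phi>"
      unfolding center_gens_def by blast
    \<comment> \<open>A generator of the center is the image of the matching coordinate of the last
      factor.\<close>
    have "presentation (\<lambda>p. \<phi> (cpt i (snd (snd p)))) = (\<lambda>q. g (fst q) * snd q ^ 1)"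
    proof
      fix q :: "(C2 \<times> 'v) \<times> complex"
      obtain \<mu> l w t where q: "q = (((\<mu>, l), w), t)" by (metis prod.exhaust)
      show "presentation (\<lambda>p. \<phi> (cpt i (snd (snd p)))) q = g (fst q) * snd q ^ 1"
        by (simp add: presentation_def q i center_gen_def cpt_window linear_functionalD(2)[OF \<phi>])
    qed
    then have "g \<in> hits 1" by (rule hitsI[OF poly_fun_cpt(2)[OF \<phi>]])
    then show "g \<in> hits 1 \<inter> poly_fun scale12" using g center_gens_subset by blast
  qed
  ultimately show ?thesis
    unfolding center_ideal_eq using R.genideal_minimal[of "hits 1 \<inter> poly_fun scale12" center_gens]
    by (simp add: ideal_ring2)
qed

lemma center_power_hits: "center_power n \<subseteq> hits n"
proof (induction n)
  case 0
  show ?case unfolding center_power_0 by (rule hits_0)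
next
  case (Suc n)
  show ?case
  proof
    fix g assume "g \<in> center_power (Suc n)"
    then have "g \<in> ideal_prod (ring2 scl) (center_power n) (center_ideal scl V k \<beta>)" by (simp add: center_power_Suc)
    then show "g \<in> hits (Suc n)"
    proof (induction rule: ideal_prod.induct)
      case (prod i j)
      have "(\<lambda>x. i x * j x) \<in> hits (n + 1)" by (rule hits_mult) (use prod Suc center_ideal_hits in auto)
      then show ?case by simp
    next
      case (sum s1 s2)
      from hits_add[OF sum.IH] show ?case by simp
    qed
  qed
qed

lemma rees_subset_image: "rees \<subseteq> presentation ` poly_fun scale3"
proof
  fix f assume "f \<in> rees"
  then obtain N g where f: "f = rees_elem N g" "\<forall>n. g n \<in> center_power n" by (auto simp: rees_def)
  have "\<forall>n. \<exists>F. F \<in> poly_fun scale3 \<and> presentation F = (\<lambda>q. g n (fst q) * snd q ^ n)"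
    using f(2) center_power_hits unfolding hits_def by blast
  then obtain F where F: "\<And>n. F n \<in> poly_fun scale3" "\<And>n. presentation (F n) = (\<lambda>q. g n (fst q) * snd q ^ n)"
    by metis
  have "presentation (\<lambda>p. \<Sum>n\<le>N. F n p) q = f q" for q
  proof -
    have "presentation (\<lambda>p. \<Sum>n\<le>N. F n p) q = (\<Sum>n\<le>N. presentation (F n) q)" by (simp add: presentation_def)
    also have "\<dots> = f q" by (simp add: F(2) f(1) rees_elem_def)
    finally show ?thesis .
  qed
  then have "f = presentation (\<lambda>p. \<Sum>n\<le>N. F n p)" by auto
  moreover have "(\<lambda>p. \<Sum>n\<le>N. F n p) \<in> poly_fun scale3" by (intro poly_fun_sum F(1))
  ultimately show "f \<in> presentation ` poly_fun scale3" by (rule image_eqI)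
qed

text \<open>All generators of the center have the common bidegree \<open>(\<beta> k, 1)\<close>,
  which becomes the shift \<open>(p, q)\<close> in \<open>is_blowup\<close>.\<close>

lemma window_scale: "window (scale2 r a, scl s w) = scl (r ^ \<beta> k * s) (window (a, w))"
proof (rule cpt_ext)
  fix j
  obtain \<mu> l where a: "a = (\<mu>, l)" by (cases a)
  show "cpt j (window (scale2 r a, scl s w)) = cpt j (scl (r ^ \<beta> k * s) (window (a, w)))"
  proof (cases "j \<le> k")
    case True
    have "r ^ \<beta> k = r ^ (\<beta> k - \<beta> j) * r ^ \<beta> j" using beta_le[OF True order.refl] by (simp flip: power_add)
    then show ?thesis by (simp add: a cpt_window[OF True] power_mult_distrib mult_ac)
  qed (simp add: comp_beyond)
qed

text \<open>Over nonzero \<mu> the vector of generators represents the image point under the action,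
  so the presentation restricts functions to the cone over the graph.\<close>

lemma window_eq_act: "\<mu> \<noteq> 0 \<Longrightarrow> window ((\<mu>, l), w) = scl (\<mu> ^ \<beta> k) (act scl V k \<beta> (l / \<mu>) w)"
proof (rule cpt_ext)
  fix j assume \<mu>: "\<mu> \<noteq> 0"
  show "cpt j (window ((\<mu>, l), w)) = cpt j (scl (\<mu> ^ \<beta> k) (act scl V k \<beta> (l / \<mu>) w))"
  proof (cases "j \<le> k")
    case True
    have "\<mu> ^ \<beta> k = \<mu> ^ (\<beta> k - \<beta> j) * \<mu> ^ \<beta> j" using beta_le[OF True order.refl] by (simp flip: power_add)
    then show ?thesis using \<mu> by (simp add: cpt_window[OF True] power_divide)
  qed (simp add: comp_beyond)
qed

text \<open>This is the kernel. Every representative \<open>(a, w, v)\<close> of a point of the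
  graph has \<open>v\<close> proportional to \<open>window (a, w)\<close>, so a kernel element
  vanishes on the graph and hence on its closure. Conversely, a function vanishing on the variety is
  tested on general triples \<open>(a, w, v)\<close> with \<open>v\<close> a multiple of the
  window.\<close>

lemma presentation_zero_iff:
  assumes F: "F \<in> poly_fun scale3"
  shows "presentation F = (\<lambda>_. 0) \<longleftrightarrow> F \<in> ideal_of3 scl (G_variety scl V k \<beta>)"
proof
  assume zero: "presentation F = (\<lambda>_. 0)"
  have "F \<in> ideal_of3 scl (action_graph scl V k \<beta>)"
  proof (rule ideal_of3I[OF F])
    fix a w v assume "pt a w v \<in> action_graph scl V k \<beta>"
    then obtain l w' where e: "pt (1, l) w' (act scl V k \<beta> l w') = pt a w v" "l \<noteq> 0" "w' \<noteq> 0"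
      unfolding action_graph_def by auto
    have nz: "(1, l) \<noteq> (0 :: C2)" "act scl V k \<beta> l w' \<noteq> 0" using e act_eq_0_iff by (auto simp: zero_prod_def)
    from pt_eq_iff[THEN iffD1, OF nz(1) e(3) nz(2) e(1)]
    obtain r s t where rst: "r \<noteq> 0" "s \<noteq> 0" "t \<noteq> 0" "a = scale2 r (1, l)" "w = scl s w'"
      "v = scl t (act scl V k \<beta> l w')"
      by (elim exE conjE)
    have "window (a, w) = scl (r ^ \<beta> k * s) (act scl V k \<beta> l w')"
      unfolding rst(4,5) window_scale by (simp add: window_eq_act)
    then have "v = scl (t / (r ^ \<beta> k * s)) (window (a, w))" using rst by simp
    then have "F (a, w, v) = presentation F ((a, w), t / (r ^ \<beta> k * s))" by (simp add: presentation_def)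
    then show "F (a, w, v) = 0" by (simp add: zero)
  qed
  then show "F \<in> ideal_of3 scl (G_variety scl V k \<beta>)" by (simp add: ideal_of3_graph)
next
  assume G: "F \<in> ideal_of3 scl (G_variety scl V k \<beta>)"
  let ?s = "pair_scale scale12 (*)"
  have vs: "vector_space ?s" by (intro vector_space_pair_scale vector_space_scale12 vector_space_complex)
  have id: "poly_map ?s ?s (\<lambda>q. q)" by (rule poly_map_ident)
  have p1: "poly_map ?s scale12 (\<lambda>q. fst q)" by (rule poly_map_fst[OF id vector_space_scale12 vector_space_complex])
  have p2: "(\<lambda>q. snd q) \<in> poly_fun ?s"
    using poly_map_snd[OF id vector_space_scale12 vector_space_complex] by (simp add: poly_map_complex)
  have p11: "poly_map ?s scale2 (\<lambda>q. fst (fst q))" by (rule poly_map_fst[OF p1 vector_space_scale2 vector_space_scl])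
  have p12: "poly_map ?s scl (\<lambda>q. snd (fst q))" by (rule poly_map_snd[OF p1 vector_space_scale2 vector_space_scl])
  have mu: "(\<lambda>q. fst (fst (fst q))) \<in> poly_fun ?s" and la: "(\<lambda>q. snd (fst (fst q))) \<in> poly_fun ?s"
    using poly_map_fst[OF p11 vector_space_complex vector_space_complex]
      poly_map_snd[OF p11 vector_space_complex vector_space_complex] by (simp_all add: poly_map_complex)
  have pres: "presentation F \<in> poly_fun ?s"
    unfolding presentation_def
    by (rule poly_map_comp[OF _ F])
      (intro poly_map_Pair poly_map_scale p11 p12 p2 poly_map_compose[OF p1 poly_map_window]
        vector_space_scale2 vector_space_scl vector_space_pair_scale)
  have "V 0 \<noteq> {0}" "0 \<in> V 0" using nontrivial[of 0] subspace_0[OF subspace_V[of 0]] by auto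
  then obtain x where "x \<in> V 0" and x: "x \<noteq> 0" by blast
  obtain \<phi> where \<phi>: "functional scl \<phi>" "\<phi> x = 1" by (rule functional_nonzero[OF vector_space_scl x])
  \<comment> \<open>Where \<open>D\<close> is nonzero the triple represents a point of the variety
    and \<open>presentation F\<close> vanishes. Since \<open>D\<close> is not identically zero,
    \<open>presentation F\<close> vanishes everywhere.\<close>
  define D where "D = (\<lambda>q :: (C2 \<times> 'v) \<times> complex. fst (fst (fst q)) * snd (fst (fst q)) * snd q * \<phi> (snd (fst q)))"
  have D: "D \<in> poly_fun ?s"
    unfolding D_def by (intro poly_fun.mult mu la p2 poly_map_functional[OF p12 \<phi>(1)])
  have zero: "presentation F q = 0" if "D q \<noteq> 0" for q
  proof -
    obtain \<mu> l w t where q: "q = (((\<mu>, l), w), t)" by (metis prod.exhaust)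
    have nz: "\<mu> \<noteq> 0" "l \<noteq> 0" "t \<noteq> 0" "w \<noteq> 0"
      using that linear_functionalD(3)[OF \<phi>(1)] by (auto simp: D_def q)
    let ?v = "scl t (window ((\<mu>, l), w))"
    have v: "?v = scl (t * \<mu> ^ \<beta> k) (act scl V k \<beta> (l / \<mu>) w)" by (simp add: window_eq_act[OF nz(1)])
    have "((\<mu>, l), w, ?v) \<in> cone" unfolding v by (rule graph_in_cone[OF nz(1)])
    moreover have "?v \<noteq> 0" unfolding v using nz act_eq_0_iff[of "l / \<mu>" w] by simp
    moreover have "(\<mu>, l) \<noteq> (0 :: C2)" using nz by (simp add: zero_prod_def)
    ultimately have "pt (\<mu>, l) w ?v \<in> G_variety scl V k \<beta>" using nz(4) pt_in_G_variety_iff by blast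
    from ideal_of3D[OF G this] show ?thesis by (simp add: presentation_def q)
  qed
  show "presentation F = (\<lambda>_. 0)"
  proof (rule ext, rule ccontr)
    fix q assume q: "presentation F q \<noteq> 0"
    have "D (((1, 1), x), 1) \<noteq> 0" by (simp add: D_def \<phi>(2))
    from poly_fun_domain[OF vs pres D q this] obtain z where "presentation F z \<noteq> 0" "D z \<noteq> 0" by blast
    with zero show False by blast
  qed
qed

lemma presentation_trihom:
  assumes F: "trihom scl d e n F"
  shows "\<exists>g. bihom scl (d + n * \<beta> k) (e + n * 1) g \<and> presentation F = (\<lambda>(x, t). g x * t ^ n)"
proof -
  define g where "g = (\<lambda>x. F (fst x, snd x, window x))"
  have "poly_map scale12 scale3 (\<lambda>x. (fst x, snd x, window x))"
    by (intro poly_map_Pair poly_map_window poly_fun_scale12_coord(3) poly_map_linear linear_fst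
        vector_space_scale2 vector_space_scl vector_space_pair_scale)
  then have "g \<in> poly_fun scale12" unfolding g_def by (rule poly_map_comp[OF _ trihomD(1)[OF F]])
  moreover have "g (scale2 r a, scl s w) = r ^ (d + n * \<beta> k) * s ^ (e + n * 1) * g (a, w)" for r s a w
    by (simp add: g_def window_scale trihomD(2)[OF F] power_add power_mult_distrib power_mult mult.commute[of n])
  ultimately have "bihom scl (d + n * \<beta> k) (e + n * 1) g" unfolding bihom_def carrier_ring2 by blast
  moreover have "presentation F = (\<lambda>(x, t). g x * t ^ n)"
  proof
    fix q :: "(C2 \<times> 'v) \<times> complex"
    have "F (scale2 1 (fst (fst q)), scl 1 (snd (fst q)), scl (snd q) (window (fst q))) =
        1 ^ d * 1 ^ e * snd q ^ n * F (fst (fst q), snd (fst q), window (fst q))" by (rule trihomD(2)[OF F])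
    then show "presentation F q = (case q of (x, t) \<Rightarrow> g x * t ^ n)"
      by (simp add: presentation_def g_def split_beta pair_scale_def)
  qed
  ultimately show ?thesis by blast
qed

text \<open>Functions pulled back from the first two factors ignore \<open>v\<close>, so the
  contraction of the ideal of a point is the ideal of its projection; this identifies
  \<open>pr12\<close> with the structure map on points.\<close>

lemma ideal_of2_pr12:
  assumes "z \<in> points3 scl"
  shows "pr12 z \<in> points2 scl"
    "ideal_of2 scl {pr12 z} = {g \<in> carrier (ring2 scl). g \<circ> pr12 \<in> ideal_of3 scl {z}}"
proof -
  obtain a w v where z: "z = pt a w v" "a \<noteq> 0" "w \<noteq> 0" "v \<noteq> 0" using assms by (rule points3_cases)
  show "pr12 z \<in> points2 scl"
    using z by (simp add: points2_def line_in_proj_iff vector_space_scale2 vector_space_scl)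
  show "ideal_of2 scl {pr12 z} = {g \<in> carrier (ring2 scl). g \<circ> pr12 \<in> ideal_of3 scl {z}}"
  proof (intro equalityI subsetI)
    fix g assume g: "g \<in> ideal_of2 scl {pr12 z}"
    then have gp: "g \<in> poly_fun scale12" by (simp add: ideal_of2_def)
    have "g \<circ> pr12 \<in> ideal_of3 scl {z}"
    proof (rule ideal_of3I[OF poly_fun_pr12[OF gp]])
      fix a' w' v' assume "pt a' w' v' \<in> {z}"
      then have "(line scale2 a', line scl w') = pr12 z" using z(1) by simp
      then show "(g \<circ> pr12) (a', w', v') = 0" using g by (simp add: ideal_of2_def)
    qed
    with gp show "g \<in> {g \<in> carrier (ring2 scl). g \<circ> pr12 \<in> ideal_of3 scl {z}}" by simp
  next
    fix g assume g: "g \<in> {g \<in> carrier (ring2 scl). g \<circ> pr12 \<in> ideal_of3 scl {z}}"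
    have "g (a', w') = 0" if "(line scale2 a', line scl w') \<in> {pr12 z}" for a' w'
    proof -
      have "pt a' w' v \<in> {z}" using that z(1) by simp
      from ideal_of3D[OF _ this, of "g \<circ> pr12"] g show ?thesis by simp
    qed
    then show "g \<in> ideal_of2 scl {pr12 z}" using g by (simp add: ideal_of2_def)
  qed
qed

text \<open>\<open>K\<close> is any ideal defining the same subscheme, so that the result applies
  both to the ideal of the closure and to \<open>G_ideal\<close>.\<close>

theorem is_blowup_center:
  assumes "same_subscheme scl (ideal_of3 scl (G_variety scl V k \<beta>)) K"
  shows "is_blowup scl (center_ideal scl V k \<beta>) K pr12"
  unfolding is_blowup_def
proof (rule conjI, rule exI[of _ presentation], rule exI[of _ "\<beta> k"], rule exI[of _ 1],
    intro conjI ballI allI impI)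
  let ?R = "rees_algebra scl (center_ideal scl V k \<beta>)"
  show "presentation \<in> ring_hom (ring3 scl) ?R"
    unfolding rees_algebra_eq
    by (rule ring_hom_memI) (simp_all add: presentation_in_rees, simp_all add: presentation_def)
  show "presentation ` carrier (ring3 scl) = carrier ?R"
    unfolding rees_algebra_eq using rees_subset_image presentation_in_rees by auto
  show "presentation (g \<circ> pr12) = g \<circ> fst" if "g \<in> carrier (ring2 scl)" for g by (rule presentation_pr12)
  show "\<exists>g. bihom scl (d + n * \<beta> k) (e + n * 1) g \<and> presentation F = (\<lambda>(x, t). g x * t ^ n)"
    if "trihom scl d e n F" for d e n F
    using presentation_trihom[OF that] .
  have "a_kernel (ring3 scl) ?R presentation = ideal_of3 scl (G_variety scl V k \<beta>)"
    using presentation_zero_iff ideal_of3_subset by (auto simp: a_kernel_def' rees_algebra_eq)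
  then show "same_subscheme scl (a_kernel (ring3 scl) ?R presentation) K" using assms by simp
next
  show "\<forall>z\<in>zeros3 scl K. pr12 z \<in> points2 scl \<and>
      ideal_of2 scl {pr12 z} = {g \<in> carrier (ring2 scl). g \<circ> pr12 \<in> ideal_of3 scl {z}}"
    using zeros3_subset ideal_of2_pr12 by (intro ballI conjI) blast+
qed

end

theorem proposition8p4:
  fixes scl :: "complex \<Rightarrow> 'v::ab_group_add \<Rightarrow> 'v"
    and Bs :: "'v set"
    and V :: "nat \<Rightarrow> 'v set"
    and k :: nat
    and \<beta> :: "nat \<Rightarrow> nat"
  assumes "finite_dimensional_vector_space scl Bs"
    and "direct_sum_decomposition scl V k"
    and "\<And>i. i \<le> k \<Longrightarrow> V i \<noteq> {0}"
    and "\<beta> 0 = 0"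
    and "\<And>i. i < k \<Longrightarrow> \<beta> i < \<beta> (Suc i)"
  shows
    "\<comment> \<open>the closure of the graph, with its reduced structure, is the blow-up\<close>
     is_blowup scl (center_ideal scl V k \<beta>)
       (ideal_of3 scl (zariski3 scl closure_of action_graph scl V k \<beta>)) pr12 \<and>
     \<comment> \<open>it is the variety \<open>G\<close>\<close>
     zariski3 scl closure_of action_graph scl V k \<beta> = G_variety scl V k \<beta> \<and>
     same_subscheme scl
       (ideal_of3 scl (zariski3 scl closure_of action_graph scl V k \<beta>)) (G_ideal scl V k \<beta>) \<and>
     \<comment> \<open>the projection restricted to \<open>G\<close> is the blow-down map\<close>
     is_blowup scl (center_ideal scl V k \<beta>) (G_ideal scl V k \<beta>) pr12 \<and>
     \<comment> \<open>the exceptional divisor\<close>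
     zeros3 scl (exceptional_ideal scl V k \<beta>) =
       (\<Union>i\<in>{..<k}. E_infinity scl V k i) \<union> (\<Union>i\<in>{1..k}. E_zero scl V k i) \<and>
     irreducible_components (zariski3 scl) (zeros3 scl (exceptional_ideal scl V k \<beta>)) =
       E_infinity scl V k ` {..<k} \<union> E_zero scl V k ` {1..k} \<and>
     inj_on (E_infinity scl V k) {..k} \<and> inj_on (E_zero scl V k) {..k} \<and>
     (\<Union>i\<in>{..<k}. E_infinity scl V k i) \<inter> (\<Union>i\<in>{1..k}. E_zero scl V k i) = {} \<and>
     (\<Union>i\<in>{..<k}. E_infinity scl V k i) =
       {z \<in> zeros3 scl (exceptional_ideal scl V k \<beta>). pr12 z \<in> center_infinity scl V k} \<and>
     pr12 ` (\<Union>i\<in>{..<k}. E_infinity scl V k i) = center_infinity scl V k \<and>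
     (\<Union>i\<in>{1..k}. E_zero scl V k i) =
       {z \<in> zeros3 scl (exceptional_ideal scl V k \<beta>). pr12 z \<in> center_zero scl V k} \<and>
     pr12 ` (\<Union>i\<in>{1..k}. E_zero scl V k i) = center_zero scl V k \<and>
     \<comment> \<open>multiplicity in the divisor of \<open>\<mu>\<close> or \<open>\<lambda>\<close> on \<open>G\<close>, and dimension, of its components\<close>
     (\<forall>i<k. multiplicity_along scl (G_section_ideal scl V k \<beta> coord_mu) (E_infinity scl V k i) = 1 \<and>
        krull_dim (zariski3 scl) (E_infinity scl V k i) = enat (vector_space.dim scl (UNIV :: 'v set) - 1)) \<and>
     (\<forall>i\<in>{1..k}. multiplicity_along scl (G_section_ideal scl V k \<beta> coord_lambda) (E_zero scl V k i) = 1 \<and>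
        krull_dim (zariski3 scl) (E_zero scl V k i) = enat (vector_space.dim scl (UNIV :: 'v set) - 1)) \<and>
     \<comment> \<open>the intersection of \<open>G\<close> with \<open>\<mu> = 0\<close>\<close>
     zeros3 scl (G_section_ideal scl V k \<beta> coord_mu) =
       (\<Union>i\<in>{..<k}. E_infinity scl V k i) \<union> E_infinity scl V k k \<and>
     irreducible_components (zariski3 scl) (zeros3 scl (G_section_ideal scl V k \<beta> coord_mu)) =
       E_infinity scl V k ` {..k} \<and>
     (\<forall>i\<le>k. multiplicity_along scl (G_section_ideal scl V k \<beta> coord_mu) (E_infinity scl V k i) = 1) \<and>
     \<comment> \<open>the intersection of \<open>G\<close> with \<open>\<lambda> = 0\<close>\<close>
     zeros3 scl (G_section_ideal scl V k \<beta> coord_lambda) =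
       (\<Union>i\<in>{1..k}. E_zero scl V k i) \<union> E_zero scl V k 0 \<and>
     irreducible_components (zariski3 scl) (zeros3 scl (G_section_ideal scl V k \<beta> coord_lambda)) =
       E_zero scl V k ` {..k} \<and>
     (\<forall>i\<le>k. multiplicity_along scl (G_section_ideal scl V k \<beta> coord_lambda) (E_zero scl V k i) = 1)"
proof -
  have "vector_space scl"
    using assms(1) by (simp add: finite_dimensional_vector_space_def)
  then interpret torus_action scl Bs V k \<beta>
    using assms
    by (simp add: torus_action_def graded_vector_space_def product_of_projective_spaces_def
        graded_vector_space_axioms_def torus_action_axioms_def)
  have closure: "ideal_of3 scl (zariski3 scl closure_of action_graph scl V k \<beta>) = ideal_of3 scl (G_variety scl V k \<beta>)"
    by (simp only: closure_of_action_graph)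
  have split: "(\<Union>i\<le>k. E_infinity scl V k i) = (\<Union>i\<in>{..<k}. E_infinity scl V k i) \<union> E_infinity scl V k k"
    "(\<Union>i\<le>k. E_zero scl V k i) = (\<Union>i\<in>{1..k}. E_zero scl V k i) \<union> E_zero scl V k 0"
  proof -
    have "{..k} = insert k {..<k}" "{..k} = insert 0 {1..k}" by auto
    then show "(\<Union>i\<le>k. E_infinity scl V k i) = (\<Union>i\<in>{..<k}. E_infinity scl V k i) \<union> E_infinity scl V k k"
      "(\<Union>i\<le>k. E_zero scl V k i) = (\<Union>i\<in>{1..k}. E_zero scl V k i) \<union> E_zero scl V k 0"
      by (metis UN_insert Un_commute)+
  qed
  have dim: "krull_dim (zariski3 scl) (E_infinity scl V k i) = enat (dim UNIV - 1)"
    "krull_dim (zariski3 scl) (E_zero scl V k i) = enat (dim UNIV - 1)" if i: "i \<le> k" for i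
  proof -
    have S: "{..i} \<inter> {i..} = {i}" "{i..} \<inter> {..i} = {i}" "{..i} \<union> {i..} = UNIV" "{i..} \<union> {..i} = UNIV" by auto
    show "krull_dim (zariski3 scl) (E_infinity scl V k i) = enat (dim UNIV - 1)"
      unfolding E_infinity_eq[OF i] by (rule krull_dim_incidence[OF a01 i S(1,3)])
    show "krull_dim (zariski3 scl) (E_zero scl V k i) = enat (dim UNIV - 1)"
      unfolding E_zero_eq[OF i] by (rule krull_dim_incidence[OF a10 i S(2,4)])
  qed
  show ?thesis
    unfolding closure closure_of_action_graph
  proof (intro conjI ballI allI impI)
    show "is_blowup scl (center_ideal scl V k \<beta>) (ideal_of3 scl (G_variety scl V k \<beta>)) pr12"
      by (rule is_blowup_center) (simp add: same_subscheme_def)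
    show "same_subscheme scl (ideal_of3 scl (G_variety scl V k \<beta>)) (G_ideal scl V k \<beta>)"
      by (rule same_subscheme_G)
    show "is_blowup scl (center_ideal scl V k \<beta>) (G_ideal scl V k \<beta>) pr12"
      by (rule is_blowup_center[OF same_subscheme_G])
    show "zeros3 scl (exceptional_ideal scl V k \<beta>) =
        (\<Union>i\<in>{..<k}. E_infinity scl V k i) \<union> (\<Union>i\<in>{1..k}. E_zero scl V k i)"
      by (rule zeros3_exceptional)
    show "irreducible_components (zariski3 scl) (zeros3 scl (exceptional_ideal scl V k \<beta>)) =
        E_infinity scl V k ` {..<k} \<union> E_zero scl V k ` {1..k}"
      unfolding zeros3_exceptional by (rule irreducible_components_Union_E) auto
    show "inj_on (E_infinity scl V k) {..k}" "inj_on (E_zero scl V k) {..k}"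
      by (rule inj_on_E_infinity inj_on_E_zero)+
    show "(\<Union>i\<in>{..<k}. E_infinity scl V k i) \<inter> (\<Union>i\<in>{1..k}. E_zero scl V k i) = {}"
    proof -
      have "E_infinity scl V k i \<inter> E_zero scl V k j = {}" if "i \<in> {..<k}" "j \<in> {1..k}" for i j
        using E_infinity_E_zero_disjoint[of i j] that by simp
      then show ?thesis by blast
    qed
    show "(\<Union>i\<in>{..<k}. E_infinity scl V k i) =
        {z \<in> zeros3 scl (exceptional_ideal scl V k \<beta>). pr12 z \<in> center_infinity scl V k}"
      by (rule Union_E_infinity_eq)
    show "pr12 ` (\<Union>i\<in>{..<k}. E_infinity scl V k i) = center_infinity scl V k"
      by (rule image_pr12_E_infinity)
    show "(\<Union>i\<in>{1..k}. E_zero scl V k i) =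
        {z \<in> zeros3 scl (exceptional_ideal scl V k \<beta>). pr12 z \<in> center_zero scl V k}"
      by (rule Union_E_zero_eq)
    show "pr12 ` (\<Union>i\<in>{1..k}. E_zero scl V k i) = center_zero scl V k"
      by (rule image_pr12_E_zero)
    show "multiplicity_along scl (G_section_ideal scl V k \<beta> coord_mu) (E_infinity scl V k i) = 1"
      "krull_dim (zariski3 scl) (E_infinity scl V k i) = enat (dim UNIV - 1)" if "i < k" for i
      using that by (simp_all add: multiplicity_E_infinity dim)
    show "multiplicity_along scl (G_section_ideal scl V k \<beta> coord_lambda) (E_zero scl V k i) = 1"
      "krull_dim (zariski3 scl) (E_zero scl V k i) = enat (dim UNIV - 1)" if "i \<in> {1..k}" for i
      using that by (simp_all add: multiplicity_E_zero dim)
    show "zeros3 scl (G_section_ideal scl V k \<beta> coord_mu) =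
        (\<Union>i\<in>{..<k}. E_infinity scl V k i) \<union> E_infinity scl V k k"
      unfolding zeros3_section_mu by (rule split)
    show "irreducible_components (zariski3 scl) (zeros3 scl (G_section_ideal scl V k \<beta> coord_mu)) =
        E_infinity scl V k ` {..k}"
      unfolding zeros3_section_mu using irreducible_components_Union_E[of "{..k}" "{}"] by simp
    show "multiplicity_along scl (G_section_ideal scl V k \<beta> coord_mu) (E_infinity scl V k i) = 1" if "i \<le> k" for i
      by (rule multiplicity_E_infinity[OF that])
    show "zeros3 scl (G_section_ideal scl V k \<beta> coord_lambda) =
        (\<Union>i\<in>{1..k}. E_zero scl V k i) \<union> E_zero scl V k 0"
      unfolding zeros3_section_lambda by (rule split)
    show "irreducible_components (zariski3 scl) (zeros3 scl (G_section_ideal scl V k \<beta> coord_lambda)) =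
        E_zero scl V k ` {..k}"
      unfolding zeros3_section_lambda using irreducible_components_Union_E[of "{}" "{..k}"] by simp
    show "multiplicity_along scl (G_section_ideal scl V k \<beta> coord_lambda) (E_zero scl V k i) = 1" if "i \<le> k" for i
      by (rule multiplicity_E_zero[OF that])
  qed (rule refl)
qed

end
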